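(* Let $\mathfrak g$ be a simple complex Lie algebra and $V=\bigoplus_{j\in\mathcal J}V_j$ a finite-dimensional faithful multiplicity free $\mathfrak g$-module, with $V_j$ irreducible and pairwise non-isomorphic; let $V_{j,\lambda}$ be the $\lambda$-weight space of $V_j$ and $\mathsf d_{j,\lambda}=\dim V_{j,\lambda}$. Let $\mathrm L^\pm$ be the generating matrices of the $R$-matrix algebra $\mathrm U_{\mathrm R}(\mathfrak g)$ and $\{\mathsf z_j^\pm\}_{j\in\mathcal J}$ the primitive central elements of $\mathrm U_{\mathrm R}(\mathfrak g)$ defined in the context. Then the zero weight component $\mathrm L_0^\pm$ of $\mathrm L^\pm$ admits the block diagonal form $$\mathrm L_0^\pm=\sum_{j,\lambda}\ell^\pm_{j,\lambda}\cdot\mathrm{id}_{V_{j,\lambda}}=I+\hbar\sum_{j,\lambda}\mathrm t^\pm_{j,\lambda}\cdot\mathrm{id}_{V_{j,\lambda}},$$ where the summation runs over all pairs $(j,\lambda)\in\mathcal J\times\mathfrak h^*$ with $V_{j,\lambda}\ne0$ ($\mathrm{id}_{V_{j,\lambda}}$ being the projection onto $V_{j,\lambda}$), and $\{\ell^\pm_{j,\lambda}=1+\hbar\mathrm t^\pm_{j,\lambda}\}_{j,\lambda}$ are grouplike elements generating a commutative subalgebra of $\mathrm U_{\mathrm R}(\mathfrak g)$. Moreover, $$\prod_{\lambda\in\mathfrak h^*}(\ell^\pm_{j,\lambda})^{\mathsf d_{j,\lambda}}=q^{\pm\dim V_j\cdot\mathsf z_j^\pm}\qquad\forall\,j\in\mathcal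 J.$$ In particular, $$\mathsf z_j^\pm=\pm\sum_{\lambda\in\mathfrak h^*}\frac{2\,\mathsf d_{j,\lambda}}{\dim V_j\cdot\hbar}\log(1+\hbar\,\mathrm t^\pm_{j,\lambda})\qquad\forall\,j\in\mathcal J.$$
   Context: Lie algebra data. $\mathfrak h\subset\mathfrak g$ is a Cartan subalgebra, $\{\alpha_i\}_{i\in\mathbf I}$ simple roots; $(\,,)$ is the invariant nondegenerate symmetric form on $\mathfrak g$ with short roots of squared length $2$; $h_i\in\mathfrak h$ corresponds to $\alpha_i$ under $\mathfrak h\cong\mathfrak h^*$; $(a_{ij})$ is the Cartan matrix, $d_i=(\alpha_i,\alpha_i)/2$; $\varpi_i^\vee\in\mathfrak h$ satisfy $\alpha_j(\varpi_i^\vee)=\delta_{ij}$. $\mathsf Q_+=\bigoplus\mathbb Z_{\ge0}\alpha_i$, $\mathsf Q_-=-\mathsf Q_+$, $\dot{\mathsf Q}_\pm=\mathsf Q_\pm\setminus\{0\}$. $x_i^\pm\in\mathfrak g_{\pm\alpha_i}$ are root vectors with $(x_i^+,x_i^-)=1$. Conventions. $q=e^{\hbar/2}$, $q_i=q^{d_i}$, $q^x=\exp(\frac\hbar2x)$. $\otimes$ between $\mathbb C[[\hbar]]$-modules is the $\hbar$-adically completed tensor product; algebras given by topological generators and relations are $\hbar$-adically separated and complete; topological Hopf algebras use the completed tensor product. $\mathsf S$ denotes the symmetric algebra. $U_\hbar\mathfrak g$ is topologically generated by $\mathfrak h\cup\{E_i,F_i\}_{i\in\mathbf I}$ with $[h,h']=0$,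 $[h,E_j]=\alpha_j(h)E_j$, $[h,F_j]=-\alpha_j(h)F_j$, $[E_i,F_j]=\delta_{ij}\frac{q^{h_i}-q^{-h_i}}{q_i-q_i^{-1}}$ and the $q_i$-Serre relations for the $E$'s and for the $F$'s. Its semiclassical limit (quotient by $\hbar$) is identified with $U(\mathfrak g)$ via $h\mapsto h$, $E_i\mapsto d_i^{-1/2}x_i^+$, $F_i\mapsto d_i^{-1/2}x_i^-$. $D(U_\hbar\mathfrak b)$, the quantum double of the Borel subalgebra $U_\hbar\mathfrak b\subset U_\hbar\mathfrak g$ generated by $\mathfrak h$ and the $E_i$, is identified as an algebra with $U_\hbar\mathfrak g\otimes\mathsf S(\mathfrak h)[[\hbar]]$. Put $\zeta(h)=1\otimes h$, $h^\pm=h\pm\zeta(h)$ for $h\in\mathfrak h$, $X_i^+=q^{\zeta(h_i)/2}E_i$, $X_i^-=q^{\zeta(h_i)/2}F_i$. The Hopf structure is: $h^\pm$ primitive, $\Delta(X_i^+)=X_i^+\otimes q^{h_i^+}+1\otimes X_i^+$, $\Delta(X_i^-)=X_i^-\otimes1+q^{-h_i^-}\otimes X_i^-$, $\varepsilon(h^\pm)=\varepsilon(X_i^\pm)=0$. $U_\hbar\mathfrak n^\pm$ is the closed subalgebra generated by the $X_i^\pm$, graded by weights under $\operatorname{ad}\mathfrak h$. $\omega_\hbar$ is the algebra involution with $\omega_\hbar(h^\pm)=-h^\mp$, $\omega_\hbar(X_i^\pm)=-X_i^\mp$. The universal $R$-matrix $R^D$ (the canonical element of the double) is the unique element of the form $q^{\sum_i(\varpi_i^\vee)^+\otimes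 h_i^-}\sum_{\beta\in\mathsf Q_+}R_\beta^+$ with $R^+_\beta\in(U_\hbar\mathfrak n^+)_\beta\otimes(U_\hbar\mathfrak n^-)_{-\beta}$, $R_0^+=1$, and $R^D\Delta(x)=\Delta^{\mathrm{op}}(x)R^D$ for all $x$. Set $\mathsf R^+_\omega=(\mathrm{id}\otimes\omega_\hbar)(R^D)$, $\mathsf R^-_\omega=(\mathrm{id}\otimes\omega_\hbar)((R^D_{21})^{-1})$. Representation. $\pi:U(\mathfrak g)\to\operatorname{End}(V)$ is the action. $\mathfrak{gl}(V)$ is a $\mathfrak g$-module under the adjoint action with weight spaces $\mathfrak{gl}(V)_\mu$ and invariants $\mathfrak{gl}(V)^{\mathfrak g}=\operatorname{End}_{\mathfrak g}(V)$; $X_\mu$ is the $\mathfrak{gl}(V)_\mu$-component of $X\in\operatorname{End}(V)\otimes W$. $\pi_\hbar:U_\hbar\mathfrak g\to\operatorname{End}(V)[[\hbar]]$ is a fixed algebra homomorphism with semiclassical limit $\pi$, $\pi_\hbar|_{\mathfrak h}=\pi|_{\mathfrak h}$ and image in $\pi(U(\mathfrak g))[[\hbar]]$, extended to $D(U_\hbar\mathfrak b)$ by composing with $\mathrm{id}\otimes\varepsilon:U_\hbar\mathfrak g\otimes\mathsf S(\mathfrak h)[[\hbar]]\to U_\hbar\mathfrak g$. $\mathrm R_\pi=(\pi_\hbar\otimes\pi_\hbar)(R^D)$, $\dot{\mathrm R}_\pi=\hbar^{-1}(\mathrm R_\pi-1)$. $\{E_{ij}\}_{i,j\in\mathcal I}$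 are the matrix units of a fixed basis of $V$. Subscripts $1,2$ on a matrix in $\operatorname{End}(V)\otimes\mathcal A$ indicate the copy of $\operatorname{End}(V)$; subscripts $[1],[2]$ indicate the copy of $\mathcal A$. Maps on $\mathcal A$ are applied coefficientwise. $\mathrm U_{\mathrm R}(\mathfrak g)$ is the unital associative $\mathbb C[[\hbar]]$-algebra topologically generated by $\{t_{ij}^\pm\}_{i,j\in\mathcal I}$ with, for $\mathrm T^\pm=\sum E_{ij}\otimes t_{ij}^\pm$, the relations $\mathrm T^\pm_\lambda=0$ for $\lambda\in\dot{\mathsf Q}_\mp$ and $[\mathrm T_2^{\epsilon_2},\mathrm T_1^{\epsilon_1}]=[\dot{\mathrm R}_\pi,\mathrm T_1^{\epsilon_1}+\mathrm T_2^{\epsilon_2}]+\hbar(\dot{\mathrm R}_\pi\mathrm T_1^{\epsilon_1}\mathrm T_2^{\epsilon_2}-\mathrm T_2^{\epsilon_2}\mathrm T_1^{\epsilon_1}\dot{\mathrm R}_\pi)$ for $(\epsilon_1,\epsilon_2)=(+,+),(-,-),(+,-)$. Put $\mathrm L^\pm=I+\hbar\mathrm T^\pm$; $\mathrm L^\pm_0$ is its zero weight component. It is a topologically free topological Hopf algebra with $\Delta_{\mathrm R}(\mathrm L^\pm)=\mathrm L^\pm_{[1]}\mathrm L^\pm_{[2]}$, $S_{\mathrm R}(\mathrm L^\pm)=(\mathrm L^\pm)^{-1}$, $\varepsilon_{\mathrm R}(\mathrm L^\pm)=I$. $\mathfrak z_V^\pm$ are two copies of $(\mathfrak{gl}(V)^{\mathfrak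 g})^*$, with canonical elements $\mathfrak Z^\pm\in\mathfrak{gl}(V)^{\mathfrak g}\otimes\mathfrak z_V^\pm$. $\mathsf S_\hbar(\mathfrak z_V^\pm)=\mathsf S(\mathfrak z_V^\pm)[[\hbar]]$ as algebras, with Hopf structure such that $\mathring{\mathfrak Z}^\pm=(I+\hbar\mathfrak Z^\pm)^{\pm1}$ satisfies $\Delta(\mathring{\mathfrak Z}^\pm)=\mathring{\mathfrak Z}^\pm_{[1]}\mathring{\mathfrak Z}^\pm_{[2]}$, with counit vanishing on $\mathfrak Z^\pm$. $\Upsilon:\mathrm U_{\mathrm R}(\mathfrak g)\to D(U_\hbar\mathfrak b)\otimes\mathsf S_\hbar(\mathfrak z_V^+)\otimes\mathsf S_\hbar(\mathfrak z_V^-)$ is the isomorphism of topological Hopf algebras determined by $\Upsilon(\mathrm L^\pm)=(\pi_\hbar\otimes\mathrm{id})(\mathsf R_\omega^\pm)\cdot\mathring{\mathfrak Z}^\pm$. Elements $\mathsf z_j^\pm$. $\mathbf 1_j:V\to V_j$ are the projections for $V=\bigoplus_jV_j$; they form a basis of $\mathfrak{gl}(V)^{\mathfrak g}$. $\mathsf Z^\pm\in\mathfrak{gl}(V)^{\mathfrak g}\otimes_{\mathbb C}\mathsf S_\hbar(\mathfrak z_V^\pm)$ is the unique solution of $\exp(\frac\hbar2\mathsf Z^\pm)=I+\hbar\mathfrak Z^\pm$, and $\mathsf z_j^\pm\in\mathrm U_{\mathrm R}(\mathfrak g)$ is defined by $\Upsilon^{-1}(\mathsf Z^\pm)=\sum_{j\in\mathcal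 J}\mathbf 1_j\otimes\mathsf z_j^\pm$. *)

theory Defs
  imports
    "HOL-Analysis.Analysis"
    "HOL-Computational_Algebra.Formal_Power_Series"
    "HOL-Library.Poly_Mapping"
    "HOL-Library.Function_Algebras"
begin

unbundle no fps_syntax

section \<open>Complete algebras over formal power series\<close>

class complex_algebra_1 = ring_1 +
  fixes of_cplx :: "complex \<Rightarrow> 'a"
  assumes of_cplx_1: "of_cplx 1 = 1"
    and of_cplx_add: "of_cplx (c + d) = of_cplx c + of_cplx d"
    and of_cplx_mult: "of_cplx (c * d) = of_cplx c * of_cplx d"
    and of_cplx_central: "of_cplx c * x = x * of_cplx c"
begin

lemma of_cplx_0 [simp]: "of_cplx 0 = 0"
  using of_cplx_add[of 0 0] by simp

lemma of_cplx_sum: "of_cplx (sum f A) = (\<Sum>i\<in>A. of_cplx (f i))"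
  by (induction A rule: infinite_finite_induct) (auto simp: of_cplx_add)

end

text \<open>
  The variable of \<^typ>\<open>complex fps\<close> plays the role of the deformation parameter
  \<open>\<hbar>\<close>. An algebra over \<open>\<complex>[[\<hbar>]]\<close> is a ring with a central homomorphism from
  \<^typ>\<open>complex fps\<close>; the last two axioms say that it is separated and complete in the
  \<open>\<hbar>\<close>-adic topology.
\<close>

class hbar_algebra = ring_1 +
  fixes of_fps :: "complex fps \<Rightarrow> 'a"
  assumes of_fps_1: "of_fps 1 = 1"
    and of_fps_add: "of_fps (c + d) = of_fps c + of_fps d"
    and of_fps_mult: "of_fps (c * d) = of_fps c * of_fps d"
    and of_fps_central: "of_fps c * x = x * of_fps c"
    and hbar_separated: "(\<And>n. \<exists>y. x = of_fps (fps_X ^ n) * y) \<Longrightarrow> x = 0"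
    and hbar_complete: "(\<And>n. \<exists>y. s (Suc n) - s n = of_fps (fps_X ^ n) * y) \<Longrightarrow>
      \<exists>x. \<forall>n. \<exists>y. x - s n = of_fps (fps_X ^ n) * y"

abbreviation hbar :: "'a::hbar_algebra" (\<open>\<hbar>\<close>) where
  "\<hbar> \<equiv> of_fps fps_X"

abbreviation of_cx :: "complex \<Rightarrow> 'a::hbar_algebra" where
  "of_cx c \<equiv> of_fps (fps_const c)"

definition hcong :: "nat \<Rightarrow> 'a::hbar_algebra \<Rightarrow> 'a \<Rightarrow> bool" where
  "hcong n x y \<longleftrightarrow> (\<exists>z. x - y = \<hbar> ^ n * z)"

definition hclosed :: "'a::hbar_algebra set \<Rightarrow> bool" where
  "hclosed S \<longleftrightarrow> (\<forall>x. (\<forall>n. \<exists>y\<in>S. hcong n x y) \<longrightarrow> x \<in> S)"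

definition hlim :: "(nat \<Rightarrow> 'a::hbar_algebra) \<Rightarrow> 'a" where
  "hlim s = (THE x. \<forall>N. \<exists>n0. \<forall>n\<ge>n0. hcong N (s n) x)"

definition has_hsum :: "('b \<Rightarrow> 'a::hbar_algebra) \<Rightarrow> 'b set \<Rightarrow> 'a \<Rightarrow> bool" where
  "has_hsum f S x \<longleftrightarrow> (\<forall>N. \<exists>F0. finite F0 \<and> F0 \<subseteq> S \<and>
     (\<forall>F. finite F \<and> F0 \<subseteq> F \<and> F \<subseteq> S \<longrightarrow> hcong N (sum f F) x))"

text \<open>The following two series converge if \<open>x\<close>, respectively \<open>x - 1\<close>, is divisible by \<open>\<hbar>\<close>.\<close>

definition hexp :: "'a::hbar_algebra \<Rightarrow> 'a" where
  "hexp x = hlim (\<lambda>N. \<Sum>n<N. of_cx (1 / fact n) * x ^ n)"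

definition hlog :: "'a::hbar_algebra \<Rightarrow> 'a" where
  "hlog x = hlim (\<lambda>N. \<Sum>n<N. of_cx ((- 1) ^ n / of_nat (Suc n)) * (x - 1) ^ Suc n)"

definition qpow :: "'a::hbar_algebra \<Rightarrow> 'a" where
  "qpow x = hexp (of_cx (1/2) * \<hbar> * x)"

text \<open>Division by a scalar; only used in torsion-free algebras, where quotients are unique.\<close>

definition hdiv :: "'a::hbar_algebra \<Rightarrow> complex fps \<Rightarrow> 'a" where
  "hdiv x c = (THE y. of_fps c * y = x)"

definition hinverse :: "'a::hbar_algebra \<Rightarrow> 'a" where
  "hinverse x = (THE y. x * y = 1 \<and> y * x = 1)"

definition hlinear :: "('a::hbar_algebra \<Rightarrow> 'b::hbar_algebra) \<Rightarrow> bool" where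
  "hlinear f \<longleftrightarrow> (\<forall>x y. f (x + y) = f x + f y) \<and> (\<forall>c x. f (of_fps c * x) = of_fps c * f x)"

text \<open>Continuity is automatic for \<open>\<complex>[[\<hbar>]]\<close>-linear maps.\<close>

definition hhom :: "('a::hbar_algebra \<Rightarrow> 'b::hbar_algebra) \<Rightarrow> bool" where
  "hhom f \<longleftrightarrow> hlinear f \<and> f 1 = 1 \<and> (\<forall>x y. f (x * y) = f x * f y)"

definition hsubmodule :: "'a::hbar_algebra set \<Rightarrow> bool" where
  "hsubmodule S \<longleftrightarrow> 0 \<in> S \<and> (\<forall>x\<in>S. \<forall>y\<in>S. x + y \<in> S) \<and> (\<forall>c. \<forall>x\<in>S. of_fps c * x \<in> S)"

definition closed_hspan :: "'a::hbar_algebra set \<Rightarrow> 'a set" where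
  "closed_hspan G = \<Inter>{S. hsubmodule S \<and> hclosed S \<and> G \<subseteq> S}"

definition closed_subalgebra :: "'a::hbar_algebra set \<Rightarrow> 'a set" where
  "closed_subalgebra G = \<Inter>{S. hsubmodule S \<and> 1 \<in> S \<and> (\<forall>x\<in>S. \<forall>y\<in>S. x * y \<in> S)
     \<and> hclosed S \<and> G \<subseteq> S}"

definition closed_ideal :: "'a::hbar_algebra set \<Rightarrow> 'a set" where
  "closed_ideal G = \<Inter>{S. hsubmodule S \<and> (\<forall>x\<in>S. \<forall>a. a * x \<in> S \<and> x * a \<in> S)
     \<and> hclosed S \<and> G \<subseteq> S}"

definition topologically_free :: "'a::hbar_algebra itself \<Rightarrow> bool" where
  "topologically_free _ \<longleftrightarrow> (\<exists>M::'a set. 0 \<in> M \<and> (\<forall>x\<in>M. \<forall>y\<in>M. x + y \<in> M) \<and>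
     (\<forall>c. \<forall>x\<in>M. of_cx c * x \<in> M) \<and>
     (\<forall>x. \<exists>!a. (\<forall>n. a n \<in> M) \<and> x = hlim (\<lambda>N. \<Sum>n<N. \<hbar> ^ n * a n)))"

lemma
  shows hsubmodule_closed_ideal: "hsubmodule (closed_ideal G)"
    and hclosed_closed_ideal: "hclosed (closed_ideal G)"
    and closed_ideal_superset: "G \<subseteq> closed_ideal G"
    and closed_ideal_mult_left: "x \<in> closed_ideal G \<Longrightarrow> a * x \<in> closed_ideal G"
    and closed_ideal_mult_right: "x \<in> closed_ideal G \<Longrightarrow> x * a \<in> closed_ideal G"
proof -
  show "hclosed (closed_ideal G)"
    unfolding hclosed_def
  proof (intro allI impI)
    fix x assume x: "\<forall>n. \<exists>y\<in>closed_ideal G. hcong n x y"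
    show "x \<in> closed_ideal G"
      unfolding closed_ideal_def
    proof (safe)
      fix S :: "'a set" assume S: "hsubmodule S" "\<forall>x\<in>S. \<forall>a. a * x \<in> S \<and> x * a \<in> S" "hclosed S" "G \<subseteq> S"
      then have "closed_ideal G \<subseteq> S" by (auto simp: closed_ideal_def)
      with x have "\<forall>n. \<exists>y\<in>S. hcong n x y" by blast
      with S(3) show "x \<in> S" by (auto simp: hclosed_def)
    qed
  qed
qed (auto simp: closed_ideal_def hsubmodule_def)

lemma of_fps_0 [simp]: "(of_fps 0 :: 'a::hbar_algebra) = 0"
  using of_fps_add[of 0 0, where ?'a = 'a] by simp

lemma of_fps_minus: "(of_fps (- c) :: 'a::hbar_algebra) = - of_fps c"
  using of_fps_add[of c "- c", where ?'a = 'a] by (simp add: eq_neg_iff_add_eq_0 add.commute)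

lemma of_fps_power: "(of_fps (c ^ n) :: 'a::hbar_algebra) = of_fps c ^ n"
  by (induction n) (auto simp: of_fps_1 of_fps_mult)

lemma
  assumes "hsubmodule S"
  shows hsubmodule_0: "0 \<in> S"
    and hsubmodule_add: "x \<in> S \<Longrightarrow> y \<in> S \<Longrightarrow> x + y \<in> S"
    and hsubmodule_minus: "x \<in> S \<Longrightarrow> - x \<in> S"
    and hsubmodule_diff: "x \<in> S \<Longrightarrow> y \<in> S \<Longrightarrow> x - y \<in> S"
proof -
  show minus: "- x \<in> S" if "x \<in> S" for x
  proof -
    have "of_fps (- 1) * x \<in> S" using assms that unfolding hsubmodule_def by blast
    then show ?thesis by (simp add: of_fps_minus of_fps_1)
  qed
  show "0 \<in> S" "x \<in> S \<Longrightarrow> y \<in> S \<Longrightarrow> x + y \<in> S" for x y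
    using assms by (auto simp: hsubmodule_def)
  then show "x \<in> S \<Longrightarrow> y \<in> S \<Longrightarrow> x - y \<in> S" for x y
    using minus[of y] by (metis add_uminus_conv_diff)
qed

section \<open>Power series over a complex algebra\<close>

instantiation complex :: complex_algebra_1
begin
definition "of_cplx_complex = (\<lambda>c::complex. c)"
instance by standard (auto simp: of_cplx_complex_def)
end

lemma poly_mapping_as_sum:
  "p = (\<Sum>k\<in>Poly_Mapping.keys p. Poly_Mapping.single k (Poly_Mapping.lookup p k))"
  by (rule poly_mapping_eqI)
    (auto simp: lookup_sum lookup_single when_def in_keys_iff)

instantiation poly_mapping :: (monoid_add, complex_algebra_1) complex_algebra_1
begin

definition of_cplx_poly_mapping :: "complex \<Rightarrow> ('a \<Rightarrow>\<^sub>0 'b)" where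
  "of_cplx_poly_mapping c = Poly_Mapping.single 0 (of_cplx c)"

instance
proof
  fix c d :: complex and x :: "'a \<Rightarrow>\<^sub>0 'b"
  show "(of_cplx 1 :: 'a \<Rightarrow>\<^sub>0 'b) = 1"
    by (simp add: of_cplx_poly_mapping_def of_cplx_1)
  show "(of_cplx (c + d) :: 'a \<Rightarrow>\<^sub>0 'b) = of_cplx c + of_cplx d"
    by (simp add: of_cplx_poly_mapping_def of_cplx_add single_add)
  show "(of_cplx (c * d) :: 'a \<Rightarrow>\<^sub>0 'b) = of_cplx c * of_cplx d"
    by (simp add: of_cplx_poly_mapping_def of_cplx_mult mult_single)
  have "of_cplx c * Poly_Mapping.single k v = Poly_Mapping.single k v * of_cplx c" for k :: 'a and v :: 'b
    by (simp add: of_cplx_poly_mapping_def mult_single of_cplx_central)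
  then show "of_cplx c * x = x * of_cplx c"
    by (subst (1 2) poly_mapping_as_sum[of x]) (simp add: sum_distrib_left sum_distrib_right)
qed

end

instantiation fps :: (complex_algebra_1) hbar_algebra
begin

definition of_fps_fps :: "complex fps \<Rightarrow> 'a fps" where
  "of_fps_fps c = Abs_fps (\<lambda>n. of_cplx (fps_nth c n))"

lemma of_fps_X_power: "(of_fps (fps_X ^ n) :: 'a fps) = fps_X ^ n"
  by (rule fps_ext) (auto simp: of_fps_fps_def fps_X_power_nth of_cplx_1)

instance
proof
  fix c d :: "complex fps" and x :: "'a fps" and s :: "nat \<Rightarrow> 'a fps"
  show "(of_fps 1 :: 'a fps) = 1"
    by (rule fps_ext) (auto simp: of_fps_fps_def of_cplx_1)
  show "(of_fps (c + d) :: 'a fps) = of_fps c + of_fps d"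
    by (rule fps_ext) (auto simp: of_fps_fps_def of_cplx_add)
  show "(of_fps (c * d) :: 'a fps) = of_fps c * of_fps d"
    by (rule fps_ext) (auto simp: of_fps_fps_def fps_mult_nth of_cplx_sum of_cplx_mult)
  show "of_fps c * x = x * of_fps c"
  proof (rule fps_ext)
    fix n
    have "(\<Sum>i=0..n. of_cplx (fps_nth c i) * fps_nth x (n - i))
        = (\<Sum>i=0..n. fps_nth x (n - i) * of_cplx (fps_nth c i))"
      by (intro sum.cong refl of_cplx_central)
    also have "\<dots> = (\<Sum>i=0..n. fps_nth x i * of_cplx (fps_nth c (n - i)))"
      by (rule sum.reindex_bij_witness[of _ "\<lambda>i. n - i" "\<lambda>i. n - i"]) auto
    finally show "fps_nth (of_fps c * x) n = fps_nth (x * of_fps c) n"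
      by (simp add: of_fps_fps_def fps_mult_nth)
  qed
  show "x = 0" if "\<And>n. \<exists>y. x = of_fps (fps_X ^ n) * y"
  proof (rule fps_ext)
    fix n
    obtain y where "x = of_fps (fps_X ^ Suc n) * y" using \<open>\<And>n. \<exists>y. x = of_fps (fps_X ^ n) * y\<close> by blast
    then have "x = fps_X ^ Suc n * y" by (simp only: of_fps_X_power)
    then show "fps_nth x n = fps_nth 0 n"
      by (simp add: fps_X_power_mult_nth del: power_Suc)
  qed
  show "\<exists>x. \<forall>n. \<exists>y. x - s n = of_fps (fps_X ^ n) * y"
    if "\<And>n. \<exists>y. s (Suc n) - s n = of_fps (fps_X ^ n) * y"
  proof -
    have step: "fps_nth (s (Suc n)) k = fps_nth (s n) k" if "k < n" for n k
    proof -
      obtain y where "s (Suc n) - s n = fps_X ^ n * y"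
        using \<open>\<And>n. \<exists>y. s (Suc n) - s n = of_fps (fps_X ^ n) * y\<close>[of n] by (auto simp: of_fps_X_power)
      then have "fps_nth (s (Suc n) - s n) k = 0"
        using that by (simp add: fps_X_power_mult_nth)
      then show ?thesis by simp
    qed
    have stable: "fps_nth (s (Suc k + m)) k = fps_nth (s (Suc k)) k" for k m
      by (induction m) (auto simp: step)
    define x where "x = Abs_fps (\<lambda>k. fps_nth (s (Suc k)) k)"
    have low: "fps_nth (x - s n) k = 0" if "k < n" for n k
      using stable[of k "n - Suc k"] that by (simp add: x_def)
    have "x - s n = of_fps (fps_X ^ n) * fps_shift n (x - s n)" for n
      unfolding of_fps_X_power
      by (rule fps_ext) (auto simp: fps_X_power_mult_nth low simp del: fps_sub_nth)
    then show ?thesis by blast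
  qed
qed

end

section \<open>Generators and relations\<close>

datatype 'x gword = GWord "'x list"

instantiation gword :: (type) monoid_add
begin
definition "0 = GWord []"
fun plus_gword :: "'a gword \<Rightarrow> 'a gword \<Rightarrow> 'a gword" where
  "GWord u + GWord v = GWord (u @ v)"
instance
proof
  fix a b c :: "'a gword"
  show "a + b + c = a + (b + c)" by (cases a; cases b; cases c) simp
  show "0 + a = a" "a + 0 = a" by (cases a; simp add: zero_gword_def)+
qed
end

text \<open>The \<open>\<hbar>\<close>-adically completed free algebra on the set of all elements of \<^typ>\<open>'x\<close>.\<close>

type_synonym 'x free_hbar = "('x gword \<Rightarrow>\<^sub>0 complex) fps"

definition hvar :: "'x \<Rightarrow> 'x free_hbar" where
  "hvar x = fps_const (Poly_Mapping.single (GWord [x]) 1)"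

text \<open>
  The algebra \<^typ>\<open>'a\<close> is topologically generated by the elements \<open>gen x\<close> for \<open>x \<in> X\<close>,
  subject to the relations \<open>r = 0\<close> for \<open>r \<in> R\<close>. Letters outside of \<open>X\<close> are discarded.
\<close>

definition presented_by :: "'x set \<Rightarrow> ('x \<Rightarrow> 'a::hbar_algebra) \<Rightarrow> 'x free_hbar set \<Rightarrow> bool" where
  "presented_by X gen R \<longleftrightarrow> (\<exists>ev. hhom ev \<and> surj ev \<and> (\<forall>x\<in>X. ev (hvar x) = gen x) \<and>
     {f. ev f = 0} = closed_ideal (R \<union> hvar ` (- X)))"

definition comm :: "'a::ring \<Rightarrow> 'a \<Rightarrow> 'a" where
  "comm x y = x * y - y * x"

text \<open>\<open>S(W)[[\<hbar>]]\<close> for a complex subspace \<open>W\<close> with scalar multiplication \<open>sc\<close>.\<close>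

definition symmetric_hbar_algebra ::
    "(complex \<Rightarrow> 'w::ab_group_add \<Rightarrow> 'w) \<Rightarrow> 'w set \<Rightarrow> ('w \<Rightarrow> 'a::hbar_algebra) \<Rightarrow> bool" where
  "symmetric_hbar_algebra sc W \<iota> \<longleftrightarrow> presented_by W \<iota>
     ({hvar (x + y) - hvar x - hvar y | x y. x \<in> W \<and> y \<in> W} \<union>
      {hvar (sc c x) - of_cx c * hvar x | c x. x \<in> W} \<union>
      {comm (hvar x) (hvar y) | x y. x \<in> W \<and> y \<in> W})"

section \<open>Completed tensor products\<close>

datatype ('a, 'b) pure_tensor = Pure_Tensor 'a 'b

instantiation pure_tensor :: (monoid_mult, monoid_mult) monoid_add
begin
definition "0 = Pure_Tensor 1 1"
fun plus_pure_tensor :: "('a, 'b) pure_tensor \<Rightarrow> ('a, 'b) pure_tensor \<Rightarrow> ('a, 'b) pure_tensor" where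
  "Pure_Tensor a b + Pure_Tensor a' b' = Pure_Tensor (a * a') (b * b')"
instance
proof
  fix a b c :: "('a, 'b) pure_tensor"
  show "a + b + c = a + (b + c)" by (cases a; cases b; cases c) (simp add: mult.assoc)
  show "0 + a = a" "a + 0 = a" by (cases a; simp add: zero_pure_tensor_def)+
qed
end

text \<open>
  The completed tensor product of \<open>A\<close> and \<open>B\<close> over \<open>\<complex>[[\<hbar>]]\<close> is the completed free module on
  \<open>A \<times> B\<close>, with multiplication \<open>(a, b) (a', b') = (a a', b b')\<close>, modulo the closed submodule
  generated by the bilinearity relations. The latter are stable under multiplication by pairs,
  so this submodule is the closed ideal used below.
\<close>

type_synonym ('a, 'b) pre_tensor = "(('a, 'b) pure_tensor \<Rightarrow>\<^sub>0 complex) fps"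

definition pre_tensor :: "'a \<Rightarrow> 'b \<Rightarrow> ('a::hbar_algebra, 'b::hbar_algebra) pre_tensor" where
  "pre_tensor a b = fps_const (Poly_Mapping.single (Pure_Tensor a b) 1)"

definition bilinearity :: "('a::hbar_algebra, 'b::hbar_algebra) pre_tensor set" where
  "bilinearity =
     {pre_tensor (a + a') b - pre_tensor a b - pre_tensor a' b | a a' b. True} \<union>
     {pre_tensor a (b + b') - pre_tensor a b - pre_tensor a b' | a b b'. True} \<union>
     {pre_tensor (of_fps c * a) b - of_fps c * pre_tensor a b | a b c. True} \<union>
     {pre_tensor a (of_fps c * b) - of_fps c * pre_tensor a b | a b c. True}"

definition tensor_rel ::
    "('a::hbar_algebra, 'b::hbar_algebra) pre_tensor \<Rightarrow> ('a, 'b) pre_tensor \<Rightarrow> bool" where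
  "tensor_rel x y \<longleftrightarrow> x - y \<in> closed_ideal bilinearity"


lemma residue_functional:
  obtains \<phi> :: "'a::hbar_algebra \<Rightarrow> complex"
  where "\<And>x y. \<phi> (x + y) = \<phi> x + \<phi> y"
    and "\<And>c x. \<phi> (of_fps c * x) = fps_nth c 0 * \<phi> x"
    and "\<phi> 1 = 1"
proof -
  let ?sc = "\<lambda>c (x::'a). of_cx c * x"
  have sc: "?sc (c + d) x = ?sc c x + ?sc d x" "?sc c (?sc d x) = ?sc (c * d) x" for c d and x :: 'a
  proof -
    show "?sc (c + d) x = ?sc c x + ?sc d x"
      by (simp only: fps_const_add[symmetric] of_fps_add distrib_right)
    show "?sc c (?sc d x) = ?sc (c * d) x"
      by (simp only: fps_const_mult[symmetric] of_fps_mult mult.assoc)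
  qed
  interpret vector_space_pair ?sc "(*) :: complex \<Rightarrow> complex \<Rightarrow> complex"
    by unfold_locales (simp_all add: sc distrib_left distrib_right of_fps_1)
  define H where "H = range (\<lambda>y::'a. \<hbar> * y)"
  have "vs1.subspace H"
    unfolding vs1.subspace_def H_def
  proof (safe)
    show "0 \<in> range ((*) \<hbar> :: 'a \<Rightarrow> 'a)" by (rule range_eqI[of _ _ 0]) simp
    show "\<hbar> * x + \<hbar> * y \<in> range ((*) \<hbar>)" for x y :: 'a
      by (rule range_eqI[of _ _ "x + y"]) (simp add: algebra_simps)
    show "of_cx c * (\<hbar> * x) \<in> range ((*) \<hbar>)" for x :: 'a and c
      using of_fps_central[of "fps_const c" "\<hbar> :: 'a"]
      by (intro range_eqI[of _ _ "of_cx c * x"]) (simp flip: mult.assoc)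
  qed
  have one: "1 \<notin> H"
  proof
    assume "1 \<in> H"
    then obtain y :: 'a where y: "1 = \<hbar> * y" by (auto simp: H_def)
    have "1 = \<hbar> ^ n * y ^ n" for n
    proof (induction n)
      case (Suc n)
      have "\<hbar> ^ Suc n * y ^ Suc n = \<hbar> ^ n * (\<hbar> * y) * y ^ n"
        by (simp only: power_Suc2[of \<hbar>] power_Suc[of y] mult.assoc)
      then show ?case using y Suc by simp
    qed simp
    then have "\<exists>y :: 'a. 1 = of_fps (fps_X ^ n) * y" for n
      unfolding of_fps_power by blast
    then have "(1::'a) = 0" by (rule hbar_separated)
    then show False by simp
  qed
  obtain B where B: "B \<subseteq> H" "vs1.independent B" "H \<subseteq> vs1.span B"
    using vs1.maximal_independent_subset by blast
  have spanB: "vs1.span B = H"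
    using B \<open>vs1.subspace H\<close> by (simp add: vs1.span_minimal subset_antisym)
  have "vs1.independent (insert 1 B)"
    using B one spanB by (simp add: vs1.independent_insert)
  then obtain f where f: "Vector_Spaces.linear ?sc (*) f" "\<forall>x\<in>insert 1 B. f x = (if x = 1 then 1 else 0)"
    using linear_independent_extend[of "insert 1 B" "\<lambda>x. if x = 1 then 1 else 0"] by auto
  interpret f: Vector_Spaces.linear ?sc "(*)" f by fact
  have f0: "f x = 0" if "x \<in> H" for x
  proof -
    have "x \<in> vs1.span B" using that spanB by simp
    moreover have "f b = 0" if "b \<in> B" for b
      using f(2) that one B(1) by auto
    ultimately show ?thesis by (rule f.eq_0_on_span[rotated]) 
  qed
  show thesis
  proof
    show "f (x + y) = f x + f y" for x y by (rule f.add)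
    show "f 1 = 1" using f(2) by simp
    show "f (of_fps c * x) = fps_nth c 0 * f x" for c x
    proof -
      have c: "c = fps_const (fps_nth c 0) + fps_X * fps_shift 1 c"
        by (rule fps_ext) auto
      have "of_fps c * x = of_cx (fps_nth c 0) * x + \<hbar> * (of_fps (fps_shift 1 c) * x)"
        by (subst c) (simp add: of_fps_add of_fps_mult algebra_simps)
      then show ?thesis
        using f0[of "\<hbar> * (of_fps (fps_shift 1 c) * x)"] by (simp add: H_def f.add f.scale)
    qed
  qed
qed

lemma one_notin_bilinearity:
  "(1 :: ('a::hbar_algebra, 'b::hbar_algebra) pre_tensor) \<notin> closed_ideal bilinearity"
proof
  assume one: "(1 :: ('a, 'b) pre_tensor) \<in> closed_ideal bilinearity"
  obtain \<phi> :: "'a \<Rightarrow> complex" where \<phi>: "\<And>x y. \<phi> (x + y) = \<phi> x + \<phi> y"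
    "\<And>c x. \<phi> (of_fps c * x) = fps_nth c 0 * \<phi> x" "\<phi> 1 = 1"
    by (rule residue_functional) blast
  obtain \<psi> :: "'b \<Rightarrow> complex" where \<psi>: "\<And>x y. \<psi> (x + y) = \<psi> x + \<psi> y"
    "\<And>c x. \<psi> (of_fps c * x) = fps_nth c 0 * \<psi> x" "\<psi> 1 = 1"
    by (rule residue_functional) blast
  define w where "w k = (case k of Pure_Tensor a b \<Rightarrow> \<phi> a * \<psi> b)" for k
  define \<Phi> where "\<Phi> p = (\<Sum>k\<in>Poly_Mapping.keys p. Poly_Mapping.lookup p k * w k)"
    for p :: "('a, 'b) pure_tensor \<Rightarrow>\<^sub>0 complex"
  have \<Phi>_eq: "\<Phi> p = (\<Sum>k\<in>K. Poly_Mapping.lookup p k * w k)"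
    if "finite K" "Poly_Mapping.keys p \<subseteq> K" for K p
    unfolding \<Phi>_def by (rule sum.mono_neutral_left) (use that in \<open>auto simp: in_keys_iff\<close>)
  have \<Phi>_add: "\<Phi> (p + q) = \<Phi> p + \<Phi> q" for p q
  proof -
    let ?K = "Poly_Mapping.keys p \<union> Poly_Mapping.keys q"
    have "Poly_Mapping.keys (p + q) \<subseteq> ?K" by (rule Poly_Mapping.keys_add)
    then have "\<Phi> (p + q) = (\<Sum>k\<in>?K. Poly_Mapping.lookup (p + q) k * w k)"
      by (intro \<Phi>_eq) auto
    also have "\<dots> = \<Phi> p + \<Phi> q"
      using \<Phi>_eq[of ?K p] \<Phi>_eq[of ?K q] by (simp add: lookup_add algebra_simps sum.distrib)
    finally show ?thesis .
  qed
  have \<Phi>_0: "\<Phi> 0 = 0" by (simp add: \<Phi>_def)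
  have \<Phi>_sum: "\<Phi> (sum f S) = (\<Sum>i\<in>S. \<Phi> (f i))" for f and S :: "'z set"
    by (induction S rule: infinite_finite_induct) (auto simp: \<Phi>_add \<Phi>_0)
  have \<Phi>_single: "\<Phi> (Poly_Mapping.single k c) = c * w k" for k c
    using \<Phi>_eq[of "{k}" "Poly_Mapping.single k c"] by (simp add: keys_single)
  have \<Phi>_scale: "\<Phi> (of_cplx c * p) = c * \<Phi> p" for c p
    by (subst (1 2) poly_mapping_as_sum[of p])
      (simp add: sum_distrib_left of_cplx_poly_mapping_def of_cplx_complex_def
        mult_single \<Phi>_sum \<Phi>_single mult.assoc)
  have \<Phi>_minus: "\<Phi> (p - q) = \<Phi> p - \<Phi> q" for p q
    using \<Phi>_add[of "p - q" q] by simp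
  define I where "I = {f :: ('a, 'b) pre_tensor. \<forall>p q. \<Phi> (p * fps_nth f 0 * q) = 0}"
  have of_fps_nth: "fps_nth (of_fps c * f) 0 = of_cplx (fps_nth c 0) * fps_nth f 0"
    for c and f :: "('a, 'b) pre_tensor"
    by (simp add: of_fps_fps_def)
  have swap: "p * (of_cplx c * x) * q = of_cplx c * (p * x * q)"
    for c p q and x :: "('a, 'b) pure_tensor \<Rightarrow>\<^sub>0 complex"
    by (metis mult.assoc of_cplx_central)
  have "hsubmodule I"
    unfolding hsubmodule_def I_def
    by (auto simp: algebra_simps \<Phi>_add \<Phi>_0 of_fps_nth)
      (metis (no_types, lifting) \<Phi>_scale mult.assoc mult_zero_right swap)
  moreover have "\<forall>x\<in>I. \<forall>a. a * x \<in> I \<and> x * a \<in> I"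
    unfolding I_def by (auto simp flip: mult.assoc) (simp add: mult.assoc)
  moreover have "hclosed I"
    unfolding hclosed_def
  proof (intro allI impI)
    fix x assume "\<forall>n. \<exists>y\<in>I. hcong n x y"
    then obtain y z where y: "y \<in> I" "x - y = \<hbar> ^ 1 * z"
      unfolding hcong_def by blast
    have "fps_nth (\<hbar> ^ 1 * z) 0 = 0"
      by (simp add: of_fps_fps_def)
    then have "fps_nth x 0 = fps_nth y 0"
      unfolding y(2)[symmetric] by simp
    then show "x \<in> I" using y(1) by (simp add: I_def)
  qed
  moreover have "bilinearity \<subseteq> I"
  proof -
    have I: "r \<in> I" if "\<And>k l. \<Phi> (Poly_Mapping.single k 1 * fps_nth r 0 * Poly_Mapping.single l 1) = 0" for r
      unfolding I_def
    proof (intro CollectI allI)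
      fix p q
      have *: "Poly_Mapping.single k c = of_cplx c * Poly_Mapping.single k 1"
        for k :: "('a, 'b) pure_tensor" and c :: complex
        by (simp add: of_cplx_poly_mapping_def of_cplx_complex_def mult_single)
      have "\<Phi> (Poly_Mapping.single k c * fps_nth r 0 * Poly_Mapping.single l d) = 0" for k l c d
      proof -
        have "Poly_Mapping.single k c * fps_nth r 0 * Poly_Mapping.single l d
          = of_cplx c * ((Poly_Mapping.single k 1 * fps_nth r 0 * of_cplx d) * Poly_Mapping.single l 1)"
          by (subst *[of k c], subst *[of l d]) (simp only: mult.assoc)
        also have "Poly_Mapping.single k 1 * fps_nth r 0 * of_cplx d
          = of_cplx d * (Poly_Mapping.single k 1 * fps_nth r 0)"
          by (rule of_cplx_central[symmetric])
        finally have "Poly_Mapping.single k c * fps_nth r 0 * Poly_Mapping.single l d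
          = of_cplx c * (of_cplx d * (Poly_Mapping.single k 1 * fps_nth r 0 * Poly_Mapping.single l 1))"
          by (simp only: mult.assoc)
        then show ?thesis by (simp add: \<Phi>_scale that)
      qed
      then show "\<Phi> (p * fps_nth r 0 * q) = 0"
        by (subst poly_mapping_as_sum[of p], subst poly_mapping_as_sum[of q])
          (simp add: sum_distrib_left sum_distrib_right \<Phi>_sum)
    qed
    have val: "\<Phi> (Poly_Mapping.single (Pure_Tensor a1 b1) 1 * fps_nth (pre_tensor a b) 0
        * Poly_Mapping.single (Pure_Tensor a2 b2) 1) = \<phi> (a1 * a * a2) * \<psi> (b1 * b * b2)"
      for a1 a a2 b1 b b2
      by (simp add: pre_tensor_def mult_single \<Phi>_single w_def)
    have sc: "\<phi> (x * (of_fps c * a) * y) = fps_nth c 0 * \<phi> (x * a * y)" for x c a y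
      by (metis \<phi>(2) mult.assoc of_fps_central)
    have sc': "\<psi> (x * (of_fps c * a) * y) = fps_nth c 0 * \<psi> (x * a * y)" for x c a y
      by (metis \<psi>(2) mult.assoc of_fps_central)
    show ?thesis
      unfolding bilinearity_def
    proof (safe)
      fix a a' b
      show "pre_tensor (a + a') b - pre_tensor a b - pre_tensor a' b \<in> I"
      proof (rule I)
        fix k l show "\<Phi> (Poly_Mapping.single k 1 * fps_nth (pre_tensor (a + a') b - pre_tensor a b - pre_tensor a' b) 0
           * Poly_Mapping.single l 1) = 0"
          by (cases k; cases l)
            (simp add: left_diff_distrib right_diff_distrib \<Phi>_minus val distrib_left distrib_right \<phi>(1))
      qed
    next
      fix a b b'
      show "pre_tensor a (b + b') - pre_tensor a b - pre_tensor a b' \<in> I"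
      proof (rule I)
        fix k l show "\<Phi> (Poly_Mapping.single k 1 * fps_nth (pre_tensor a (b + b') - pre_tensor a b - pre_tensor a b') 0
           * Poly_Mapping.single l 1) = 0"
          by (cases k; cases l)
            (simp add: left_diff_distrib right_diff_distrib \<Phi>_minus val distrib_left distrib_right \<psi>(1))
      qed
    next
      fix a b c
      show "pre_tensor (of_fps c * a) b - of_fps c * pre_tensor a b \<in> I"
      proof (rule I)
        fix k l show "\<Phi> (Poly_Mapping.single k 1 * fps_nth (pre_tensor (of_fps c * a) b - of_fps c * pre_tensor a b) 0
           * Poly_Mapping.single l 1) = 0"
          unfolding fps_sub_nth of_fps_nth left_diff_distrib right_diff_distrib \<Phi>_minus swap \<Phi>_scale
          by (cases k; cases l) (simp add: val sc)
      qed
    next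
      fix a b c
      show "pre_tensor a (of_fps c * b) - of_fps c * pre_tensor a b \<in> I"
      proof (rule I)
        fix k l show "\<Phi> (Poly_Mapping.single k 1 * fps_nth (pre_tensor a (of_fps c * b) - of_fps c * pre_tensor a b) 0
           * Poly_Mapping.single l 1) = 0"
          unfolding fps_sub_nth of_fps_nth left_diff_distrib right_diff_distrib \<Phi>_minus swap \<Phi>_scale
          by (cases k; cases l) (simp add: val sc')
      qed
    qed
  qed
  ultimately have "closed_ideal bilinearity \<subseteq> I"
    unfolding closed_ideal_def by blast
  with one have "\<Phi> (1 * fps_nth 1 0 * 1) = 0" unfolding I_def by blast
  moreover have "\<Phi> (1 * fps_nth 1 0 * 1) = 1"
    by (simp add: \<Phi>_single w_def zero_pure_tensor_def mult_single \<phi>(3) \<psi>(3) flip: single_one)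
  ultimately show False by simp
qed

quotient_type (overloaded) ('a, 'b) ctensor (infixr \<open>\<otimes>\<close> 22) =
  "('a::hbar_algebra, 'b::hbar_algebra) pre_tensor" / tensor_rel
proof (rule equivpI)
  note sub = hsubmodule_closed_ideal[of "bilinearity :: ('a, 'b) pre_tensor set"]
  show "reflp (tensor_rel :: ('a, 'b) pre_tensor \<Rightarrow> _)"
    by (auto intro!: reflpI simp: tensor_rel_def hsubmodule_0[OF sub])
  show "symp (tensor_rel :: ('a, 'b) pre_tensor \<Rightarrow> _)"
  proof (rule sympI)
    fix x y :: "('a, 'b) pre_tensor"
    assume "tensor_rel x y"
    then have "- (x - y) \<in> closed_ideal bilinearity"
      unfolding tensor_rel_def by (rule hsubmodule_minus[OF sub])
    then show "tensor_rel y x" by (simp add: tensor_rel_def)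
  qed
  show "transp (tensor_rel :: ('a, 'b) pre_tensor \<Rightarrow> _)"
  proof (rule transpI)
    fix x y z :: "('a, 'b) pre_tensor"
    assume "tensor_rel x y" "tensor_rel y z"
    then have "(x - y) + (y - z) \<in> closed_ideal bilinearity"
      unfolding tensor_rel_def by (rule hsubmodule_add[OF sub])
    then show "tensor_rel x z" by (simp add: tensor_rel_def)
  qed
qed

instantiation ctensor :: (hbar_algebra, hbar_algebra) ring_1
begin

lift_definition zero_ctensor :: "'a \<otimes> 'b" is 0 .
lift_definition one_ctensor :: "'a \<otimes> 'b" is 1 .
lift_definition plus_ctensor :: "'a \<otimes> 'b \<Rightarrow> 'a \<otimes> 'b \<Rightarrow> 'a \<otimes> 'b" is "(+)"
proof -
  fix a a' b b' :: "('a, 'b) pre_tensor"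
  assume "tensor_rel a a'" "tensor_rel b b'"
  then have "(a - a') + (b - b') \<in> closed_ideal bilinearity"
    unfolding tensor_rel_def by (rule hsubmodule_add[OF hsubmodule_closed_ideal])
  then show "tensor_rel (a + b) (a' + b')" by (simp add: tensor_rel_def algebra_simps)
qed

lift_definition minus_ctensor :: "'a \<otimes> 'b \<Rightarrow> 'a \<otimes> 'b \<Rightarrow> 'a \<otimes> 'b" is "(-)"
proof -
  fix a a' b b' :: "('a, 'b) pre_tensor"
  assume "tensor_rel a a'" "tensor_rel b b'"
  then have "(a - a') - (b - b') \<in> closed_ideal bilinearity"
    unfolding tensor_rel_def by (rule hsubmodule_diff[OF hsubmodule_closed_ideal])
  then show "tensor_rel (a - b) (a' - b')" by (simp add: tensor_rel_def algebra_simps)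
qed

lift_definition uminus_ctensor :: "'a \<otimes> 'b \<Rightarrow> 'a \<otimes> 'b" is "uminus"
proof -
  fix a a' :: "('a, 'b) pre_tensor"
  assume "tensor_rel a a'"
  then have "- (a - a') \<in> closed_ideal bilinearity"
    unfolding tensor_rel_def by (rule hsubmodule_minus[OF hsubmodule_closed_ideal])
  then show "tensor_rel (- a) (- a')" by (simp add: tensor_rel_def algebra_simps)
qed

lift_definition times_ctensor :: "'a \<otimes> 'b \<Rightarrow> 'a \<otimes> 'b \<Rightarrow> 'a \<otimes> 'b" is "(*)"
proof -
  fix a a' b b' :: "('a, 'b) pre_tensor"
  assume "tensor_rel a a'" "tensor_rel b b'"
  then have "(a - a') * b + a' * (b - b') \<in> closed_ideal bilinearity"
    unfolding tensor_rel_def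
    by (intro hsubmodule_add[OF hsubmodule_closed_ideal] closed_ideal_mult_left closed_ideal_mult_right)
  then show "tensor_rel (a * b) (a' * b')" by (simp add: tensor_rel_def algebra_simps)
qed

instance
proof
  note sub = hsubmodule_closed_ideal[of "bilinearity :: ('a, 'b) pre_tensor set"]
  have refl: "x = y \<Longrightarrow> tensor_rel x y" for x y :: "('a, 'b) pre_tensor"
    by (simp add: tensor_rel_def hsubmodule_0[OF sub])
  fix a b c :: "'a \<otimes> 'b"
  show "a * b * c = a * (b * c)" by transfer (simp add: refl mult.assoc)
  show "a + b + c = a + (b + c)" by transfer (simp add: refl add.assoc)
  show "a + b = b + a" by transfer (simp add: refl add.commute)
  show "0 + a = a" by transfer (simp add: refl)
  show "- a + a = 0" by transfer (simp add: refl)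
  show "a - b = a + - b" by transfer (simp add: refl)
  show "(a + b) * c = a * c + b * c" by transfer (simp add: refl distrib_right)
  show "a * (b + c) = a * b + a * c" by transfer (simp add: refl distrib_left)
  show "1 * a = a" by transfer (simp add: refl)
  show "a * 1 = a" by transfer (simp add: refl)
  show "(0 :: 'a \<otimes> 'b) \<noteq> 1"
  proof transfer
    show "\<not> tensor_rel (0 :: ('a, 'b) pre_tensor) 1"
      using one_notin_bilinearity hsubmodule_minus[OF sub, of "0 - 1"] by (auto simp: tensor_rel_def)
  qed
qed

end

instantiation ctensor :: (hbar_algebra, hbar_algebra) hbar_algebra
begin

lift_definition of_fps_ctensor :: "complex fps \<Rightarrow> 'a \<otimes> 'b" is of_fps .

instance
proof
  note sub = hsubmodule_closed_ideal[of "bilinearity :: ('a, 'b) pre_tensor set"]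
  have refl: "x = y \<Longrightarrow> tensor_rel x y" for x y :: "('a, 'b) pre_tensor"
    by (simp add: tensor_rel_def hsubmodule_0[OF sub])
  fix a :: "'a \<otimes> 'b" and f g :: "complex fps" and s :: "nat \<Rightarrow> 'a \<otimes> 'b"
  show "(of_fps 1 :: 'a \<otimes> 'b) = 1" by transfer (simp add: refl of_fps_1)
  show "(of_fps (f + g) :: 'a \<otimes> 'b) = of_fps f + of_fps g"
    by transfer (simp add: refl of_fps_add)
  show "(of_fps (f * g) :: 'a \<otimes> 'b) = of_fps f * of_fps g"
    by transfer (simp add: refl of_fps_mult)
  show "of_fps f * a = a * of_fps f" by transfer (simp add: refl of_fps_central)
  show "a = 0" if "\<And>n. \<exists>y. a = of_fps (fps_X ^ n) * y"
    using that
  proof transfer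
    fix a :: "('a, 'b) pre_tensor"
    assume *: "\<And>n. \<exists>y. tensor_rel a (of_fps (fps_X ^ n) * y)"
    have "a \<in> closed_ideal bilinearity"
    proof (rule hclosed_closed_ideal[unfolded hclosed_def, rule_format])
      fix n
      obtain y where "tensor_rel a (of_fps (fps_X ^ n) * y)" using * by blast
      then show "\<exists>y\<in>closed_ideal bilinearity. hcong n a y"
        unfolding tensor_rel_def hcong_def
        by (intro bexI[of _ "a - of_fps (fps_X ^ n) * y"]) (auto simp: of_fps_power)
    qed
    then show "tensor_rel a 0" by (simp add: tensor_rel_def)
  qed
  show "\<exists>x. \<forall>n. \<exists>y. x - s n = of_fps (fps_X ^ n) * y"
    if cauchy: "\<And>n. \<exists>y. s (Suc n) - s n = of_fps (fps_X ^ n) * y"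
  proof -
    obtain y where y: "s (Suc n) - s n = of_fps (fps_X ^ n) * y n" for n
      using cauchy by metis
    define u where "u = rec_nat (rep_ctensor (s 0)) (\<lambda>n v. v + of_fps (fps_X ^ n) * rep_ctensor (y n))"
    have abs_rep: "abs_ctensor (rep_ctensor x) = x" for x :: "'a \<otimes> 'b"
      using Quotient_ctensor by (rule Quotient_abs_rep)
    have abs_step: "abs_ctensor (v + of_fps (fps_X ^ n) * w)
        = abs_ctensor v + of_fps (fps_X ^ n) * abs_ctensor w" for v w :: "('a, 'b) pre_tensor" and n
      by (simp add: plus_ctensor.abs_eq times_ctensor.abs_eq of_fps_ctensor.abs_eq)
    have u: "abs_ctensor (u n) = s n" for n
    proof (induction n)
      case (Suc n)
      have "abs_ctensor (u (Suc n)) = s n + of_fps (fps_X ^ n) * y n"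
        using Suc by (simp add: u_def abs_step abs_rep)
      also have "\<dots> = s (Suc n)" by (simp flip: y)
      finally show ?case .
    qed (simp add: u_def abs_rep)
    have "\<exists>w. u (Suc n) - u n = of_fps (fps_X ^ n) * w" for n
      by (auto simp: u_def)
    then obtain x where "\<forall>n. \<exists>w. x - u n = of_fps (fps_X ^ n) * w"
      using hbar_complete by blast
    then obtain w where "x = u n + of_fps (fps_X ^ n) * w n" for n
      by (metis add.commute diff_add_cancel)
    then have "abs_ctensor x = s n + of_fps (fps_X ^ n) * abs_ctensor (w n)" for n
      using abs_step[of "u n" n "w n"] u[of n] by metis
    then have "abs_ctensor x - s n = of_fps (fps_X ^ n) * abs_ctensor (w n)" for n
      by (simp add: algebra_simps)
    then show ?thesis by blast
  qed
qed

end


lift_definition tensor :: "'a::hbar_algebra \<Rightarrow> 'b::hbar_algebra \<Rightarrow> 'a \<otimes> 'b" (infixl \<open>\<otimes>\<close> 76)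
  is pre_tensor .

text \<open>For \<open>\<complex>[[\<hbar>]]\<close>-bilinear \<open>\<beta>\<close> the map \<open>F\<close> exists and is unique, since \<open>'c\<close> is separated and
  complete.\<close>

definition tensor_lift ::
    "('a::hbar_algebra \<Rightarrow> 'b::hbar_algebra \<Rightarrow> 'c::hbar_algebra) \<Rightarrow> 'a \<otimes> 'b \<Rightarrow> 'c" where
  "tensor_lift \<beta> = (THE F. hlinear F \<and> (\<forall>a b. F (a \<otimes> b) = \<beta> a b))"

definition tensor_map ::
    "('a::hbar_algebra \<Rightarrow> 'c::hbar_algebra) \<Rightarrow> ('b::hbar_algebra \<Rightarrow> 'd::hbar_algebra) \<Rightarrow>
     'a \<otimes> 'b \<Rightarrow> 'c \<otimes> 'd" where
  "tensor_map f g = tensor_lift (\<lambda>a b. f a \<otimes> g b)"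

definition tensor_flip :: "'a::hbar_algebra \<otimes> 'b::hbar_algebra \<Rightarrow> 'b \<otimes> 'a" where
  "tensor_flip = tensor_lift (\<lambda>a b. b \<otimes> a)"

definition tensor_assoc ::
    "('a::hbar_algebra \<otimes> 'b::hbar_algebra) \<otimes> 'c::hbar_algebra \<Rightarrow> 'a \<otimes> ('b \<otimes> 'c)" where
  "tensor_assoc = tensor_lift (\<lambda>u c. tensor_lift (\<lambda>a b. a \<otimes> (b \<otimes> c)) u)"

definition tensor_middle_flip ::
    "('a::hbar_algebra \<otimes> 'a) \<otimes> ('b::hbar_algebra \<otimes> 'b) \<Rightarrow> ('a \<otimes> 'b) \<otimes> ('a \<otimes> 'b)" where
  "tensor_middle_flip = tensor_lift (\<lambda>u v. tensor_lift (\<lambda>a a'.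
     tensor_lift (\<lambda>b b'. (a \<otimes> b) \<otimes> (a' \<otimes> b')) v) u)"

section \<open>Topological Hopf algebras\<close>

record (overloaded) 'a hopf =
  comult :: "'a::hbar_algebra \<Rightarrow> 'a \<otimes> 'a"
  counit :: "'a \<Rightarrow> complex fps"
  antipode :: "'a \<Rightarrow> 'a"

definition topological_hopf_algebra :: "'a::hbar_algebra hopf \<Rightarrow> bool" where
  "topological_hopf_algebra H \<longleftrightarrow>
     hhom (comult H) \<and> hhom (counit H) \<and> hlinear (antipode H) \<and>
     (\<forall>x. tensor_assoc (tensor_map (comult H) id (comult H x))
        = tensor_map id (comult H) (comult H x)) \<and>
     (\<forall>x. tensor_lift (\<lambda>a b. of_fps (counit H a) * b) (comult H x) = x) \<and>
     (\<forall>x. tensor_lift (\<lambda>a b. a * of_fps (counit H b)) (comult H x) = x) \<and>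
     (\<forall>x. tensor_lift (\<lambda>a b. antipode H a * b) (comult H x) = of_fps (counit H x)) \<and>
     (\<forall>x. tensor_lift (\<lambda>a b. a * antipode H b) (comult H x) = of_fps (counit H x))"

definition tensor_hopf ::
    "'a::hbar_algebra hopf \<Rightarrow> 'b::hbar_algebra hopf \<Rightarrow> ('a \<otimes> 'b) hopf" where
  "tensor_hopf H K = \<lparr>
     comult = (\<lambda>x. tensor_middle_flip (tensor_map (comult H) (comult K) x)),
     counit = tensor_lift (\<lambda>a b. counit H a * counit K b),
     antipode = tensor_map (antipode H) (antipode K)\<rparr>"

definition hopf_isomorphism ::
    "'a::hbar_algebra hopf \<Rightarrow> 'b::hbar_algebra hopf \<Rightarrow> ('a \<Rightarrow> 'b) \<Rightarrow> bool" where
  "hopf_isomorphism H K f \<longleftrightarrow> hhom f \<and> bij f \<and>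
     (\<forall>x. comult K (f x) = tensor_map f f (comult H x)) \<and>
     (\<forall>x. counit K (f x) = counit H x) \<and>
     (\<forall>x. antipode K (f x) = f (antipode H x))"

definition grouplike :: "'a::hbar_algebra hopf \<Rightarrow> 'a \<Rightarrow> bool" where
  "grouplike H x \<longleftrightarrow> comult H x = x \<otimes> x \<and> counit H x = 1"

section \<open>Matrices\<close>

text \<open>
  \<open>V\<close> is \<open>\<complex>\<^sup>n\<close> by the choice of its fixed basis. Elements of \<open>End(V) \<otimes> A\<close> are matrices over
  \<open>A\<close>, multiplied by \<open>(**)\<close>; elements of \<open>End(V) \<otimes> End(V) \<otimes> A\<close> are matrices whose rows and
  columns are indexed by pairs.
\<close>

definition map_mat :: "('a \<Rightarrow> 'b) \<Rightarrow> 'a^'n^'m \<Rightarrow> 'b^'n^'m" where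
  "map_mat f M = (\<chi> i j. f (M $ i $ j))"

definition smat :: "'a::times \<Rightarrow> 'a^'n^'m \<Rightarrow> 'a^'n^'m" where
  "smat c M = (\<chi> i j. c * M $ i $ j)"

definition mcomm :: "'a::ring_1^'n^'n \<Rightarrow> 'a^'n^'n \<Rightarrow> 'a^'n^'n" where
  "mcomm A B = A ** B - B ** A"

definition mat_power :: "'a::ring_1^'n^'n \<Rightarrow> nat \<Rightarrow> 'a^'n^'n" where
  "mat_power A k = (((**) A) ^^ k) (mat 1)"

definition mat_hexp :: "'a::hbar_algebra^'n^'n \<Rightarrow> 'a^'n^'n" where
  "mat_hexp A = (\<chi> i j. hlim (\<lambda>N. (\<Sum>n<N. smat (of_cx (1 / fact n)) (mat_power A n)) $ i $ j))"

definition mat_unit :: "'n \<Rightarrow> 'n \<Rightarrow> complex^'n^'n" where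
  "mat_unit a b = (\<chi> i j. if i = a \<and> j = b then 1 else 0)"

definition leg1 :: "'a::zero^'n^'n \<Rightarrow> 'a^('n::finite \<times> 'n)^('n \<times> 'n)" where
  "leg1 T = (\<chi> p q. if snd p = snd q then T $ fst p $ fst q else 0)"

definition leg2 :: "'a::zero^'n^'n \<Rightarrow> 'a^('n::finite \<times> 'n)^('n \<times> 'n)" where
  "leg2 T = (\<chi> p q. if fst p = fst q then T $ snd p $ snd q else 0)"

text \<open>The product of \<open>A\<close> with entries placed in the first tensor factor and \<open>B\<close> with entries
  placed in the second one.\<close>

definition mat_tensor :: "'a::hbar_algebra^'n^'n \<Rightarrow> 'a^'n^'n \<Rightarrow> ('a \<otimes> 'a)^'n^'n" where
  "mat_tensor A B = (\<chi> i j. \<Sum>k\<in>UNIV. A $ i $ k \<otimes> B $ k $ j)"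

section \<open>Linear functionals\<close>

text \<open>Functionals on a subspace \<open>W\<close> are extended by \<open>0\<close> outside of \<open>W\<close>.\<close>

definition dual :: "(complex \<Rightarrow> 'w::ab_group_add \<Rightarrow> 'w) \<Rightarrow> 'w set \<Rightarrow> ('w \<Rightarrow> complex) set" where
  "dual sc W = {f. (\<forall>x\<in>W. \<forall>y\<in>W. f (x + y) = f x + f y) \<and>
     (\<forall>c. \<forall>x\<in>W. f (sc c x) = c * f x) \<and> (\<forall>x. x \<notin> W \<longrightarrow> f x = 0)}"

definition fun_scale :: "complex \<Rightarrow> ('w \<Rightarrow> complex) \<Rightarrow> 'w \<Rightarrow> complex" where
  "fun_scale c f = (\<lambda>x. c * f x)"

section \<open>Simple Lie algebras\<close>

record ('g, 'i) lie_data =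
  scaleL :: "complex \<Rightarrow> 'g \<Rightarrow> 'g"
  bracket :: "'g \<Rightarrow> 'g \<Rightarrow> 'g"
  form :: "'g \<Rightarrow> 'g \<Rightarrow> complex"
  cartan :: "'g set"
  simple_root :: "'i \<Rightarrow> 'g \<Rightarrow> complex"
  hroot :: "'i \<Rightarrow> 'g"
  coweight :: "'i \<Rightarrow> 'g"
  xplus :: "'i \<Rightarrow> 'g"
  xminus :: "'i \<Rightarrow> 'g"

definition lie_algebra :: "('g::ab_group_add, 'i) lie_data \<Rightarrow> bool" where
  "lie_algebra L \<longleftrightarrow> vector_space (scaleL L) \<and>
     (\<forall>x. Vector_Spaces.linear (scaleL L) (scaleL L) (bracket L x)) \<and>
     (\<forall>y. Vector_Spaces.linear (scaleL L) (scaleL L) (\<lambda>x. bracket L x y)) \<and>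
     (\<forall>x. bracket L x x = 0) \<and>
     (\<forall>x y z. bracket L x (bracket L y z) + bracket L y (bracket L z x)
        + bracket L z (bracket L x y) = 0)"

definition simple_lie_algebra :: "('g::ab_group_add, 'i) lie_data \<Rightarrow> bool" where
  "simple_lie_algebra L \<longleftrightarrow> lie_algebra L \<and>
     (\<exists>B. finite B \<and> module.span (scaleL L) B = UNIV) \<and>
     (\<exists>x y. bracket L x y \<noteq> 0) \<and>
     (\<forall>I. module.subspace (scaleL L) I \<and> (\<forall>x. \<forall>y\<in>I. bracket L x y \<in> I) \<longrightarrow> I = {0} \<or> I = UNIV)"

primrec lower_central :: "('g::ab_group_add, 'i) lie_data \<Rightarrow> 'g set \<Rightarrow> nat \<Rightarrow> 'g set" where
  "lower_central L W 0 = W"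
| "lower_central L W (Suc n) =
     module.span (scaleL L) {bracket L x y | x y. x \<in> W \<and> y \<in> lower_central L W n}"

definition cartan_subalgebra :: "('g::ab_group_add, 'i) lie_data \<Rightarrow> 'g set \<Rightarrow> bool" where
  "cartan_subalgebra L W \<longleftrightarrow> module.subspace (scaleL L) W \<and>
     (\<forall>x\<in>W. \<forall>y\<in>W. bracket L x y \<in> W) \<and>
     (\<exists>n. lower_central L W n = {0}) \<and>
     {x. \<forall>h\<in>W. bracket L x h \<in> W} = W"

abbreviation cartan_dual :: "('g::ab_group_add, 'i) lie_data \<Rightarrow> ('g \<Rightarrow> complex) set" where
  "cartan_dual L \<equiv> dual (scaleL L) (cartan L)"

definition root_space :: "('g::ab_group_add, 'i) lie_data \<Rightarrow> ('g \<Rightarrow> complex) \<Rightarrow> 'g set" where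
  "root_space L \<alpha> = {x. \<forall>h\<in>cartan L. bracket L h x = scaleL L (\<alpha> h) x}"

definition roots :: "('g::ab_group_add, 'i) lie_data \<Rightarrow> ('g \<Rightarrow> complex) set" where
  "roots L = {\<alpha>\<in>cartan_dual L. \<alpha> \<noteq> 0 \<and> root_space L \<alpha> \<noteq> {0}}"

definition Qplus :: "('g, 'i::finite) lie_data \<Rightarrow> ('g \<Rightarrow> complex) set" where
  "Qplus L = {\<Sum>i\<in>UNIV. fun_scale (of_nat (n i)) (simple_root L i) | n. True}"

definition base :: "('g::ab_group_add, 'i::finite) lie_data \<Rightarrow> bool" where
  "base L \<longleftrightarrow> (\<forall>i. simple_root L i \<in> roots L) \<and>
     (\<forall>\<mu>\<in>cartan_dual L. \<exists>!c. \<mu> = (\<Sum>i\<in>UNIV. fun_scale (c i) (simple_root L i))) \<and>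
     (\<forall>\<beta>\<in>roots L. \<beta> \<in> Qplus L \<or> - \<beta> \<in> Qplus L)"

definition invariant_form :: "('g::ab_group_add, 'i) lie_data \<Rightarrow> bool" where
  "invariant_form L \<longleftrightarrow>
     (\<forall>x. Vector_Spaces.linear (scaleL L) (*) (form L x)) \<and>
     (\<forall>x y. form L x y = form L y x) \<and>
     (\<forall>x y z. form L (bracket L x y) z = form L x (bracket L y z)) \<and>
     (\<forall>x. (\<forall>y. form L x y = 0) \<longrightarrow> x = 0)"

text \<open>\<open>t \<in> \<hh>\<close> corresponds to \<open>\<mu>\<close> under the isomorphism of \<open>\<hh>\<close> with its dual given by the form.\<close>

definition corresponds :: "('g, 'i) lie_data \<Rightarrow> 'g \<Rightarrow> ('g \<Rightarrow> complex) \<Rightarrow> bool" where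
  "corresponds L t \<mu> \<longleftrightarrow> t \<in> cartan L \<and> (\<forall>h\<in>cartan L. form L t h = \<mu> h)"

definition dual_form :: "('g, 'i) lie_data \<Rightarrow> ('g \<Rightarrow> complex) \<Rightarrow> ('g \<Rightarrow> complex) \<Rightarrow> complex" where
  "dual_form L \<mu> \<nu> = (THE c. \<exists>s t. corresponds L s \<mu> \<and> corresponds L t \<nu> \<and> c = form L s t)"

text \<open>
  Before the form is normalized, squared lengths of roots are only known up to a common
  complex factor, so lengths are compared via absolute values.
\<close>

definition short_root :: "('g::ab_group_add, 'i) lie_data \<Rightarrow> ('g \<Rightarrow> complex) \<Rightarrow> bool" where
  "short_root L \<beta> \<longleftrightarrow> \<beta> \<in> roots L \<and>
     (\<forall>\<gamma>\<in>roots L. cmod (dual_form L \<beta> \<beta>) \<le> cmod (dual_form L \<gamma> \<gamma>))"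

definition simple_lie_data :: "('g::ab_group_add, 'i::finite) lie_data \<Rightarrow> bool" where
  "simple_lie_data L \<longleftrightarrow> simple_lie_algebra L \<and> cartan_subalgebra L (cartan L) \<and> base L \<and>
     invariant_form L \<and> (\<forall>\<beta>. short_root L \<beta> \<longrightarrow> dual_form L \<beta> \<beta> = 2) \<and>
     (\<forall>i. corresponds L (hroot L i) (simple_root L i)) \<and>
     (\<forall>i. coweight L i \<in> cartan L) \<and>
     (\<forall>i j. simple_root L j (coweight L i) = (if i = j then 1 else 0)) \<and>
     (\<forall>i. xplus L i \<in> root_space L (simple_root L i)) \<and>
     (\<forall>i. xminus L i \<in> root_space L (- simple_root L i)) \<and>
     (\<forall>i. form L (xplus L i) (xminus L i) = 1)"

definition sym_d :: "('g, 'i) lie_data \<Rightarrow> 'i \<Rightarrow> complex" where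
  "sym_d L i = dual_form L (simple_root L i) (simple_root L i) / 2"

definition cartan_entry :: "('g, 'i) lie_data \<Rightarrow> 'i \<Rightarrow> 'i \<Rightarrow> int" where
  "cartan_entry L i j = (THE k. of_int k = 2 * dual_form L (simple_root L i) (simple_root L j)
     / dual_form L (simple_root L i) (simple_root L i))"

section \<open>Representations\<close>

definition representation :: "('g::ab_group_add, 'i) lie_data \<Rightarrow> ('g \<Rightarrow> complex^'n^'n) \<Rightarrow> bool" where
  "representation L \<pi> \<longleftrightarrow> Vector_Spaces.linear (scaleL L) smat \<pi> \<and>
     (\<forall>x y. \<pi> (bracket L x y) = mcomm (\<pi> x) (\<pi> y))"

definition submodule :: "('g \<Rightarrow> complex^'n^'n) \<Rightarrow> (complex^'n) set \<Rightarrow> bool" where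
  "submodule \<pi> W \<longleftrightarrow> vec.subspace W \<and> (\<forall>x. \<forall>v\<in>W. \<pi> x *v v \<in> W)"

definition irreducible_submodule :: "('g \<Rightarrow> complex^'n^'n) \<Rightarrow> (complex^'n) set \<Rightarrow> bool" where
  "irreducible_submodule \<pi> W \<longleftrightarrow> submodule \<pi> W \<and> W \<noteq> {0} \<and>
     (\<forall>U. submodule \<pi> U \<and> U \<subseteq> W \<longrightarrow> U = {0} \<or> U = W)"

definition isomorphic_submodules ::
    "('g \<Rightarrow> complex^'n^'n) \<Rightarrow> (complex^'n) set \<Rightarrow> (complex^'n) set \<Rightarrow> bool" where
  "isomorphic_submodules \<pi> U W \<longleftrightarrow> (\<exists>A :: complex^'n^'n. bij_betw ((*v) A) U W \<and>
     (\<forall>x. \<forall>v\<in>U. A *v (\<pi> x *v v) = \<pi> x *v (A *v v)))"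

definition multiplicity_free :: "('g \<Rightarrow> complex^'n^'n) \<Rightarrow> ('j::finite \<Rightarrow> (complex^'n) set) \<Rightarrow> bool" where
  "multiplicity_free \<pi> V \<longleftrightarrow> (\<forall>j. irreducible_submodule \<pi> (V j)) \<and>
     (\<forall>i j. i \<noteq> j \<longrightarrow> \<not> isomorphic_submodules \<pi> (V i) (V j)) \<and>
     (\<forall>v. \<exists>!f. (\<forall>j. f j \<in> V j) \<and> v = (\<Sum>j\<in>UNIV. f j))"

definition weight_space ::
    "('g, 'i) lie_data \<Rightarrow> ('g \<Rightarrow> complex^'n^'n) \<Rightarrow> (complex^'n) set \<Rightarrow> ('g \<Rightarrow> complex) \<Rightarrow>
     (complex^'n) set" where
  "weight_space L \<pi> W \<mu> = {v\<in>W. \<forall>h\<in>cartan L. \<pi> h *v v = \<mu> h *s v}"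

definition weights ::
    "('g::ab_group_add, 'i) lie_data \<Rightarrow> ('g \<Rightarrow> complex^'n^'n) \<Rightarrow> (complex^'n) set \<Rightarrow>
     ('g \<Rightarrow> complex) set" where
  "weights L \<pi> W = {\<mu>\<in>cartan_dual L. weight_space L \<pi> W \<mu> \<noteq> {0}}"

text \<open>The projection onto \<open>W k\<close> for a space which is the direct sum of the \<open>W l\<close>, \<open>l \<in> K\<close>.\<close>

definition projection_onto :: "'k set \<Rightarrow> ('k \<Rightarrow> (complex^'n) set) \<Rightarrow> 'k \<Rightarrow> complex^'n^'n" where
  "projection_onto K W k = (THE P. \<forall>l\<in>K. \<forall>v\<in>W l. P *v v = (if l = k then v else 0))"

definition gl_invariants :: "('g \<Rightarrow> complex^'n^'n) \<Rightarrow> (complex^'n^'n) set" where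
  "gl_invariants \<pi> = {X. \<forall>x. mcomm (\<pi> x) X = 0}"

definition gl_weight ::
    "('g, 'i) lie_data \<Rightarrow> ('g \<Rightarrow> complex^'n^'n) \<Rightarrow> ('g \<Rightarrow> complex) \<Rightarrow> (complex^'n^'n) set" where
  "gl_weight L \<pi> \<mu> = {X. \<forall>h\<in>cartan L. mcomm (\<pi> h) X = smat (\<mu> h) X}"

definition gl_component ::
    "('g::ab_group_add, 'i) lie_data \<Rightarrow> ('g \<Rightarrow> complex^'n^'n) \<Rightarrow> ('g \<Rightarrow> complex) \<Rightarrow>
     complex^'n^'n \<Rightarrow> complex^'n^'n" where
  "gl_component L \<pi> \<mu> X = (THE f. (\<forall>\<nu>. f \<nu> \<in> gl_weight L \<pi> \<nu>) \<and> finite {\<nu>. f \<nu> \<noteq> 0} \<and>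
     {\<nu>. f \<nu> \<noteq> 0} \<subseteq> cartan_dual L \<and> (\<Sum>\<nu> | f \<nu> \<noteq> 0. f \<nu>) = X) \<mu>"

text \<open>The projection of \<open>gl(V)\<close> onto its weight space, tensored with the identity of \<open>A\<close>.\<close>

definition weight_component ::
    "('g::ab_group_add, 'i) lie_data \<Rightarrow> ('g \<Rightarrow> complex^'n^'n) \<Rightarrow> ('g \<Rightarrow> complex) \<Rightarrow>
     'a::hbar_algebra^'n^'n \<Rightarrow> 'a^'n^'n" where
  "weight_component L \<pi> \<mu> X =
     (\<Sum>a\<in>UNIV. \<Sum>b\<in>UNIV. smat (X $ a $ b) (map_mat of_cx (gl_component L \<pi> \<mu> (mat_unit a b))))"

section \<open>The quantized enveloping algebra\<close>

text \<open>\<open>q\<^sup>c\<close> for a scalar \<open>c\<close>, and the \<open>q\<^sup>d\<close>-analogues of integers, factorials and binomials.\<close>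

definition qscal :: "complex \<Rightarrow> complex fps" where
  "qscal c = fps_exp (c / 2)"

definition qint :: "complex \<Rightarrow> nat \<Rightarrow> complex fps" where
  "qint d n = (qscal (d * of_nat n) - qscal (- d * of_nat n)) / (qscal d - qscal (- d))"

definition qfact :: "complex \<Rightarrow> nat \<Rightarrow> complex fps" where
  "qfact d n = (\<Prod>k=1..n. qint d k)"

definition qbinom :: "complex \<Rightarrow> nat \<Rightarrow> nat \<Rightarrow> complex fps" where
  "qbinom d n k = qfact d n / (qfact d k * qfact d (n - k))"

definition q_serre :: "complex \<Rightarrow> int \<Rightarrow> 'a::hbar_algebra \<Rightarrow> 'a \<Rightarrow> 'a" where
  "q_serre d a x y = (let m = nat (1 - a) in
     \<Sum>k\<le>m. of_fps ((- 1) ^ k * qbinom d m k) * (x ^ (m - k) * y * x ^ k))"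

datatype ('g, 'i) ugen = GH 'g | GE 'i | GF 'i

definition quantum_relations ::
    "('g::ab_group_add, 'i) lie_data \<Rightarrow> ('g, 'i) ugen free_hbar set" where
  "quantum_relations L = (let h = (\<lambda>x. hvar (GH x)); E = (\<lambda>i. hvar (GE i)); F = (\<lambda>i. hvar (GF i)) in
     {h (x + y) - h x - h y | x y. x \<in> cartan L \<and> y \<in> cartan L} \<union>
     {h (scaleL L c x) - of_cx c * h x | c x. x \<in> cartan L} \<union>
     {comm (h x) (h y) | x y. x \<in> cartan L \<and> y \<in> cartan L} \<union>
     {comm (h x) (E j) - of_cx (simple_root L j x) * E j | x j. x \<in> cartan L} \<union>
     {comm (h x) (F j) + of_cx (simple_root L j x) * F j | x j. x \<in> cartan L} \<union>
     {comm (E i) (F j) - (if i = j then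
        hdiv (qpow (h (hroot L i)) - qpow (- h (hroot L i)))
             (qscal (sym_d L i) - qscal (- sym_d L i)) else 0) | i j. True} \<union>
     {q_serre (sym_d L i) (cartan_entry L i j) (E i) (E j) | i j. i \<noteq> j} \<union>
     {q_serre (sym_d L i) (cartan_entry L i j) (F i) (F j) | i j. i \<noteq> j})"

section \<open>The quantum double of the Borel subalgebra\<close>

text \<open>
  \<^typ>\<open>'u\<close> is the quantized enveloping algebra, \<^typ>\<open>'c\<close> is \<open>S(\<hh>)[[\<hbar>]]\<close>, and the double is
  \<^typ>\<open>'u::hbar_algebra \<otimes> 'c::hbar_algebra\<close>. The Hopf structure and the involution are
  uniquely determined by the values prescribed in \<open>quantum_double\<close> below.
\<close>

record (overloaded) ('g, 'i, 'u, 'c) double =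
  Uh :: "'g \<Rightarrow> 'u::hbar_algebra"
  UE :: "'i \<Rightarrow> 'u"
  UF :: "'i \<Rightarrow> 'u"
  Sh :: "'g \<Rightarrow> 'c::hbar_algebra"
  hopfD :: "('u \<otimes> 'c) hopf"
  omegaD :: "'u \<otimes> 'c \<Rightarrow> 'u \<otimes> 'c"

definition zetaD :: "('g, 'i, 'u::hbar_algebra, 'c::hbar_algebra) double \<Rightarrow> 'g \<Rightarrow> 'u \<otimes> 'c" where
  "zetaD Q h = 1 \<otimes> Sh Q h"

definition hplus :: "('g, 'i, 'u::hbar_algebra, 'c::hbar_algebra) double \<Rightarrow> 'g \<Rightarrow> 'u \<otimes> 'c" where
  "hplus Q h = Uh Q h \<otimes> 1 + zetaD Q h"

definition hminus :: "('g, 'i, 'u::hbar_algebra, 'c::hbar_algebra) double \<Rightarrow> 'g \<Rightarrow> 'u \<otimes> 'c" where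
  "hminus Q h = Uh Q h \<otimes> 1 - zetaD Q h"

definition Xplus ::
    "('g, 'i) lie_data \<Rightarrow> ('g, 'i, 'u::hbar_algebra, 'c::hbar_algebra) double \<Rightarrow> 'i \<Rightarrow> 'u \<otimes> 'c" where
  "Xplus L Q i = qpow (of_cx (1/2) * zetaD Q (hroot L i)) * (UE Q i \<otimes> 1)"

definition Xminus ::
    "('g, 'i) lie_data \<Rightarrow> ('g, 'i, 'u::hbar_algebra, 'c::hbar_algebra) double \<Rightarrow> 'i \<Rightarrow> 'u \<otimes> 'c" where
  "Xminus L Q i = qpow (of_cx (1/2) * zetaD Q (hroot L i)) * (UF Q i \<otimes> 1)"

definition quantum_double ::
    "('g::ab_group_add, 'i) lie_data \<Rightarrow> ('g, 'i, 'u::hbar_algebra, 'c::hbar_algebra) double \<Rightarrow> bool" where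
  "quantum_double L Q \<longleftrightarrow>
     presented_by (GH ` cartan L \<union> range GE \<union> range GF)
       (case_ugen (Uh Q) (UE Q) (UF Q)) (quantum_relations L) \<and>
     symmetric_hbar_algebra (scaleL L) (cartan L) (Sh Q) \<and>
     topological_hopf_algebra (hopfD Q) \<and>
     (\<forall>h\<in>cartan L.
        comult (hopfD Q) (hplus Q h) = hplus Q h \<otimes> 1 + 1 \<otimes> hplus Q h \<and>
        comult (hopfD Q) (hminus Q h) = hminus Q h \<otimes> 1 + 1 \<otimes> hminus Q h \<and>
        counit (hopfD Q) (hplus Q h) = 0 \<and> counit (hopfD Q) (hminus Q h) = 0) \<and>
     (\<forall>i.
        comult (hopfD Q) (Xplus L Q i)
          = Xplus L Q i \<otimes> qpow (hplus Q (hroot L i)) + 1 \<otimes> Xplus L Q i \<and>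
        comult (hopfD Q) (Xminus L Q i)
          = Xminus L Q i \<otimes> 1 + qpow (- hminus Q (hroot L i)) \<otimes> Xminus L Q i \<and>
        counit (hopfD Q) (Xplus L Q i) = 0 \<and> counit (hopfD Q) (Xminus L Q i) = 0) \<and>
     hhom (omegaD Q) \<and> omegaD Q \<circ> omegaD Q = id \<and>
     (\<forall>h\<in>cartan L. omegaD Q (hplus Q h) = - hminus Q h \<and> omegaD Q (hminus Q h) = - hplus Q h) \<and>
     (\<forall>i. omegaD Q (Xplus L Q i) = - Xminus L Q i \<and> omegaD Q (Xminus L Q i) = - Xplus L Q i)"

definition nilpotent_weight ::
    "('g, 'i) lie_data \<Rightarrow> ('g, 'i, 'u::hbar_algebra, 'c::hbar_algebra) double \<Rightarrow>
     ('i \<Rightarrow> 'u \<otimes> 'c) \<Rightarrow> ('g \<Rightarrow> complex) \<Rightarrow> ('u \<otimes> 'c) set" where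
  "nilpotent_weight L Q X \<beta> = {x \<in> closed_subalgebra (range X).
     \<forall>h\<in>cartan L. comm (Uh Q h \<otimes> 1) x = of_cx (\<beta> h) * x}"

definition universal_R ::
    "('g, 'i::finite) lie_data \<Rightarrow> ('g, 'i, 'u::hbar_algebra, 'c::hbar_algebra) double \<Rightarrow>
     ('u \<otimes> 'c) \<otimes> ('u \<otimes> 'c) \<Rightarrow> bool" where
  "universal_R L Q R \<longleftrightarrow>
     (\<exists>R\<beta> S. R\<beta> 0 = 1 \<and>
        (\<forall>\<beta>\<in>Qplus L. R\<beta> \<beta> \<in> closed_hspan {a \<otimes> b | a b.
           a \<in> nilpotent_weight L Q (Xplus L Q) \<beta> \<and> b \<in> nilpotent_weight L Q (Xminus L Q) (- \<beta>)}) \<and>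
        has_hsum R\<beta> (Qplus L) S \<and>
        R = qpow (\<Sum>i\<in>UNIV. hplus Q (coweight L i) \<otimes> hminus Q (hroot L i)) * S) \<and>
     (\<forall>x. R * comult (hopfD Q) x = tensor_flip (comult (hopfD Q) x) * R)"

datatype pm = Pls | Mns

primrec pm_sign :: "pm \<Rightarrow> complex" where
  "pm_sign Pls = 1"
| "pm_sign Mns = - 1"

primrec R_omega ::
    "('g, 'i, 'u::hbar_algebra, 'c::hbar_algebra) double \<Rightarrow> ('u \<otimes> 'c) \<otimes> ('u \<otimes> 'c) \<Rightarrow> pm \<Rightarrow>
     ('u \<otimes> 'c) \<otimes> ('u \<otimes> 'c)" where
  "R_omega Q R Pls = tensor_map id (omegaD Q) R"
| "R_omega Q R Mns = tensor_map id (omegaD Q) (hinverse (tensor_flip R))"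

section \<open>The quantized representation\<close>

text \<open>The image of \<open>U(\<gg>)\<close> in \<open>End(V)\<close>.\<close>

definition enveloping_image :: "('g \<Rightarrow> complex^'n^'n) \<Rightarrow> (complex^'n^'n) set" where
  "enveloping_image \<pi> = \<Inter>{S. module.subspace smat S \<and> mat 1 \<in> S \<and>
     (\<forall>X\<in>S. \<forall>Y\<in>S. X ** Y \<in> S) \<and> range \<pi> \<subseteq> S}"

definition quantum_representation ::
    "('g, 'i) lie_data \<Rightarrow> ('g, 'i, 'u::hbar_algebra, 'c::hbar_algebra) double \<Rightarrow>
     ('g \<Rightarrow> complex^'n^'n) \<Rightarrow> ('u \<Rightarrow> complex fps^'n^'n) \<Rightarrow> bool" where
  "quantum_representation L Q \<pi> \<pi>h \<longleftrightarrow>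
     (\<forall>x y. \<pi>h (x + y) = \<pi>h x + \<pi>h y) \<and> (\<forall>c x. \<pi>h (of_fps c * x) = smat c (\<pi>h x)) \<and>
     \<pi>h 1 = mat 1 \<and> (\<forall>x y. \<pi>h (x * y) = \<pi>h x ** \<pi>h y) \<and>
     (\<forall>h\<in>cartan L. \<pi>h (Uh Q h) = map_mat fps_const (\<pi> h)) \<and>
     (\<forall>i. map_mat (\<lambda>f. fps_nth f 0) (\<pi>h (UE Q i)) = smat (1 / csqrt (sym_d L i)) (\<pi> (xplus L i))) \<and>
     (\<forall>i. map_mat (\<lambda>f. fps_nth f 0) (\<pi>h (UF Q i)) = smat (1 / csqrt (sym_d L i)) (\<pi> (xminus L i))) \<and>
     (\<forall>x n. map_mat (\<lambda>f. fps_nth f n) (\<pi>h x) \<in> enveloping_image \<pi>)"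

definition counit_Sh ::
    "('g, 'i) lie_data \<Rightarrow> ('g, 'i, 'u::hbar_algebra, 'c::hbar_algebra) double \<Rightarrow> 'c \<Rightarrow> complex fps" where
  "counit_Sh L Q = (THE e. hhom e \<and> (\<forall>h\<in>cartan L. e (Sh Q h) = 0))"

definition piD ::
    "('g, 'i) lie_data \<Rightarrow> ('g, 'i, 'u::hbar_algebra, 'c::hbar_algebra) double \<Rightarrow>
     ('u \<Rightarrow> complex fps^'n^'n) \<Rightarrow> 'u \<otimes> 'c \<Rightarrow> complex fps^'n^'n" where
  "piD L Q \<pi>h x = \<pi>h (tensor_lift (\<lambda>u s. u * of_fps (counit_Sh L Q s)) x)"

definition pi_tensor_id ::
    "('a::hbar_algebra \<Rightarrow> complex fps^'n^'n) \<Rightarrow> 'a \<otimes> 'b::hbar_algebra \<Rightarrow> 'b^'n^'n" where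
  "pi_tensor_id p x = (\<chi> i j. tensor_lift (\<lambda>a b. of_fps (p a $ i $ j) * b) x)"

definition pi_tensor_pi ::
    "('a::hbar_algebra \<Rightarrow> complex fps^'n^'n) \<Rightarrow> 'a \<otimes> 'a \<Rightarrow> complex fps^('n::finite \<times> 'n)^('n \<times> 'n)" where
  "pi_tensor_pi p x = (\<chi> r s. tensor_lift (\<lambda>a b. p a $ fst r $ fst s * p b $ snd r $ snd s) x)"

definition R_dot :: "complex fps^('n::finite \<times> 'n)^('n \<times> 'n) \<Rightarrow> complex fps^('n::finite \<times> 'n)^('n \<times> 'n)" where
  "R_dot R = map_mat (\<lambda>f. f / fps_X) (R - mat 1)"

section \<open>The R-matrix algebra\<close>

definition rtt_relation ::
    "complex fps^('n::finite \<times> 'n)^('n \<times> 'n) \<Rightarrow> 'a::hbar_algebra^'n^'n \<Rightarrow> 'a^'n^'n \<Rightarrow>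
     'a^('n::finite \<times> 'n)^('n \<times> 'n)" where
  "rtt_relation D T T' = (let R = map_mat of_fps D; T1 = leg1 T; T2 = leg2 T' in
     mcomm T2 T1 - (mcomm R (T1 + T2) + smat \<hbar> (R ** T1 ** T2 - T2 ** T1 ** R)))"

definition R_matrix_relations ::
    "('g::ab_group_add, 'i::finite) lie_data \<Rightarrow> ('g \<Rightarrow> complex^'n^'n) \<Rightarrow>
     complex fps^('n::finite \<times> 'n)^('n \<times> 'n) \<Rightarrow> (pm \<times> 'n \<times> 'n) free_hbar set" where
  "R_matrix_relations L \<pi> D = (let T = (\<lambda>s. \<chi> i j. hvar (s, i, j)) in
     {weight_component L \<pi> \<mu> (T Pls) $ i $ j | \<mu> i j. - \<mu> \<in> Qplus L - {0}} \<union>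
     {weight_component L \<pi> \<mu> (T Mns) $ i $ j | \<mu> i j. \<mu> \<in> Qplus L - {0}} \<union>
     {rtt_relation D (T s) (T s') $ p $ r | s s' p r. (s, s') \<in> {(Pls, Pls), (Mns, Mns), (Pls, Mns)}})"

definition L_mat :: "(pm \<Rightarrow> 'a::hbar_algebra^'n^'n) \<Rightarrow> pm \<Rightarrow> 'a^'n^'n" where
  "L_mat T s = mat 1 + smat \<hbar> (T s)"

definition R_matrix_algebra ::
    "('g::ab_group_add, 'i::finite) lie_data \<Rightarrow> ('g \<Rightarrow> complex^'n^'n) \<Rightarrow>
     complex fps^('n::finite \<times> 'n)^('n \<times> 'n) \<Rightarrow> (pm \<Rightarrow> 'r::hbar_algebra^'n^'n) \<Rightarrow> 'r hopf \<Rightarrow> bool" where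
  "R_matrix_algebra L \<pi> R T H \<longleftrightarrow>
     presented_by UNIV (\<lambda>(s, i, j). T s $ i $ j) (R_matrix_relations L \<pi> (R_dot R)) \<and>
     topologically_free TYPE('r) \<and> topological_hopf_algebra H \<and>
     (\<forall>s. map_mat (comult H) (L_mat T s) = mat_tensor (L_mat T s) (L_mat T s)) \<and>
     (\<forall>s. map_mat (antipode H) (L_mat T s) = matrix_inv (L_mat T s)) \<and>
     (\<forall>s. map_mat (counit H) (L_mat T s) = mat 1)"

section \<open>The central factor\<close>

text \<open>
  The canonical element of \<open>gl(V)\<^sup>g \<otimes> (gl(V)\<^sup>g)\<^sup>*\<close>: its \<open>(a, b)\<close> entry is the functional
  \<open>X \<mapsto> X\<^sub>a\<^sub>b\<close> on \<open>gl(V)\<^sup>g\<close>. The same algebra is used for the two copies \<open>\<plusminus>\<close>;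
  only the Hopf structures depend on the sign.
\<close>

definition canonical_element ::
    "('g \<Rightarrow> complex^'n^'n) \<Rightarrow> ((complex^'n^'n \<Rightarrow> complex) \<Rightarrow> 's) \<Rightarrow> 's^'n^'n" where
  "canonical_element \<pi> \<iota> = (\<chi> a b. \<iota> (\<lambda>X. if X \<in> gl_invariants \<pi> then X $ a $ b else 0))"

primrec Z_ring ::
    "('g \<Rightarrow> complex^'n^'n) \<Rightarrow> ((complex^'n^'n \<Rightarrow> complex) \<Rightarrow> 's::hbar_algebra) \<Rightarrow> pm \<Rightarrow> 's^'n^'n" where
  "Z_ring \<pi> \<iota> Pls = mat 1 + smat \<hbar> (canonical_element \<pi> \<iota>)"
| "Z_ring \<pi> \<iota> Mns = matrix_inv (mat 1 + smat \<hbar> (canonical_element \<pi> \<iota>))"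

definition central_factor ::
    "('g \<Rightarrow> complex^'n^'n) \<Rightarrow> ((complex^'n^'n \<Rightarrow> complex) \<Rightarrow> 's::hbar_algebra) \<Rightarrow> (pm \<Rightarrow> 's hopf) \<Rightarrow>
     bool" where
  "central_factor \<pi> \<iota> H \<longleftrightarrow>
     symmetric_hbar_algebra fun_scale (dual smat (gl_invariants \<pi>)) \<iota> \<and>
     (\<forall>s. topological_hopf_algebra (H s) \<and>
        map_mat (comult (H s)) (Z_ring \<pi> \<iota> s) = mat_tensor (Z_ring \<pi> \<iota> s) (Z_ring \<pi> \<iota> s) \<and>
        map_mat (counit (H s)) (canonical_element \<pi> \<iota>) = 0)"

primrec embed_central :: "pm \<Rightarrow> 's::hbar_algebra \<Rightarrow> ('d::hbar_algebra \<otimes> 's) \<otimes> 's" where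
  "embed_central Pls x = (1 \<otimes> x) \<otimes> 1"
| "embed_central Mns x = (1 \<otimes> 1) \<otimes> x"

definition Upsilon_isomorphism ::
    "('g, 'i) lie_data \<Rightarrow> ('g, 'i, 'u::hbar_algebra, 'c::hbar_algebra) double \<Rightarrow>
     ('u \<otimes> 'c) \<otimes> ('u \<otimes> 'c) \<Rightarrow> ('g \<Rightarrow> complex^'n^'n) \<Rightarrow> ('u \<Rightarrow> complex fps^'n^'n) \<Rightarrow>
     (pm \<Rightarrow> 'r::hbar_algebra^'n^'n) \<Rightarrow> 'r hopf \<Rightarrow>
     ((complex^'n^'n \<Rightarrow> complex) \<Rightarrow> 's::hbar_algebra) \<Rightarrow> (pm \<Rightarrow> 's hopf) \<Rightarrow>
     ('r \<Rightarrow> (('u \<otimes> 'c) \<otimes> 's) \<otimes> 's) \<Rightarrow> bool" where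
  "Upsilon_isomorphism L Q R \<pi> \<pi>h T HR \<iota> HZ \<Upsilon> \<longleftrightarrow>
     hopf_isomorphism HR (tensor_hopf (tensor_hopf (hopfD Q) (HZ Pls)) (HZ Mns)) \<Upsilon> \<and>
     (\<forall>s. map_mat \<Upsilon> (L_mat T s) =
        map_mat (\<lambda>d. (d \<otimes> 1) \<otimes> 1) (pi_tensor_id (piD L Q \<pi>h) (R_omega Q R s)) **
        map_mat (embed_central s) (Z_ring \<pi> \<iota> s))"

text \<open>The first conjunct says that \<open>Z\<close> lies in \<open>gl(V)\<^sup>g \<otimes> S\<close>.\<close>

definition central_elements ::
    "('g \<Rightarrow> complex^'n^'n) \<Rightarrow> ('j::finite \<Rightarrow> (complex^'n) set) \<Rightarrow>
     ((complex^'n^'n \<Rightarrow> complex) \<Rightarrow> 's::hbar_algebra) \<Rightarrow>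
     ('r::hbar_algebra \<Rightarrow> ('d::hbar_algebra \<otimes> 's) \<otimes> 's) \<Rightarrow> (pm \<Rightarrow> 'j \<Rightarrow> 'r) \<Rightarrow> bool" where
  "central_elements \<pi> V \<iota> \<Upsilon> z \<longleftrightarrow>
     (\<exists>Z. (\<forall>x. mcomm (map_mat of_cx (\<pi> x)) Z = 0) \<and>
        mat_hexp (smat (of_cx (1/2) * \<hbar>) Z) = mat 1 + smat \<hbar> (canonical_element \<pi> \<iota>) \<and>
        (\<forall>s. map_mat (\<lambda>x. inv \<Upsilon> (embed_central s x)) Z =
           (\<Sum>j\<in>UNIV. smat (z s j) (map_mat of_cx (projection_onto UNIV V j)))))"

end

theory Submission
  imports Defs
begin

text \<open>
  Let \<open>g(d) = \<Upsilon>\<inverse>((\<omega>(d) \<otimes> 1) \<otimes> 1)\<close> and \<open>\<Psi> = \<pi> \<otimes> g\<close>. Applying \<open>\<Upsilon>\<inverse>\<close> to the formula for \<open>\<Upsilon>(L)\<close> gives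
  \<open>L = \<Psi>(R) Y\<close> for the sign plus and \<open>L = \<Psi>(R\<^sub>2\<^sub>1\<inverse>) Y\<close> for the sign minus, where \<open>Y\<close> is the block
  diagonal matrix with blocks \<open>q\<close> to the power \<open>\<plusminus> z\<^sub>j\<close>. The Cartan factor of \<open>R\<close> becomes block
  diagonal along the weight spaces with blocks of the form \<open>q\<close> to the power \<open>A\<^sub>\<lambda>\<close>, where \<open>A\<^sub>\<lambda>\<close> is linear
  in \<open>\<lambda>\<close>, and the factor \<open>\<Sum>R\<^sub>\<beta>\<close> becomes unitriangular for the order of the weights. Hence \<open>L\<close> has a Gauss
  decomposition, and its zero weight component is block diagonal with entries \<open>q\<close> to the power
  \<open>A\<^sub>\<lambda> \<plusminus> z\<^sub>j\<close>. These commute; they are grouplike by comparing diagonal blocks in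
  the formula for \<open>\<Delta>(L)\<close>, as triangularity kills the products of off-diagonal blocks. The product formula
  follows since the weights of \<open>V\<^sub>j\<close>, taken with multiplicities, add up to zero.

  That \<open>R\<^sub>2\<^sub>1\<close> is invertible needs \<open>R = 1\<close> modulo \<open>\<hbar>\<close>: if \<open>R\<^sub>\<beta>\<close> is nonzero modulo \<open>\<hbar>\<close> with \<open>\<beta> \<noteq> 0\<close> of
  minimal height, then it commutes with all \<open>1 \<otimes> X\<^sub>i\<^sup>+\<close> modulo \<open>\<hbar>\<close>, while the commutator with
  \<open>1 \<otimes> X\<^sub>i\<^sup>-\<close> is nilpotent on it by the Serre relations. So \<open>-\<beta>\<close> is dominant, which contradicts the
  positivity of the trace form of \<open>V\<close>.
\<close>

section \<open>The adic topology\<close>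

text \<open>The invertibility step is forced by the data: \<open>universal_R\<close> fixes
  \<open>R\<close> only by its shape and the intertwining property, and \<open>hinverse\<close> is a
  definite description, so the matrix for the sign minus has no usable value until
  \<open>tensor_flip R\<close> is known to be a unit. Completeness reduces this to
  \<open>R = 1\<close> modulo \<hbar>, a statement about the classical Lie algebra. The classical
  structure theory has to be derived as well: the Cartan subalgebra is only given as nilpotent and
  self-normalizing, and nothing says that weight vectors span \<open>V\<close>. Everything is read
  off from the faithful matrices. An eigenvector of ad h with nonzero eigenvalue is nilpotent, so
  simple root vectors act nilpotently; with the sl2 relations this makes the normalized coroots
  diagonalizable with integral eigenvalues. The same integrality provides the real structure on
  which the trace form is positive. Projections, weight components, \<open>counit_Sh\<close>,
  \<open>hdiv\<close> and tensor lifts are definite descriptions too, so each is pinned down before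
  use; dividing by \<hbar> in the logarithm formula rests on the torsion-freeness of topologically
  free modules.\<close>

declare of_fps_1 [simp]

lemma hpow_central: "\<hbar> ^ n * x = x * (\<hbar> :: 'a::hbar_algebra) ^ n"
  by (simp flip: of_fps_power add: of_fps_central)

lemma of_cx_0 [simp]: "(of_cx 0 :: 'a::hbar_algebra) = 0"
  and of_cx_1 [simp]: "(of_cx 1 :: 'a::hbar_algebra) = 1"
  by (simp_all add: of_fps_1)

lemma of_cx_add: "(of_cx (a + b) :: 'a::hbar_algebra) = of_cx a + of_cx b"
  by (simp only: fps_const_add[symmetric] of_fps_add)

lemma of_cx_mult: "(of_cx (a * b) :: 'a::hbar_algebra) = of_cx a * of_cx b"
  by (simp only: fps_const_mult[symmetric] of_fps_mult)

lemma of_cx_minus: "(of_cx (- a) :: 'a::hbar_algebra) = - of_cx a"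
  by (simp only: fps_const_neg[symmetric] of_fps_minus)

lemma of_cx_diff: "(of_cx (a - b) :: 'a::hbar_algebra) = of_cx a - of_cx b"
  using of_cx_add[of a "- b"] by (simp add: of_cx_minus)

lemma of_cx_sum: "(of_cx (sum f A) :: 'a::hbar_algebra) = (\<Sum>i\<in>A. of_cx (f i))"
  by (induction A rule: infinite_finite_induct) (auto simp: of_cx_add)

lemma of_cx_of_nat: "(of_cx (of_nat n) :: 'a::hbar_algebra) = of_nat n"
  by (induction n) (auto simp: of_cx_add)

lemma of_cx_cancel: "c \<noteq> 0 \<Longrightarrow> of_cx (inverse c) * (of_cx c * x) = (x::'a::hbar_algebra)"
  by (simp add: mult.assoc[symmetric] of_cx_mult[symmetric])

lemma of_cx_eq_0: "of_cx c * x = 0 \<Longrightarrow> c \<noteq> 0 \<Longrightarrow> x = (0::'a::hbar_algebra)"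
  by (metis of_cx_cancel mult_zero_right)

lemma of_fps_left_commute: "x * (of_fps c * y) = of_fps c * (x * (y::'a::hbar_algebra))"
  by (metis mult.assoc of_fps_central)

lemma of_fps_mult_mult: "of_fps c * x * (of_fps d * y) = of_fps (c * d) * (x * (y::'a::hbar_algebra))"
  by (simp only: of_fps_mult mult.assoc of_fps_left_commute[of x])

lemma hpow_left_commute: "x * (\<hbar> ^ n * y) = \<hbar> ^ n * (x * (y::'a::hbar_algebra))"
  by (metis mult.assoc hpow_central)

section \<open>Congruences modulo powers of \<hbar>\<close>

lemma hcong_refl [simp, intro]: "hcong n x x"
  unfolding hcong_def by (rule exI[of _ 0]) simp

lemma hcong_sym: "hcong n x y \<Longrightarrow> hcong n y x"
  unfolding hcong_def by (metis minus_diff_eq mult_minus_right)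

lemma hcong_add: "hcong n x y \<Longrightarrow> hcong n x' y' \<Longrightarrow> hcong n (x + x') (y + y')"
  unfolding hcong_def by (metis add_diff_add distrib_left)

lemma hcong_trans [trans]: "hcong n x y \<Longrightarrow> hcong n y z \<Longrightarrow> hcong n x z"
  unfolding hcong_def by (metis diff_add_cancel distrib_left add_diff_eq)

lemma hcong_minus: "hcong n x y \<Longrightarrow> hcong n (- x) (- y)"
  unfolding hcong_def by (metis minus_diff_minus mult_minus_right)

lemma hcong_diff: "hcong n x y \<Longrightarrow> hcong n x' y' \<Longrightarrow> hcong n (x - x') (y - y')"
  using hcong_add[of n x y "- x'" "- y'"] hcong_minus[of n x' y'] by simp

lemma hcong_mult_left: "hcong n x y \<Longrightarrow> hcong n (a * x) (a * y)"
  unfolding hcong_def by (metis right_diff_distrib hpow_left_commute)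

lemma hcong_mult_right: "hcong n x y \<Longrightarrow> hcong n (x * a) (y * a)"
  unfolding hcong_def by (metis left_diff_distrib mult.assoc)

lemma hcong_mult: "hcong n x y \<Longrightarrow> hcong n x' y' \<Longrightarrow> hcong n (x * x') (y * y')"
  by (meson hcong_mult_left hcong_mult_right hcong_trans)

lemma hcong_sum: "(\<And>i. i \<in> A \<Longrightarrow> hcong n (f i) (g i)) \<Longrightarrow> hcong n (sum f A) (sum g A)"
  by (induction A rule: infinite_finite_induct) (auto intro: hcong_add)

lemma hcong_mono: "hcong n x y \<Longrightarrow> m \<le> n \<Longrightarrow> hcong m x y"
  unfolding hcong_def by (metis le_add_diff_inverse power_add mult.assoc)

lemma hcong_hpow: "n \<le> m \<Longrightarrow> hcong n (\<hbar> ^ m * x) 0"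
  unfolding hcong_def by (metis diff_zero le_add_diff_inverse power_add mult.assoc)

lemma hcong_eqI: "(\<And>n. hcong n x y) \<Longrightarrow> x = y"
  using hbar_separated[of "x - y"] by (auto simp: hcong_def of_fps_power)

lemma hcong_power_small: "hcong 1 x 0 \<Longrightarrow> n \<le> m \<Longrightarrow> hcong n (x ^ m) 0"
proof -
  assume "hcong 1 x 0" "n \<le> m"
  then obtain y where "x = \<hbar> * y" by (auto simp: hcong_def)
  then have "x ^ m = \<hbar> ^ m * y ^ m"
    by (induction m) (auto simp: hpow_left_commute mult.assoc hpow_central)
  then show ?thesis using \<open>n \<le> m\<close> by (simp add: hcong_hpow)
qed

section \<open>Linear maps and algebra homomorphisms\<close>

lemma hlinear_0: "hlinear f \<Longrightarrow> f 0 = 0"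
  unfolding hlinear_def by (metis mult_zero_left of_fps_0)

lemma hlinear_add: "hlinear f \<Longrightarrow> f (x + y) = f x + f y"
  and hlinear_scale: "hlinear f \<Longrightarrow> f (of_fps c * x) = of_fps c * f x"
  unfolding hlinear_def by blast+

lemma hlinear_minus: "hlinear f \<Longrightarrow> f (- x) = - f x"
  using hlinear_scale[of f "-1" x] by (simp add: of_fps_minus of_fps_1)

lemma hlinear_diff: "hlinear f \<Longrightarrow> f (x - y) = f x - f y"
  using hlinear_add[of f x "- y"] by (simp add: hlinear_minus)

lemma hlinear_sum: "hlinear f \<Longrightarrow> f (sum g A) = (\<Sum>i\<in>A. f (g i))"
  by (induction A rule: infinite_finite_induct) (auto simp: hlinear_0 hlinear_add)

lemma hlinear_hpow: "hlinear f \<Longrightarrow> f (\<hbar> ^ n * x) = \<hbar> ^ n * f x"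
  using hlinear_scale[of f "fps_X ^ n" x] by (simp add: of_fps_power)

lemma hlinear_hcong: "hlinear f \<Longrightarrow> hcong n x y \<Longrightarrow> hcong n (f x) (f y)"
  unfolding hcong_def by (metis hlinear_diff hlinear_hpow)

lemma hhom_hlinear: "hhom f \<Longrightarrow> hlinear f"
  and hhom_1: "hhom f \<Longrightarrow> f 1 = 1"
  and hhom_mult: "hhom f \<Longrightarrow> f (x * y) = f x * f y"
  by (auto simp: hhom_def)

lemma hhom_of_fps: "hhom f \<Longrightarrow> f (of_fps c) = of_fps c"
  using hlinear_scale[of f c 1] by (simp add: hhom_def)

lemma hhom_power: "hhom f \<Longrightarrow> f (x ^ n) = f x ^ n"
  by (induction n) (auto simp: hhom_1 hhom_mult)

lemma hhom_comp: "hhom f \<Longrightarrow> hhom g \<Longrightarrow> hhom (\<lambda>x. f (g x))"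
  unfolding hhom_def hlinear_def by metis

lemma hhom_inv:
  assumes "hhom f" "bij f" shows "hhom (inv f)"
proof -
  have s: "f (inv f y) = y" for y using assms(2) by (simp add: bij_is_surj surj_f_inv_f)
  have inj: "inj f" using assms(2) by (rule bij_is_inj)
  note l = hhom_hlinear[OF assms(1)]
  have "inv f (x + y) = inv f x + inv f y" for x y
    by (rule inv_f_eq[OF inj]) (simp add: hlinear_add[OF l] s)
  moreover have "inv f (of_fps c * x) = of_fps c * inv f x" for c x
    by (rule inv_f_eq[OF inj]) (simp add: hlinear_scale[OF l] s)
  moreover have "inv f (x * y) = inv f x * inv f y" for x y
    by (rule inv_f_eq[OF inj]) (simp add: hhom_mult[OF assms(1)] s)
  moreover have "inv f 1 = 1" by (rule inv_f_eq[OF inj]) (simp add: hhom_1[OF assms(1)])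
  ultimately show ?thesis by (simp add: hhom_def hlinear_def)
qed

section \<open>Limits\<close>

lemma hlim_eqI:
  assumes "\<And>N. \<exists>n0. \<forall>n\<ge>n0. hcong N (s n) x"
  shows "hlim s = x"
  unfolding hlim_def
proof (rule the_equality)
  fix y assume y: "\<forall>N. \<exists>n0. \<forall>n\<ge>n0. hcong N (s n) y"
  show "y = x"
  proof (rule hcong_eqI)
    fix N
    obtain n1 n2 where "\<forall>n\<ge>n1. hcong N (s n) y" "\<forall>n\<ge>n2. hcong N (s n) x"
      using y assms[of N] by blast
    then show "hcong N y x"
      by (meson hcong_sym hcong_trans max.cobounded1 max.cobounded2)
  qed
qed (use assms in blast)

text \<open>The rate is part of the result: \<open>s n\<close> is already correct modulo
  \<open>\<hbar> ^ n\<close>, which is what allows identities between series to be checked on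
  truncations.\<close>

lemma hlim_exists:
  assumes "\<And>n. hcong n (s (Suc n)) (s n)"
  obtains x where "hlim s = x" "\<And>N n. n \<ge> N \<Longrightarrow> hcong N (s n) x"
proof -
  obtain x where x: "\<forall>n. \<exists>y. x - s n = of_fps (fps_X ^ n) * y"
    using hbar_complete[of s] assms by (auto simp: hcong_def of_fps_power)
  then have *: "hcong N (s n) x" if "n \<ge> N" for n N
    using that by (metis hcong_def of_fps_power hcong_sym hcong_mono)
  then have "hlim s = x" by (intro hlim_eqI) blast
  with * that show thesis by blast
qed

section \<open>Closed submodules and closed subalgebras\<close>

lemma hsubmodule_scale: "hsubmodule S \<Longrightarrow> x \<in> S \<Longrightarrow> of_fps c * x \<in> S"
  by (auto simp: hsubmodule_def)

lemma hsubmodule_sum: "hsubmodule S \<Longrightarrow> (\<And>i. i \<in> A \<Longrightarrow> f i \<in> S) \<Longrightarrow> sum f A \<in> S"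
  by (induction A rule: infinite_finite_induct) (auto simp: hsubmodule_0 hsubmodule_add)

lemma hsubmodule_equalizer: "hlinear f \<Longrightarrow> hlinear g \<Longrightarrow> hsubmodule {x. f x = g x}"
  by (auto simp: hsubmodule_def hlinear_0 hlinear_add hlinear_scale)

text \<open>A linear map commutes with \<open>\<hbar> ^ n\<close> and is therefore continuous.
  Together with \<open>hsubmodule_equalizer\<close> this is the density principle used throughout:
  linear maps that agree on topological generators agree.\<close>

lemma hclosed_equalizer:
  assumes "hlinear f" "hlinear g" shows "hclosed {x. f x = g x}"
  unfolding hclosed_def
proof (intro allI impI CollectI hcong_eqI)
  fix x n assume "\<forall>n. \<exists>y\<in>{x. f x = g x}. hcong n x y"
  then obtain y where y: "f y = g y" "hcong n x y" by blast
  have "hcong n (f x) (f y)" by (rule hlinear_hcong[OF assms(1) y(2)])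
  also have "hcong n \<dots> (g x)"
    unfolding y(1) by (rule hlinear_hcong[OF assms(2) hcong_sym[OF y(2)]])
  finally show "hcong n (f x) (g x)" .
qed

lemma closed_hspan_least: "hsubmodule S \<Longrightarrow> hclosed S \<Longrightarrow> G \<subseteq> S \<Longrightarrow> closed_hspan G \<subseteq> S"
  by (auto simp: closed_hspan_def)

lemma closed_subalgebra_least:
  "hsubmodule S \<Longrightarrow> 1 \<in> S \<Longrightarrow> (\<And>x y. x \<in> S \<Longrightarrow> y \<in> S \<Longrightarrow> x * y \<in> S) \<Longrightarrow> hclosed S \<Longrightarrow> G \<subseteq> S \<Longrightarrow>
   closed_subalgebra G \<subseteq> S"
  by (auto simp: closed_subalgebra_def)

lemma hsubmodule_commutant: "hsubmodule {x. \<forall>y\<in>S. x * y = y * (x::'a::hbar_algebra)}"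
  unfolding hsubmodule_def
  by (simp add: distrib_left distrib_right) (simp add: of_fps_left_commute mult.assoc)

lemma hlinear_mult_left: "hlinear (\<lambda>x. a * x)" and hlinear_mult_right: "hlinear (\<lambda>x. x * a)"
  by (auto simp: hlinear_def distrib_left distrib_right of_fps_left_commute mult.assoc)

lemma hclosed_Inter: "(\<And>i. i \<in> A \<Longrightarrow> hclosed (S i)) \<Longrightarrow> hclosed {x. \<forall>i\<in>A. x \<in> S i}"
  unfolding hclosed_def by blast

lemma hclosed_commutant: "hclosed {x. \<forall>y\<in>S. x * y = y * (x::'a::hbar_algebra)}"
  using hclosed_Inter[of S "\<lambda>y. {x. x * y = y * x}",
      OF hclosed_equalizer[OF hlinear_mult_right hlinear_mult_left]] by simp

text \<open>Commutants are closed subalgebras. So commutation passes from \<open>G\<close> to its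
  closed subalgebra with \<open>H\<close> fixed, and then from \<open>H\<close> to its closed
  subalgebra.\<close>

lemma closed_subalgebra_commute:
  assumes "\<And>x y. x \<in> G \<Longrightarrow> y \<in> H \<Longrightarrow> x * y = y * (x::'a::hbar_algebra)"
    and "x \<in> closed_subalgebra G" "y \<in> closed_subalgebra H"
  shows "x * y = y * x"
proof -
  have comm: "closed_subalgebra K \<subseteq> {x. \<forall>y\<in>S. x * y = y * x}"
    if "\<And>x y. x \<in> K \<Longrightarrow> y \<in> S \<Longrightarrow> x * y = y * x" for K S :: "'a set"
  proof (rule closed_subalgebra_least[OF hsubmodule_commutant _ _ hclosed_commutant])
    fix x x' assume "x \<in> {x. \<forall>y\<in>S. x * y = y * x}" "x' \<in> {x. \<forall>y\<in>S. x * y = y * x}"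
    then have *: "x * y = y * x" "x' * y = y * x'" if "y \<in> S" for y using that by blast+
    have "x * x' * y = y * (x * x')" if "y \<in> S" for y
      by (simp only: mult.assoc *(2)[OF that]) (simp only: mult.assoc[symmetric] *(1)[OF that])
    then show "x * x' \<in> {x. \<forall>y\<in>S. x * y = y * x}" by blast
  qed (use that in \<open>simp, blast\<close>)
  have "closed_subalgebra G \<subseteq> {x. \<forall>y\<in>H. x * y = y * x}"
    by (rule comm) (rule assms(1))
  then have "closed_subalgebra H \<subseteq> {y. \<forall>x\<in>closed_subalgebra G. y * x = x * y}"
    by (intro comm) (blast intro: sym)
  with assms(2,3) have "y * x = x * y" by blast
  then show ?thesis by (rule sym)
qed

text \<open>Scalars from the complex numbers and \<hbar> suffice: a power series is a polynomial in
  \<hbar> up to a multiple of \<open>\<hbar> ^ N\<close>, the polynomial part is covered by the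
  hypotheses, and on both sides the tail is divisible by \<open>\<hbar> ^ N\<close>. Separatedness
  finishes.\<close>

lemma hlinearI:
  fixes f :: "'a::hbar_algebra \<Rightarrow> 'b::hbar_algebra"
  assumes add: "\<And>x y. f (x + y) = f x + f y" and scale: "\<And>c x. f (of_cx c * x) = of_cx c * f x"
    and hbar: "\<And>x. f (\<hbar> * x) = \<hbar> * f x"
  shows "hlinear f"
proof -
  have pow: "f (\<hbar> ^ n * x) = \<hbar> ^ n * f x" for n x
    by (induction n) (auto simp: hbar mult.assoc)
  have "f 0 = 0" using scale[of 0 0] by simp
  then have sum: "f (sum g A) = (\<Sum>i\<in>A. f (g i))" for g and A :: "nat set"
    by (induction A rule: infinite_finite_induct) (auto simp: add)
  have "f (of_fps c * x) = of_fps c * f x" for c x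
  proof (rule hcong_eqI)
    fix N
    define p where "p = (\<Sum>n<N. fps_const (fps_nth c n) * fps_X ^ n)"
    have c: "c = p + fps_X ^ N * fps_shift N c"
      by (rule fps_ext) (auto simp: p_def fps_sum_nth fps_X_power_mult_nth if_distrib cong: if_cong)
    have p: "of_fps p = (\<Sum>n<N. of_cx (fps_nth c n) * (\<hbar>::'z::hbar_algebra) ^ n)"
      unfolding p_def by (induction N) (auto simp: of_fps_add of_fps_mult of_fps_power)
    have "f (of_fps c * x) = of_fps p * f x + \<hbar> ^ N * f (of_fps (fps_shift N c) * x)"
      by (subst c) (simp add: of_fps_add of_fps_mult of_fps_power distrib_right add p sum_distrib_right
          sum scale pow mult.assoc)
    moreover have "of_fps c * f x = of_fps p * f x + \<hbar> ^ N * (of_fps (fps_shift N c) * f x)"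
      by (subst c) (simp add: of_fps_add of_fps_mult of_fps_power distrib_right mult.assoc)
    ultimately show "hcong N (f (of_fps c * x)) (of_fps c * f x)"
      unfolding hcong_def by (auto simp flip: right_diff_distrib)
  qed
  then show ?thesis by (simp add: hlinear_def add)
qed

section \<open>Evaluation of power series\<close>

text \<open>Substitution of an element divisible by \<hbar> into a scalar power series.
  \<open>hexp\<close>, \<open>hlog\<close> and the geometric series are values of it, so their
  relations can be imported from identities of formal power series in one variable.\<close>

definition heval :: "complex fps \<Rightarrow> 'a::hbar_algebra \<Rightarrow> 'a" where
  "heval f x = hlim (\<lambda>N. \<Sum>n<N. of_cx (fps_nth f n) * x ^ n)"

lemma heval_cong_trunc:
  assumes "hcong 1 x 0" "m \<ge> N"
  shows "hcong N (heval f x) (\<Sum>n<m. of_cx (fps_nth f n) * x ^ n)"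
proof -
  have small: "hcong n (of_cx (fps_nth f n) * x ^ n) 0" for n
    using hcong_mult_left[OF hcong_power_small[OF assms(1) order_refl]] by fastforce
  let ?s = "\<lambda>N. \<Sum>n<N. of_cx (fps_nth f n) * x ^ n"
  have "hcong n (?s (Suc n)) (?s n)" for n
    using hcong_add[OF hcong_refl small, of n "?s n"] by simp
  then obtain y where "hlim ?s = y" "\<And>N n. n \<ge> N \<Longrightarrow> hcong N (?s n) y"
    by (rule hlim_exists) blast
  with assms(2) show ?thesis by (simp add: heval_def hcong_sym)
qed

lemma heval_fps_X: "hcong 1 x 0 \<Longrightarrow> heval fps_X x = x"
proof (rule hcong_eqI)
  fix N assume "hcong 1 x 0"
  have "hcong N (heval fps_X x) (\<Sum>n<Suc (Suc N). of_cx (fps_nth fps_X n) * x ^ n)"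
    by (rule heval_cong_trunc) (simp_all add: \<open>hcong 1 x 0\<close> del: One_nat_def)
  then show "hcong N (heval fps_X x) x"
    unfolding sum.lessThan_Suc_shift by simp
qed

lemma heval_mult:
  assumes x: "hcong 1 (x::'a::hbar_algebra) 0"
  shows "heval (f * g) x = heval f x * heval g x"
proof (rule hcong_eqI)
  fix N
  let ?t = "\<lambda>f i. of_cx (fps_nth f i) * x ^ i :: 'a"
  have prd: "of_cx (fps_nth f i) * x ^ i * (of_cx (fps_nth g j) * x ^ j) =
     of_cx (fps_nth f i * fps_nth g j) * x ^ (i + j)" for i j
    by (simp add: of_fps_mult_mult power_add)
  have "hcong N (heval f x * heval g x) ((\<Sum>i<N. ?t f i) * (\<Sum>j<N. ?t g j))"
    by (intro hcong_mult heval_cong_trunc x) auto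
  also have "(\<Sum>i<N. ?t f i) * (\<Sum>j<N. ?t g j)
     = (\<Sum>(i,j)\<in>{..<N} \<times> {..<N}. of_cx (fps_nth f i * fps_nth g j) * x ^ (i + j))"
    by (simp add: sum_product sum.cartesian_product prd)
  also have "hcong N \<dots> (\<Sum>(i,j)\<in>{..<N} \<times> {..<N}. if i + j < N then of_cx (fps_nth f i * fps_nth g j) * x ^ (i + j) else 0)"
  proof (intro hcong_sum, clarsimp)
    fix i j assume "\<not> i + j < N"
    then show "hcong N (of_cx (fps_nth f i * fps_nth g j) * x ^ (i + j)) 0"
      using hcong_mult_left[OF hcong_power_small[OF x, of N "i + j"]] by fastforce
  qed
  also have "\<dots> = (\<Sum>(i,j)\<in>{(i,j). i + j < N}. of_cx (fps_nth f i * fps_nth g j) * x ^ (i + j))"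
    by (intro sum.mono_neutral_cong_right) (auto split: if_splits)
  also have "\<dots> = (\<Sum>n<N. \<Sum>i\<le>n. of_cx (fps_nth f i * fps_nth g (n - i)) * x ^ n)"
    by (subst sum.triangle_reindex) (auto intro!: sum.cong)
  also have "\<dots> = (\<Sum>n<N. ?t (f * g) n)"
    by (simp add: fps_mult_nth of_cx_sum sum_distrib_right atMost_atLeast0)
  also have "hcong N \<dots> (heval (f * g) x)"
    by (intro hcong_sym[OF heval_cong_trunc] x) auto
  finally show "hcong N (heval (f * g) x) (heval f x * heval g x)" by (rule hcong_sym)
qed

lemma heval_const: "hcong 1 x 0 \<Longrightarrow> heval (fps_const c) x = of_cx c"
proof (rule hcong_eqI)
  fix N assume "hcong 1 x 0"
  from heval_cong_trunc[OF this le_SucI[OF order_refl], of N "fps_const c"]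
  moreover have "(\<Sum>n<Suc N. of_cx (fps_nth (fps_const c) n) * x ^ n) = of_cx c"
    unfolding sum.lessThan_Suc_shift by simp
  ultimately show "hcong N (heval (fps_const c) x) (of_cx c)" by (simp only:)
qed

lemma heval_power: "hcong 1 x 0 \<Longrightarrow> heval (f ^ n) x = heval f x ^ n"
proof (induction n)
  case 0
  then show ?case using heval_const[of x 1] by simp
next
  case (Suc n)
  then show ?case by (simp only: power_Suc heval_mult)
qed

lemma heval_small: "hcong 1 x 0 \<Longrightarrow> fps_nth f 0 = 0 \<Longrightarrow> hcong 1 (heval f x) 0"
  using heval_cong_trunc[of x 1 1 f] by simp

lemma heval_compose:
  assumes x: "hcong 1 (x::'a::hbar_algebra) 0" and g: "fps_nth g 0 = 0"
  shows "heval (fps_compose f g) x = heval f (heval g x)"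
proof (rule hcong_eqI)
  fix N
  have "hcong N (heval f (heval g x)) (\<Sum>n<N. of_cx (fps_nth f n) * heval g x ^ n)"
    by (intro heval_cong_trunc heval_small x g) auto
  also have "\<dots> = (\<Sum>n<N. of_cx (fps_nth f n) * heval (g ^ n) x)"
    by (simp add: heval_power[OF x])
  also have "hcong N \<dots> (\<Sum>n<N. of_cx (fps_nth f n) * (\<Sum>m<N. of_cx (fps_nth (g ^ n) m) * x ^ m))"
    by (intro hcong_sum hcong_mult_left heval_cong_trunc x) auto
  also have "\<dots> = (\<Sum>m<N. (\<Sum>n<N. of_cx (fps_nth f n * fps_nth (g ^ n) m)) * x ^ m)"
    by (simp add: sum_distrib_left sum_distrib_right of_cx_mult mult.assoc) (rule sum.swap)
  also have "\<dots> = (\<Sum>m<N. of_cx (fps_nth (fps_compose f g) m) * x ^ m)"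
  proof (intro sum.cong refl arg_cong2[of _ _ _ _ "(*)"])
    fix m assume "m \<in> {..<N}"
    \<comment> \<open>Since \<open>g\<close> has no constant term, \<open>g ^ n\<close> starts in
      degree n, so only n \<le> m contributes.\<close>
    then have "(\<Sum>n<N. fps_nth f n * fps_nth (g ^ n) m) = (\<Sum>n=0..m. fps_nth f n * fps_nth (g ^ n) m)"
      by (intro sum.mono_neutral_right) (auto simp: startsby_zero_power_prefix[OF g])
    then show "(\<Sum>n<N. of_cx (fps_nth f n * fps_nth (g ^ n) m)) = of_cx (fps_nth (fps_compose f g) m)"
      by (simp add: fps_compose_nth flip: of_cx_sum)
  qed
  also have "hcong N \<dots> (heval (fps_compose f g) x)"
    by (intro hcong_sym[OF heval_cong_trunc] x) auto
  finally show "hcong N (heval (fps_compose f g) x) (heval f (heval g x))" by (rule hcong_sym)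
qed

lemma heval_hhom:
  assumes "hhom \<phi>" "hcong 1 x 0" shows "\<phi> (heval f x) = heval f (\<phi> x)"
proof (rule hcong_eqI)
  fix N
  have l: "hlinear \<phi>" using assms(1) by (rule hhom_hlinear)
  have "hcong 1 (\<phi> x) 0" using hlinear_hcong[OF l assms(2)] by (simp add: hlinear_0[OF l])
  then have "hcong N (heval f (\<phi> x)) (\<Sum>n<N. of_cx (fps_nth f n) * \<phi> x ^ n)"
    by (rule heval_cong_trunc) simp
  also have "\<dots> = \<phi> (\<Sum>n<N. of_cx (fps_nth f n) * x ^ n)"
    by (simp add: hlinear_sum[OF l] hlinear_scale[OF l] hhom_power[OF assms(1)])
  also have "hcong N \<dots> (\<phi> (heval f x))"
    by (intro hlinear_hcong[OF l] hcong_sym[OF heval_cong_trunc] assms) auto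
  finally show "hcong N (\<phi> (heval f x)) (heval f (\<phi> x))" by (rule hcong_sym)
qed

lemma heval_commute:
  assumes "hcong 1 x 0" "x * y = y * x" shows "heval f x * y = y * heval f x"
proof (rule hcong_eqI)
  fix N
  have pow: "x ^ n * y = y * x ^ n" for n
    by (induction n) (simp_all add: mult.assoc assms(2), metis assms(2) mult.assoc)
  let ?s = "\<Sum>n<N. of_cx (fps_nth f n) * x ^ n"
  have s: "?s * y = y * ?s"
    by (simp add: sum_distrib_left sum_distrib_right pow mult.assoc of_fps_left_commute)
  have *: "hcong N (heval f x) ?s" by (intro heval_cong_trunc assms) simp
  show "hcong N (heval f x * y) (y * heval f x)"
    using hcong_trans[OF hcong_mult_right[OF *, of y, unfolded s] hcong_sym[OF hcong_mult_left[OF *, of y]]] .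
qed

lemma hexp_eq_heval: "hexp x = heval (fps_exp 1) x"
  by (simp add: hexp_def heval_def divide_inverse)

lemma hlog_eq_heval:
  assumes "hcong 1 (u - 1) 0" shows "hlog u = heval (fps_ln 1) (u - 1)"
  unfolding hlog_def
proof (rule hlim_eqI)
  fix N
  have "hcong N (\<Sum>n<m. of_cx ((- 1) ^ n / of_nat (Suc n)) * (u - 1) ^ Suc n) (heval (fps_ln 1) (u - 1))"
    if "m \<ge> N" for m
  proof -
    have "hcong N (heval (fps_ln 1) (u - 1)) (\<Sum>n<Suc m. of_cx (fps_nth (fps_ln 1) n) * (u - 1) ^ n)"
      by (rule heval_cong_trunc[OF assms]) (use that in simp)
    then show ?thesis
      by (subst (asm) sum.lessThan_Suc_shift) (simp add: fps_ln_def hcong_sym)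
  qed
  then show "\<exists>n0. \<forall>n\<ge>n0. hcong N (\<Sum>n<n. of_cx ((- 1) ^ n / of_nat (Suc n)) * (u - 1) ^ Suc n)
     (heval (fps_ln 1) (u - 1))" by blast
qed

text \<open>The formal identity ln(1 + (exp X - 1)) = X, evaluated at \<open>x\<close>. The constant
  term 1 is split off because composition of series requires an inner series without constant
  term.\<close>

lemma hlog_hexp:
  assumes x: "hcong 1 x 0" shows "hlog (hexp x) = x"
proof -
  have eq: "hexp x - 1 = heval (fps_exp 1 - 1) x"
  proof (rule hcong_eqI)
    fix N
    have "hcong N (hexp x - 1) ((\<Sum>n<Suc N. of_cx (fps_nth (fps_exp 1) n) * x ^ n) - 1)"
      unfolding hexp_eq_heval by (intro hcong_diff heval_cong_trunc x) auto
    also have "\<dots> = (\<Sum>n<Suc N. of_cx (fps_nth (fps_exp 1 - 1) n) * x ^ n)"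
      unfolding sum.lessThan_Suc_shift by simp
    also have "hcong N \<dots> (heval (fps_exp 1 - 1) x)"
      by (intro hcong_sym[OF heval_cong_trunc] x) auto
    finally show "hcong N (hexp x - 1) (heval (fps_exp 1 - 1) x)" .
  qed
  have "hcong 1 (heval (fps_exp 1 - 1) x) 0" by (rule heval_small[OF x]) simp
  then have "hlog (hexp x) = heval (fps_ln 1) (heval (fps_exp 1 - 1) x)"
    by (simp add: hlog_eq_heval eq)
  also have "\<dots> = heval (fps_compose (fps_ln 1) (fps_exp 1 - 1)) x"
    by (rule heval_compose[OF x, symmetric]) simp
  also have "fps_compose (fps_ln 1) (fps_exp 1 - 1) = (fps_X :: complex fps)"
    using fps_inv[of "fps_exp 1 - 1 :: complex fps"] by (simp add: fps_ln_fps_exp_inv)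
  finally show ?thesis by (simp add: heval_fps_X[OF x])
qed

text \<open>Two commuting elements do not fit the evaluation of a series in one variable, so the
  addition theorem is proved directly on the divided powers \<open>S z n\<close>, which satisfy the
  binomial formula without coefficients.\<close>

lemma hexp_add:
  fixes x y :: "'a::hbar_algebra"
  assumes x: "hcong 1 x 0" and y: "hcong 1 y 0" and comm: "x * y = y * x"
  shows "hexp (x + y) = hexp x * hexp y"
proof (rule hcong_eqI)
  fix N
  define S where "S z n = of_cx (1 / fact n) * z ^ n" for z :: 'a and n
  have xy: "hcong 1 (x + y) 0" using hcong_add[OF x y] by simp
  have trunc: "hcong N (hexp z) (\<Sum>n<N. S z n)" if "hcong 1 z 0" for z
    unfolding hexp_eq_heval S_def
    using heval_cong_trunc[OF that, of N N "fps_exp 1"] by (simp add: divide_inverse)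
  have S_Suc: "of_cx (of_nat (Suc n)) * S z (Suc n) = z * S z n" for z n
  proof -
    have "of_cx (of_nat (Suc n)) * S z (Suc n) = of_cx (of_nat (Suc n) * (1 / fact (Suc n))) * z ^ Suc n"
      by (simp only: S_def of_cx_mult mult.assoc)
    also have "of_nat (Suc n) * (1 / fact (Suc n)) = (1 / fact n :: complex)"
      by (simp add: field_simps del: of_nat_Suc)
    finally show ?thesis by (simp only: S_def of_fps_left_commute[of z] power_Suc)
  qed
  have S_comm: "y * S x n = S x n * y" for n
    using power_commuting_commutes[OF comm, of n]
    by (simp add: S_def of_fps_left_commute[of y] mult.assoc)
  have S_add: "S (x + y) n = (\<Sum>i\<le>n. S x i * S y (n - i))" for n
  proof (induction n)
    case (Suc n)
    let ?k = "\<lambda>k. of_cx (of_nat k) :: 'a"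
    have "?k (Suc n) * S (x + y) (Suc n) = (x + y) * (\<Sum>i\<le>n. S x i * S y (n - i))"
      by (simp only: S_Suc Suc.IH)
    also have "\<dots> = (\<Sum>i\<le>n. x * S x i * S y (n - i)) + (\<Sum>i\<le>n. S x i * (y * S y (n - i)))"
      by (simp add: distrib_right sum_distrib_left mult.assoc[symmetric] S_comm sum.distrib)
    also have "\<dots> = (\<Sum>i\<le>n. ?k (Suc i) * (S x (Suc i) * S y (n - i)))
        + (\<Sum>i\<le>n. ?k (Suc n - i) * (S x i * S y (Suc n - i)))"
      by (intro arg_cong2[of _ _ _ _ "(+)"] sum.cong refl)
        (simp_all add: S_Suc[symmetric] Suc_diff_le mult.assoc of_fps_left_commute[of "S _ _"])
    also have "(\<Sum>i\<le>n. ?k (Suc i) * (S x (Suc i) * S y (n - i)))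
        = (\<Sum>i\<le>Suc n. ?k i * (S x i * S y (Suc n - i)))"
      by (subst sum.atMost_Suc_shift) simp
    also have "(\<Sum>i\<le>n. ?k (Suc n - i) * (S x i * S y (Suc n - i)))
        = (\<Sum>i\<le>Suc n. ?k (Suc n - i) * (S x i * S y (Suc n - i)))"
      by simp
    \<comment> \<open>The two sums carry the factors i and n + 1 - i, which add up to the constant n
      + 1; that constant is invertible and cancels.\<close>
    also have "(\<Sum>i\<le>Suc n. ?k i * (S x i * S y (Suc n - i))) + \<dots>
        = (\<Sum>i\<le>Suc n. ?k (Suc n) * (S x i * S y (Suc n - i)))"
      unfolding sum.distrib[symmetric]
    proof (intro sum.cong refl)
      fix i assume "i \<in> {..Suc n}"
      then have "?k i + ?k (Suc n - i) = ?k (Suc n)"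
        by (simp flip: of_cx_add of_nat_add)
      then show "?k i * (S x i * S y (Suc n - i)) + ?k (Suc n - i) * (S x i * S y (Suc n - i))
        = ?k (Suc n) * (S x i * S y (Suc n - i))" by (metis distrib_right)
    qed
    finally have "?k (Suc n) * (S (x + y) (Suc n) - (\<Sum>i\<le>Suc n. S x i * S y (Suc n - i))) = 0"
      by (simp only: right_diff_distrib sum_distrib_left diff_self)
    then have "S (x + y) (Suc n) - (\<Sum>i\<le>Suc n. S x i * S y (Suc n - i)) = 0"
      by (rule of_cx_eq_0) (metis of_nat_eq_0_iff nat.distinct(1))
    then show ?case by simp
  qed (simp add: S_def)
  have small: "hcong n (S z n) 0" if "hcong 1 z 0" for z n
    unfolding S_def using hcong_mult_left[OF hcong_power_small[OF that order_refl]] by fastforce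
  have "hcong N (hexp x * hexp y) ((\<Sum>i<N. S x i) * (\<Sum>j<N. S y j))"
    by (intro hcong_mult trunc x y)
  also have "(\<Sum>i<N. S x i) * (\<Sum>j<N. S y j) = (\<Sum>(i,j)\<in>{..<N} \<times> {..<N}. S x i * S y j)"
    by (simp add: sum_product sum.cartesian_product)
  also have "hcong N \<dots> (\<Sum>(i,j)\<in>{..<N} \<times> {..<N}. if i + j < N then S x i * S y j else 0)"
  proof (intro hcong_sum, clarsimp)
    fix i j assume "\<not> i + j < N"
    have "S x i * S y j = of_cx (1 / fact i * (1 / fact j)) * (x ^ i * y ^ j)"
      by (simp only: S_def of_fps_mult_mult fps_const_mult)
    moreover have "hcong N (x ^ i * y ^ j) 0"
    proof -
      obtain a b where "x ^ i - 0 = \<hbar> ^ i * a" "y ^ j - 0 = \<hbar> ^ j * b"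
        using hcong_power_small[OF x order_refl, of i] hcong_power_small[OF y order_refl, of j]
        unfolding hcong_def by blast
      then have "x ^ i * y ^ j = \<hbar> ^ (i + j) * (a * b)"
        by (simp only: diff_0_right power_add mult.assoc hpow_left_commute[of a])
      then show ?thesis using \<open>\<not> i + j < N\<close> by (simp add: hcong_hpow)
    qed
    ultimately show "hcong N (S x i * S y j) 0" by (metis hcong_mult_left mult_zero_right)
  qed
  also have "\<dots> = (\<Sum>(i,j)\<in>{(i,j). i + j < N}. S x i * S y j)"
    by (intro sum.mono_neutral_cong_right) (auto split: if_splits)
  also have "\<dots> = (\<Sum>n<N. \<Sum>i\<le>n. S x i * S y (n - i))"
    by (rule sum.triangle_reindex)
  also have "\<dots> = (\<Sum>n<N. S (x + y) n)" by (simp add: S_add)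
  also have "hcong N \<dots> (hexp (x + y))" by (rule hcong_sym[OF trunc[OF xy]])
  finally show "hcong N (hexp (x + y)) (hexp x * hexp y)" by (rule hcong_sym)
qed

section \<open>Powers of q and units\<close>

lemma qpow_arg_small: "hcong 1 (of_cx (1/2) * \<hbar> * x) 0"
  using hcong_hpow[of 1 1 "of_cx (1/2) * x"] of_fps_left_commute[of "of_cx (1/2)" fps_X x]
  by (simp only: mult.assoc power_one_right order_refl simp_thms)

lemma qpow_add: "x * y = y * x \<Longrightarrow> qpow (x + y) = qpow x * qpow (y::'a::hbar_algebra)"
proof -
  assume "x * y = y * x"
  then have "(of_cx (1/2) * \<hbar> * x) * (of_cx (1/2) * \<hbar> * y) = (of_cx (1/2) * \<hbar> * y) * (of_cx (1/2) * \<hbar> * x)"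
    using \<open>x * y = y * x\<close> by (simp only: of_fps_mult_mult flip: of_fps_mult)
  from hexp_add[OF qpow_arg_small qpow_arg_small this] show ?thesis
    by (simp add: qpow_def distrib_left)
qed

lemma qpow_0: "qpow (0::'a::hbar_algebra) = 1"
proof (rule hcong_eqI)
  fix N
  have "hcong N (qpow (0::'a)) (\<Sum>n<Suc N. of_cx (fps_nth (fps_exp 1) n) * 0 ^ n)"
    unfolding qpow_def hexp_eq_heval mult_zero_right by (rule heval_cong_trunc) auto
  then show "hcong N (qpow (0::'a)) 1" unfolding sum.lessThan_Suc_shift by simp
qed

lemma qpow_cong_1: "hcong 1 (qpow x) 1"
  using heval_cong_trunc[OF qpow_arg_small, of 1 1 "fps_exp 1" x] by (simp add: qpow_def hexp_eq_heval)

lemma qpow_hhom: "hhom \<phi> \<Longrightarrow> \<phi> (qpow x) = qpow (\<phi> x)"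
  unfolding qpow_def hexp_eq_heval
  by (simp add: heval_hhom[OF _ qpow_arg_small] hhom_mult hhom_of_fps)

lemma qpow_commute: "x * y = y * x \<Longrightarrow> qpow x * y = y * qpow (x::'a::hbar_algebra)"
  unfolding qpow_def hexp_eq_heval
  by (rule heval_commute[OF qpow_arg_small])
    (simp add: mult.assoc of_fps_left_commute[of y] flip: of_fps_mult)

lemma qpow_scale_nat: "qpow (of_nat n * x) = qpow (x::'a::hbar_algebra) ^ n"
proof (induction n)
  case (Suc n)
  have "x * (of_nat n * x) = of_nat n * x * x"
    by (simp add: mult_of_nat_commute mult.assoc)
  from qpow_add[OF this] Suc show ?case by (simp add: distrib_right)
qed (simp add: qpow_0)

text \<open>Neumann series: the geometric series evaluated at 1 - x.\<close>

lemma hunit_exists: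
  assumes "hcong 1 (x::'a::hbar_algebra) 1"
  obtains y where "x * y = 1" "y * x = 1"
proof -
  have u: "hcong 1 (1 - x) 0" using hcong_sym[OF assms] by (simp add: hcong_def)
  let ?g = "Abs_fps (\<lambda>_. 1) :: complex fps"
  have inv: "heval (1 - fps_X) (1 - x) = x"
  proof (rule hcong_eqI)
    fix N
    have "hcong N (heval (1 - fps_X) (1 - x)) (\<Sum>n<Suc (Suc N). of_cx (fps_nth (1 - fps_X) n) * (1 - x) ^ n)"
      by (intro heval_cong_trunc u) simp
    then show "hcong N (heval (1 - fps_X) (1 - x)) x"
      unfolding sum.lessThan_Suc_shift by (simp add: of_cx_minus fps_X_def)
  qed
  have g: "(1 - fps_X) * ?g = 1" "?g * (1 - fps_X) = 1"
    by (simp_all add: fps_eq_iff left_diff_distrib right_diff_distrib)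
  have one: "heval 1 (1 - x) = 1" using heval_const[OF u, of 1] by simp
  show thesis
    using that[of "heval ?g (1 - x)"] heval_mult[OF u, of "1 - fps_X" ?g] heval_mult[OF u, of ?g "1 - fps_X"]
    by (simp only: g inv one)
qed

lemma hinverse_props:
  assumes "x * y = 1" "y * x = (1::'a::hbar_algebra)"
  shows "hinverse x = y"
  unfolding hinverse_def
  by (rule the_equality) (use assms in \<open>auto, metis mult.assoc mult.left_neutral mult.right_neutral\<close>)

section \<open>Completed tensor products\<close>

lemma hlinear_comp: "hlinear f \<Longrightarrow> hlinear g \<Longrightarrow> hlinear (\<lambda>x. f (g x))"
  unfolding hlinear_def by simp

lemma hlinear_zero: "hlinear (\<lambda>x. 0)" and hlinear_id: "hlinear (\<lambda>x. x)"
  by (simp_all add: hlinear_def)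

lemma hlinear_plus: "hlinear f \<Longrightarrow> hlinear g \<Longrightarrow> hlinear (\<lambda>x. f x + g x)"
  by (simp add: hlinear_def distrib_left add_ac)

lemma hlinear_lincomb: "(\<And>i. i \<in> A \<Longrightarrow> hlinear (f i)) \<Longrightarrow> hlinear (\<lambda>x. \<Sum>i\<in>A. f i x)"
  by (induction A rule: infinite_finite_induct) (auto simp: hlinear_zero hlinear_plus)

text \<open>The topological basis of a completed monoid algebra. Words give the free algebra and
  pure tensors the algebra covering the tensor product, so one universal property serves
  both.\<close>

definition monom_hbar :: "'k \<Rightarrow> ('k::monoid_add \<Rightarrow>\<^sub>0 complex) fps" where
  "monom_hbar k = fps_const (Poly_Mapping.single k 1)"

lemma fps_const_as_sum:
  fixes p :: "'k::monoid_add \<Rightarrow>\<^sub>0 complex"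
  shows "fps_const p = (\<Sum>k\<in>Poly_Mapping.keys p. of_cx (Poly_Mapping.lookup p k) * monom_hbar k)"
proof -
  have "of_cx c * monom_hbar k = fps_const (Poly_Mapping.single k c)" for c and k :: 'k
    by (rule fps_ext)
      (simp add: monom_hbar_def of_fps_fps_def fps_mult_nth of_cplx_poly_mapping_def
        of_cplx_complex_def mult_single if_distrib if_distribR sum.If_cases cong: if_cong)
  moreover have "fps_const (sum f A) = (\<Sum>k\<in>A. fps_const (f k))" for f :: "'k \<Rightarrow> ('k \<Rightarrow>\<^sub>0 complex)" and A
    by (induction A rule: infinite_finite_induct) (auto simp flip: fps_const_add)
  ultimately show ?thesis by (subst poly_mapping_as_sum[of p]) simp
qed

lemma fps_hcong_trunc:
  fixes f :: "('k::monoid_add \<Rightarrow>\<^sub>0 complex) fps"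
  shows "hcong N f (\<Sum>n<N. \<hbar> ^ n * fps_const (fps_nth f n))"
proof -
  have "f - (\<Sum>n<N. fps_X ^ n * fps_const (fps_nth f n)) = fps_X ^ N * fps_shift N f"
    by (rule fps_ext) (auto simp: fps_sum_nth fps_X_power_mult_nth mult.assoc if_distrib if_distribR cong: if_cong)
  then show ?thesis unfolding hcong_def of_fps_power[symmetric] of_fps_X_power by blast
qed

text \<open>Modulo \<open>\<hbar> ^ N\<close> every element is a finite combination of monomials,
  because each coefficient has finite support.\<close>

lemma monom_hbar_span:
  fixes S :: "('k::monoid_add \<Rightarrow>\<^sub>0 complex) fps set"
  assumes "hsubmodule S" "hclosed S" "\<And>k. monom_hbar k \<in> S"
  shows "f \<in> S"
proof (rule assms(2)[unfolded hclosed_def, rule_format])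
  fix N
  have "(\<Sum>n<N. \<hbar> ^ n * fps_const (fps_nth f n)) \<in> S"
    unfolding fps_const_as_sum of_fps_power[symmetric]
    by (intro hsubmodule_sum[OF assms(1)] hsubmodule_scale[OF assms(1)] assms(3))
  then show "\<exists>y\<in>S. hcong N f y" using fps_hcong_trunc by blast
qed

text \<open>The universal property of the completed free module. \<open>val\<close> extends
  \<open>w\<close> linearly to a single coefficient, and \<open>F\<close> sums the values with
  weights \<open>\<hbar> ^ n\<close>, which converges by completeness of the target.\<close>

lemma hlinear_extension:
  fixes w :: "'k::monoid_add \<Rightarrow> 'c::hbar_algebra"
  obtains F where "hlinear F" "\<And>k. F (monom_hbar k) = w k"
proof -
  define val where "val p = (\<Sum>k\<in>Poly_Mapping.keys p. of_cx (Poly_Mapping.lookup p k) * w k)"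
    for p :: "'k \<Rightarrow>\<^sub>0 complex"
  have val_eq: "val p = (\<Sum>k\<in>K. of_cx (Poly_Mapping.lookup p k) * w k)"
    if "finite K" "Poly_Mapping.keys p \<subseteq> K" for K p
    unfolding val_def by (rule sum.mono_neutral_left) (use that in \<open>auto simp: in_keys_iff\<close>)
  have val_add: "val (p + q) = val p + val q" for p q
  proof -
    let ?K = "Poly_Mapping.keys p \<union> Poly_Mapping.keys q"
    have "Poly_Mapping.keys (p + q) \<subseteq> ?K" by (rule Poly_Mapping.keys_add)
    then have "val (p + q) = (\<Sum>k\<in>?K. of_cx (Poly_Mapping.lookup (p + q) k) * w k)"
      by (intro val_eq) auto
    also have "\<dots> = val p + val q"
      using val_eq[of ?K p] val_eq[of ?K q] by (simp add: lookup_add of_cx_add distrib_right sum.distrib)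
    finally show ?thesis .
  qed
  have val_0: "val 0 = 0" by (simp add: val_def)
  have val_single: "val (Poly_Mapping.single k c) = of_cx c * w k" for k c
    using val_eq[of "{k}" "Poly_Mapping.single k c"] by (simp add: keys_single)
  have val_sum: "val (sum f S) = (\<Sum>i\<in>S. val (f i))" for f and S :: "'k set"
    by (induction S rule: infinite_finite_induct) (auto simp: val_add val_0)
  have val_scale: "val (of_cplx c * p) = of_cx c * val p" for c p
  proof -
    have "of_cplx c * p = (\<Sum>k\<in>Poly_Mapping.keys p. Poly_Mapping.single k (c * Poly_Mapping.lookup p k))"
      by (subst poly_mapping_as_sum[of p])
        (simp add: sum_distrib_left of_cplx_poly_mapping_def of_cplx_complex_def mult_single)
    then have "val (of_cplx c * p) = (\<Sum>k\<in>Poly_Mapping.keys p. of_cx (c * Poly_Mapping.lookup p k) * w k)"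
      by (simp only: val_sum val_single)
    then show ?thesis
      by (simp only: sum_distrib_left val_def of_cx_mult mult.assoc)
  qed
  define F where "F f = hlim (\<lambda>N. \<Sum>n<N. \<hbar> ^ n * val (fps_nth f n))" for f
  have F: "hcong N (F f) (\<Sum>n<N. \<hbar> ^ n * val (fps_nth f n))" for N f
  proof -
    let ?s = "\<lambda>N. \<Sum>n<N. \<hbar> ^ n * val (fps_nth f n)"
    have "hcong n (?s (Suc n)) (?s n)" for n
      using hcong_add[OF hcong_refl hcong_hpow[OF order_refl], of n "?s n"] by simp
    then obtain y where "hlim ?s = y" "\<And>N n. n \<ge> N \<Longrightarrow> hcong N (?s n) y"
      by (rule hlim_exists) blast
    then show ?thesis by (simp add: F_def hcong_sym)
  qed
  have F_eqI: "F f = y" if "\<And>N. hcong N y (\<Sum>n<N. \<hbar> ^ n * val (fps_nth f n))" for f y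
    by (rule hcong_eqI) (rule hcong_trans[OF F hcong_sym[OF that]])
  have "hlinear F"
  proof (rule hlinearI)
    fix x y and c :: complex
    show "F (x + y) = F x + F y"
    proof (rule F_eqI)
      fix N
      show "hcong N (F x + F y) (\<Sum>n<N. \<hbar> ^ n * val (fps_nth (x + y) n))"
        using hcong_add[OF F[of N x] F[of N y]] by (simp add: val_add distrib_left sum.distrib)
    qed
    show "F (of_cx c * x) = of_cx c * F x"
    proof (rule F_eqI)
      fix N
      have "fps_nth (of_cx c * x) n = of_cplx c * fps_nth x n" for n
      proof -
        have "of_cx c = (fps_const (of_cplx c) :: ('k \<Rightarrow>\<^sub>0 complex) fps)"
          by (rule fps_ext) (simp add: of_fps_fps_def)
        then show ?thesis by simp
      qed
      then show "hcong N (of_cx c * F x) (\<Sum>n<N. \<hbar> ^ n * val (fps_nth (of_cx c * x) n))"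
        using hcong_mult_left[OF F[of N x], of "of_cx c"]
        by (simp add: val_scale sum_distrib_left hpow_left_commute)
    qed
    show "F (\<hbar> * x) = \<hbar> * F x"
    proof (rule F_eqI)
      fix N
      have X: "\<hbar> * x = fps_X * x" by (simp add: of_fps_X_power[of 1, simplified])
      have "hcong N (\<hbar> * F x) (\<hbar> * (\<Sum>n<N. \<hbar> ^ n * val (fps_nth x n)))"
        by (rule hcong_mult_left[OF F])
      also have "\<dots> = (\<Sum>n<Suc N. \<hbar> ^ n * val (fps_nth (\<hbar> * x) n))"
        unfolding X sum.lessThan_Suc_shift by (simp add: val_0 sum_distrib_left mult.assoc)
      also have "hcong N \<dots> (\<Sum>n<N. \<hbar> ^ n * val (fps_nth (\<hbar> * x) n))"
        using hcong_add[OF hcong_refl hcong_hpow[OF order_refl]] by fastforce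
      finally show "hcong N (\<hbar> * F x) (\<Sum>n<N. \<hbar> ^ n * val (fps_nth (\<hbar> * x) n))" .
    qed
  qed
  moreover have "F (monom_hbar k) = w k" for k
  proof (rule hcong_eqI)
    fix N
    have "hcong N (F (monom_hbar k)) (\<Sum>n<Suc N. \<hbar> ^ n * val (fps_nth (monom_hbar k) n))"
      by (rule hcong_mono[OF F]) simp
    then show "hcong N (F (monom_hbar k)) (w k)"
      unfolding sum.lessThan_Suc_shift monom_hbar_def by (simp add: val_single val_0)
  qed
  ultimately show thesis by (rule that)
qed

lemma pre_tensor_eq: "pre_tensor a b = monom_hbar (Pure_Tensor a b)"
  by (simp add: pre_tensor_def monom_hbar_def)

lemma pre_tensor_mult: "pre_tensor a b * pre_tensor a' b' = pre_tensor (a * a') (b * b')"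
  by (simp add: pre_tensor_def mult_single)

lemma abs_ctensor_eq_iff: "abs_ctensor x = abs_ctensor y \<longleftrightarrow> x - y \<in> closed_ideal bilinearity"
  using Quotient_rel[OF Quotient_ctensor, of x y]
  by (simp add: tensor_rel_def hsubmodule_0[OF hsubmodule_closed_ideal])

lemma abs_rep_ctensor: "abs_ctensor (rep_ctensor x) = x"
  using Quotient_ctensor by (rule Quotient_abs_rep)

lemma tensor_eq_abs: "a \<otimes> b = abs_ctensor (pre_tensor a b)"
  by (rule tensor.abs_eq)

lemma hlinear_abs_ctensor: "hlinear abs_ctensor"
  by (simp add: hlinear_def plus_ctensor.abs_eq times_ctensor.abs_eq of_fps_ctensor.abs_eq)

lemma tensor_one: "(1 :: 'a::hbar_algebra \<otimes> 'b::hbar_algebra) = 1 \<otimes> 1"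
  by (simp add: tensor_eq_abs one_ctensor_def pre_tensor_def zero_pure_tensor_def[symmetric])

lemma tensor_mult: "(a \<otimes> b) * (a' \<otimes> b') = (a * a') \<otimes> (b * b')"
  by (simp add: tensor_eq_abs times_ctensor.abs_eq pre_tensor_mult)

lemma bilinearity_zero: "r \<in> bilinearity \<Longrightarrow> abs_ctensor r = 0"
  using closed_ideal_superset[of bilinearity] abs_ctensor_eq_iff[of r 0]
  by (auto simp: zero_ctensor_def)

lemma
  shows tensor_add_left: "(a + a') \<otimes> b = a \<otimes> b + a' \<otimes> b"
    and tensor_add_right: "a \<otimes> (b + b') = a \<otimes> b + a \<otimes> b'"
    and tensor_scale_left: "(of_fps c * a) \<otimes> b = of_fps c * (a \<otimes> b)"
    and tensor_scale_right: "a \<otimes> (of_fps c * b) = of_fps c * (a \<otimes> b)"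
proof -
  note lin = hlinear_diff[OF hlinear_abs_ctensor] hlinear_add[OF hlinear_abs_ctensor]
    hlinear_scale[OF hlinear_abs_ctensor]
  have "abs_ctensor (pre_tensor (a + a') b - pre_tensor a b - pre_tensor a' b) = 0"
    by (rule bilinearity_zero) (unfold bilinearity_def, blast)
  then show "(a + a') \<otimes> b = a \<otimes> b + a' \<otimes> b" by (simp add: tensor_eq_abs lin algebra_simps)
  have "abs_ctensor (pre_tensor a (b + b') - pre_tensor a b - pre_tensor a b') = 0"
    by (rule bilinearity_zero) (unfold bilinearity_def, blast)
  then show "a \<otimes> (b + b') = a \<otimes> b + a \<otimes> b'" by (simp add: tensor_eq_abs lin algebra_simps)
  have "abs_ctensor (pre_tensor (of_fps c * a) b - of_fps c * pre_tensor a b) = 0"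
    by (rule bilinearity_zero) (unfold bilinearity_def, blast)
  then show "(of_fps c * a) \<otimes> b = of_fps c * (a \<otimes> b)" by (simp add: tensor_eq_abs lin)
  have "abs_ctensor (pre_tensor a (of_fps c * b) - of_fps c * pre_tensor a b) = 0"
    by (rule bilinearity_zero) (unfold bilinearity_def, blast)
  then show "a \<otimes> (of_fps c * b) = of_fps c * (a \<otimes> b)" by (simp add: tensor_eq_abs lin)
qed

lemma hlinear_tensor_left: "hlinear (\<lambda>a. a \<otimes> b)" and hlinear_tensor_right: "hlinear (\<lambda>b. a \<otimes> b)"
  by (simp_all add: hlinear_def tensor_add_left tensor_add_right tensor_scale_left tensor_scale_right)

lemma hhom_tensor_left: "hhom (\<lambda>a. a \<otimes> 1)" and hhom_tensor_right: "hhom (\<lambda>b. 1 \<otimes> b)"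
  by (simp_all add: hhom_def hlinear_tensor_left hlinear_tensor_right tensor_mult tensor_one)

lemma tensor_span:
  fixes S :: "('a::hbar_algebra \<otimes> 'b::hbar_algebra) set"
  assumes "hsubmodule S" "hclosed S" "\<And>a b. a \<otimes> b \<in> S"
  shows "x \<in> S"
proof -
  let ?S = "{f. abs_ctensor f \<in> S}"
  note lin = hlinear_add[OF hlinear_abs_ctensor] hlinear_scale[OF hlinear_abs_ctensor] hlinear_0[OF hlinear_abs_ctensor]
  have "rep_ctensor x \<in> ?S"
  proof (rule monom_hbar_span)
    show "hsubmodule ?S"
      using assms(1) by (simp add: hsubmodule_def lin)
    show "hclosed ?S"
      unfolding hclosed_def
    proof (intro allI impI CollectI)
      fix f assume f: "\<forall>n. \<exists>g\<in>?S. hcong n f g"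
      have "\<exists>y\<in>S. hcong n (abs_ctensor f) y" for n
        using f hlinear_hcong[OF hlinear_abs_ctensor] by blast
      then show "abs_ctensor f \<in> S" using assms(2) unfolding hclosed_def by blast
    qed
    fix k :: "('a, 'b) pure_tensor"
    show "monom_hbar k \<in> ?S"
      using assms(3) by (cases k) (simp add: tensor_eq_abs pre_tensor_eq)
  qed
  then show ?thesis by (simp add: abs_rep_ctensor)
qed

lemma hlinear_tensor_eqI:
  assumes "hlinear f" "hlinear g" "\<And>a b. f (a \<otimes> b) = g (a \<otimes> b)"
  shows "f x = g x"
  using tensor_span[OF hsubmodule_equalizer[OF assms(1,2)] hclosed_equalizer[OF assms(1,2)]] assms(3)
  by blast

definition hbilinear :: "('a::hbar_algebra \<Rightarrow> 'b::hbar_algebra \<Rightarrow> 'c::hbar_algebra) \<Rightarrow> bool" where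
  "hbilinear \<beta> \<longleftrightarrow> (\<forall>a. hlinear (\<beta> a)) \<and> (\<forall>b. hlinear (\<lambda>a. \<beta> a b))"

lemma hbilinearI: "(\<And>a. hlinear (\<beta> a)) \<Longrightarrow> (\<And>b. hlinear (\<lambda>a. \<beta> a b)) \<Longrightarrow> hbilinear \<beta>"
  by (simp add: hbilinear_def)

lemma hbilinear_extension:
  assumes "hbilinear (\<beta> :: 'a::hbar_algebra \<Rightarrow> 'b::hbar_algebra \<Rightarrow> 'c::hbar_algebra)"
  obtains F where "hlinear F" "\<And>a b. F (a \<otimes> b) = \<beta> a b"
proof -
  obtain F' :: "('a, 'b) pre_tensor \<Rightarrow> 'c" where F': "hlinear F'"
    and val0: "\<And>k. F' (monom_hbar k) = (case k of Pure_Tensor a b \<Rightarrow> \<beta> a b)"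
    by (rule hlinear_extension[of "\<lambda>k. case k of Pure_Tensor a b \<Rightarrow> \<beta> a b"]) blast
  have val: "F' (pre_tensor a b) = \<beta> a b" for a b by (simp add: val0 pre_tensor_eq)
  have lin: "hlinear (\<beta> a)" "hlinear (\<lambda>a. \<beta> a b)" for a b
    using assms by (auto simp: hbilinear_def)
  \<comment> \<open>The bilinearity relations were made into a closed two-sided ideal, so it does
    not suffice that \<open>F'\<close> kills them; the multipliers \<open>u\<close> and
    \<open>v\<close> make \<open>I\<close> stable under multiplication on both sides.\<close>
  define I where "I = {f. \<forall>u v. F' (u * f * v) = 0}"
  have I: "r \<in> I" if "\<And>a b a' b'. F' (pre_tensor a b * r * pre_tensor a' b') = 0" for r
  proof -
    have 1: "F' (pre_tensor a b * r * v) = 0" for a b v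
    proof -
      have "hlinear (\<lambda>v. F' (pre_tensor a b * r * v))"
        by (rule hlinear_comp[OF F' hlinear_mult_left])
      note * = this hlinear_zero
      have "v \<in> {v. F' (pre_tensor a b * r * v) = 0}"
      proof (rule monom_hbar_span[OF hsubmodule_equalizer[OF *] hclosed_equalizer[OF *]])
        show "monom_hbar k \<in> {v. F' (pre_tensor a b * r * v) = 0}" for k
          using that by (cases k) (simp add: pre_tensor_eq)
      qed
      then show ?thesis by simp
    qed
    have "F' (u * r * v) = 0" for u v
    proof -
      have "hlinear (\<lambda>u. F' (u * (r * v)))"
        by (rule hlinear_comp[OF F' hlinear_mult_right])
      note * = this hlinear_zero
      have "u \<in> {u. F' (u * (r * v)) = 0}"
      proof (rule monom_hbar_span[OF hsubmodule_equalizer[OF *] hclosed_equalizer[OF *]])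
        show "monom_hbar k \<in> {u. F' (u * (r * v)) = 0}" for k
          using 1 by (cases k) (simp add: pre_tensor_eq mult.assoc)
      qed
      then show ?thesis by (simp add: mult.assoc)
    qed
    then show ?thesis by (simp add: I_def)
  qed
  have "bilinearity \<subseteq> I"
  proof -
    note simps = left_diff_distrib right_diff_distrib hlinear_diff[OF F'] pre_tensor_mult val
      hlinear_scale[OF F']
      of_fps_left_commute[of "pre_tensor _ _"] mult.assoc
      hlinear_add[OF lin(1)] hlinear_add[OF lin(2)] hlinear_scale[OF lin(1)] hlinear_scale[OF lin(2)]
    show ?thesis
      unfolding bilinearity_def
      by (auto intro!: I simp: simps distrib_left distrib_right of_fps_left_commute)
  qed
  moreover have "hsubmodule I"
    unfolding hsubmodule_def I_def
    by (simp add: hlinear_0[OF F'] distrib_left distrib_right hlinear_add[OF F'])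
      (simp add: of_fps_left_commute hlinear_scale[OF F'] mult.assoc)
  moreover have "\<forall>x\<in>I. \<forall>a. a * x \<in> I \<and> x * a \<in> I"
    unfolding I_def by (simp flip: mult.assoc) (simp add: mult.assoc)
  moreover have "hclosed I"
  proof -
    have "hlinear (\<lambda>f. F' (u * f * v))" for u v
      using hlinear_comp[OF F' hlinear_comp[OF hlinear_mult_right hlinear_mult_left]] .
    from hclosed_Inter[of UNIV "\<lambda>(u, v). {f. F' (u * f * v) = 0}"] hclosed_equalizer[OF this hlinear_zero]
    show ?thesis by (simp add: I_def split_beta)
  qed
  ultimately have "closed_ideal bilinearity \<subseteq> I"
    unfolding closed_ideal_def by blast
  then have zero: "F' f = 0" if "f \<in> closed_ideal bilinearity" for f
    using that by (auto simp: I_def dest!: subsetD spec[of _ 1])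
  have eq: "F' (rep_ctensor (abs_ctensor f)) = F' f" for f
  proof -
    have "rep_ctensor (abs_ctensor f) - f \<in> closed_ideal bilinearity"
      by (simp add: abs_rep_ctensor flip: abs_ctensor_eq_iff)
    from zero[OF this] show ?thesis by (simp add: hlinear_diff[OF F'])
  qed
  define F where "F x = F' (rep_ctensor x)" for x
  have F_abs: "F (abs_ctensor f) = F' f" for f by (simp add: F_def eq)
  have "hlinear F"
  proof (unfold hlinear_def, intro conjI allI)
    fix x y :: "'a \<otimes> 'b" and c
    obtain f g where fg: "x = abs_ctensor f" "y = abs_ctensor g" by (metis abs_rep_ctensor)
    show "F (x + y) = F x + F y"
      by (simp add: fg F_abs hlinear_add[OF F'] flip: hlinear_add[OF hlinear_abs_ctensor])
    show "F (of_fps c * x) = of_fps c * F x"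
      by (simp add: fg F_abs hlinear_scale[OF F'] flip: hlinear_scale[OF hlinear_abs_ctensor])
  qed
  moreover have "F (a \<otimes> b) = \<beta> a b" for a b by (simp add: tensor_eq_abs F_abs val)
  ultimately show thesis by (rule that)
qed

lemma
  assumes "hbilinear \<beta>"
  shows hlinear_tensor_lift: "hlinear (tensor_lift \<beta>)"
    and tensor_lift_tensor: "tensor_lift \<beta> (a \<otimes> b) = \<beta> a b"
proof -
  obtain F where F: "hlinear F" "\<And>a b. F (a \<otimes> b) = \<beta> a b"
    using hbilinear_extension[OF assms] by blast
  have "tensor_lift \<beta> = F"
    unfolding tensor_lift_def
  proof (rule the_equality)
    fix G assume "hlinear G \<and> (\<forall>a b. G (a \<otimes> b) = \<beta> a b)"
    then show "G = F" by - (rule ext, elim conjE, rule hlinear_tensor_eqI[of G F], simp_all add: F)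
  qed (use F in blast)
  then show "hlinear (tensor_lift \<beta>)" "tensor_lift \<beta> (a \<otimes> b) = \<beta> a b" by (simp_all add: F)
qed

text \<open>Multiplicativity spreads from pure tensors by density, one argument at a time.\<close>

lemma hhom_tensorI:
  fixes F :: "'a::hbar_algebra \<otimes> 'b::hbar_algebra \<Rightarrow> 'c::hbar_algebra"
  assumes F: "hlinear F" and one: "F 1 = 1"
    and mult: "\<And>a b a' b'. F ((a \<otimes> b) * (a' \<otimes> b')) = F (a \<otimes> b) * F (a' \<otimes> b')"
  shows "hhom F"
proof -
  have 1: "F ((a \<otimes> b) * y) = F (a \<otimes> b) * F y" for a b y
    by (rule hlinear_tensor_eqI[of "\<lambda>y. F ((a \<otimes> b) * y)" "\<lambda>y. F (a \<otimes> b) * F y"])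
      (rule hlinear_comp[OF F hlinear_mult_left] hlinear_comp[OF hlinear_mult_left F] mult)+
  have "F (x * y) = F x * F y" for x y
    by (rule hlinear_tensor_eqI[of "\<lambda>x. F (x * y)" "\<lambda>x. F x * F y"])
      (rule hlinear_comp[OF F hlinear_mult_right] hlinear_comp[OF hlinear_mult_right F] 1)+
  with F one show ?thesis by (simp add: hhom_def)
qed

lemma hbilinear_tensor_hom:
  assumes "hlinear f" "hlinear g" shows "hbilinear (\<lambda>a b. f a \<otimes> g b)"
  by (intro hbilinearI hlinear_comp[OF hlinear_tensor_left] hlinear_comp[OF hlinear_tensor_right] assms)

lemma tensor_map_tensor: "hlinear f \<Longrightarrow> hlinear g \<Longrightarrow> tensor_map f g (a \<otimes> b) = f a \<otimes> g b"
  unfolding tensor_map_def by (rule tensor_lift_tensor[OF hbilinear_tensor_hom])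

lemma hlinear_tensor_map: "hlinear f \<Longrightarrow> hlinear g \<Longrightarrow> hlinear (tensor_map f g)"
  unfolding tensor_map_def by (rule hlinear_tensor_lift[OF hbilinear_tensor_hom])

lemma hbilinear_flip: "hbilinear (\<lambda>a b. b \<otimes> a)"
  by (intro hbilinearI hlinear_tensor_left hlinear_tensor_right)

lemma tensor_flip_tensor: "tensor_flip (a \<otimes> b) = b \<otimes> a"
  unfolding tensor_flip_def by (rule tensor_lift_tensor[OF hbilinear_flip])

lemma hhom_tensor_flip: "hhom tensor_flip"
  by (rule hhom_tensorI)
    (simp_all add: tensor_flip_def[symmetric] tensor_flip_tensor tensor_mult tensor_one,
     simp add: tensor_flip_def hlinear_tensor_lift[OF hbilinear_flip])

section \<open>Algebras given by generators and relations\<close>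

lemma monom_gword_Nil: "monom_hbar (GWord []) = 1"
  by (simp add: monom_hbar_def flip: zero_gword_def)

lemma monom_gword_append: "monom_hbar (GWord (u @ v)) = monom_hbar (GWord u) * monom_hbar (GWord v)"
  by (simp add: monom_hbar_def mult_single)

lemma monom_gword_Cons: "monom_hbar (GWord (x # w)) = hvar x * monom_hbar (GWord w)"
  using monom_gword_append[of "[x]" w] by (simp add: hvar_def monom_hbar_def)

lemma presented_by_evaluation:
  assumes "presented_by X gen R"
  obtains ev where "hhom ev" "surj ev" "\<And>x. x \<in> X \<Longrightarrow> ev (hvar x) = gen x"
    "\<And>x. x \<notin> X \<Longrightarrow> ev (hvar x) = 0" "\<And>r. r \<in> R \<Longrightarrow> ev r = 0"
    "{f. ev f = 0} = closed_ideal (R \<union> hvar ` (- X))"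
proof -
  obtain ev where ev: "hhom ev" "surj ev" "\<forall>x\<in>X. ev (hvar x) = gen x"
    "{f. ev f = 0} = closed_ideal (R \<union> hvar ` (- X))"
    using assms unfolding presented_by_def by blast
  have "R \<union> hvar ` (- X) \<subseteq> {f. ev f = 0}"
    unfolding ev(4) by (rule closed_ideal_superset)
  with ev that show thesis by blast
qed

text \<open>Words span the free algebra topologically, and a letter outside of \<open>X\<close>
  evaluates to zero. So every word lands in a closed subalgebra that contains the generators, and
  \<open>ev\<close> is surjective.\<close>

lemma presented_by_generated:
  assumes "presented_by X gen R"
  shows "closed_subalgebra (gen ` X) = UNIV"
proof -
  obtain ev where ev: "hhom ev" "surj ev" "\<And>x. x \<in> X \<Longrightarrow> ev (hvar x) = gen x"
    "\<And>x. x \<notin> X \<Longrightarrow> ev (hvar x) = 0"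
    by (rule presented_by_evaluation[OF assms]) blast
  note l = hhom_hlinear[OF ev(1)]
  have "y \<in> S" if S: "hsubmodule S" "1 \<in> S" "\<forall>x\<in>S. \<forall>y\<in>S. x * y \<in> S" "hclosed S" "gen ` X \<subseteq> S"
    for S y
  proof -
    let ?S = "{f. ev f \<in> S}"
    have word: "monom_hbar (GWord w) \<in> ?S" for w
    proof (induction w)
      case Nil
      then show ?case by (simp add: monom_gword_Nil hhom_1[OF ev(1)] S(2))
    next
      case (Cons x w)
      then have "gen x * ev (monom_hbar (GWord w)) \<in> S" if "x \<in> X"
        using S(3,5) that by blast
      then show ?case
        by (cases "x \<in> X") (simp_all add: monom_gword_Cons hhom_mult[OF ev(1)] ev(3,4) hsubmodule_0[OF S(1)])
    qed
    have hs: "hsubmodule ?S"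
      using S(1) by (simp add: hsubmodule_def hlinear_0[OF l] hlinear_add[OF l] hlinear_scale[OF l])
    have hc: "hclosed ?S"
      unfolding hclosed_def
    proof (intro allI impI CollectI)
      fix f assume f: "\<forall>n. \<exists>g\<in>?S. hcong n f g"
      have "\<exists>y\<in>S. hcong n (ev f) y" for n
        using f hlinear_hcong[OF l] by blast
      then show "ev f \<in> S" using S(4) unfolding hclosed_def by blast
    qed
    obtain f where f: "y = ev f" using ev(2) by blast
    have "f \<in> ?S" by (rule monom_hbar_span[OF hs hc]) (metis gword.exhaust word)
    then show ?thesis by (simp add: f)
  qed
  then show ?thesis unfolding closed_subalgebra_def by fast
qed

lemma hhom_eq_on_generators:
  assumes "hhom f" "hhom g" "closed_subalgebra G = UNIV" "\<And>x. x \<in> G \<Longrightarrow> f x = g x"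
  shows "f = g"
proof -
  note l = hhom_hlinear[OF assms(1)] hhom_hlinear[OF assms(2)]
  have "closed_subalgebra G \<subseteq> {x. f x = g x}"
    by (rule closed_subalgebra_least[OF hsubmodule_equalizer[OF l] _ _ hclosed_equalizer[OF l]])
      (use assms in \<open>auto simp: hhom_1 hhom_mult\<close>)
  with assms(3) show ?thesis by auto
qed

lemma free_hbar_hom:
  fixes w :: "'x \<Rightarrow> 'b::hbar_algebra"
  obtains F where "hhom F" "\<And>x. F (hvar x) = w x"
proof -
  obtain F where F: "hlinear F" "\<And>k. F (monom_hbar k) = (case k of GWord u \<Rightarrow> prod_list (map w u))"
    by (rule hlinear_extension[of "\<lambda>k. case k of GWord u \<Rightarrow> prod_list (map w u)"]) blast
  have 1: "F (monom_hbar (GWord u) * y) = F (monom_hbar (GWord u)) * F y" for u y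
  proof -
    note l = hlinear_comp[OF F(1) hlinear_mult_left[of "monom_hbar (GWord u)"]]
      hlinear_comp[OF hlinear_mult_left[of "F (monom_hbar (GWord u))"] F(1)]
    have "y \<in> {y. F (monom_hbar (GWord u) * y) = F (monom_hbar (GWord u)) * F y}"
    proof (rule monom_hbar_span[OF hsubmodule_equalizer[OF l] hclosed_equalizer[OF l]])
      fix k :: "'x gword"
      show "monom_hbar k \<in> {y. F (monom_hbar (GWord u) * y) = F (monom_hbar (GWord u)) * F y}"
        by (cases k) (simp add: F(2) flip: monom_gword_append)
    qed
    then show ?thesis by simp
  qed
  have "F (x * y) = F x * F y" for x y
  proof -
    note l = hlinear_comp[OF F(1) hlinear_mult_right[of y]]
      hlinear_comp[OF hlinear_mult_right[of "F y"] F(1)]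
    have "x \<in> {x. F (x * y) = F x * F y}"
      by (rule monom_hbar_span[OF hsubmodule_equalizer[OF l] hclosed_equalizer[OF l]])
        (metis (mono_tags) 1 gword.exhaust mem_Collect_eq)
    then show ?thesis by simp
  qed
  moreover have "F 1 = 1" using F(2)[of "GWord []"] by (simp add: monom_gword_Nil)
  moreover have "F (hvar x) = w x" for x
    using F(2)[of "GWord [x]"] by (simp add: monom_hbar_def hvar_def)
  ultimately show thesis by (intro that[of F]) (auto simp: hhom_def F(1))
qed

text \<open>The kernel of \<open>F\<close> is a closed ideal containing the relations, hence
  contains the kernel of the evaluation; \<open>F\<close> descends along the surjection.\<close>

lemma presented_by_hom:
  assumes pres: "presented_by X gen R" and F: "hhom F" "\<And>r. r \<in> R \<Longrightarrow> F r = 0"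
    "\<And>x. x \<notin> X \<Longrightarrow> F (hvar x) = 0"
  obtains e where "hhom e" "\<And>x. x \<in> X \<Longrightarrow> e (gen x) = F (hvar x)"
proof -
  obtain ev where ev: "hhom ev" "surj ev" "\<And>x. x \<in> X \<Longrightarrow> ev (hvar x) = gen x"
    "{f. ev f = 0} = closed_ideal (R \<union> hvar ` (- X))"
    by (rule presented_by_evaluation[OF pres]) blast
  note lF = hhom_hlinear[OF F(1)] and lev = hhom_hlinear[OF ev(1)]
  have "closed_ideal (R \<union> hvar ` (- X)) \<subseteq> {f. F f = 0}"
    unfolding closed_ideal_def
    by (rule Inter_lower)
      (use F in \<open>auto simp: hsubmodule_equalizer[OF lF hlinear_zero] hclosed_equalizer[OF lF hlinear_zero]
        hhom_mult\<close>)
  then have ker: "F f = 0" if "ev f = 0" for f using ev(4) that by blast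
  have eq: "F f = F g" if "ev f = ev g" for f g
    using ker[of "f - g"] that by (simp add: hlinear_diff[OF lF] hlinear_diff[OF lev])
  define e where "e y = F (inv ev y)" for y
  have e: "e (ev f) = F f" for f
    unfolding e_def by (rule eq) (simp add: surj_f_inv_f[OF ev(2)])
  have "hhom e"
    unfolding hhom_def hlinear_def
  proof (intro conjI allI)
    fix x y and c
    obtain f g where [simp]: "x = ev f" "y = ev g" using ev(2) by (metis surjD)
    show "e (x + y) = e x + e y"
      by (simp add: e hlinear_add[OF lF] flip: hlinear_add[OF lev])
    show "e (of_fps c * x) = of_fps c * e x"
      by (simp add: e hlinear_scale[OF lF] flip: hlinear_scale[OF lev])
    show "e (x * y) = e x * e y"
      by (simp add: e hhom_mult[OF F(1)] flip: hhom_mult[OF ev(1)])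
    show "e 1 = 1" using e[of 1] by (simp add: hhom_1 F(1) ev(1))
  qed
  moreover have "e (gen x) = F (hvar x)" if "x \<in> X" for x
    using e[of "hvar x"] ev(3)[OF that] by simp
  ultimately show thesis by (rule that)
qed

lemma symmetric_hbar_algebra_commute:
  fixes \<iota> :: "'w::ab_group_add \<Rightarrow> 'a::hbar_algebra"
  assumes "symmetric_hbar_algebra sc W \<iota>"
  shows "x * y = y * (x :: 'a)"
proof -
  have pres: "presented_by W \<iota>
     ({hvar (x + y) - hvar x - hvar y | x y. x \<in> W \<and> y \<in> W} \<union>
      {hvar (sc c x) - of_cx c * hvar x | c x. x \<in> W} \<union>
      {comm (hvar x) (hvar y) | x y. x \<in> W \<and> y \<in> W})"
    using assms by (simp add: symmetric_hbar_algebra_def)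
  obtain ev where ev: "hhom ev" "\<And>x. x \<in> W \<Longrightarrow> ev (hvar x) = \<iota> x"
    and rel: "\<And>r. r \<in> {comm (hvar x) (hvar y) | x y. x \<in> W \<and> y \<in> W} \<Longrightarrow> ev r = 0"
    by (rule presented_by_evaluation[OF pres]) blast
  have "\<iota> a * \<iota> b = \<iota> b * \<iota> a" if "a \<in> W" "b \<in> W" for a b
    using rel[of "comm (hvar a) (hvar b)"] ev(2) that
    by (auto simp: comm_def hlinear_diff[OF hhom_hlinear[OF ev(1)]] hhom_mult[OF ev(1)])
  then show ?thesis
    using closed_subalgebra_commute[of "\<iota> ` W" "\<iota> ` W" x y] presented_by_generated[OF pres] by auto
qed

text \<open>This gives meaning to the definite description \<open>counit_Sh\<close>. The relations
  have no constant term, so sending every letter to zero respects them.\<close>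

lemma symmetric_hbar_algebra_counit:
  fixes \<iota> :: "'w::ab_group_add \<Rightarrow> 'a::hbar_algebra"
  assumes "symmetric_hbar_algebra sc W \<iota>"
  shows "\<exists>!e. hhom (e :: 'a \<Rightarrow> complex fps) \<and> (\<forall>x\<in>W. e (\<iota> x) = 0)"
proof -
  have pres: "presented_by W \<iota>
     ({hvar (x + y) - hvar x - hvar y | x y. x \<in> W \<and> y \<in> W} \<union>
      {hvar (sc c x) - of_cx c * hvar x | c x. x \<in> W} \<union>
      {comm (hvar x) (hvar y) | x y. x \<in> W \<and> y \<in> W})"
    using assms by (simp add: symmetric_hbar_algebra_def)
  obtain F :: "'w free_hbar \<Rightarrow> complex fps" where F: "hhom F" "\<And>x. F (hvar x) = 0"
    by (rule free_hbar_hom[of "\<lambda>_. 0"]) blast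
  note lF = hhom_hlinear[OF F(1)]
  obtain e where e: "hhom e" "\<And>x. x \<in> W \<Longrightarrow> e (\<iota> x) = F (hvar x)"
  proof (rule presented_by_hom[OF pres F(1)])
    fix r
    assume "r \<in> {hvar (x + y) - hvar x - hvar y | x y. x \<in> W \<and> y \<in> W} \<union>
      {hvar (sc c x) - of_cx c * hvar x | c x. x \<in> W} \<union>
      {comm (hvar x) (hvar y) | x y. x \<in> W \<and> y \<in> W}"
    then show "F r = 0"
      by (auto simp: hlinear_diff[OF lF] hlinear_scale[OF lF] comm_def hhom_mult[OF F(1)] F(2))
  qed (auto simp: F(2))
  show ?thesis
  proof (intro ex1I conjI ballI)
    show "e (\<iota> x) = 0" if "x \<in> W" for x using e(2)[OF that] by (simp add: F(2))
    show "hhom e" by (rule e(1))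
    fix e' :: "'a \<Rightarrow> complex fps" assume "hhom e' \<and> (\<forall>x\<in>W. e' (\<iota> x) = 0)"
    then show "e' = e"
      by (intro hhom_eq_on_generators[OF _ e(1) presented_by_generated[OF pres]]) (auto simp: e F(2))
  qed
qed

section \<open>Matrices over complete algebras\<close>

abbreviation cmat :: "complex^'n^'m \<Rightarrow> 'a::hbar_algebra^'n^'m" where
  "cmat \<equiv> map_mat of_cx"

lemma map_mat_nth [simp]: "map_mat f M $ i $ j = f (M $ i $ j)"
  by (simp add: map_mat_def)

lemma smat_nth [simp]: "smat c M $ i $ j = c * M $ i $ j"
  by (simp add: smat_def)

lemma mat_eqI: "(\<And>i j. A $ i $ j = B $ i $ j) \<Longrightarrow> A = B"
  by (simp add: vec_eq_iff)

lemma mat_mult_nth: "(A ** B) $ i $ j = (\<Sum>k\<in>UNIV. A $ i $ k * B $ k $ j)"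
  by (simp add: matrix_matrix_mult_def)

lemma cmat_mult: "cmat (A ** B) = cmat A ** cmat B"
  by (rule mat_eqI) (simp add: mat_mult_nth of_cx_sum of_cx_mult)

lemma cmat_1: "cmat (mat 1) = mat 1"
  by (rule mat_eqI) (simp add: mat_def)

lemma cmat_0 [simp]: "cmat 0 = 0"
  by (rule mat_eqI) simp

lemma cmat_add: "cmat (A + B) = cmat A + cmat B"
  by (rule mat_eqI) (simp add: of_cx_add)

lemma cmat_sum: "cmat (sum f K) = (\<Sum>k\<in>K. cmat (f k))"
  by (induction K rule: infinite_finite_induct) (auto simp: cmat_add)

lemma cmat_smat: "cmat (smat c A) = smat (of_cx c) (cmat A)"
  by (rule mat_eqI) (simp add: of_cx_mult)

lemma smat_mult_left: "smat a X ** Y = smat (a::'a::semiring_1) (X ** Y)"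
  by (rule mat_eqI) (simp add: mat_mult_nth sum_distrib_left mult.assoc)

lemma cmat_smat_mult: "cmat P ** smat a X = smat (a::'a::hbar_algebra) (cmat P ** X)"
  by (rule mat_eqI) (simp add: mat_mult_nth sum_distrib_left of_fps_left_commute[of a])

lemma smat_smat: "smat a (smat b X) = smat (a * b :: 'a::semigroup_mult) X"
  by (rule mat_eqI) (simp add: mult.assoc)

lemma smat_cmat_mult: "smat a (cmat P) ** smat b (cmat Q) = smat (a * b :: 'a::hbar_algebra) (cmat (P ** Q))"
  by (simp add: smat_mult_left cmat_smat_mult smat_smat cmat_mult)

lemma smat_add_right: "smat a (X + Y) = smat a X + smat (a::'a::semiring) Y"
  and smat_add_left: "smat (a + b) X = smat a X + smat (b::'a) X"
  by (rule mat_eqI, simp add: distrib_left distrib_right)+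

lemma smat_0_right [simp]: "smat a 0 = (0 :: 'a::mult_zero^'n^'m)"
  and smat_0_left [simp]: "smat 0 X = (0 :: 'a::mult_zero^'n^'m)"
  by (rule mat_eqI, simp)+

lemma smat_1 [simp]: "smat 1 X = (X :: 'a::monoid_mult^'n^'m)"
  by (rule mat_eqI) simp

lemma smat_sum_right: "smat a (sum f K) = (\<Sum>k\<in>K. smat (a::'a::semiring_0) (f k))"
  by (induction K rule: infinite_finite_induct) (auto simp: smat_add_right)

lemma smat_sum_left: "smat (sum f K) X = (\<Sum>k\<in>K. smat (f k :: 'a::semiring_0) X)"
  by (induction K rule: infinite_finite_induct) (auto simp: smat_add_left)

lemma mat_sum_nth [simp]: "(sum f K :: 'a::comm_monoid_add^'n^'m) $ i $ j = (\<Sum>k\<in>K. f k $ i $ j)"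
  by simp

lemma mat_mult_sum_left: "sum f K ** B = (\<Sum>k\<in>K. f k ** (B :: 'a::semiring_1^'n^'m))"
  by (rule mat_eqI) (simp add: mat_mult_nth sum_distrib_right, rule sum.swap)

lemma mat_mult_sum_right: "A ** sum f K = (\<Sum>k\<in>K. (A :: 'a::semiring_1^'n^'m) ** f k)"
  by (rule mat_eqI) (simp add: mat_mult_nth sum_distrib_left, rule sum.swap)

lemma mat_mult_0 [simp]: "(0 :: 'a::semiring_1^'n^'m) ** B = 0" "A ** (0 :: 'a::semiring_1^'n^'m) = 0"
  by (rule mat_eqI, simp add: mat_mult_nth)+

lemma mat_mult_add_left: "(A + B) ** C = A ** C + B ** (C :: 'a::semiring_1^'n^'m)"
  and mat_mult_add_right: "D ** (A + B) = D ** A + (D :: 'a::semiring_1^'m^'k) ** B"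
  by (rule mat_eqI, simp add: mat_mult_nth distrib_left distrib_right sum.distrib)+

lemma mat_mult_diff_left: "(A - B) ** C = A ** C - B ** (C :: 'a::ring_1^'n^'m)"
  and mat_mult_diff_right: "D ** (A - B) = D ** A - (D :: 'a::ring_1^'m^'k) ** B"
  by (rule mat_eqI, simp add: mat_mult_nth left_diff_distrib right_diff_distrib sum_subtractf)+

lemma map_mat_mult: "hhom g \<Longrightarrow> map_mat g (A ** B) = map_mat g A ** map_mat g B"
  by (rule mat_eqI) (simp add: mat_mult_nth hlinear_sum[OF hhom_hlinear] hhom_mult)

lemma map_mat_cmat: "hhom g \<Longrightarrow> map_mat g (cmat A) = cmat A"
  by (rule mat_eqI) (simp add: hhom_of_fps)

lemma map_mat_smat: "hhom g \<Longrightarrow> map_mat g (smat a A) = smat (g a) (map_mat g A)"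
  by (rule mat_eqI) (simp add: hhom_mult)

lemma map_mat_sum: "hlinear g \<Longrightarrow> map_mat g (sum f K) = (\<Sum>k\<in>K. map_mat g (f k))"
  by (rule mat_eqI) (simp add: hlinear_sum)

lemma map_mat_comp: "map_mat f (map_mat g A) = map_mat (\<lambda>x. f (g x)) A"
  by (rule mat_eqI) simp

lemma matrix_inv_unique_ring:
  assumes "A ** B = mat 1" "B ** A = (mat 1 :: 'a::semiring_1^'n^'n)"
  shows "matrix_inv A = B"
proof -
  have "A ** matrix_inv A = mat 1 \<and> matrix_inv A ** A = mat 1"
    unfolding matrix_inv_def by (rule someI[of _ B]) (simp add: assms)
  then have "matrix_inv A = matrix_inv A ** (A ** B)" using assms by simp
  also have "\<dots> = B" using \<open>_ \<and> _\<close> by (simp add: matrix_mul_assoc)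
  finally show ?thesis .
qed

text \<open>Homomorphisms into matrices, whose product is \<open>**\<close>, so that
  \<open>hhom\<close> does not apply; linearity is imposed entrywise.\<close>

definition mat_hom :: "('a::hbar_algebra \<Rightarrow> 'b::hbar_algebra^'n^'n) \<Rightarrow> bool" where
  "mat_hom p \<longleftrightarrow> (\<forall>i j. hlinear (\<lambda>x. p x $ i $ j)) \<and> p 1 = mat 1 \<and> (\<forall>x y. p (x * y) = p x ** p y)"

lemma mat_hom_hlinear: "mat_hom p \<Longrightarrow> hlinear (\<lambda>x. p x $ i $ j)"
  and mat_hom_1: "mat_hom p \<Longrightarrow> p 1 = mat 1"
  and mat_hom_mult: "mat_hom p \<Longrightarrow> p (x * y) = p x ** p y"
  by (auto simp: mat_hom_def)

lemma mat_hom_diff: "mat_hom p \<Longrightarrow> p (x - y) = p x - p y"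
  by (rule mat_eqI) (simp add: hlinear_diff[OF mat_hom_hlinear])

lemma mat_hom_scale: "mat_hom p \<Longrightarrow> p (of_fps c * x) = smat (of_fps c) (p x)"
  by (rule mat_eqI) (simp add: hlinear_scale[OF mat_hom_hlinear])

lemma mat_hom_sum: "mat_hom p \<Longrightarrow> p (sum f K) = (\<Sum>k\<in>K. p (f k))"
  by (rule mat_eqI) (simp add: hlinear_sum[OF mat_hom_hlinear])

lemma mat_hom_comp: "mat_hom p \<Longrightarrow> hhom g \<Longrightarrow> mat_hom (\<lambda>x. p (g x))"
  unfolding mat_hom_def by (auto simp: hhom_1 hhom_mult intro: hlinear_comp[OF _ hhom_hlinear])

lemma of_fps_complex: "(of_fps c :: complex fps) = c"
  by (rule fps_ext) (simp add: of_fps_fps_def of_cplx_complex_def)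

lemma hbilinear_entry:
  assumes "mat_hom p" "hhom g"
  shows "hbilinear (\<lambda>a b. of_fps (p a $ i $ j :: complex fps) * g b)"
proof (intro hbilinearI)
  fix a b
  show "hlinear (\<lambda>b. of_fps (p a $ i $ j) * g b)"
    by (intro hlinear_comp[OF hlinear_mult_left] hhom_hlinear assms)
  note p = hlinear_add[OF mat_hom_hlinear[OF assms(1)]] hlinear_scale[OF mat_hom_hlinear[OF assms(1)]]
  show "hlinear (\<lambda>a. of_fps (p a $ i $ j) * g b)"
    by (simp add: hlinear_def p of_fps_add distrib_right of_fps_complex of_fps_mult mult.assoc)
qed

text \<open>The map p \<otimes> g. It is multiplicative because the entries of \<open>p\<close> are
  scalars, hence central, and can be moved past the values of \<open>g\<close>.\<close>

lemma mat_hom_tensor: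
  fixes p :: "'a::hbar_algebra \<Rightarrow> complex fps^'n^'n" and g :: "'b::hbar_algebra \<Rightarrow> 'r::hbar_algebra"
  assumes p: "mat_hom p" and g: "hhom g"
  obtains \<Psi> :: "'a \<otimes> 'b \<Rightarrow> 'r^'n^'n" where "mat_hom \<Psi>"
    "\<And>a b. \<Psi> (a \<otimes> b) = smat (g b) (map_mat of_fps (p a))"
    "\<And>x i j. \<Psi> x $ i $ j = tensor_lift (\<lambda>a b. of_fps (p a $ i $ j) * g b) x"
proof -
  define \<Psi> :: "'a \<otimes> 'b \<Rightarrow> 'r^'n^'n"
    where "\<Psi> x = (\<chi> i j. tensor_lift (\<lambda>a b. of_fps (p a $ i $ j) * g b) x)" for x
  have l: "hlinear (\<lambda>x. \<Psi> x $ i $ j)" for i j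
    by (simp add: \<Psi>_def hlinear_tensor_lift[OF hbilinear_entry[OF p g]])
  have entry: "\<Psi> (a \<otimes> b) $ i $ j = of_fps (p a $ i $ j) * g b" for a b i j
    by (simp add: \<Psi>_def tensor_lift_tensor[OF hbilinear_entry[OF p g]])
  have 0: "(\<Psi> ((a \<otimes> b) * (a' \<otimes> b'))) $ i $ j = (\<Psi> (a \<otimes> b) ** \<Psi> (a' \<otimes> b')) $ i $ j" for a b a' b' i j
  proof -
    have "of_fps (p (a * a') $ i $ j) = (\<Sum>k\<in>UNIV. of_fps (p a $ i $ k) * of_fps (p a' $ k $ j) :: 'r)"
      unfolding mat_hom_mult[OF p] mat_mult_nth
      by (simp add: hlinear_sum[of of_fps] hlinear_def of_fps_add of_fps_mult of_fps_complex)
    then show ?thesis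
      by (simp add: tensor_mult entry mat_mult_nth hhom_mult[OF g] sum_distrib_right of_fps_mult_mult of_fps_mult)
  qed
  have 1: "(\<Psi> ((a \<otimes> b) * y)) $ i $ j = (\<Psi> (a \<otimes> b) ** \<Psi> y) $ i $ j" for a b y i j
  proof (rule hlinear_tensor_eqI[of "\<lambda>y. (\<Psi> ((a \<otimes> b) * y)) $ i $ j" "\<lambda>y. (\<Psi> (a \<otimes> b) ** \<Psi> y) $ i $ j", OF _ _ 0])
    show "hlinear (\<lambda>y. \<Psi> ((a \<otimes> b) * y) $ i $ j)" by (rule hlinear_comp[OF l hlinear_mult_left])
    show "hlinear (\<lambda>y. (\<Psi> (a \<otimes> b) ** \<Psi> y) $ i $ j)"
      unfolding mat_mult_nth by (intro hlinear_lincomb hlinear_comp[OF hlinear_mult_left l])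
  qed
  have "(\<Psi> (x * y)) $ i $ j = (\<Psi> x ** \<Psi> y) $ i $ j" for x y i j
  proof (rule hlinear_tensor_eqI[of "\<lambda>x. (\<Psi> (x * y)) $ i $ j" "\<lambda>x. (\<Psi> x ** \<Psi> y) $ i $ j", OF _ _ 1])
    show "hlinear (\<lambda>x. \<Psi> (x * y) $ i $ j)" by (rule hlinear_comp[OF l hlinear_mult_right])
    show "hlinear (\<lambda>x. (\<Psi> x ** \<Psi> y) $ i $ j)"
      unfolding mat_mult_nth by (intro hlinear_lincomb hlinear_comp[OF hlinear_mult_right l])
  qed
  then have mult: "\<Psi> (x * y) = \<Psi> x ** \<Psi> y" for x y by (rule mat_eqI)
  have one: "\<Psi> 1 = mat 1"
    by (rule mat_eqI) (simp add: tensor_one entry mat_hom_1[OF p] hhom_1[OF g] mat_def)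
  show thesis
  proof (rule that)
    show "mat_hom \<Psi>" by (simp add: mat_hom_def l one mult)
    show "\<Psi> (a \<otimes> b) = smat (g b) (map_mat of_fps (p a))" for a b
      by (rule mat_eqI) (simp add: entry of_fps_central)
  qed (simp add: \<Psi>_def)
qed

section \<open>Block diagonal matrices and their exponentials\<close>

definition idempotents :: "'k set \<Rightarrow> ('k \<Rightarrow> complex^'n^'n) \<Rightarrow> bool" where
  "idempotents K P \<longleftrightarrow> finite K \<and> (\<forall>k\<in>K. \<forall>l\<in>K. P k ** P l = (if k = l then P k else 0)) \<and>
     (\<Sum>k\<in>K. P k) = mat 1"

lemma
  assumes "idempotents K P"
  shows idempotents_finite: "finite K" and idempotents_sum: "(\<Sum>k\<in>K. P k) = mat 1"
    and idempotents_mult: "k \<in> K \<Longrightarrow> l \<in> K \<Longrightarrow> P k ** P l = (if k = l then P k else 0)"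
  using assms by (auto simp: idempotents_def)

lemma block_diag_mult:
  fixes a b :: "'k \<Rightarrow> 'a::hbar_algebra"
  assumes "idempotents K P"
  shows "(\<Sum>k\<in>K. smat (a k) (cmat (P k))) ** (\<Sum>k\<in>K. smat (b k) (cmat (P k)))
       = (\<Sum>k\<in>K. smat (a k * b k) (cmat (P k)))"
proof -
  have "(\<Sum>k\<in>K. smat (a k) (cmat (P k))) ** (\<Sum>k\<in>K. smat (b k) (cmat (P k)))
    = (\<Sum>k\<in>K. \<Sum>l\<in>K. smat (a k * b l) (cmat (P k ** P l)))"
    by (simp only: mat_mult_sum_left) (simp only: mat_mult_sum_right smat_cmat_mult)
  also have "\<dots> = (\<Sum>k\<in>K. \<Sum>l\<in>K. if l = k then smat (a k * b l) (cmat (P k)) else 0)"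
    by (intro sum.cong refl) (simp add: idempotents_mult[OF assms])
  finally show ?thesis using idempotents_finite[OF assms] by simp
qed

lemma block_diag_1:
  assumes "idempotents K P"
  shows "(\<Sum>k\<in>K. smat (1 :: 'a::hbar_algebra) (cmat (P k))) = mat 1"
  by (simp add: cmat_1 idempotents_sum[OF assms] flip: cmat_sum)

lemma qpow_trunc:
  "hcong N (qpow x) (\<Sum>n<N. of_cx (1 / fact n) * (of_fps (fps_const (1/2) * fps_X) * x) ^ n)"
proof -
  have "fps_nth (fps_exp 1) n = (1 / fact n :: complex)" for n by simp
  then show ?thesis
    using heval_cong_trunc[OF qpow_arg_small order_refl, of N "fps_exp 1" x]
    by (simp only: qpow_def hexp_eq_heval of_fps_mult)
qed

text \<open>Powers of a block diagonal matrix are taken blockwise, so every truncation of the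
  exponential is. Here \<open>a k\<close> may be noncommuting for different \<open>k\<close>, since
  distinct blocks never meet.\<close>

lemma mat_hom_qpow:
  fixes \<Psi> :: "'a::hbar_algebra \<Rightarrow> 'b::hbar_algebra^'n^'n"
  assumes \<Psi>: "mat_hom \<Psi>" and P: "idempotents K P" and t: "\<Psi> t = (\<Sum>k\<in>K. smat (a k) (cmat (P k)))"
  shows "\<Psi> (qpow t) = (\<Sum>k\<in>K. smat (qpow (a k)) (cmat (P k)))"
proof (intro mat_eqI hcong_eqI)
  fix i j N
  let ?h = "of_fps (fps_const (1/2) * fps_X)"
  have pow: "\<Psi> ((?h * t) ^ n) = (\<Sum>k\<in>K. smat ((?h * a k) ^ n) (cmat (P k)))" for n
  proof (induction n)
    case 0
    then show ?case by (simp only: mat_hom_1[OF \<Psi>] power_0 block_diag_1[OF P])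
  next
    case (Suc n)
    have "\<Psi> (?h * t) = (\<Sum>k\<in>K. smat (?h * a k) (cmat (P k)))"
      by (simp only: mat_hom_scale[OF \<Psi>] t smat_sum_right smat_smat)
    then show ?case by (simp only: power_Suc mat_hom_mult[OF \<Psi>] Suc block_diag_mult[OF P])
  qed
  have "hcong N (\<Psi> (qpow t) $ i $ j) (\<Psi> (\<Sum>n<N. of_cx (1 / fact n) * (?h * t) ^ n) $ i $ j)"
    by (rule hlinear_hcong[OF mat_hom_hlinear[OF \<Psi>] qpow_trunc])
  also have "\<Psi> (\<Sum>n<N. of_cx (1 / fact n) * (?h * t) ^ n)
     = (\<Sum>n<N. \<Sum>k\<in>K. smat (of_cx (1 / fact n) * (?h * a k) ^ n) (cmat (P k)))"
    by (simp only: mat_hom_sum[OF \<Psi>] mat_hom_scale[OF \<Psi>] pow smat_sum_right smat_smat)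
  also have "\<dots> = (\<Sum>k\<in>K. smat (\<Sum>n<N. of_cx (1 / fact n) * (?h * a k) ^ n) (cmat (P k)))"
    by (subst sum.swap) (simp only: smat_sum_left)
  also have "hcong N (\<dots> $ i $ j) ((\<Sum>k\<in>K. smat (qpow (a k)) (cmat (P k))) $ i $ j)"
    unfolding mat_sum_nth smat_nth
    by (intro hcong_sum hcong_mult_right hcong_sym[OF qpow_trunc])
  finally show "hcong N (\<Psi> (qpow t) $ i $ j) ((\<Sum>k\<in>K. smat (qpow (a k)) (cmat (P k))) $ i $ j)" .
qed

lemma mat_power_Suc: "mat_power A (Suc n) = A ** mat_power A n"
  by (simp add: mat_power_def)

lemma mat_hexp_block_diag:
  fixes z :: "'k \<Rightarrow> 'a::hbar_algebra"
  assumes P: "idempotents K P"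
  shows "mat_hexp (smat (of_cx (1/2) * \<hbar>) (\<Sum>k\<in>K. smat (z k) (cmat (P k))))
       = (\<Sum>k\<in>K. smat (qpow (z k)) (cmat (P k)))"
proof (rule mat_eqI)
  fix i j
  let ?h = "of_fps (fps_const (1/2) * fps_X)" and ?S = "\<lambda>a. (\<Sum>k\<in>K. smat (a k) (cmat (P k)))"
  have h: "smat (of_cx (1/2) * \<hbar>) (?S z) = ?S (\<lambda>k. ?h * z k)"
    by (simp only: smat_sum_right smat_smat of_fps_mult)
  have pow: "mat_power (?S (\<lambda>k. ?h * z k)) n = ?S (\<lambda>k. (?h * z k) ^ n)" for n
  proof (induction n)
    case 0
    then show ?case by (simp only: mat_power_def power_0 block_diag_1[OF P] funpow_0)
  next
    case (Suc n)
    then show ?case by (simp only: mat_power_Suc power_Suc block_diag_mult[OF P])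
  qed
  have "hlim (\<lambda>N. (\<Sum>n<N. smat (of_cx (1 / fact n)) (mat_power (?S (\<lambda>k. ?h * z k)) n)) $ i $ j)
    = ?S (\<lambda>k. qpow (z k)) $ i $ j"
  proof (rule hlim_eqI)
    fix M
    have "hcong M ((\<Sum>n<N. smat (of_cx (1 / fact n)) (mat_power (?S (\<lambda>k. ?h * z k)) n)) $ i $ j)
      (?S (\<lambda>k. qpow (z k)) $ i $ j)" if "N \<ge> M" for N
    proof -
      have "(\<Sum>n<N. smat (of_cx (1 / fact n)) (mat_power (?S (\<lambda>k. ?h * z k)) n))
        = (\<Sum>n<N. \<Sum>k\<in>K. smat (of_cx (1 / fact n) * (?h * z k) ^ n) (cmat (P k)))"
        by (simp only: pow smat_sum_right smat_smat)
      also have "\<dots> = ?S (\<lambda>k. \<Sum>n<N. of_cx (1 / fact n) * (?h * z k) ^ n)"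
        by (subst sum.swap) (simp only: smat_sum_left)
      also have "hcong N (\<dots> $ i $ j) (?S (\<lambda>k. qpow (z k)) $ i $ j)"
        unfolding mat_sum_nth smat_nth
        by (intro hcong_sum hcong_mult_right hcong_sym[OF qpow_trunc])
      finally show ?thesis using that by (rule hcong_mono)
    qed
    then show "\<exists>n0. \<forall>N\<ge>n0. hcong M ((\<Sum>n<N. smat (of_cx (1 / fact n)) (mat_power (?S (\<lambda>k. ?h * z k)) n)) $ i $ j)
      (?S (\<lambda>k. qpow (z k)) $ i $ j)" by blast
  qed
  then show "mat_hexp (smat (of_cx (1/2) * \<hbar>) (?S z)) $ i $ j = ?S (\<lambda>k. qpow (z k)) $ i $ j"
    by (simp only: h mat_hexp_def vec_lambda_beta)
qed

section \<open>Weight vectors\<close>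

text \<open>Choose \<open>h\<close> at which the weight of \<open>u j0\<close> differs from \<beta>.
  The operator \<open>A h - wt j0 h\<close> kills \<open>u j0\<close>, multiplies \<open>v\<close>
  by a nonzero scalar and preserves \<open>N\<close>, so the number of other summands drops. The
  subspace \<open>N\<close> is zero when weight vectors are shown to be independent, and consists of
  the multiples of \<hbar> when weights are compared modulo \<hbar>.\<close>

lemma weight_vector_separation:
  fixes sc :: "complex \<Rightarrow> 'v::ab_group_add \<Rightarrow> 'v"
  assumes sc: "vector_space sc" and N: "module.subspace sc N"
    and lin: "\<And>h. h \<in> H \<Longrightarrow> Vector_Spaces.linear sc sc (A h)"
    and inv: "\<And>h x. h \<in> H \<Longrightarrow> x \<in> N \<Longrightarrow> A h x \<in> N"
    and "finite J"
    and u: "\<And>j h. j \<in> J \<Longrightarrow> h \<in> H \<Longrightarrow> A h (u j) = sc (wt j h) (u j)"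
    and v: "\<And>h. h \<in> H \<Longrightarrow> A h v = sc (\<beta> h) v"
    and "\<And>j. j \<in> J \<Longrightarrow> \<exists>h\<in>H. wt j h \<noteq> \<beta> h"
    and "v + (\<Sum>j\<in>J. u j) \<in> N"
  shows "v \<in> N"
  using assms(5-)
proof (induction J arbitrary: u v rule: finite_induct)
  case empty
  then show ?case by simp
next
  case (insert j0 J)
  interpret vector_space sc by (rule sc)
  note N' = subspace_diff[OF N] subspace_scale[OF N]
  obtain h where h: "h \<in> H" "wt j0 h \<noteq> \<beta> h" using insert.prems(3) by blast
  interpret A: Vector_Spaces.linear sc sc "A h" by (rule lin[OF h(1)])
  have A_scale: "A h' (sc c x) = sc c (A h' x)" if "h' \<in> H" for h' c x
  proof -
    interpret B: Vector_Spaces.linear sc sc "A h'" by (rule lin[OF that])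
    show ?thesis by (rule B.scale)
  qed
  define T where "T x = A h x - sc (wt j0 h) x" for x
  have T_sum: "T (x + (y + sum f J)) = T x + (T y + (\<Sum>j\<in>J. T (f j)))" for x y f
    by (simp add: T_def A.add A.sum scale_right_distrib scale_sum_right sum_subtractf algebra_simps)
  have "T (v + (\<Sum>j\<in>insert j0 J. u j)) \<in> N"
    unfolding T_def by (intro N' inv h(1) insert.prems)
  then have "T v + (T (u j0) + (\<Sum>j\<in>J. T (u j))) \<in> N"
    using insert.hyps by (simp add: T_sum)
  moreover have "T (u j0) = 0" using insert.prems(1)[OF _ h(1), of j0] by (simp add: T_def)
  moreover have "T (u j) = sc (wt j h - wt j0 h) (u j)" if "j \<in> J" for j
    using insert.prems(1)[OF _ h(1), of j] that by (simp add: T_def scale_left_diff_distrib)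
  moreover have Tv: "T v = sc (\<beta> h - wt j0 h) v"
    using insert.prems(2)[OF h(1)] by (simp add: T_def scale_left_diff_distrib)
  ultimately have sum: "sc (\<beta> h - wt j0 h) v + (\<Sum>j\<in>J. sc (wt j h - wt j0 h) (u j)) \<in> N"
    by simp
  have "sc (\<beta> h - wt j0 h) v \<in> N"
  proof (rule insert.IH[OF _ _ _ sum])
    fix j h' assume "j \<in> J" "h' \<in> H"
    then show "A h' (sc (wt j h - wt j0 h) (u j)) = sc (wt j h') (sc (wt j h - wt j0 h) (u j))"
      by (simp add: A_scale insert.prems(1) mult.commute)
  next
    fix h' assume "h' \<in> H"
    then show "A h' (sc (\<beta> h - wt j0 h) v) = sc (\<beta> h') (sc (\<beta> h - wt j0 h) v)"
      by (simp add: A_scale insert.prems(2) mult.commute)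
  next
    fix j assume "j \<in> J" then show "\<exists>h\<in>H. wt j h \<noteq> \<beta> h" using insert.prems(3) by blast
  qed
  then have "sc (inverse (\<beta> h - wt j0 h)) (sc (\<beta> h - wt j0 h) v) \<in> N" by (rule N'(2))
  then show ?case using h(2) by simp
qed

lemma span_UN_decomposition:
  fixes W :: "'k \<Rightarrow> (complex^'n) set"
  assumes W: "\<And>k. vec.subspace (W k)" and "x \<in> vec.span (\<Union>k. W k)"
  shows "\<exists>I w. finite I \<and> (\<forall>k\<in>I. w k \<in> W k) \<and> x = (\<Sum>k\<in>I. w k)"
  using assms(2)
proof (induction rule: vec.span_induct_alt)
  case base
  show ?case by (rule exI[of _ "{}"]) simp
next
  case (step c x y)
  obtain k where k: "x \<in> W k" using step(1) by blast
  obtain I w where Iw: "finite I" "\<forall>k\<in>I. w k \<in> W k" "y = (\<Sum>k\<in>I. w k)" using step(2) by blast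
  define w' where "w' l = (if l = k then c *s x + (if k \<in> I then w k else 0) else w l)" for l
  have "w' l \<in> W l" if "l \<in> insert k I" for l
    using that k Iw(2) vec.subspace_add[OF W] vec.subspace_scale[OF W] vec.subspace_0[OF W]
    by (auto simp: w'_def)
  moreover have "(\<Sum>l\<in>insert k I. w' l) = c *s x + y"
  proof -
    have "(\<Sum>l\<in>insert k I. w' l) = w' k + (\<Sum>l\<in>I - {k}. w' l)"
      using Iw(1) by (simp add: sum.insert_remove)
    also have "(\<Sum>l\<in>I - {k}. w' l) = (\<Sum>l\<in>I - {k}. w l)"
      by (rule sum.cong) (auto simp: w'_def)
    also have "w' k + \<dots> = c *s x + (\<Sum>l\<in>I. w l)"
      using Iw(1) by (auto simp: w'_def sum.remove[of I k w] add.assoc)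
    finally show ?thesis by (simp add: Iw(3))
  qed
  ultimately show ?case using Iw(1) by (metis finite_insert)
qed

lemma eigenvector_components_zero:
  fixes H :: "complex^'n \<Rightarrow> complex^'n" and w :: "'k \<Rightarrow> complex^'n"
  assumes H: "Vector_Spaces.linear (*s) (*s) H" and "finite I"
    and "\<And>k. k \<in> I \<Longrightarrow> H (w k) = c k *s w k" and "inj_on c I"
    and "(\<Sum>k\<in>I. w k) = 0" and k: "k \<in> I"
  shows "w k = 0"
proof -
  have "w k \<in> {0}"
  proof (rule weight_vector_separation[where sc = "(*s)" and H = "{()}" and A = "\<lambda>_. H" and J = "I - {k}"
        and u = w and wt = "\<lambda>j _. c j" and \<beta> = "\<lambda>_. c k" and N = "{0}"])
    show "w k + (\<Sum>j\<in>I - {k}. w j) \<in> {0}"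
      using assms(2,5) k by (simp add: sum.remove[symmetric])
    show "H x \<in> {0}" if "x \<in> {0}" for x
      using that Vector_Spaces.linear_iff[THEN iffD1, OF H] by (metis singletonD singletonI vec.scale_zero_left)
    show "\<exists>h\<in>{()}. c j \<noteq> c k" if "j \<in> I - {k}" for j
      using that assms(4) k by (auto dest: inj_onD)
  qed (use assms in \<open>auto intro: vec.vector_space_axioms\<close>)
  then show ?thesis by simp
qed

lemma linear_rules:
  assumes "Vector_Spaces.linear (*s) (*s) (T :: complex^'n \<Rightarrow> complex^'m)"
  shows "T (x + y) = T x + T y" "T (c *s x) = c *s T x" "T 0 = 0" "T (x - y) = T x - T y"
    "T (sum f K) = (\<Sum>k\<in>K. T (f k))"
proof -
  interpret Vector_Spaces.linear "(*s)" "(*s)" T by fact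
  show "T (x + y) = T x + T y" "T (c *s x) = c *s T x" "T 0 = 0" "T (x - y) = T x - T y"
    "T (sum f K) = (\<Sum>k\<in>K. T (f k))" by (simp_all add: add scale diff sum)
qed

lemma linear_funpow:
  assumes "Vector_Spaces.linear (*s) (*s) (T :: complex^'n \<Rightarrow> complex^'n)"
  shows "(T ^^ k) (x + y) = (T ^^ k) x + (T ^^ k) y" "(T ^^ k) (c *s x) = c *s (T ^^ k) x"
    "(T ^^ k) 0 = 0" "(T ^^ k) (x - y) = (T ^^ k) x - (T ^^ k) y"
  by (induction k) (auto simp: linear_rules[OF assms])

section \<open>Representations of sl2\<close>

locale sl2_action =
  fixes E F H :: "complex^'n \<Rightarrow> complex^'n"
  assumes linE: "Vector_Spaces.linear (*s) (*s) E" and linF: "Vector_Spaces.linear (*s) (*s) F"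
    and linH: "Vector_Spaces.linear (*s) (*s) H"
    and EF: "E (F v) = F (E v) + H v"
    and HE: "H (E v) = E (H v) + 2 *s E v"
    and HF: "H (F v) = F (H v) - 2 *s F v"
begin

lemmas lin_simps = linear_rules[OF linE] linear_rules[OF linF] linear_rules[OF linH]
lemmas pow_simps = linear_funpow[OF linE] linear_funpow[OF linF]

definition W :: "int \<Rightarrow> (complex^'n) set" where
  "W k = {v. H v = of_int k *s v}"

text \<open>The sum of the integral weight spaces. The goal is \<open>S = UNIV\<close>, which yields
  at once that \<open>H\<close> is diagonalizable and that its eigenvalues are integers.\<close>

definition S :: "(complex^'n) set" where
  "S = vec.span (\<Union>k. W k)"

lemma W_subspace: "vec.subspace (W k)"
  unfolding W_def by (rule vec.subspaceI)
    (auto simp: lin_simps vec.scale_right_distrib mult.commute)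

lemma S_subspace: "vec.subspace S"
  by (simp add: S_def)

lemma W_S: "v \<in> W k \<Longrightarrow> v \<in> S"
  by (auto simp: S_def intro: vec.span_base)

lemma S_decomposition: "x \<in> S \<Longrightarrow> \<exists>I w. finite I \<and> (\<forall>k\<in>I. w k \<in> W k) \<and> x = (\<Sum>k\<in>I. w k)"
  unfolding S_def by (rule span_UN_decomposition[OF W_subspace])

lemma W_E: "v \<in> W k \<Longrightarrow> E v \<in> W (k + 2)"
  and W_F: "v \<in> W k \<Longrightarrow> F v \<in> W (k - 2)"
  by (simp_all add: W_def HE HF lin_simps vec.scale_left_distrib vec.scale_left_diff_distrib)

lemma S_stable:
  assumes "x \<in> S" shows "E x \<in> S" "F x \<in> S" "H x \<in> S"
proof -
  obtain I w where w: "\<forall>k\<in>I. w k \<in> W k" "x = (\<Sum>k\<in>I. w k)"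
    using S_decomposition[OF assms] by blast
  show "E x \<in> S" "F x \<in> S" unfolding w(2) lin_simps
    using w(1) by (auto intro!: vec.subspace_sum[OF S_subspace] W_S[OF W_E] W_S[OF W_F])
  have "H (w k) \<in> S" if "k \<in> I" for k
    using that w(1) vec.subspace_scale[OF S_subspace W_S, of "w k" k] by (simp add: W_def)
  then show "H x \<in> S" unfolding w(2) lin_simps by (intro vec.subspace_sum[OF S_subspace])
qed

text \<open>The polynomial H (H - 1) ... (H - k + 1) applied to \<open>v\<close>. Its roots are
  simple, which is the source of diagonalizability.\<close>

fun falling :: "nat \<Rightarrow> complex^'n \<Rightarrow> complex^'n" where
  "falling 0 v = v"
| "falling (Suc k) v = falling k (H v - of_nat k *s v)"

text \<open>Moving E through F^(k+1) produces H at each of the k + 1 places; moved to the right end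
  these are H - 2j for j = 0, ..., k, with sum (k + 1)(H - k).\<close>

lemma E_F_power: "E ((F ^^ Suc k) v) = (F ^^ Suc k) (E v) + of_nat (Suc k) *s (F ^^ k) (H v - of_nat k *s v)"
proof (induction k)
  case 0
  then show ?case by (simp add: EF)
next
  case (Suc k)
  have HFk: "H ((F ^^ j) v) = (F ^^ j) (H v) - of_nat (2 * j) *s (F ^^ j) v" for j
  proof (induction j)
    case (Suc j)
    have "H ((F ^^ Suc j) v) = F (H ((F ^^ j) v)) - 2 *s F ((F ^^ j) v)" by (simp add: HF)
    also have "\<dots> = F ((F ^^ j) (H v)) - of_nat (2 * j) *s F ((F ^^ j) v) - 2 *s F ((F ^^ j) v)"
      by (simp only: Suc lin_simps)
    finally show ?case by (simp add: vec_eq_iff algebra_simps)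
  qed simp
  have "E ((F ^^ Suc (Suc k)) v) = F (E ((F ^^ Suc k) v)) + H ((F ^^ Suc k) v)"
    by (simp add: EF)
  also have "\<dots> = (F ^^ Suc (Suc k)) (E v) + (of_nat (Suc k) *s (F ^^ Suc k) (H v - of_nat k *s v)
     + ((F ^^ Suc k) (H v) - of_nat (2 * Suc k) *s (F ^^ Suc k) v))"
    by (simp only: Suc HFk) (simp add: lin_simps)
  also have "of_nat (Suc k) *s (F ^^ Suc k) (H v - of_nat k *s v)
     + ((F ^^ Suc k) (H v) - of_nat (2 * Suc k) *s (F ^^ Suc k) v)
     = of_nat (Suc (Suc k)) *s (F ^^ Suc k) (H v - of_nat (Suc k) *s v)"
    unfolding pow_simps by (simp add: vec_eq_iff algebra_simps)
  finally show ?case .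
qed

text \<open>The identity E^k F^k = k! H (H - 1) ... (H - k + 1) on vectors killed by E, in a form
  relative to a stable subspace: it is applied with \<open>U = {0}\<close> and with
  \<open>U = S\<close>, that is, in the quotient by \<open>S\<close>.\<close>

lemma E_power_F_power:
  assumes U: "vec.subspace U" "\<And>x. x \<in> U \<Longrightarrow> E x \<in> U" "\<And>x. x \<in> U \<Longrightarrow> F x \<in> U" "\<And>x. x \<in> U \<Longrightarrow> H x \<in> U"
    and "E v \<in> U"
  shows "(E ^^ k) ((F ^^ k) v) - fact k *s falling k v \<in> U"
  using assms(5)
proof (induction k arbitrary: v)
  case 0
  then show ?case by (simp add: vec.subspace_0[OF U(1)])
next
  case (Suc k)
  let ?v = "H v - of_nat k *s v"
  have pow: "(E ^^ j) x \<in> U" "(F ^^ j) x \<in> U" if "x \<in> U" for j x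
    by (induction j) (auto simp: that U)
  have "E (H v) = H (E v) - 2 *s E v" by (simp add: HE)
  then have "E ?v \<in> U"
    using Suc.prems by (auto simp: lin_simps intro!: vec.subspace_diff[OF U(1)] vec.subspace_scale[OF U(1)] U(4))
  then have "(E ^^ k) ((F ^^ k) ?v) - fact k *s falling k ?v \<in> U" by (rule Suc.IH)
  then have "of_nat (Suc k) *s ((E ^^ k) ((F ^^ k) ?v) - fact k *s falling k ?v) + (E ^^ k) ((F ^^ Suc k) (E v)) \<in> U"
    by (intro vec.subspace_add[OF U(1)] vec.subspace_scale[OF U(1)] pow Suc.prems)
  moreover have "(E ^^ Suc k) ((F ^^ Suc k) v)
      = (E ^^ k) ((F ^^ Suc k) (E v)) + of_nat (Suc k) *s (E ^^ k) ((F ^^ k) ?v)"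
    unfolding funpow_Suc_right[of k E] o_def E_F_power pow_simps by simp
  ultimately show ?case
    by (simp add: vec.scale_right_diff_distrib algebra_simps del: funpow.simps of_nat_Suc)
qed

text \<open>A vector killed by a polynomial in \<open>H\<close> with the simple roots 0, ..., k - 1
  is a sum of eigenvectors.\<close>

lemma falling_zero_S: "falling k v = 0 \<Longrightarrow> \<exists>w. (\<forall>i<k. w i \<in> W (int i)) \<and> v = (\<Sum>i<k. w i)"
proof (induction k arbitrary: v)
  case (Suc k)
  obtain w where w: "\<forall>i<k. w i \<in> W (int i)" "H v - of_nat k *s v = (\<Sum>i<k. w i)"
    using Suc.IH[of "H v - of_nat k *s v"] Suc.prems by auto
  \<comment> \<open>On \<open>W i\<close> the operator H - k is the scalar i - k, so
    \<open>c i *s w i\<close> is the preimage of \<open>w i\<close>; what remains of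
    \<open>v\<close> is an eigenvector for k.\<close>
  define c where "c i = inverse (of_nat i - of_nat k :: complex)" for i
  define x where "x = v - (\<Sum>i<k. c i *s w i)"
  have Hw: "H (w i) = of_nat i *s w i" if "i < k" for i
    using w(1) that by (simp add: W_def)
  have c: "c i * of_nat i = 1 + of_nat k * c i" if "i < k" for i
    using that by (simp add: c_def field_simps)
  have "H (\<Sum>i<k. c i *s w i) = (\<Sum>i<k. w i) + of_nat k *s (\<Sum>i<k. c i *s w i)"
    by (simp add: lin_simps Hw c vec.scale_left_distrib sum.distrib vec.scale_sum_right)
  then have "H x = of_nat k *s x"
    using w(2) by (simp add: x_def lin_simps algebra_simps)
  then have "x \<in> W (int k)" by (simp add: W_def)
  moreover have "c i *s w i \<in> W (int i)" if "i < k" for i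
    using w(1) that by (auto intro: vec.subspace_scale[OF W_subspace])
  ultimately show ?case
    by (intro exI[of _ "\<lambda>i. if i = k then x else c i *s w i"]) (auto simp: less_Suc_eq x_def)
qed simp

lemma E_power_F: "(E ^^ m) (F w) = F ((E ^^ m) w) + of_nat m *s (E ^^ (m - 1)) (H w + of_nat (m - 1) *s w)"
proof (induction m)
  case (Suc m)
  show ?case
  proof (cases m)
    case 0
    then show ?thesis by (simp add: EF)
  next
    case m: (Suc l)
    have HEk: "H ((E ^^ j) w) = (E ^^ j) (H w) + of_nat (2 * j) *s (E ^^ j) w" for j
    proof (induction j)
      case (Suc j)
      have "H ((E ^^ Suc j) w) = E (H ((E ^^ j) w)) + 2 *s E ((E ^^ j) w)" by (simp add: HE)
      also have "\<dots> = E ((E ^^ j) (H w)) + of_nat (2 * j) *s E ((E ^^ j) w) + 2 *s E ((E ^^ j) w)"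
        by (simp only: Suc lin_simps)
      finally show ?case by (simp add: vec_eq_iff algebra_simps)
    qed simp
    have "(E ^^ Suc m) (F w) = E ((E ^^ m) (F w))" by simp
    also have "\<dots> = F ((E ^^ Suc m) w) + (H ((E ^^ m) w) + of_nat m *s (E ^^ m) (H w + of_nat l *s w))"
      by (simp only: Suc.IH) (simp add: m lin_simps EF)
    also have "H ((E ^^ m) w) + of_nat m *s (E ^^ m) (H w + of_nat l *s w)
      = of_nat (Suc m) *s (E ^^ m) (H w + of_nat m *s w)"
      unfolding HEk pow_simps by (simp add: vec_eq_iff algebra_simps m)
    finally show ?thesis by simp
  qed
qed simp

text \<open>If E^(m+1) kills \<open>w\<close>, then E^m kills EF w - t w with t = (m + 1)(k + m), by
  \<open>E_power_F\<close>. For k \<ge> 1 the number t is nonzero, so w can be solved for by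
  induction on m.\<close>

lemma EF_surjective:
  assumes "k \<ge> 1" "w \<in> W k" "(E ^^ m) w = 0"
  shows "\<exists>x\<in>W k. E (F x) = w"
  using assms(2,3)
proof (induction m arbitrary: w)
  case 0
  then show ?case by (intro bexI[of _ 0]) (auto simp: lin_simps vec.subspace_0[OF W_subspace])
next
  case (Suc m)
  define t where "t = (of_nat (Suc m) * (of_int k + of_nat m) :: complex)"
  have "t = of_int (int (Suc m) * (k + int m))" by (simp add: t_def)
  then have t: "t \<noteq> 0" using assms(1) by (simp del: of_int_mult)
  have Hw: "H w = of_int k *s w" using Suc.prems(1) by (simp add: W_def)
  have EFW: "E (F x) \<in> W k" if "x \<in> W k" for x
    using W_E[OF W_F[OF that]] by simp
  have "(E ^^ m) (E (F w)) = of_nat (Suc m) *s (E ^^ m) (H w + of_nat m *s w)"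
    using E_power_F[of "Suc m" w] Suc.prems(2) by (simp add: funpow_swap1 lin_simps)
  also have "\<dots> = t *s (E ^^ m) w"
  proof -
    have "H w + of_nat m *s w = (of_int k + of_nat m) *s w"
      by (simp add: Hw vec.scale_left_distrib)
    then show ?thesis by (simp only: pow_simps t_def vec.scale_scale)
  qed
  finally have "(E ^^ m) (E (F w) - t *s w) = 0" by (simp add: pow_simps)
  moreover have "E (F w) - t *s w \<in> W k"
    by (intro vec.subspace_diff[OF W_subspace] vec.subspace_scale[OF W_subspace] EFW Suc.prems)
  ultimately obtain x where x: "x \<in> W k" "E (F x) = E (F w) - t *s w" using Suc.IH by blast
  have "E (F (inverse t *s (w - x))) = w"
    using t by (simp add: lin_simps x(2))
  moreover have "inverse t *s (w - x) \<in> W k"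
    by (intro vec.subspace_diff[OF W_subspace] vec.subspace_scale[OF W_subspace] x Suc.prems)
  ultimately show ?case by blast
qed

text \<open>The factors of \<open>falling k\<close> are applied one after the other; the last vector
  outside of \<open>S\<close> is an eigenvector modulo \<open>S\<close>. The factors preserve the
  condition that E maps the vector into \<open>S\<close>.\<close>

lemma primitive_mod_S:
  "v \<notin> S \<Longrightarrow> E v \<in> S \<Longrightarrow> falling k v \<in> S \<Longrightarrow>
   \<exists>v i. v \<notin> S \<and> E v \<in> S \<and> H v - of_nat i *s v \<in> S"
proof (induction k arbitrary: v)
  case (Suc k)
  show ?case
  proof (cases "H v - of_nat k *s v \<in> S")
    case True
    then show ?thesis using Suc.prems by blast
  next
    case False
    have "E (H v - of_nat k *s v) = H (E v) - 2 *s E v - of_nat k *s E v"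
      by (simp add: HE lin_simps)
    also have "\<dots> \<in> S"
      by (intro vec.subspace_diff[OF S_subspace] vec.subspace_scale[OF S_subspace] S_stable Suc.prems)
    finally show ?thesis using False Suc by simp
  qed
qed simp

text \<open>A substitute for complete reducibility. The kernel of E lies in \<open>S\<close> because
  \<open>falling K\<close> vanishes on it. If \<open>S\<close> is proper, there is v outside of
  \<open>S\<close> with E v in \<open>S\<close> and H v = i v modulo \<open>S\<close>. Subtracting y
  in \<open>S\<close> puts (H - i)(v - y) into weight i; then x = E (v - y) turns out to have weight
  i + 2 \<ge> 1, so x = E F x' by surjectivity, and v - y - F x' lies in the kernel of E, hence in
  \<open>S\<close>, a contradiction.\<close>

lemma weight_vectors_span:
  assumes nE: "\<And>v. (E ^^ K) v = 0" and nF: "\<And>v. (F ^^ K) v = 0"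
  shows "S = UNIV"
proof (rule ccontr)
  have kerE: "v \<in> S" if "E v = 0" for v
  proof -
    have "(E ^^ K) ((F ^^ K) v) - fact K *s falling K v \<in> {0}"
      by (rule E_power_F_power) (use that in \<open>auto simp: lin_simps\<close>)
    then have "falling K v = 0" by (simp add: nF pow_simps)
    then obtain w where "\<forall>i<K. w i \<in> W (int i)" "v = (\<Sum>i<K. w i)"
      using falling_zero_S by blast
    then show ?thesis by (auto intro!: vec.subspace_sum[OF S_subspace] intro: W_S)
  qed
  assume "S \<noteq> UNIV"
  then obtain v0 where v0: "v0 \<notin> S" by blast
  \<comment> \<open>\<open>v1\<close> below is the last power of E applied to \<open>v0\<close> that
    still lies outside of \<open>S\<close>.\<close>
  define m where "m = (LEAST m. (E ^^ m) v0 \<in> S)"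
  have Em: "(E ^^ m) v0 \<in> S" unfolding m_def
    by (rule LeastI[of _ K]) (simp add: nE vec.subspace_0[OF S_subspace])
  have "m \<noteq> 0" using v0 Em by (cases m) auto
  define v1 where "v1 = (E ^^ (m - 1)) v0"
  have "E v1 \<in> S" using Em \<open>m \<noteq> 0\<close> by (cases m) (auto simp: v1_def)
  moreover have "v1 \<notin> S"
    unfolding v1_def using \<open>m \<noteq> 0\<close> not_less_Least[of "m - 1" "\<lambda>m. (E ^^ m) v0 \<in> S"] by (simp add: m_def)
  moreover have "falling K v1 \<in> S"
  proof -
    have "(E ^^ K) ((F ^^ K) v1) - fact K *s falling K v1 \<in> S"
      by (rule E_power_F_power[OF S_subspace S_stable]) (assumption | fact)+
    then have "inverse (- fact K) *s (- (fact K *s falling K v1)) \<in> S"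
      by (intro vec.subspace_scale[OF S_subspace]) (simp add: nF pow_simps)
    then show ?thesis by simp
  qed
  ultimately obtain v i where v: "v \<notin> S" "E v \<in> S" "H v - of_nat i *s v \<in> S"
    using primitive_mod_S by blast
  define c where "c = int i"
  obtain I w where w: "finite I" "\<forall>k\<in>I. w k \<in> W k" "H v - of_nat i *s v = (\<Sum>k\<in>I. w k)"
    using S_decomposition[OF v(3)] by blast
  \<comment> \<open>On weight k different from \<open>c\<close> the operator H - c is invertible;
    \<open>y\<close> solves (H - c) y for all these components at once.\<close>
  define y where "y = (\<Sum>k\<in>I - {c}. inverse (of_int (k - c)) *s w k)"
  have yS: "y \<in> S"
    unfolding y_def using w(2) by (intro vec.subspace_sum[OF S_subspace] vec.subspace_scale[OF S_subspace]) (auto intro: W_S)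
  have "H y - of_nat i *s y = (\<Sum>k\<in>I - {c}. w k)"
  proof -
    have "H (inverse (of_int (k - c)) *s w k) - of_nat i *s (inverse (of_int (k - c)) *s w k) = w k"
      if "k \<in> I - {c}" for k
    proof -
      have "H (w k) = of_int k *s w k" using w(2) that by (auto simp: W_def)
      then have "H (inverse (of_int (k - c)) *s w k) - of_nat i *s (inverse (of_int (k - c)) *s w k)
        = (inverse (of_int (k - c)) * of_int (k - c)) *s w k"
        by (simp add: lin_simps vec_eq_iff c_def algebra_simps)
      then show ?thesis using that by simp
    qed
    then show ?thesis
      by (simp add: y_def lin_simps vec.scale_sum_right flip: sum_subtractf)
  qed
  then have vy: "H (v - y) - of_nat i *s (v - y) \<in> W c"
  proof -
    assume Hy: "H y - of_nat i *s y = (\<Sum>k\<in>I - {c}. w k)"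
    have "H (v - y) - of_nat i *s (v - y) = (H v - of_nat i *s v) - (H y - of_nat i *s y)"
      by (simp add: lin_simps algebra_simps)
    also have "\<dots> = (if c \<in> I then w c else 0)"
      unfolding Hy w(3) using w(1) by (auto simp: sum.remove[of I c])
    also have "\<dots> \<in> W c" using w(2) vec.subspace_0[OF W_subspace] by auto
    finally show ?thesis .
  qed
  define x where "x = E (v - y)"
  \<comment> \<open>A priori \<open>x\<close> is only a generalized eigenvector, annihilated by the
    square of \<open>D\<close>. Being in \<open>S\<close>, it is a sum of eigenvectors, on each of
    which \<open>D\<close> is a scalar; the square of a nonzero scalar is nonzero, so only weight c
    + 2 occurs.\<close>
  define D where "D z = H z - of_int (c + 2) *s z" for z
  have Dlin: "Vector_Spaces.linear (*s) (*s) D"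
    unfolding D_def Vector_Spaces.linear_iff
    by (auto simp: lin_simps algebra_simps vec.vector_space_axioms)
  have xS: "x \<in> S" unfolding x_def lin_simps
    by (intro vec.subspace_diff[OF S_subspace] S_stable yS v)
  have "D (E u) = E (H u - of_nat i *s u)" for u
    unfolding D_def HE by (simp add: lin_simps c_def vec_eq_iff algebra_simps)
  then have "D x = E (H (v - y) - of_nat i *s (v - y))" by (simp only: x_def)
  then have Dx: "D x \<in> W (c + 2)" using W_E[OF vy] by simp
  have "D z = 0" if "z \<in> W (c + 2)" for z using that by (simp add: D_def W_def)
  then have DDx: "D (D x) = 0" using Dx by blast
  obtain I' w' where w': "finite I'" "\<forall>k\<in>I'. w' k \<in> W k" "x = (\<Sum>k\<in>I'. w' k)"
    using S_decomposition[OF xS] by blast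
  have Hw': "H (w' k) = of_int k *s w' k" if "k \<in> I'" for k using w'(2) that by (auto simp: W_def)
  have Dw': "D (w' k) = of_int (k - c - 2) *s w' k" if "k \<in> I'" for k
    by (simp add: D_def Hw'[OF that] vec.scale_left_diff_distrib[symmetric] algebra_simps)
  have "(\<Sum>k\<in>I'. D (D (w' k))) = 0"
    using DDx by (simp add: w'(3) linear_rules[OF Dlin])
  have w'0: "w' k = 0" if "k \<in> I'" "k \<noteq> c + 2" for k
  proof -
    have "D (D (w' k)) = 0"
    proof (rule eigenvector_components_zero[OF linH w'(1) _ _ \<open>(\<Sum>k\<in>I'. D (D (w' k))) = 0\<close> that(1)])
      fix k assume k: "k \<in> I'"
      define a where "a = (of_int (k - c - 2) * of_int (k - c - 2) :: complex)"
      have "D (D (w' k)) = a *s w' k"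
        by (simp add: Dw'[OF k] linear_rules[OF Dlin] a_def del: of_int_diff)
      then show "H (D (D (w' k))) = of_int k *s D (D (w' k))"
        by (simp add: lin_simps Hw'[OF k] mult.commute)
    qed (auto intro: inj_onI)
    moreover have "of_int (k - c - 2) \<noteq> (0::complex)"
      using that(2) unfolding of_int_eq_0_iff by simp
    ultimately show ?thesis
      by (simp add: Dw'[OF that(1)] linear_rules[OF Dlin] del: of_int_diff)
  qed
  have "x \<in> W (c + 2)"
    unfolding w'(3) using w'(2) w'0 vec.subspace_0[OF W_subspace]
    by (intro vec.subspace_sum[OF W_subspace]) metis
  moreover have "c + 2 \<ge> 1" by (simp add: c_def)
  ultimately obtain x' where x': "x' \<in> W (c + 2)" "E (F x') = x"
    using EF_surjective nE by blast
  have "E (v - y - F x') = 0" using x'(2) unfolding x_def by (simp add: lin_simps)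
  then have "v - y - F x' \<in> S" by (rule kerE)
  then have "(v - y - F x') + (y + F x') \<in> S"
    by (intro vec.subspace_add[OF S_subspace] yS W_S[OF W_F[OF x'(1)]])
  then show False using v(1) by simp
qed

end

section \<open>Nilpotent and diagonalizable matrices\<close>

lemma vec_linear_mat [simp]: "Vector_Spaces.linear (*s) (*s) ((*v) (A :: complex^'n^'m))"
  by (rule matrix_vector_mul_linear_gen)

lemma mat_eq_vecI: "(\<And>v. A *v v = B *v v) \<Longrightarrow> A = (B :: complex^'n^'m)"
  using matrix_eq by blast

lemma smat_vec: "smat c A *v v = c *s (A *v (v :: complex^'n))"
  by (simp add: vec_eq_iff matrix_vector_mult_def sum_distrib_left mult.assoc)

lemma mat_power_vec: "mat_power A k *v v = (((*v) A) ^^ k) (v :: complex^'n)"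
  by (induction k) (simp_all add: mat_power_def flip: matrix_vector_mul_assoc)

text \<open>The powers of \<open>e\<close> are eigenvectors of ad h for the distinct eigenvalues k
  c. The space of matrices is finite-dimensional, so they cannot all be nonzero.\<close>

lemma nilpotent_of_commutator:
  fixes h e :: "complex^'n^'n"
  assumes comm: "h ** e - e ** h = smat c e" and c: "c \<noteq> 0"
  shows "\<exists>K. mat_power e K = 0"
proof (rule ccontr)
  assume "\<nexists>K. mat_power e K = 0"
  then have nz: "mat_power e k \<noteq> 0" for k by blast
  have comm': "h ** mat_power e k - mat_power e k ** h = smat (of_nat k * c) (mat_power e k)" for k
  proof (induction k)
    case 0
    then show ?case by (simp add: mat_power_def)
  next
    case (Suc k)
    have "h ** mat_power e (Suc k) - mat_power e (Suc k) ** h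
      = (h ** e - e ** h) ** mat_power e k + e ** (h ** mat_power e k - mat_power e k ** h)"
      by (simp add: mat_power_Suc mat_mult_diff_left mat_mult_diff_right matrix_mul_assoc)
    also have "\<dots> = smat c (mat_power e (Suc k)) + e ** smat (of_nat k * c) (mat_power e k)"
      by (simp only: comm Suc.IH smat_mult_left mat_power_Suc)
    also have "e ** smat (of_nat k * c) (mat_power e k) = smat (of_nat k * c) (mat_power e (Suc k))"
      by (rule mat_eqI) (simp add: mat_power_Suc mat_mult_nth sum_distrib_left mult_ac)
    finally show ?case by (simp add: smat_add_left[symmetric] algebra_simps)
  qed
  \<comment> \<open>Matrices are flattened to vectors indexed by pairs, which makes the dimension
    count and \<open>eigenvector_components_zero\<close> available.\<close>
  define \<psi> where "\<psi> w = (\<chi> i j. w $ (i, j))" for w :: "complex^('n \<times> 'n)"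
  define \<phi> where "\<phi> M = (\<chi> p. M $ fst p $ snd p)" for M :: "complex^'n^'n"
  have \<psi>\<phi>: "\<psi> (\<phi> M) = M" for M by (simp add: \<psi>_def \<phi>_def vec_eq_iff)
  define D where "D w = \<phi> (h ** \<psi> w - \<psi> w ** h)" for w
  have linD: "Vector_Spaces.linear (*s) (*s) D"
    unfolding Vector_Spaces.linear_iff
    by (auto simp: vec.vector_space_axioms D_def \<phi>_def \<psi>_def vec_eq_iff mat_mult_nth
        sum.distrib sum_distrib_left distrib_left distrib_right right_diff_distrib mult_ac)
  define x where "x k = \<phi> (mat_power e k)" for k
  have x0: "x k \<noteq> 0" for k using nz[of k] \<psi>\<phi>[of "mat_power e k"]
    by (auto simp: x_def \<psi>_def) (metis (mono_tags, lifting) mat_eqI vec_lambda_beta zero_index)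
  have Dx: "D (x k) = (of_nat k * c) *s x k" for k
    by (simp add: D_def x_def \<psi>\<phi> comm') (simp add: \<phi>_def vec_eq_iff)
  let ?N = "CARD('n \<times> 'n)"
  have inj: "inj_on x {..?N}"
  proof (rule inj_onI)
    fix k l assume "x k = x l"
    then have "(of_nat k * c) *s x k = (of_nat l * c) *s x k" using Dx[of k] Dx[of l] by auto
    then show "k = l" using x0[of k] c by simp
  qed
  have ind: "vec.independent (x ` {..?N})"
    unfolding vec.dependent_finite[OF finite_imageI[OF finite_atMost]]
  proof (rule notI, elim exE conjE bexE)
    fix u v assume sum: "(\<Sum>v\<in>x ` {..?N}. u v *s v) = 0" and v: "v \<in> x ` {..?N}" "u v \<noteq> 0"
    from v obtain k where k: "k \<in> {..?N}" and u: "u (x k) \<noteq> 0" by auto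
    have 1: "D (u (x k) *s x k) = (of_nat k * c) *s (u (x k) *s x k)" for k
      by (simp add: linear_rules[OF linD] Dx mult.commute)
    have 2: "inj_on (\<lambda>k. of_nat k * c) {..?N}" using c by (auto intro!: inj_onI)
    have 3: "(\<Sum>k\<le>?N. u (x k) *s x k) = 0"
      using sum by (simp only: sum.reindex[OF inj] o_def)
    have "u (x k) *s x k = 0"
      by (rule eigenvector_components_zero[OF linD finite_atMost 1 2 3 k])
    then show False using u x0 by simp
  qed
  have "card (x ` {..?N}) \<le> ?N"
    using vec.independent_card_le_dim[OF subset_UNIV ind] by (simp add: vec_dim_card del: vec.dim_UNIV)
  moreover have "card (x ` {..?N}) = Suc ?N" by (simp only: card_image[OF inj] card_atMost)
  ultimately show False by linarith
qed

text \<open>With H central, commuting F past a power of E trades one factor E for one factor H.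
  Starting from E^N = 0, this gives H^k E^(N-k) = 0 for all k up to N.\<close>

lemma heisenberg_nilpotent:
  fixes E F H :: "complex^'n \<Rightarrow> complex^'n"
  assumes lin: "Vector_Spaces.linear (*s) (*s) E" "Vector_Spaces.linear (*s) (*s) F"
      "Vector_Spaces.linear (*s) (*s) H"
    and EF: "\<And>v. E (F v) = F (E v) + H v" and HE: "\<And>v. H (E v) = E (H v)" and HF: "\<And>v. H (F v) = F (H v)"
    and N: "\<And>v. (E ^^ N) v = 0"
  shows "(H ^^ N) v = 0"
proof -
  note simps = linear_rules[OF lin(1)] linear_rules[OF lin(2)] linear_rules[OF lin(3)]
    linear_funpow[OF lin(3)]
  have HkF: "(H ^^ k) (F v) = F ((H ^^ k) v)" for k v
    by (induction k) (simp_all add: HF)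
  have EmF: "E ((E ^^ m) (F v)) = F (E ((E ^^ m) v)) + of_nat (Suc m) *s H ((E ^^ m) v)" for m v
  proof (induction m)
    case (Suc m)
    have "E ((E ^^ Suc m) (F v)) = E (E ((E ^^ m) (F v)))" by simp
    also have "\<dots> = F (E ((E ^^ Suc m) v)) + (H ((E ^^ Suc m) v) + of_nat (Suc m) *s H ((E ^^ Suc m) v))"
      unfolding Suc by (simp add: simps EF HE)
    finally show ?case by (simp add: vec_eq_iff algebra_simps)
  qed (simp add: EF)
  have "\<forall>v. (H ^^ k) ((E ^^ (N - k)) v) = 0" if "k \<le> N" for k
    using that
  proof (induction k)
    case (Suc k)
    define m where "m = N - Suc k"
    have m: "N - k = Suc m" using Suc.prems by (simp add: m_def)
    have IH: "(H ^^ k) (E ((E ^^ m) v)) = 0" for v using Suc m by simp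
    have "(H ^^ k) (of_nat (Suc m) *s H ((E ^^ m) v)) = 0" for v
      using IH[of "F v"] unfolding EmF simps HkF IH by (simp add: simps)
    then have "(H ^^ Suc k) ((E ^^ m) v) = 0" for v
      by (simp add: simps funpow_swap1 del: of_nat_Suc)
    then show ?case by (simp add: m_def)
  qed (simp add: N)
  from this[of N] show ?thesis by simp
qed

text \<open>Let k be minimal with Y H^k = 0. A nonzero vector Y H^(k-1) v is then an eigenvector of
  H with eigenvalue a, which nilpotency forces to be zero.\<close>

lemma nilpotent_ad_eigenvalue:
  fixes H Y :: "complex^'n \<Rightarrow> complex^'n"
  assumes lin: "Vector_Spaces.linear (*s) (*s) H" "Vector_Spaces.linear (*s) (*s) Y"
    and N: "\<And>v. (H ^^ N) v = 0" and HY: "\<And>v. H (Y v) = Y (H v) + a *s Y v" and Y: "Y v \<noteq> 0"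
  shows "a = 0"
proof (rule ccontr)
  assume a: "a \<noteq> 0"
  let ?P = "\<lambda>k. \<forall>v. Y ((H ^^ k) v) = 0"
  have ex: "?P N" by (simp add: N linear_rules[OF lin(2)])
  define k where "k = (LEAST k. ?P k)"
  have k: "?P k" unfolding k_def by (rule LeastI[of ?P, OF ex])
  have "k \<noteq> 0" using k Y by (cases k) auto
  then have "\<not> ?P (k - 1)" unfolding k_def by (intro not_less_Least) (simp add: k_def[symmetric])
  then obtain v where v: "Y ((H ^^ (k - 1)) v) \<noteq> 0" by blast
  define z where "z = Y ((H ^^ (k - 1)) v)"
  have "H ((H ^^ (k - 1)) v) = (H ^^ k) v" using \<open>k \<noteq> 0\<close> by (cases k) auto
  then have "H z = a *s z" using k by (simp add: z_def HY)
  then have "(H ^^ j) z = a ^ j *s z" for j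
    by (induction j) (simp_all add: linear_rules[OF lin(1)] mult.commute)
  from this[of N] show False using N a v by (simp add: z_def)
qed

lemma (in sl2_action) eigenvalue_integer:
  assumes "S = UNIV" "H v = c *s v" "v \<noteq> 0" shows "c \<in> \<int>"
proof -
  obtain I w where w: "finite I" "\<forall>k\<in>I. w k \<in> W k" "v = (\<Sum>k\<in>I. w k)"
    using S_decomposition[of v] assms(1) by blast
  have Hw: "H (w k) = of_int k *s w k" if "k \<in> I" for k using w(2) that by (auto simp: W_def)
  have "(\<Sum>k\<in>I. (of_int k - c) *s w k) = H v - c *s v"
    by (simp add: w(3) lin_simps Hw vec.scale_sum_right vec.scale_left_diff_distrib sum_subtractf)
  then have "(\<Sum>k\<in>I. (of_int k - c) *s w k) = 0" using assms(2) by simp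
  then have "(of_int k - c) *s w k = 0" if "k \<in> I" for k
    using eigenvector_components_zero[OF linH w(1), of "\<lambda>k. (of_int k - c) *s w k" of_int k] that
    by (auto simp: lin_simps Hw mult.commute inj_on_def)
  moreover obtain k where "k \<in> I" "w k \<noteq> 0" using assms(3) w(3) by (metis sum.neutral)
  ultimately show ?thesis by fastforce
qed

text \<open>The matrices \<open>M j\<close> preserve the eigenspaces of \<open>M i\<close>, so the
  \<open>M i\<close>-components of a joint eigenvector for \<open>I\<close> are again joint
  eigenvectors.\<close>

lemma joint_eigenvectors_span:
  fixes M :: "'i \<Rightarrow> complex^'n^'n"
  assumes "finite I" "\<And>i j. i \<in> I \<Longrightarrow> j \<in> I \<Longrightarrow> M i ** M j = M j ** M i"
    and "\<And>i. i \<in> I \<Longrightarrow> vec.span (\<Union>c. {v. M i *v v = c *s v}) = UNIV"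
  shows "vec.span {v. \<forall>i\<in>I. \<exists>c. M i *v v = c *s v} = UNIV"
  using assms
proof (induction I rule: finite_induct)
  case empty
  then show ?case by simp
next
  case (insert i I)
  let ?J = "{v. \<forall>i\<in>I. \<exists>c. M i *v v = c *s v}" and ?J' = "{v. \<forall>j\<in>insert i I. \<exists>c. M j *v v = c *s v}"
  have "?J \<subseteq> vec.span ?J'"
  proof
    fix v assume "v \<in> ?J"
    then obtain \<mu> where \<mu>: "M j *v v = \<mu> j *s v" if "j \<in> I" for j by auto metis
    have sub: "vec.subspace {v. M i *v v = c *s v}" for c
      by (rule vec.subspaceI) (auto simp: algebra_simps vec.scale_right_distrib vector_scalar_commute)
    have "v \<in> vec.span (\<Union>c. {v. M i *v v = c *s v})" using insert.prems(2) by auto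
    from span_UN_decomposition[OF sub this] obtain K w where
      w: "finite K" "\<forall>k\<in>K. M i *v w k = k *s w k" "v = (\<Sum>k\<in>K. w k)" by auto
    have "w k \<in> ?J'" if k: "k \<in> K" for k
    proof -
      have "M j *v w k = \<mu> j *s w k" if j: "j \<in> I" for j
      proof -
        have "M j *v w k - \<mu> j *s w k = 0"
        proof (rule eigenvector_components_zero[OF vec_linear_mat[of "M i"] w(1) _ _ _ k, where c = "\<lambda>k. k"])
          fix l assume l: "l \<in> K"
          have "M i *v (M j *v w l) = M j *v (M i *v w l)"
            using insert.prems(1)[of i j] j by (simp add: matrix_vector_mul_assoc)
          then show "M i *v (M j *v w l - \<mu> j *s w l) = l *s (M j *v w l - \<mu> j *s w l)"
            using w(2) l by (simp add: algebra_simps vector_scalar_commute)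
        next
          have "(\<Sum>k\<in>K. M j *v w k - \<mu> j *s w k) = M j *v v - \<mu> j *s v"
            by (simp add: w(3) linear_rules[OF vec_linear_mat] vec.scale_sum_right sum_subtractf)
          then show "(\<Sum>k\<in>K. M j *v w k - \<mu> j *s w k) = 0" using \<mu>[OF j] by simp
        qed (simp add: inj_on_def)
        then show ?thesis by simp
      qed
      then show ?thesis using w(2) k by auto
    qed
    then show "v \<in> vec.span ?J'"
      unfolding w(3) by (intro vec.span_sum vec.span_base)
  qed
  then have "vec.span ?J \<subseteq> vec.span ?J'" by (rule vec.span_minimal) (rule vec.subspace_span)
  moreover have "vec.span ?J = UNIV" by (rule insert.IH) (use insert.prems in auto)
  ultimately show ?case by blast
qed

section \<open>Projections\<close>

text \<open>\<open>ex\<close> and \<open>ind\<close> say that the space is the direct sum of the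
  \<open>W k\<close>. Uniqueness of components makes them linear in the vector, and the resulting
  matrices are what \<open>projection_onto\<close> describes.\<close>

lemma direct_sum_projections:
  fixes W :: "'k \<Rightarrow> (complex^'n) set"
  assumes K: "finite K" and W: "\<And>k. k \<in> K \<Longrightarrow> vec.subspace (W k)"
    and ex: "\<And>x. \<exists>w. (\<forall>k\<in>K. w k \<in> W k) \<and> x = (\<Sum>k\<in>K. w k)"
    and ind: "\<And>w k. \<forall>k\<in>K. w k \<in> W k \<Longrightarrow> (\<Sum>k\<in>K. w k) = 0 \<Longrightarrow> k \<in> K \<Longrightarrow> w k = 0"
  shows "idempotents K (projection_onto K W)"
    and "\<And>k l v. k \<in> K \<Longrightarrow> l \<in> K \<Longrightarrow> v \<in> W l \<Longrightarrow> projection_onto K W k *v v = (if l = k then v else 0)"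
    and "\<And>k v. k \<in> K \<Longrightarrow> projection_onto K W k *v v \<in> W k"
proof -
  obtain w where w: "\<And>x k. k \<in> K \<Longrightarrow> w x k \<in> W k" "\<And>x. x = (\<Sum>k\<in>K. w x k)"
    using ex by metis
  have uniq: "u k = w x k" if "\<forall>k\<in>K. u k \<in> W k" "x = (\<Sum>k\<in>K. u k)" "k \<in> K" for u x k
  proof -
    have "u k - w x k = 0"
    proof (rule ind[OF _ _ that(3), of "\<lambda>k. u k - w x k"])
      show "\<forall>k\<in>K. u k - w x k \<in> W k" using that w(1) by (auto intro: vec.subspace_diff[OF W])
      show "(\<Sum>k\<in>K. u k - w x k) = 0" using w(2)[of x] that(2) by (simp add: sum_subtractf)
    qed
    then show ?thesis by simp
  qed
  have lin: "Vector_Spaces.linear (*s) (*s) (\<lambda>x. w x k)" if "k \<in> K" for k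
    unfolding Vector_Spaces.linear_iff
  proof (intro conjI allI vec.vector_space_axioms)
    fix x y c
    have "w x k + w y k = w (x + y) k"
      by (rule uniq[OF _ _ that, of "\<lambda>k. w x k + w y k"])
        (auto simp: sum.distrib w(2)[symmetric] intro: vec.subspace_add[OF W] w(1))
    then show "w (x + y) k = w x k + w y k" by simp
    have "c *s w x k = w (c *s x) k"
      by (rule uniq[OF _ _ that, of "\<lambda>k. c *s w x k"])
        (auto simp: vec.scale_sum_right[symmetric] w(2)[symmetric] intro: vec.subspace_scale[OF W] w(1))
    then show "w (c *s x) k = c *s w x k" by simp
  qed
  have wW: "w v k = (if l = k then v else 0)" if "k \<in> K" "l \<in> K" "v \<in> W l" for k l v
    using uniq[of "\<lambda>k. if l = k then v else 0" v k] that K vec.subspace_0[OF W]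
    by auto
  define P where "P k = matrix (\<lambda>x. w x k)" for k
  have P: "P k *v x = w x k" if "k \<in> K" for k x
    unfolding P_def by (rule matrix_works[OF lin[OF that]])
  have proj: "projection_onto K W k = P k" if "k \<in> K" for k
    unfolding projection_onto_def
  proof (rule the_equality)
    show "\<forall>l\<in>K. \<forall>v\<in>W l. P k *v v = (if l = k then v else 0)" using that by (simp add: P wW)
    fix P' assume P': "\<forall>l\<in>K. \<forall>v\<in>W l. P' *v v = (if l = k then v else 0)"
    show "P' = P k"
    proof (rule mat_eq_vecI)
      fix v
      have "P' *v v = (\<Sum>l\<in>K. P' *v w v l)"
        using linear_rules(5)[OF vec_linear_mat[of P'], of "w v" K] w(2)[of v] by simp
      also have "\<dots> = (\<Sum>l\<in>K. if l = k then w v l else 0)"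
        using P' w(1) by (intro sum.cong) auto
      finally show "P' *v v = P k *v v" using that K by (simp add: P)
    qed
  qed
  show "projection_onto K W k *v v = (if l = k then v else 0)" if "k \<in> K" "l \<in> K" "v \<in> W l" for k l v
    using that by (simp add: proj P wW)
  show "projection_onto K W k *v v \<in> W k" if "k \<in> K" for k v
    using that by (simp add: proj P w(1))
  have "P k ** P l = (if k = l then P k else 0)" if "k \<in> K" "l \<in> K" for k l
    by (rule mat_eq_vecI) (use that in \<open>auto simp: P wW[OF _ _ w(1)] simp flip: matrix_vector_mul_assoc\<close>)
  moreover have "(\<Sum>k\<in>K. P k) = mat 1"
  proof (rule mat_eq_vecI)
    fix v
    have "(\<Sum>k\<in>K'. P k) *v v = (\<Sum>k\<in>K'. P k *v v)" if "finite K'" for K'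
      using that by (induction K') (auto simp: algebra_simps)
    then show "(\<Sum>k\<in>K. P k) *v v = mat 1 *v v"
      using K w(2)[of v] by (simp add: P)
  qed
  ultimately show "idempotents K (projection_onto K W)"
    using K by (simp add: idempotents_def proj)
qed

lemma matrix_axis: "(A :: complex^'n^'m) *v axis j 1 = column j A"
  by (simp add: vec_eq_iff matrix_vector_mult_def axis_def column_def if_distrib cong: if_cong)

text \<open>In a basis that extends a basis of \<open>W\<close>, the diagonal entries are 1 at the
  basis vectors in \<open>W\<close>. At the others they are 0, because the image lies in
  \<open>W\<close>.\<close>

lemma trace_projection:
  fixes P :: "complex^'n^'n"
  assumes W: "vec.subspace W" and P: "\<And>v. v \<in> W \<Longrightarrow> P *v v = v" "\<And>v. P *v v \<in> W"
  shows "trace P = of_nat (vec.dim W)"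
proof -
  obtain B1 where B1: "B1 \<subseteq> W" "vec.independent B1" "W \<subseteq> vec.span B1" "card B1 = vec.dim W"
    by (rule vec.basis_exists)
  obtain B where B: "B1 \<subseteq> B" "vec.independent B" "UNIV \<subseteq> vec.span B"
    by (rule vec.maximal_independent_subset_extend[OF subset_UNIV B1(2)])
  have fin: "finite B" by (rule vec.finiteI_independent[OF B(2)])
  have "card B = CARD('n)"
    using vec.basis_card_eq_dim[OF subset_UNIV B(3,2)] by (simp add: vec_dim_card del: vec.dim_UNIV)
  then obtain \<beta> where \<beta>: "bij_betw \<beta> (UNIV :: 'n set) B"
    using fin finite_same_card_bij[of "UNIV :: 'n set" B] by auto
  define A :: "complex^'n^'n" where "A = (\<chi> i j. \<beta> j $ i)"
  have col: "column j A = \<beta> j" for j by (simp add: A_def column_def vec_eq_iff)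
  have "columns A = B" unfolding columns_def using bij_betw_imp_surj_on[OF \<beta>] by (auto simp: col)
  then obtain C where AC: "A ** C = mat 1"
    using matrix_right_invertible_span_columns[of A] B(3) by auto
  then have CA: "C ** A = mat 1" by (rule matrix_left_right_inverse1)
  have A_axis: "A *v axis j 1 = \<beta> j" for j by (simp add: matrix_axis col)
  have C\<beta>: "C *v \<beta> j = axis j 1" for j
    unfolding A_axis[symmetric] matrix_vector_mul_assoc CA by simp
  have diag: "(C ** (P ** A)) $ j $ j = (if \<beta> j \<in> B1 then 1 else 0)" for j
  proof -
    have "(C ** (P ** A)) $ j $ j = ((C ** (P ** A)) *v axis j 1) $ j"
      by (simp add: matrix_axis column_def)
    also have "\<dots> = (C *v (P *v \<beta> j)) $ j" by (simp add: A_axis flip: matrix_vector_mul_assoc)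
    also have "\<dots> = (if \<beta> j \<in> B1 then 1 else 0)"
    proof (cases "\<beta> j \<in> B1")
      case True
      then show ?thesis using P(1) B1(1) by (simp add: subset_iff C\<beta> axis_def)
    next
      case False
      have "(C *v x) $ j = 0" if "x \<in> vec.span B1" for x
        using that
      proof (induction rule: vec.span_induct_alt)
        case (step c x y)
        obtain k where k: "x = \<beta> k" using step(1) B(1) bij_betw_imp_surj_on[OF \<beta>] by blast
        then have "k \<noteq> j" using False step(1) by auto
        then show ?case using step(2) by (simp add: algebra_simps vector_scalar_commute k C\<beta> axis_def)
      qed simp
      then show ?thesis using False P(2) B1(3) by auto
    qed
    finally show ?thesis .
  qed
  have "trace P = trace (P ** (A ** C))" by (simp add: AC)
  also have "\<dots> = trace (C ** (P ** A))" using trace_mul_sym[of C "P ** A"] by (simp only: matrix_mul_assoc)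
  also have "\<dots> = (\<Sum>j\<in>UNIV. if \<beta> j \<in> B1 then 1 else 0)" by (simp add: trace_def diag)
  also have "\<dots> = of_nat (card {j. \<beta> j \<in> B1})" by (simp add: sum.If_cases)
  also have "card {j. \<beta> j \<in> B1} = card B1"
  proof (rule bij_betw_same_card[of \<beta>])
    show "bij_betw \<beta> {j. \<beta> j \<in> B1} B1"
      using \<beta> B(1) unfolding bij_betw_def inj_on_def by auto
  qed
  finally show ?thesis by (simp add: B1(4))
qed

section \<open>Cartan subalgebra and coroots\<close>

lemma smat_vector_space: "vector_space (smat :: complex \<Rightarrow> complex^'n^'m \<Rightarrow> complex^'n^'m)"
  by unfold_locales (simp_all add: smat_add_left smat_add_right smat_smat)

lemma trace_smat: "trace (smat c A) = c * trace (A :: complex^'n^'n)"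
  by (simp add: trace_def sum_distrib_left)

lemma trace_sum: "trace (sum f K) = (\<Sum>k\<in>K. trace (f k :: complex^'n^'n))"
  unfolding trace_def mat_sum_nth by (rule sum.swap)

lemma mat_mult_smat: "A ** smat c B = smat (c::complex) (A ** B)"
  by (rule mat_eqI) (simp add: mat_mult_nth sum_distrib_left mult_ac)

locale lie_representation =
  fixes L :: "('g::ab_group_add, 'i::finite) lie_data" and \<pi> :: "'g \<Rightarrow> complex^'n^'n"
  assumes simple: "simple_lie_data L" and rep: "representation L \<pi>" and inj: "inj \<pi>"
begin

abbreviation "\<alpha> \<equiv> simple_root L"
abbreviation "coroot i \<equiv> hroot L i"

lemma
  shows vs: "vector_space (scaleL L)"
    and cartan_subspace: "module.subspace (scaleL L) (cartan L)"
    and centralizer: "(\<And>h. h \<in> cartan L \<Longrightarrow> bracket L x h = 0) \<Longrightarrow> x \<in> cartan L"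
    and root: "\<alpha> i \<in> roots L"
    and root_coordinates: "\<mu> \<in> cartan_dual L \<Longrightarrow> \<exists>c. \<mu> = (\<Sum>i\<in>UNIV. fun_scale (c i) (\<alpha> i))"
    and form_linear: "Vector_Spaces.linear (scaleL L) (*) (form L x)"
    and form_sym: "form L x y = form L y x"
    and form_invariant: "form L (bracket L x y) z = form L x (bracket L y z)"
    and coroot_cartan: "coroot i \<in> cartan L"
    and form_coroot: "h \<in> cartan L \<Longrightarrow> form L (coroot i) h = \<alpha> i h"
    and coweight_cartan: "coweight L i \<in> cartan L"
    and root_coweight: "\<alpha> j (coweight L i) = (if i = j then 1 else 0)"
    and xplus: "h \<in> cartan L \<Longrightarrow> bracket L h (xplus L i) = scaleL L (\<alpha> i h) (xplus L i)"
    and xminus: "h \<in> cartan L \<Longrightarrow> bracket L h (xminus L i) = scaleL L (- \<alpha> i h) (xminus L i)"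
    and form_xplus_xminus: "form L (xplus L i) (xminus L i) = 1"
proof -
  have alg: "lie_algebra L" "cartan_subalgebra L (cartan L)" "base L" "invariant_form L"
    using simple by (auto simp: simple_lie_data_def simple_lie_algebra_def)
  show vs: "vector_space (scaleL L)" using alg(1) by (simp add: lie_algebra_def)
  show sub: "module.subspace (scaleL L) (cartan L)" using alg(2) by (simp add: cartan_subalgebra_def)
  show "x \<in> cartan L" if "\<And>h. h \<in> cartan L \<Longrightarrow> bracket L x h = 0"
  proof -
    interpret vector_space "scaleL L" by (rule vs)
    have "x \<in> {x. \<forall>h\<in>cartan L. bracket L x h \<in> cartan L}" using that subspace_0[OF sub] by simp
    then show ?thesis using alg(2) unfolding cartan_subalgebra_def by blast
  qed
  show "\<alpha> i \<in> roots L" using alg(3) by (simp add: base_def)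
  show "\<exists>c. \<mu> = (\<Sum>i\<in>UNIV. fun_scale (c i) (\<alpha> i))" if "\<mu> \<in> cartan_dual L"
    using alg(3) that unfolding base_def by blast
  show "Vector_Spaces.linear (scaleL L) (*) (form L x)" "form L x y = form L y x"
    "form L (bracket L x y) z = form L x (bracket L y z)"
    using alg(4) unfolding invariant_form_def by blast+
  show "coroot i \<in> cartan L" "h \<in> cartan L \<Longrightarrow> form L (coroot i) h = \<alpha> i h" "coweight L i \<in> cartan L"
    "\<alpha> j (coweight L i) = (if i = j then 1 else 0)"
    "h \<in> cartan L \<Longrightarrow> bracket L h (xplus L i) = scaleL L (\<alpha> i h) (xplus L i)"
    "h \<in> cartan L \<Longrightarrow> bracket L h (xminus L i) = scaleL L (- \<alpha> i h) (xminus L i)"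
    "form L (xplus L i) (xminus L i) = 1"
    using simple by (auto simp: simple_lie_data_def corresponds_def root_space_def)
qed

lemma root_dual: "\<alpha> i \<in> cartan_dual L"
  using root[of i] by (simp add: roots_def)

lemma
  shows pi_linear: "Vector_Spaces.linear (scaleL L) smat \<pi>"
    and pi_bracket: "\<pi> (bracket L x y) = mcomm (\<pi> x) (\<pi> y)"
  using rep by (auto simp: representation_def)

lemma
  shows pi_add: "\<pi> (x + y) = \<pi> x + \<pi> y" and pi_scale: "\<pi> (scaleL L c x) = smat c (\<pi> x)"
    and pi_0: "\<pi> 0 = 0" and pi_sum: "\<pi> (sum f A) = (\<Sum>i\<in>A. \<pi> (f i))" and pi_diff: "\<pi> (x - y) = \<pi> x - \<pi> y"
proof -
  interpret Vector_Spaces.linear "scaleL L" smat \<pi> by (rule pi_linear)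
  show "\<pi> (x + y) = \<pi> x + \<pi> y" "\<pi> (scaleL L c x) = smat c (\<pi> x)" "\<pi> 0 = 0"
    "\<pi> (sum f A) = (\<Sum>i\<in>A. \<pi> (f i))" "\<pi> (x - y) = \<pi> x - \<pi> y"
    by (simp_all add: add scale sum diff)
qed

lemma
  shows form_add: "form L x (y + y') = form L x y + form L x y'"
    and form_scale: "form L x (scaleL L c y) = c * form L x y"
    and form_0: "form L x 0 = 0" and form_sum: "form L x (sum f A) = (\<Sum>i\<in>A. form L x (f i))"
    and form_diff: "form L x (y - y') = form L x y - form L x y'"
proof -
  interpret Vector_Spaces.linear "scaleL L" "(*)" "form L x" by (rule form_linear)
  show "form L x (y + y') = form L x y + form L x y'"
    "form L x (scaleL L c y) = c * form L x y" "form L x 0 = 0" "form L x (sum f A) = (\<Sum>i\<in>A. form L x (f i))"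
    "form L x (y - y') = form L x y - form L x y'"
    by (simp_all add: add scale sum diff)
qed

lemma
  assumes "\<mu> \<in> cartan_dual L"
  shows dual_add: "h \<in> cartan L \<Longrightarrow> k \<in> cartan L \<Longrightarrow> \<mu> (h + k) = \<mu> h + \<mu> k"
    and dual_scale: "h \<in> cartan L \<Longrightarrow> \<mu> (scaleL L c h) = c * \<mu> h"
    and dual_outside: "h \<notin> cartan L \<Longrightarrow> \<mu> h = 0"
  using assms by (auto simp: dual_def)

lemma
  shows cartan_0: "0 \<in> cartan L" and cartan_add: "h \<in> cartan L \<Longrightarrow> k \<in> cartan L \<Longrightarrow> h + k \<in> cartan L"
    and cartan_diff: "h \<in> cartan L \<Longrightarrow> k \<in> cartan L \<Longrightarrow> h - k \<in> cartan L"
    and cartan_scale: "h \<in> cartan L \<Longrightarrow> scaleL L c h \<in> cartan L"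
    and cartan_sum: "(\<And>i. i \<in> A \<Longrightarrow> f i \<in> cartan L) \<Longrightarrow> sum f A \<in> cartan L"
proof -
  interpret vector_space "scaleL L" by (rule vs)
  show "0 \<in> cartan L" "h \<in> cartan L \<Longrightarrow> k \<in> cartan L \<Longrightarrow> h + k \<in> cartan L"
    "h \<in> cartan L \<Longrightarrow> k \<in> cartan L \<Longrightarrow> h - k \<in> cartan L"
    "h \<in> cartan L \<Longrightarrow> scaleL L c h \<in> cartan L"
    "(\<And>i. i \<in> A \<Longrightarrow> f i \<in> cartan L) \<Longrightarrow> sum f A \<in> cartan L"
    using cartan_subspace by (auto intro: subspace_0 subspace_add subspace_diff subspace_scale subspace_sum)
qed

lemma fun_sum_apply: "(\<Sum>i\<in>A. f i) x = (\<Sum>i\<in>A. (f i x :: complex))"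
  by (induction A rule: infinite_finite_induct) auto

lemma dual_sum: "\<mu> \<in> cartan_dual L \<Longrightarrow> (\<And>i. i \<in> A \<Longrightarrow> f i \<in> cartan L) \<Longrightarrow> \<mu> (sum f A) = (\<Sum>i\<in>A. \<mu> (f i))"
proof (induction A rule: infinite_finite_induct)
  case (insert a A)
  then show ?case by (simp add: dual_add cartan_sum)
next
  case empty
  interpret vector_space "scaleL L" by (rule vs)
  show ?case using dual_scale[OF empty(1) cartan_0, of 0] by simp
next
  case (infinite A)
  interpret vector_space "scaleL L" by (rule vs)
  show ?case using dual_scale[OF infinite(2) cartan_0, of 0] infinite(1) by simp
qed

text \<open>The simple roots span the whole dual space, so they separate points. This takes the
  place of nondegeneracy of the form on the Cartan subalgebra.\<close>

lemma cartan_eq_0: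
  assumes k: "k \<in> cartan L" and "\<And>i. \<alpha> i k = 0" shows "k = 0"
proof (rule ccontr)
  assume "k \<noteq> 0"
  interpret vector_space_pair "scaleL L" "(*) :: complex \<Rightarrow> _"
    by (intro vector_space_pair.intro vs) unfold_locales
  have "vs1.independent {k}" using \<open>k \<noteq> 0\<close> by (simp add: vs1.dependent_single)
  then obtain f where f: "Vector_Spaces.linear (scaleL L) (*) f" "f k = 1"
    using linear_independent_extend[of "{k}" "\<lambda>_. 1"] by auto
  interpret f: Vector_Spaces.linear "scaleL L" "(*)" f by (rule f)
  define \<phi> where "\<phi> x = (if x \<in> cartan L then f x else 0)" for x
  have "\<phi> \<in> cartan_dual L"
    by (auto simp: dual_def \<phi>_def cartan_add cartan_scale f.add f.scale)
  then obtain c where "\<phi> = (\<Sum>i\<in>UNIV. fun_scale (c i) (\<alpha> i))" using root_coordinates by blast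
  then have "\<phi> k = (\<Sum>i\<in>UNIV. c i * \<alpha> i k)" by (simp add: fun_sum_apply fun_scale_def)
  then show False using assms f(2) by (simp add: \<phi>_def)
qed

lemma pi_eq_0: "\<pi> x = 0 \<Longrightarrow> x = 0"
  using inj pi_0 by (metis injD)

lemma mat_commute_bracket:
  fixes H X Y :: "complex^'n^'n"
  assumes "mcomm H X = smat a X" "mcomm H Y = smat (- a) Y"
  shows "H ** mcomm X Y = mcomm X Y ** H"
proof -
  have HX: "H ** X = X ** H + smat a X" using assms(1) by (simp add: mcomm_def algebra_simps)
  have HY: "H ** Y = Y ** H + smat (- a) Y" using assms(2) by (simp add: mcomm_def algebra_simps)
  have "H ** (X ** Y) = (X ** Y) ** H"
    unfolding matrix_mul_assoc HX mat_mult_add_left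
    by (simp add: HY mat_mult_add_right smat_mult_left mat_mult_smat flip: matrix_mul_assoc)
      (rule mat_eqI, simp)
  moreover have "H ** (Y ** X) = (Y ** X) ** H"
    unfolding matrix_mul_assoc HY mat_mult_add_left
    by (simp add: HX mat_mult_add_right smat_mult_left mat_mult_smat flip: matrix_mul_assoc)
      (rule mat_eqI, simp)
  ultimately show ?thesis by (simp add: mcomm_def mat_mult_diff_left mat_mult_diff_right)
qed

lemma pi_xplus: "h \<in> cartan L \<Longrightarrow> mcomm (\<pi> h) (\<pi> (xplus L i)) = smat (\<alpha> i h) (\<pi> (xplus L i))"
  and pi_xminus: "h \<in> cartan L \<Longrightarrow> mcomm (\<pi> h) (\<pi> (xminus L i)) = smat (- \<alpha> i h) (\<pi> (xminus L i))"
  by (simp_all add: xplus xminus pi_scale flip: pi_bracket)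

lemma bracket_antisym: "bracket L x y = - bracket L y x"
proof -
  have "\<pi> (bracket L x y + bracket L y x) = 0" by (simp add: pi_add pi_bracket mcomm_def)
  then show ?thesis using pi_eq_0 eq_neg_iff_add_eq_0 by blast
qed

text \<open>The bracket has weight zero, so it centralizes the Cartan subalgebra and lies in it by
  self-normalization. By invariance it pairs with h to \<alpha>(h), just as the coroot does, and all
  simple roots then vanish on the difference.\<close>

lemma xplus_xminus: "bracket L (xplus L i) (xminus L i) = coroot i"
proof -
  let ?y = "bracket L (xplus L i) (xminus L i)"
  have y: "?y \<in> cartan L"
  proof (rule centralizer)
    fix h assume h: "h \<in> cartan L"
    have "\<pi> (bracket L ?y h) = 0"
      using mat_commute_bracket[OF pi_xplus[OF h, of i] pi_xminus[OF h]]
      by (simp add: pi_bracket mcomm_def)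
    then show "bracket L ?y h = 0" by (rule pi_eq_0)
  qed
  have form_y: "form L ?y h = \<alpha> i h" if h: "h \<in> cartan L" for h
  proof -
    have "bracket L (xminus L i) h = scaleL L (\<alpha> i h) (xminus L i)"
    proof -
      interpret vector_space "scaleL L" by (rule vs)
      show ?thesis by (subst bracket_antisym) (simp add: xminus[OF h])
    qed
    then show ?thesis by (simp add: form_invariant form_scale form_xplus_xminus)
  qed
  have "?y - coroot i = 0"
  proof (rule cartan_eq_0)
    show "?y - coroot i \<in> cartan L" by (intro cartan_diff y coroot_cartan)
    fix j
    have "\<alpha> j (?y - coroot i) = form L (coroot j) (?y - coroot i)"
      by (intro form_coroot[symmetric] cartan_diff y coroot_cartan)
    also have "\<dots> = form L ?y (coroot j) - form L (coroot i) (coroot j)"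
      by (simp only: form_diff form_sym[of "coroot j"])
    finally show "\<alpha> j (?y - coroot i) = 0" by (simp add: form_y form_coroot coroot_cartan)
  qed
  then show ?thesis by simp
qed

lemma pi_coroot: "\<pi> (coroot i) = mcomm (\<pi> (xplus L i)) (\<pi> (xminus L i))"
  by (simp add: pi_bracket flip: xplus_xminus)

text \<open>Expand the functional form(h, -) in simple roots; the combination of the coroots with
  the same coefficients differs from h by an element on which all simple roots vanish.\<close>

lemma cartan_span:
  assumes h: "h \<in> cartan L" obtains c where "h = (\<Sum>i\<in>UNIV. scaleL L (c i) (coroot i))"
proof -
  define \<phi> where "\<phi> x = (if x \<in> cartan L then form L h x else 0)" for x
  have "\<phi> \<in> cartan_dual L"
    by (auto simp: dual_def \<phi>_def cartan_add cartan_scale form_add form_scale)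
  then obtain c where c: "\<phi> = (\<Sum>i\<in>UNIV. fun_scale (c i) (\<alpha> i))" using root_coordinates by blast
  let ?k = "\<Sum>i\<in>UNIV. scaleL L (c i) (coroot i)"
  have k: "?k \<in> cartan L" by (intro cartan_sum cartan_scale coroot_cartan)
  have "h - ?k = 0"
  proof (rule cartan_eq_0)
    show "h - ?k \<in> cartan L" by (intro cartan_diff h k)
    fix j
    have "\<alpha> j (h - ?k) = form L (coroot j) (h - ?k)"
      by (intro form_coroot[symmetric] cartan_diff h k)
    also have "\<dots> = \<phi> (coroot j) - (\<Sum>i\<in>UNIV. c i * \<alpha> i (coroot j))"
      by (simp add: form_diff form_sum form_scale form_sym[of "coroot j" h] \<phi>_def coroot_cartan
          form_sym[of "coroot j" "coroot _"] form_coroot)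
    also have "\<dots> = 0" by (simp add: c fun_sum_apply fun_scale_def)
    finally show "\<alpha> j (h - ?k) = 0" .
  qed
  then show thesis by (intro that[of c]) simp
qed

text \<open>A Cartan subalgebra is only defined as nilpotent. It acts commutatively because it is
  spanned by brackets of vectors of opposite weights, which have weight zero.\<close>

lemma cartan_commute:
  assumes "h \<in> cartan L" "k \<in> cartan L" shows "\<pi> h ** \<pi> k = \<pi> k ** \<pi> h"
proof -
  obtain c where c: "k = (\<Sum>i\<in>UNIV. scaleL L (c i) (coroot i))" by (rule cartan_span[OF assms(2)])
  have "\<pi> h ** \<pi> (coroot i) = \<pi> (coroot i) ** \<pi> h" for i
    unfolding pi_coroot by (rule mat_commute_bracket[OF pi_xplus[OF assms(1)] pi_xminus[OF assms(1)]])
  then show ?thesis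
    by (simp add: c pi_sum pi_scale mat_mult_sum_left mat_mult_sum_right mat_mult_smat smat_mult_left)
qed

lemma mcomm_vec:
  fixes H X :: "complex^'n^'n"
  assumes "mcomm H X = smat a X" shows "H *v (X *v v) = X *v (H *v v) + a *s (X *v v)"
proof -
  have "(H ** X - X ** H) *v v = a *s (X *v v)" using assms by (simp only: mcomm_def smat_vec)
  then show ?thesis by (simp add: algebra_simps matrix_vector_mul_assoc)
qed

lemma xplus_nonzero: "\<pi> (xplus L i) \<noteq> 0"
proof
  assume "\<pi> (xplus L i) = 0"
  then have "xplus L i = 0" by (rule pi_eq_0)
  then show False using form_xplus_xminus[of i] form_sym[of 0] by (simp add: form_0)
qed

lemma root_nontrivial: obtains h where "h \<in> cartan L" "\<alpha> i h \<noteq> 0"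
proof -
  have "\<alpha> i \<noteq> 0" using root[of i] by (simp add: roots_def)
  then obtain h where "\<alpha> i h \<noteq> 0" by (metis ext zero_fun_apply)
  then show thesis using that dual_outside[OF root_dual] by blast
qed

lemma xplus_nilpotent: obtains K where "\<And>v. (((*v) (\<pi> (xplus L i))) ^^ K) v = 0"
proof -
  obtain h where h: "h \<in> cartan L" "\<alpha> i h \<noteq> 0" by (rule root_nontrivial)
  obtain K where "mat_power (\<pi> (xplus L i)) K = 0"
    using nilpotent_of_commutator[OF pi_xplus[OF h(1), unfolded mcomm_def] h(2)] by blast
  then show thesis using that[of K] by (metis mat_power_vec matrix_vector_mult_0)
qed

lemma xminus_nilpotent: obtains K where "\<And>v. (((*v) (\<pi> (xminus L i))) ^^ K) v = 0"
proof -
  obtain h where h: "h \<in> cartan L" "\<alpha> i h \<noteq> 0" by (rule root_nontrivial)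
  then obtain K where "mat_power (\<pi> (xminus L i)) K = 0"
    using nilpotent_of_commutator[OF pi_xminus[OF h(1), unfolded mcomm_def]] by auto
  then show thesis using that[of K] by (metis mat_power_vec matrix_vector_mult_0)
qed

text \<open>Otherwise the two root vectors and the coroot satisfy Heisenberg relations, so the
  coroot acts nilpotently. Each simple root vector is an eigenvector for its adjoint action, so
  every simple root vanishes on the coroot, which is then zero although \<alpha> is not.\<close>

lemma root_coroot_nonzero: "\<alpha> i (coroot i) \<noteq> 0"
proof
  assume zero: "\<alpha> i (coroot i) = 0"
  let ?X = "\<pi> (xplus L i)" and ?Y = "\<pi> (xminus L i)" and ?H = "\<pi> (coroot i)"
  have EF: "?X *v (?Y *v v) = ?Y *v (?X *v v) + ?H *v v" for v
    by (simp add: pi_coroot mcomm_def algebra_simps matrix_vector_mul_assoc)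
  have HX: "?H *v (?X *v v) = ?X *v (?H *v v)" and HY: "?H *v (?Y *v v) = ?Y *v (?H *v v)" for v
    using mcomm_vec[OF pi_xplus[OF coroot_cartan, of i i]] mcomm_vec[OF pi_xminus[OF coroot_cartan, of i i]]
    by (simp_all add: zero)
  obtain N where N: "\<And>v. (((*v) ?X) ^^ N) v = 0" by (rule xplus_nilpotent[of i]) blast
  have nil: "(((*v) ?H) ^^ N) v = 0" for v
    by (rule heisenberg_nilpotent[OF vec_linear_mat vec_linear_mat vec_linear_mat EF HX HY N])
  have "\<alpha> j (coroot i) = 0" for j
  proof -
    obtain v where "\<pi> (xplus L j) *v v \<noteq> 0"
      using xplus_nonzero[of j] by (metis mat_eq_vecI matrix_vector_mult_0)
    then show ?thesis
      by (rule nilpotent_ad_eigenvalue[OF vec_linear_mat vec_linear_mat nil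
            mcomm_vec[OF pi_xplus[OF coroot_cartan]]])
  qed
  then have "coroot i = 0" by (intro cartan_eq_0 coroot_cartan)
  moreover obtain h where "h \<in> cartan L" "\<alpha> i h \<noteq> 0" by (rule root_nontrivial)
  ultimately show False using form_coroot[of h i] form_sym[of 0 h] by (simp add: form_0)
qed

text \<open>Resolves the definite description in \<open>dual_form\<close>: the element corresponding
  to a simple root is unique.\<close>

lemma sym_d_eq: "sym_d L i = \<alpha> i (coroot i) / 2"
proof -
  have uniq: "s = coroot i" if "corresponds L s (\<alpha> i)" for s
  proof -
    have s: "s \<in> cartan L" "\<And>h. h \<in> cartan L \<Longrightarrow> form L s h = \<alpha> i h"
      using that by (auto simp: corresponds_def)
    have "s - coroot i = 0"
    proof (rule cartan_eq_0)
      show "s - coroot i \<in> cartan L" by (intro cartan_diff s coroot_cartan)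
      fix j
      have "\<alpha> j (s - coroot i) = form L (coroot j) (s - coroot i)"
        by (intro form_coroot[symmetric] cartan_diff s coroot_cartan)
      then show "\<alpha> j (s - coroot i) = 0"
        by (simp add: form_diff form_sym[of "coroot j" s] form_sym[of "coroot j" "coroot i"] s form_coroot coroot_cartan)
    qed
    then show ?thesis by simp
  qed
  have cor: "corresponds L (coroot i) (\<alpha> i)" by (simp add: corresponds_def coroot_cartan form_coroot)
  have "dual_form L (\<alpha> i) (\<alpha> i) = form L (coroot i) (coroot i)"
    unfolding dual_form_def by (rule the_equality) (use cor uniq in blast)+
  then show ?thesis by (simp add: sym_d_def form_coroot coroot_cartan)
qed

lemma sym_d_nonzero: "sym_d L i \<noteq> 0"
  by (simp add: sym_d_eq root_coroot_nonzero)

text \<open>The factor 1 / d normalizes the coroot so that \<alpha> takes the value 2 on it; since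
  the coroot here is the form-dual of \<alpha>, its own value is 2 d.\<close>

lemma sl2: "sl2_action ((*v) (\<pi> (xplus L i))) ((*v) (smat (1 / sym_d L i) (\<pi> (xminus L i))))
   ((*v) (smat (1 / sym_d L i) (\<pi> (coroot i))))"
proof -
  have d: "\<alpha> i (coroot i) = 2 * sym_d L i" by (simp add: sym_d_eq)
  let ?X = "\<pi> (xplus L i)" and ?Y = "\<pi> (xminus L i)" and ?H = "\<pi> (coroot i)"
  have EF: "?X *v (?Y *v v) = ?Y *v (?X *v v) + ?H *v v" for v
    by (simp add: pi_coroot mcomm_def algebra_simps matrix_vector_mul_assoc)
  have HX: "?H *v (?X *v v) = ?X *v (?H *v v) + (2 * sym_d L i) *s (?X *v v)"
    and HY: "?H *v (?Y *v v) = ?Y *v (?H *v v) - (2 * sym_d L i) *s (?Y *v v)" for v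
    using mcomm_vec[OF pi_xplus[OF coroot_cartan, of i i]] mcomm_vec[OF pi_xminus[OF coroot_cartan, of i i]]
    by (simp_all add: d)
  show ?thesis
  proof (unfold_locales, unfold smat_vec vector_scalar_commute)
    fix v
    show "(1 / sym_d L i) *s (?X *v (?Y *v v)) = (1 / sym_d L i) *s (?Y *v (?X *v v)) + (1 / sym_d L i) *s (?H *v v)"
      by (simp only: EF vec.scale_right_distrib)
    show "(1 / sym_d L i) *s (?H *v (?X *v v)) = (1 / sym_d L i) *s (?X *v (?H *v v)) + 2 *s (?X *v v)"
      using sym_d_nonzero by (simp only: HX vec.scale_right_distrib vec.scale_scale) simp
    show "(1 / sym_d L i) *s ((1 / sym_d L i) *s (?H *v (?Y *v v)))
      = (1 / sym_d L i) *s ((1 / sym_d L i) *s (?Y *v (?H *v v))) - 2 *s ((1 / sym_d L i) *s (?Y *v v))"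
      using sym_d_nonzero by (simp only: HY vec.scale_right_diff_distrib vec.scale_scale) simp
  qed
qed

lemma sl2_span: "sl2_action.S ((*v) (smat (1 / sym_d L i) (\<pi> (coroot i)))) = UNIV"
proof -
  interpret sl2_action "(*v) (\<pi> (xplus L i))" "(*v) (smat (1 / sym_d L i) (\<pi> (xminus L i)))"
    "(*v) (smat (1 / sym_d L i) (\<pi> (coroot i)))" by (rule sl2)
  obtain K K' where K: "\<And>v. (((*v) (\<pi> (xplus L i))) ^^ K) v = 0" "\<And>v. (((*v) (\<pi> (xminus L i))) ^^ K') v = 0"
    using xplus_nilpotent xminus_nilpotent by metis
  have pow: "(((*v) (smat c A)) ^^ k) v = c ^ k *s (((*v) A) ^^ k) v" for c k v and A :: "complex^'n^'n"
    by (induction k) (simp_all add: smat_vec vector_scalar_commute mult.commute)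
  show ?thesis
  proof (rule weight_vectors_span[of "K + K'"])
    show "(((*v) (\<pi> (xplus L i))) ^^ (K + K')) v = 0" for v
      by (simp add: funpow_add K)
    show "(((*v) (smat (1 / sym_d L i) (\<pi> (xminus L i)))) ^^ (K + K')) v = 0" for v
      by (simp add: funpow_add add.commute[of K] pow K vec.scale_zero_right)
  qed
qed

lemma coroot_diagonalizable: "vec.span (\<Union>c. {v. \<pi> (coroot i) *v v = c *s v}) = UNIV"
proof -
  interpret sl2_action "(*v) (\<pi> (xplus L i))" "(*v) (smat (1 / sym_d L i) (\<pi> (xminus L i)))"
    "(*v) (smat (1 / sym_d L i) (\<pi> (coroot i)))" by (rule sl2)
  have "W k \<subseteq> {v. \<pi> (coroot i) *v v = (sym_d L i * of_int k) *s v}" for k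
  proof
    fix v assume "v \<in> W k"
    then have "sym_d L i *s ((1 / sym_d L i) *s (\<pi> (coroot i) *v v)) = sym_d L i *s (of_int k *s v)"
      by (simp add: W_def smat_vec)
    then show "v \<in> {v. \<pi> (coroot i) *v v = (sym_d L i * of_int k) *s v}"
      using sym_d_nonzero by simp
  qed
  then have "(\<Union>k. W k) \<subseteq> (\<Union>c. {v. \<pi> (coroot i) *v v = c *s v})" by blast
  then show ?thesis using sl2_span[of i] vec.span_mono unfolding S_def by blast
qed

lemma coroot_eigenvalue_integer:
  assumes "\<pi> (coroot i) *v v = c *s v" "v \<noteq> 0" shows "c / sym_d L i \<in> \<int>"
proof -
  interpret sl2_action "(*v) (\<pi> (xplus L i))" "(*v) (smat (1 / sym_d L i) (\<pi> (xminus L i)))"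
    "(*v) (smat (1 / sym_d L i) (\<pi> (coroot i)))" by (rule sl2)
  show ?thesis
    by (rule eigenvalue_integer[OF sl2_span _ assms(2)]) (simp add: smat_vec assms(1))
qed

end

section \<open>Weight decomposition\<close>

context lie_representation
begin

lemma dual_eqI:
  assumes "\<mu> \<in> cartan_dual L" "\<nu> \<in> cartan_dual L" "\<And>h. h \<in> cartan L \<Longrightarrow> \<mu> h = \<nu> h" shows "\<mu> = \<nu>"
  using assms dual_outside by (metis ext)

lemma weight_space_subspace: "vec.subspace W \<Longrightarrow> vec.subspace (weight_space L \<pi> W \<mu>)"
  unfolding weight_space_def
  by (rule vec.subspaceI)
    (auto simp: vec.subspace_0 vec.subspace_add vec.subspace_scale matrix_vector_right_distrib
      vec.scale_right_distrib vector_scalar_commute mult.commute)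

lemma weight_vectors_independent:
  assumes "finite K" "\<And>k. k \<in> K \<Longrightarrow> wt k \<in> cartan_dual L" "inj_on wt K"
    and "\<And>k h. k \<in> K \<Longrightarrow> h \<in> cartan L \<Longrightarrow> \<pi> h *v w k = wt k h *s w k"
    and "(\<Sum>k\<in>K. w k) = 0" and k: "k \<in> K"
  shows "w k = 0"
proof -
  have "w k \<in> {0}"
  proof (rule weight_vector_separation[where sc = "(*s)" and H = "cartan L" and A = "\<lambda>h. (*v) (\<pi> h)"
        and J = "K - {k}" and u = w and wt = wt and \<beta> = "wt k" and N = "{0}"])
    show "w k + (\<Sum>j\<in>K - {k}. w j) \<in> {0}"
      using assms(1,5) k by (simp add: sum.remove[symmetric])
    show "\<exists>h\<in>cartan L. wt j h \<noteq> wt k h" if "j \<in> K - {k}" for j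
    proof -
      have "wt j \<noteq> wt k" using that assms(3) k by (auto dest: inj_onD)
      then show ?thesis using dual_eqI[OF assms(2)[of j] assms(2)[OF k]] that by blast
    qed
  qed (use assms in \<open>auto intro: vec.vector_space_axioms\<close>)
  then show ?thesis by simp
qed

lemma joint_eigenvector_weight:
  assumes "\<And>i. \<exists>c. \<pi> (coroot i) *v v = c *s v" "v \<noteq> 0"
  obtains \<mu> where "\<mu> \<in> cartan_dual L" "\<And>h. h \<in> cartan L \<Longrightarrow> \<pi> h *v v = \<mu> h *s v"
proof -
  obtain c where c: "\<And>i. \<pi> (coroot i) *v v = c i *s v" using assms(1) by metis
  have "\<exists>d. \<pi> h *v v = d *s v" if h: "h \<in> cartan L" for h
  proof -
    obtain b where b: "h = (\<Sum>i\<in>UNIV. scaleL L (b i) (coroot i))" by (rule cartan_span[OF h])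
    have sum_vec: "(\<Sum>i\<in>A. M i) *v v = (\<Sum>i\<in>A. M i *v v)" for A and M :: "'i \<Rightarrow> complex^'n^'n"
      by (induction A rule: infinite_finite_induct) (auto simp: matrix_vector_mult_add_rdistrib)
    have "\<pi> h *v v = (\<Sum>i\<in>UNIV. b i * c i) *s v"
      by (simp add: b pi_sum pi_scale sum_vec smat_vec c vec.scale_sum_left)
    then show ?thesis by blast
  qed
  then obtain d where d: "\<And>h. h \<in> cartan L \<Longrightarrow> \<pi> h *v v = d h *s v" by metis
  \<comment> \<open>Elements of \<open>cartan_dual\<close> vanish outside of the Cartan subalgebra
    by convention.\<close>
  define \<mu> where "\<mu> h = (if h \<in> cartan L then d h else 0)" for h
  have "\<mu> \<in> cartan_dual L"
    unfolding dual_def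
  proof (intro CollectI conjI ballI allI impI)
    fix h k a assume h: "h \<in> cartan L"
    show "\<mu> (h + k) = \<mu> h + \<mu> k" if k: "k \<in> cartan L"
    proof -
      have "d (h + k) *s v = (d h + d k) *s v"
        using d[OF cartan_add[OF h k]] d[OF h] d[OF k]
        by (simp add: pi_add matrix_vector_mult_add_rdistrib vec.scale_left_distrib)
      then have "d (h + k) = d h + d k" unfolding vec.scale_cancel_right using assms(2) by blast
      then show ?thesis using h k by (simp add: \<mu>_def cartan_add)
    qed
    have "d (scaleL L a h) *s v = a *s (\<pi> h *v v)"
      unfolding d[OF cartan_scale[OF h, of a], symmetric] pi_scale smat_vec ..
    then have "d (scaleL L a h) = a * d h"
      unfolding d[OF h] vec.scale_scale vec.scale_cancel_right using assms(2) by blast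
    then show "\<mu> (scaleL L a h) = a * \<mu> h" using h by (simp add: \<mu>_def cartan_scale)
  qed (simp add: \<mu>_def)
  then show thesis by (rule that) (simp add: \<mu>_def d)
qed

text \<open>Functions that agree on the Cartan subalgebra define the same
  \<open>weight_space\<close>. Giving zero to those outside of \<open>cartan_dual\<close> avoids
  counting a weight space more than once.\<close>

definition wspace :: "('g \<Rightarrow> complex) \<Rightarrow> (complex^'n) set" where
  "wspace \<mu> = (if \<mu> \<in> cartan_dual L then weight_space L \<pi> UNIV \<mu> else {0})"

lemma wspace_subspace: "vec.subspace (wspace \<mu>)"
  by (simp add: wspace_def weight_space_subspace)

lemma wspace_decomposition: "\<exists>M w. finite M \<and> (\<forall>\<mu>\<in>M. w \<mu> \<in> wspace \<mu>) \<and> x = (\<Sum>\<mu>\<in>M. w \<mu>)"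
proof (rule span_UN_decomposition[OF wspace_subspace])
  have "vec.span {v. \<forall>i\<in>UNIV. \<exists>c. \<pi> (coroot i) *v v = c *s v} = UNIV"
    by (rule joint_eigenvectors_span[OF finite cartan_commute[OF coroot_cartan coroot_cartan] coroot_diagonalizable])
  moreover have "{v. \<forall>i\<in>UNIV. \<exists>c. \<pi> (coroot i) *v v = c *s v} \<subseteq> (\<Union>\<mu>. wspace \<mu>)"
  proof
    fix v assume v: "v \<in> {v. \<forall>i\<in>UNIV. \<exists>c. \<pi> (coroot i) *v v = c *s v}"
    show "v \<in> (\<Union>\<mu>. wspace \<mu>)"
    proof (cases "v = 0")
      case True
      then show ?thesis using vec.subspace_0[OF wspace_subspace] by auto
    next
      case False
      with v obtain \<mu> where "\<mu> \<in> cartan_dual L" "\<And>h. h \<in> cartan L \<Longrightarrow> \<pi> h *v v = \<mu> h *s v"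
        using joint_eigenvector_weight[of v] by auto
      then have "v \<in> wspace \<mu>" by (simp add: wspace_def weight_space_def)
      then show ?thesis by blast
    qed
  qed
  ultimately show "x \<in> vec.span (\<Union>\<mu>. wspace \<mu>)"
    using vec.span_mono by blast
qed

text \<open>Only the finitely many weights in the decompositions of the standard basis vectors can
  occur: a vector of another weight is a sum of vectors of these weights, and independence makes it
  zero.\<close>

lemma finite_weights:
  assumes W: "vec.subspace W" shows "finite (weights L \<pi> W)"
proof -
  have "\<forall>j::'n. \<exists>M w. finite M \<and> (\<forall>\<mu>\<in>M. w \<mu> \<in> wspace \<mu>) \<and> axis j 1 = (\<Sum>\<mu>\<in>M. w \<mu>)"
    using wspace_decomposition by blast
  then obtain M w where M: "\<And>j. finite (M j)" "\<And>j \<mu>. \<mu> \<in> M j \<Longrightarrow> w j \<mu> \<in> wspace \<mu>"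
    "\<And>j. axis j 1 = (\<Sum>\<mu>\<in>M j. w j \<mu>)" by metis
  let ?M = "\<Union>j. M j"
  have "weights L \<pi> W \<subseteq> ?M"
  proof (rule subsetI, rule ccontr)
    fix \<mu> assume \<mu>: "\<mu> \<in> weights L \<pi> W" "\<mu> \<notin> ?M"
    have dual: "\<mu> \<in> cartan_dual L" using \<mu>(1) by (simp add: weights_def)
    have "v = 0" if v: "v \<in> weight_space L \<pi> W \<mu>" for v
    proof -
      define u where "u \<nu> = (\<Sum>j\<in>{j. \<nu> \<in> M j}. v $ j *s w j \<nu>)" for \<nu>
      have u: "u \<nu> \<in> wspace \<nu>" for \<nu>
        unfolding u_def by (intro vec.subspace_sum[OF wspace_subspace] vec.subspace_scale[OF wspace_subspace]) (simp add: M)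
      have "v = (\<Sum>j\<in>UNIV. v $ j *s axis j 1)" by (rule basis_expansion[symmetric])
      also have "\<dots> = (\<Sum>j\<in>UNIV. \<Sum>\<nu>\<in>?M. if \<nu> \<in> M j then v $ j *s w j \<nu> else 0)"
      proof (intro sum.cong refl)
        fix j
        have "v $ j *s axis j 1 = (\<Sum>\<nu>\<in>M j. v $ j *s w j \<nu>)"
          by (simp add: M(3) vec.scale_sum_right)
        also have "\<dots> = (\<Sum>\<nu>\<in>?M. if \<nu> \<in> M j then v $ j *s w j \<nu> else 0)"
          by (rule sum.mono_neutral_cong_left) (auto simp: M(1))
        finally show "v $ j *s axis j 1 = (\<Sum>\<nu>\<in>?M. if \<nu> \<in> M j then v $ j *s w j \<nu> else 0)" .
      qed
      also have "\<dots> = (\<Sum>\<nu>\<in>?M. u \<nu>)"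
        unfolding u_def by (subst sum.swap) (simp add: sum.If_cases)
      finally have "- v + (\<Sum>\<nu>\<in>?M. u \<nu>) = 0" by simp
      moreover have u_out: "u \<nu> = 0" if "\<nu> \<notin> cartan_dual L" for \<nu> using u[of \<nu>] that by (simp add: wspace_def)
      moreover have finM: "finite {\<nu>\<in>?M. \<nu> \<in> cartan_dual L}"
        by (rule finite_subset[of _ ?M]) (auto simp: M(1))
      ultimately have sum0: "(\<Sum>\<nu>\<in>insert \<mu> {\<nu>\<in>?M. \<nu> \<in> cartan_dual L}. if \<nu> = \<mu> then - v else u \<nu>) = 0"
      proof -
        assume *: "- v + (\<Sum>\<nu>\<in>?M. u \<nu>) = 0"
        have "(\<Sum>\<nu>\<in>?M. u \<nu>) = (\<Sum>\<nu>\<in>{\<nu>\<in>?M. \<nu> \<in> cartan_dual L}. if \<nu> = \<mu> then - v else u \<nu>)"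
          using \<mu>(2) u_out M(1) by (intro sum.mono_neutral_cong_right) auto
        then show ?thesis using * \<mu>(2) finM by simp
      qed
      have neg: "\<pi> h *v (- v) = \<mu> h *s (- v)" if "h \<in> cartan L" for h
      proof -
        have m: "- v = (-1) *s v" by (simp add: vec_eq_iff)
        show ?thesis unfolding m vector_scalar_commute using v that
          by (simp add: weight_space_def mult.commute)
      qed
      have "(if \<mu> = \<mu> then - v else u \<mu>) = 0"
      proof (rule weight_vectors_independent[where wt = "\<lambda>\<nu>. \<nu>", OF _ _ _ _ sum0])
        fix \<nu> h assume "\<nu> \<in> insert \<mu> {\<nu>\<in>?M. \<nu> \<in> cartan_dual L}" "h \<in> cartan L"
        then show "\<pi> h *v (if \<nu> = \<mu> then - v else u \<nu>) = \<nu> h *s (if \<nu> = \<mu> then - v else u \<nu>)"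
          using v u[of \<nu>] neg by (auto simp: weight_space_def wspace_def)
      qed (use dual finM in auto)
      then show ?thesis by simp
    qed
    then have "weight_space L \<pi> W \<mu> \<subseteq> {0}" by blast
    moreover have "weight_space L \<pi> W \<mu> \<noteq> {0}" using \<mu>(1) by (simp add: weights_def)
    moreover have "0 \<in> weight_space L \<pi> W \<mu>" by (rule vec.subspace_0[OF weight_space_subspace[OF W]])
    ultimately show False by blast
  qed
  then show ?thesis by (rule finite_subset) (simp add: M(1))
qed

end

section \<open>Projections onto the irreducible summands and their weight spaces\<close>

locale multiplicity_free_representation = lie_representation L \<pi>
  for L :: "('g::ab_group_add, 'i::finite) lie_data" and \<pi> :: "'g \<Rightarrow> complex^'n^'n" +
  fixes V :: "'j::finite \<Rightarrow> (complex^'n) set"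
  assumes mf: "multiplicity_free \<pi> V"
begin

lemma V_submodule: "vec.subspace (V j)" "v \<in> V j \<Longrightarrow> \<pi> x *v v \<in> V j" "V j \<noteq> {0}"
  using mf by (auto simp: multiplicity_free_def irreducible_submodule_def submodule_def)

abbreviation "proj \<equiv> projection_onto UNIV V"

lemma
  shows proj_idempotents: "idempotents UNIV proj"
    and proj_vec: "v \<in> V l \<Longrightarrow> proj j *v v = (if l = j then v else 0)"
    and proj_in: "proj j *v v \<in> V j"
proof -
  have uniq: "\<exists>!f. (\<forall>j. f j \<in> V j) \<and> v = (\<Sum>j\<in>UNIV. f j)" for v
    by (rule mf[unfolded multiplicity_free_def, THEN conjunct2, THEN conjunct2, THEN spec])
  have ex: "\<exists>w. (\<forall>k\<in>UNIV. w k \<in> V k) \<and> x = (\<Sum>k\<in>UNIV. w k)" for x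
    using ex1_implies_ex[OF uniq[of x]] by simp
  have ind: "w k = 0" if "\<forall>k\<in>UNIV. w k \<in> V k" "(\<Sum>k\<in>UNIV. w k) = 0" "k \<in> UNIV" for w k
  proof -
    have 1: "(\<forall>j. w j \<in> V j) \<and> 0 = (\<Sum>j\<in>UNIV. w j)" using that by simp
    have 2: "(\<forall>j. (\<lambda>_. 0) j \<in> V j) \<and> 0 = (\<Sum>j\<in>UNIV. (\<lambda>_. 0) j)"
      by (simp add: vec.subspace_0[OF V_submodule(1)])
    obtain f where f: "\<And>g. (\<forall>j. g j \<in> V j) \<and> 0 = (\<Sum>j\<in>UNIV. g j) \<Longrightarrow> g = f"
      by (rule ex1E[OF uniq[of 0]]) blast
    show ?thesis using f[OF 1] f[OF 2] by (metis (no_types))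
  qed
  show "idempotents UNIV proj"
    by (rule direct_sum_projections(1)) (rule finite V_submodule(1) ex | erule (2) ind)+
  show "proj j *v v = (if l = j then v else 0)" if "v \<in> V l"
    by (rule direct_sum_projections(2)[where W = V]) (rule finite V_submodule(1) ex UNIV_I that | erule (2) ind)+
  show "proj j *v v \<in> V j"
    by (rule direct_sum_projections(3)) (rule finite V_submodule(1) ex UNIV_I | erule (2) ind)+
qed

lemma proj_commute: "proj j ** \<pi> x = \<pi> x ** proj j"
proof (rule mat_eq_vecI)
  fix v
  have v: "v = (\<Sum>l\<in>UNIV. proj l *v v)"
  proof -
    have "(\<Sum>l\<in>A. proj l) *v v = (\<Sum>l\<in>A. proj l *v v)" for A
      by (induction A rule: infinite_finite_induct) (auto simp: matrix_vector_mult_add_rdistrib)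
    from this[of UNIV] show ?thesis by (simp add: idempotents_sum[OF proj_idempotents])
  qed
  have "proj j *v (\<pi> x *v (\<Sum>l\<in>UNIV. proj l *v v)) = (\<Sum>l\<in>UNIV. proj j *v (\<pi> x *v (proj l *v v)))"
    by (simp only: linear_rules(5)[OF vec_linear_mat])
  then have "proj j *v (\<pi> x *v v) = (\<Sum>l\<in>UNIV. proj j *v (\<pi> x *v (proj l *v v)))"
    by (simp only: v[symmetric])
  also have "\<dots> = (\<Sum>l\<in>UNIV. if l = j then \<pi> x *v (proj l *v v) else 0)"
    by (intro sum.cong refl proj_vec V_submodule(2) proj_in)
  finally show "(proj j ** \<pi> x) *v v = (\<pi> x ** proj j) *v v"
    by (simp flip: matrix_vector_mul_assoc)
qed

abbreviation "indices \<equiv> Sigma UNIV (\<lambda>j. weights L \<pi> (V j))"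
abbreviation "Vw \<equiv> \<lambda>(j, \<mu>). weight_space L \<pi> (V j) \<mu>"
abbreviation "wproj \<equiv> projection_onto indices Vw"

lemma finite_V_weights: "finite (weights L \<pi> (V j))"
  by (rule finite_weights[OF V_submodule(1)])

lemma finite_indices: "finite indices"
  by (intro finite_SigmaI finite_V_weights) simp

lemma proj_weight: "v \<in> wspace \<mu> \<Longrightarrow> proj j *v v \<in> weight_space L \<pi> (V j) \<mu>"
proof -
  assume v: "v \<in> wspace \<mu>"
  have "\<pi> h *v (proj j *v v) = \<mu> h *s (proj j *v v)" if "h \<in> cartan L" for h
  proof -
    have "\<pi> h *v v = \<mu> h *s v"
      using v that by (auto simp: wspace_def weight_space_def split: if_splits)
    then show ?thesis
      by (simp add: matrix_vector_mul_assoc proj_commute[symmetric]) (simp add: vector_scalar_commute flip: matrix_vector_mul_assoc)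
  qed
  then show ?thesis by (simp add: weight_space_def proj_in)
qed

lemma Vw_decomposition: "\<exists>w. (\<forall>k\<in>indices. w k \<in> Vw k) \<and> x = (\<Sum>k\<in>indices. w k)"
proof -
  have "\<exists>u. (\<forall>\<mu>. u \<mu> \<in> weight_space L \<pi> (V j) \<mu>) \<and> proj j *v x = (\<Sum>\<mu>\<in>weights L \<pi> (V j). u \<mu>)" for j
  proof -
    obtain M w where w: "finite M" "\<forall>\<mu>\<in>M. w \<mu> \<in> wspace \<mu>" "x = (\<Sum>\<mu>\<in>M. w \<mu>)"
      using wspace_decomposition by blast
    define u where "u \<mu> = (if \<mu> \<in> M then proj j *v w \<mu> else 0)" for \<mu>
    have u: "u \<mu> \<in> weight_space L \<pi> (V j) \<mu>" for \<mu>
      using w(2) proj_weight vec.subspace_0[OF weight_space_subspace[OF V_submodule(1)]] by (simp add: u_def)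
    have "u \<mu> = 0" if "\<mu> \<in> M" "\<mu> \<notin> weights L \<pi> (V j)" for \<mu>
    proof (cases "\<mu> \<in> cartan_dual L")
      case True
      then show ?thesis using that u[of \<mu>] by (auto simp: weights_def)
    next
      case False
      then have "w \<mu> = 0" using w(2) that by (auto simp: wspace_def)
      then show ?thesis by (simp add: u_def)
    qed
    then have "(\<Sum>\<mu>\<in>M. u \<mu>) = (\<Sum>\<mu>\<in>weights L \<pi> (V j). u \<mu>)"
      by - (rule sum.mono_neutral_cong[OF finite_V_weights w(1)], auto simp: u_def)
    moreover have "proj j *v x = (\<Sum>\<mu>\<in>M. u \<mu>)"
      by (simp add: w(3) linear_rules[OF vec_linear_mat] u_def)
    ultimately show ?thesis using u by auto
  qed
  then obtain u where u: "\<And>j \<mu>. u j \<mu> \<in> weight_space L \<pi> (V j) \<mu>"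
    "\<And>j. proj j *v x = (\<Sum>\<mu>\<in>weights L \<pi> (V j). u j \<mu>)" by metis
  have "(\<Sum>l\<in>A. proj l) *v x = (\<Sum>l\<in>A. proj l *v x)" for A
    by (induction A rule: infinite_finite_induct) (auto simp: matrix_vector_mult_add_rdistrib)
  from this[of UNIV] have "x = (\<Sum>j\<in>UNIV. \<Sum>\<mu>\<in>weights L \<pi> (V j). u j \<mu>)"
    by (simp add: idempotents_sum[OF proj_idempotents] u(2))
  also have "\<dots> = (\<Sum>(j, \<mu>)\<in>indices. u j \<mu>)"
    by (rule sum.Sigma) (simp_all add: finite_V_weights)
  finally show ?thesis using u(1) by (intro exI[of _ "\<lambda>(j, \<mu>). u j \<mu>"]) auto
qed

lemma Vw_independent:
  assumes w: "\<forall>k\<in>indices. w k \<in> Vw k" and sum: "(\<Sum>k\<in>indices. w k) = 0" and k: "k \<in> indices"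
  shows "w k = 0"
proof -
  obtain j \<mu> where [simp]: "k = (j, \<mu>)" by (cases k)
  have "0 = proj j *v (\<Sum>(l, \<nu>)\<in>indices. w (l, \<nu>))" using sum by simp
  also have "\<dots> = (\<Sum>l\<in>UNIV. \<Sum>\<nu>\<in>weights L \<pi> (V l). proj j *v w (l, \<nu>))"
    by (simp add: linear_rules(5)[OF vec_linear_mat] sum.Sigma finite_V_weights split_beta)
  also have "\<dots> = (\<Sum>l\<in>UNIV. if l = j then \<Sum>\<nu>\<in>weights L \<pi> (V l). w (l, \<nu>) else 0)"
  proof (intro sum.cong refl)
    fix l
    have "proj j *v w (l, \<nu>) = (if l = j then w (l, \<nu>) else 0)" if "\<nu> \<in> weights L \<pi> (V l)" for \<nu>
      by (rule proj_vec) (use w that in \<open>auto simp: weight_space_def\<close>)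
    then show "(\<Sum>\<nu>\<in>weights L \<pi> (V l). proj j *v w (l, \<nu>))
      = (if l = j then \<Sum>\<nu>\<in>weights L \<pi> (V l). w (l, \<nu>) else 0)" by simp
  qed
  finally have "(\<Sum>\<nu>\<in>weights L \<pi> (V j). w (j, \<nu>)) = 0" by simp
  then have "w (j, \<mu>) = 0"
    by (intro weight_vectors_independent[where wt = "\<lambda>\<nu>. \<nu>" and w = "\<lambda>\<nu>. w (j, \<nu>)"])
      (use w k finite_V_weights in \<open>auto simp: weights_def weight_space_def simp del: Collect_conj_eq\<close>)
  then show ?thesis by simp
qed

lemma
  shows wproj_idempotents: "idempotents indices wproj"
    and wproj_vec: "k \<in> indices \<Longrightarrow> l \<in> indices \<Longrightarrow> v \<in> Vw l \<Longrightarrow> wproj k *v v = (if l = k then v else 0)"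
    and wproj_in: "k \<in> indices \<Longrightarrow> wproj k *v v \<in> Vw k"
proof -
  have sub: "vec.subspace (Vw k)" for k by (cases k) (simp add: weight_space_subspace V_submodule)
  show "idempotents indices wproj"
    by (rule direct_sum_projections(1)) (rule finite_indices sub Vw_decomposition | erule (2) Vw_independent)+
  show "wproj k *v v = (if l = k then v else 0)" if "k \<in> indices" "l \<in> indices" "v \<in> Vw l"
    by (rule direct_sum_projections(2)[where W = Vw])
      (rule finite_indices sub Vw_decomposition that | erule (2) Vw_independent)+
  show "wproj k *v v \<in> Vw k" if "k \<in> indices"
    by (rule direct_sum_projections(3)[where W = Vw])
      (rule finite_indices sub Vw_decomposition that | erule (2) Vw_independent)+
qed

lemma pi_wproj: "h \<in> cartan L \<Longrightarrow> k \<in> indices \<Longrightarrow> \<pi> h ** wproj k = smat (snd k h) (wproj k)"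
proof (rule mat_eq_vecI)
  fix v assume "h \<in> cartan L" "k \<in> indices"
  then show "(\<pi> h ** wproj k) *v v = smat (snd k h) (wproj k) *v v"
    using wproj_in[of k v] by (cases k) (simp add: smat_vec weight_space_def flip: matrix_vector_mul_assoc)
qed

lemma pi_cartan_sum:
  assumes "h \<in> cartan L" shows "\<pi> h = (\<Sum>k\<in>indices. smat (snd k h) (wproj k))"
proof -
  have "\<pi> h = \<pi> h ** (\<Sum>k\<in>indices. wproj k)" by (simp add: idempotents_sum[OF wproj_idempotents])
  then show ?thesis unfolding mat_mult_sum_right using assms by (simp add: pi_wproj)
qed

lemma wproj_pi: "h \<in> cartan L \<Longrightarrow> k \<in> indices \<Longrightarrow> wproj k ** \<pi> h = smat (snd k h) (wproj k)"
proof -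
  assume h: "h \<in> cartan L" and k: "k \<in> indices"
  have "wproj k ** \<pi> h = (\<Sum>l\<in>indices. smat (snd l h) (wproj k ** wproj l))"
    by (subst pi_cartan_sum[OF h]) (simp add: mat_mult_sum_right mat_mult_smat)
  also have "\<dots> = (\<Sum>l\<in>indices. if k = l then smat (snd l h) (wproj k) else 0)"
    by (intro sum.cong refl) (simp add: idempotents_mult[OF wproj_idempotents] k)
  finally show ?thesis using finite_indices k by simp
qed

lemma proj_wproj: "k \<in> indices \<Longrightarrow> proj j ** wproj k = (if fst k = j then wproj k else 0)"
proof (rule mat_eq_vecI)
  fix v assume "k \<in> indices"
  then have "wproj k *v v \<in> V (fst k)"
    using wproj_in[of k v] by (cases k) (simp add: weight_space_def)
  then show "(proj j ** wproj k) *v v = (if fst k = j then wproj k else 0) *v v"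
    by (simp add: proj_vec flip: matrix_vector_mul_assoc)
qed

lemma proj_sum: "proj j = (\<Sum>\<mu>\<in>weights L \<pi> (V j). wproj (j, \<mu>))"
proof -
  have "proj j = proj j ** (\<Sum>k\<in>indices. wproj k)" by (simp add: idempotents_sum[OF wproj_idempotents])
  also have "\<dots> = (\<Sum>(l, \<mu>)\<in>indices. if l = j then wproj (l, \<mu>) else 0)"
    unfolding mat_mult_sum_right by (intro sum.cong) (auto simp: proj_wproj)
  also have "\<dots> = (\<Sum>l\<in>UNIV. \<Sum>\<mu>\<in>weights L \<pi> (V l). if l = j then wproj (l, \<mu>) else 0)"
    by (rule sum.Sigma[symmetric]) (simp_all add: finite_V_weights)
  also have "\<dots> = (\<Sum>l\<in>UNIV. if l = j then \<Sum>\<mu>\<in>weights L \<pi> (V l). wproj (l, \<mu>) else 0)"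
    by (intro sum.cong) auto
  finally show ?thesis by simp
qed

lemma wproj_nonzero: "k \<in> indices \<Longrightarrow> wproj k \<noteq> 0"
proof
  assume k: "k \<in> indices" and 0: "wproj k = 0"
  obtain j \<mu> where jm: "k = (j, \<mu>)" by (cases k)
  have "weight_space L \<pi> (V j) \<mu> \<noteq> {0}" using k jm by (auto simp: weights_def)
  moreover have "0 \<in> weight_space L \<pi> (V j) \<mu>"
    by (rule vec.subspace_0[OF weight_space_subspace[OF V_submodule(1)]])
  ultimately obtain v where v: "v \<in> weight_space L \<pi> (V j) \<mu>" "v \<noteq> 0" by blast
  then show False using wproj_vec[OF k k, of v] 0 jm by simp
qed

lemma trace_wproj:
  assumes "k \<in> indices" shows "trace (wproj k) = of_nat (vec.dim (Vw k))"
proof (rule trace_projection)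
  show "vec.subspace (Vw k)" by (cases k) (simp add: weight_space_subspace V_submodule)
qed (use wproj_vec[OF assms assms] wproj_in[OF assms] in auto)

lemma trace_proj: "trace (proj j) = of_nat (vec.dim (V j))"
  by (rule trace_projection[OF V_submodule(1) _ proj_in]) (simp add: proj_vec)

lemma dim_V: "of_nat (vec.dim (V j)) = (\<Sum>\<mu>\<in>weights L \<pi> (V j). of_nat (vec.dim (weight_space L \<pi> (V j) \<mu>)) :: complex)"
  unfolding trace_proj[symmetric] proj_sum[of j] trace_sum
  by (intro sum.cong refl) (simp add: trace_wproj)

lemma dim_V_nonzero: "vec.dim (V j) \<noteq> 0"
  using V_submodule(1,3)[of j] vec.dim_eq_0 vec.subspace_0 by (metis subset_singletonD empty_iff)

lemma dim_Vw_nonzero: "k \<in> indices \<Longrightarrow> vec.dim (Vw k) \<noteq> 0"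
proof
  assume k: "k \<in> indices" and 0: "vec.dim (Vw k) = 0"
  have "Vw k \<subseteq> {0}" using 0 by (simp only: vec.dim_eq_0)
  then have "wproj k *v v = 0" for v using subsetD[OF _ wproj_in[OF k]] by blast
  then have "wproj k = 0" by (intro mat_eq_vecI) simp
  with wproj_nonzero[OF k] show False by simp
qed

text \<open>Both sides are the trace of h on \<open>V j\<close>. A coroot is a commutator of
  operators commuting with the projection onto \<open>V j\<close>, so its trace there is zero, and
  coroots span.\<close>

lemma weight_sum_zero:
  assumes h: "h \<in> cartan L"
  shows "(\<Sum>\<mu>\<in>weights L \<pi> (V j). of_nat (vec.dim (weight_space L \<pi> (V j) \<mu>)) * \<mu> h) = 0"
proof -
  have tr: "trace (proj j ** \<pi> (coroot i)) = 0" for i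
  proof -
    let ?X = "\<pi> (xplus L i)" and ?Y = "\<pi> (xminus L i)"
    have "trace (proj j ** ?X ** ?Y) = trace (?Y ** (proj j ** ?X))" by (rule trace_mul_sym)
    also have "?Y ** (proj j ** ?X) = proj j ** ?Y ** ?X" by (simp only: matrix_mul_assoc proj_commute[symmetric, where x = "xminus L i"])
    finally show ?thesis
      by (simp add: pi_coroot mcomm_def mat_mult_diff_right trace_sub matrix_mul_assoc)
  qed
  obtain c where c: "h = (\<Sum>i\<in>UNIV. scaleL L (c i) (coroot i))" by (rule cartan_span[OF h])
  have "trace (proj j ** \<pi> h) = (\<Sum>i\<in>UNIV. c i * trace (proj j ** \<pi> (coroot i)))"
    by (simp add: c pi_sum pi_scale mat_mult_sum_right mat_mult_smat trace_sum trace_smat)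
  then have "0 = trace (proj j ** \<pi> h)" by (simp add: tr)
  also have "\<dots> = (\<Sum>\<mu>\<in>weights L \<pi> (V j). \<mu> h * trace (wproj (j, \<mu>)))"
    unfolding proj_sum[of j] mat_mult_sum_left trace_sum
    by (intro sum.cong refl) (simp add: wproj_pi h trace_smat)
  also have "\<dots> = (\<Sum>\<mu>\<in>weights L \<pi> (V j). of_nat (vec.dim (weight_space L \<pi> (V j) \<mu>)) * \<mu> h)"
    by (intro sum.cong refl) (simp add: trace_wproj)
  finally show ?thesis by simp
qed

lemma mcomm_linear:
  fixes A :: "complex^'n^'n"
  shows "mcomm A 0 = 0" "mcomm A (X + Y) = mcomm A X + mcomm A Y" "mcomm A (smat c X) = smat c (mcomm A X)"
proof -
  interpret vector_space "smat :: complex \<Rightarrow> complex^'n^'n \<Rightarrow> _" by (rule smat_vector_space)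
  show "mcomm A 0 = 0" "mcomm A (X + Y) = mcomm A X + mcomm A Y" "mcomm A (smat c X) = smat c (mcomm A X)"
    by (simp_all add: mcomm_def mat_mult_add_left mat_mult_add_right mat_mult_smat smat_mult_left
        scale_right_diff_distrib)
qed

text \<open>Resolves the definite description in \<open>gl_component\<close>. Cutting X by weight
  projections on both sides produces weight vectors of weight \<open>snd k - snd l\<close>;
  uniqueness is \<open>weight_vector_separation\<close> for the adjoint action on matrices.\<close>

lemma gl_component_eq:
  "gl_component L \<pi> \<mu> X = (\<Sum>k\<in>indices. \<Sum>l\<in>indices. if snd k - snd l = \<mu> then wproj k ** X ** wproj l else 0)"
proof -
  define f where "f \<nu> = (\<Sum>k\<in>indices. \<Sum>l\<in>indices. if snd k - snd l = \<nu> then wproj k ** X ** wproj l else 0)" for \<nu>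
  let ?D = "(\<lambda>(k, l). snd k - snd l) ` (indices \<times> indices)"
  have finD: "finite ?D" using finite_indices by blast
  have dual: "snd k \<in> cartan_dual L" if "k \<in> indices" for k using that by (auto simp: weights_def)
  have dualD: "?D \<subseteq> cartan_dual L"
  proof
    fix \<nu> assume "\<nu> \<in> ?D"
    then obtain k l where kl: "k \<in> indices" "l \<in> indices" and \<nu>: "\<nu> = snd k - snd l" by force
    show "\<nu> \<in> cartan_dual L" unfolding \<nu> using dual[OF kl(1)] dual[OF kl(2)]
      by (simp add: dual_def right_diff_distrib)
  qed
  have sub: "module.subspace smat (gl_weight L \<pi> \<nu>)" for \<nu>
  proof -
    interpret vector_space "smat :: complex \<Rightarrow> complex^'n^'n \<Rightarrow> _" by (rule smat_vector_space)
    show ?thesis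
      by (rule subspaceI) (simp_all add: gl_weight_def mcomm_linear mult.commute smat_add_right)
  qed
  have supp: "f \<nu> = 0" if "\<nu> \<notin> ?D" for \<nu>
  proof -
    have "snd k - snd l \<noteq> \<nu>" if "k \<in> indices" "l \<in> indices" for k l using \<open>\<nu> \<notin> ?D\<close> that by auto
    then show ?thesis by (simp add: f_def)
  qed
  have fin: "finite {\<nu>. f \<nu> \<noteq> 0}" by (rule finite_subset[OF _ finD]) (use supp in blast)
  have wt: "f \<nu> \<in> gl_weight L \<pi> \<nu>" for \<nu>
  proof -
    interpret vector_space "smat :: complex \<Rightarrow> complex^'n^'n \<Rightarrow> _" by (rule smat_vector_space)
    have "wproj k ** X ** wproj l \<in> gl_weight L \<pi> (snd k - snd l)" if "k \<in> indices" "l \<in> indices" for k l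
      unfolding gl_weight_def mcomm_def
    proof (intro CollectI ballI)
      fix h assume h: "h \<in> cartan L"
      have "\<pi> h ** (wproj k ** X ** wproj l) = smat (snd k h) (wproj k ** X ** wproj l)"
        by (simp add: matrix_mul_assoc pi_wproj h that smat_mult_left)
      moreover have "wproj k ** X ** wproj l ** \<pi> h = smat (snd l h) (wproj k ** X ** wproj l)"
        using wproj_pi[OF h that(2)] by (simp add: mat_mult_smat flip: matrix_mul_assoc)
      ultimately show "\<pi> h ** (wproj k ** X ** wproj l) - wproj k ** X ** wproj l ** \<pi> h
         = smat ((snd k - snd l) h) (wproj k ** X ** wproj l)"
        by (simp add: scale_left_diff_distrib)
    qed
    then show ?thesis unfolding f_def
      by (intro subspace_sum[OF sub]) (auto simp: subspace_0[OF sub])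
  qed
  have sum: "(\<Sum>\<nu> | f \<nu> \<noteq> 0. f \<nu>) = X"
  proof -
    have "(\<Sum>\<nu> | f \<nu> \<noteq> 0. f \<nu>) = (\<Sum>\<nu>\<in>?D. f \<nu>)"
      by (rule sum.mono_neutral_left[OF finD]) (use supp in auto)
    also have "\<dots> = (\<Sum>k\<in>indices. \<Sum>l\<in>indices. \<Sum>\<nu>\<in>?D. if snd k - snd l = \<nu> then wproj k ** X ** wproj l else 0)"
      unfolding f_def by (subst sum.swap) (intro sum.cong refl, subst sum.swap, rule refl)
    also have "\<dots> = (\<Sum>k\<in>indices. \<Sum>l\<in>indices. wproj k ** X ** wproj l)"
    proof (intro sum.cong refl)
      fix k l assume "k \<in> indices" "l \<in> indices"
      then have "snd k - snd l \<in> ?D" by force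
      then show "(\<Sum>\<nu>\<in>?D. if snd k - snd l = \<nu> then wproj k ** X ** wproj l else 0) = wproj k ** X ** wproj l"
        using finD by simp
    qed
    also have "\<dots> = (\<Sum>k\<in>indices. wproj k) ** X ** (\<Sum>l\<in>indices. wproj l)"
      by (simp only: mat_mult_sum_left) (simp only: mat_mult_sum_right)
    finally show ?thesis by (simp add: idempotents_sum[OF wproj_idempotents])
  qed
  have "(THE f. (\<forall>\<nu>. f \<nu> \<in> gl_weight L \<pi> \<nu>) \<and> finite {\<nu>. f \<nu> \<noteq> 0} \<and>
     {\<nu>. f \<nu> \<noteq> 0} \<subseteq> cartan_dual L \<and> (\<Sum>\<nu> | f \<nu> \<noteq> 0. f \<nu>) = X) = f"
  proof (rule the_equality)
    show "(\<forall>\<nu>. f \<nu> \<in> gl_weight L \<pi> \<nu>) \<and> finite {\<nu>. f \<nu> \<noteq> 0} \<and>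
      {\<nu>. f \<nu> \<noteq> 0} \<subseteq> cartan_dual L \<and> (\<Sum>\<nu> | f \<nu> \<noteq> 0. f \<nu>) = X"
      using wt fin sum supp dualD by blast
    fix g assume g: "(\<forall>\<nu>. g \<nu> \<in> gl_weight L \<pi> \<nu>) \<and> finite {\<nu>. g \<nu> \<noteq> 0} \<and>
      {\<nu>. g \<nu> \<noteq> 0} \<subseteq> cartan_dual L \<and> (\<Sum>\<nu> | g \<nu> \<noteq> 0. g \<nu>) = X"
    let ?K = "{\<nu>. f \<nu> \<noteq> 0} \<union> {\<nu>. g \<nu> \<noteq> 0}"
    have K: "finite ?K" "?K \<subseteq> cartan_dual L" using g fin supp dualD by auto
    have fK: "(\<Sum>\<nu>\<in>?K. f \<nu>) = X" using sum K(1) by (metis (mono_tags, lifting) mem_Collect_eq sum.mono_neutral_left[OF K(1)] Un_upper1 DiffD2)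
    have gK: "(\<Sum>\<nu>\<in>?K. g \<nu>) = X" using g K(1) by (metis (mono_tags, lifting) mem_Collect_eq sum.mono_neutral_left[OF K(1)] Un_upper2 DiffD2)
    have zero: "(\<Sum>\<nu>\<in>?K. g \<nu> - f \<nu>) = 0" by (simp add: sum_subtractf fK gK)
    interpret vector_space "smat :: complex \<Rightarrow> complex^'n^'n \<Rightarrow> _" by (rule smat_vector_space)
    have lin: "Vector_Spaces.linear smat smat (mcomm A)" for A :: "complex^'n^'n"
      unfolding Vector_Spaces.linear_iff by (simp add: smat_vector_space mcomm_linear)
    have "g \<nu> - f \<nu> \<in> {0}" if \<nu>: "\<nu> \<in> ?K" for \<nu>
    proof (rule weight_vector_separation[where sc = smat and H = "cartan L" and A = "\<lambda>h. mcomm (\<pi> h)"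
          and J = "?K - {\<nu>}" and u = "\<lambda>\<nu>. g \<nu> - f \<nu>" and wt = "\<lambda>\<nu>. \<nu>" and \<beta> = \<nu>])
      show "g \<nu> - f \<nu> + (\<Sum>j\<in>?K - {\<nu>}. g j - f j) \<in> {0}"
        using zero sum.remove[OF K(1) \<nu>, of "\<lambda>\<nu>. g \<nu> - f \<nu>"] by simp
      show "\<exists>h\<in>cartan L. j h \<noteq> \<nu> h" if "j \<in> ?K - {\<nu>}" for j
        using dual_eqI[of j \<nu>] that \<nu> K(2) by blast
      have diff: "g j - f j \<in> gl_weight L \<pi> j" for j
        using g wt by (intro subspace_diff[OF sub]) auto
      then show "mcomm (\<pi> h) (g \<nu> - f \<nu>) = smat (\<nu> h) (g \<nu> - f \<nu>)" if "h \<in> cartan L" for h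
        using that by (simp add: gl_weight_def)
      show "mcomm (\<pi> h) (g j - f j) = smat (j h) (g j - f j)" if "h \<in> cartan L" for h j
        using that diff[of j] by (simp add: gl_weight_def)
    qed (use K(1) lin in \<open>auto simp: smat_vector_space subspace_single_0 mcomm_def\<close>)
    then have "g \<nu> = f \<nu>" if "\<nu> \<in> ?K" for \<nu> using that by simp
    moreover have "g \<nu> = f \<nu>" if "\<nu> \<notin> ?K" for \<nu> using that by simp
    ultimately show "g = f" by blast
  qed
  then show ?thesis by (simp add: gl_component_def f_def)
qed

end

section \<open>The monoid of nonnegative root combinations and its height function\<close>

context lie_representation
begin

lemma Qplus_dual: "\<beta> \<in> Qplus L \<Longrightarrow> \<beta> \<in> cartan_dual L"
proof -
  assume "\<beta> \<in> Qplus L"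
  then obtain n where n: "\<beta> = (\<Sum>i\<in>UNIV. fun_scale (of_nat (n i)) (\<alpha> i))" by (auto simp: Qplus_def)
  show ?thesis
    unfolding n dual_def
    by (auto simp: fun_sum_apply fun_scale_def dual_add[OF root_dual] dual_scale[OF root_dual]
        dual_outside[OF root_dual] distrib_left sum.distrib sum_distrib_left mult_ac)
qed

lemma Qplus_0: "0 \<in> Qplus L"
  unfolding Qplus_def by (intro CollectI exI[of _ "\<lambda>_. 0"]) (auto simp: fun_eq_iff fun_sum_apply fun_scale_def)

text \<open>The sum of the coefficients in the simple roots, read off by evaluating at the sum of
  the fundamental coweights.\<close>

definition height :: "('g \<Rightarrow> complex) \<Rightarrow> nat" where
  "height \<beta> = (THE m. \<beta> (\<Sum>i\<in>UNIV. coweight L i) = of_nat m)"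

lemma coefficient_coweight:
  "(\<Sum>i\<in>UNIV. fun_scale (of_nat (n i)) (\<alpha> i)) (coweight L j) = of_nat (n j)"
  by (simp add: fun_sum_apply fun_scale_def root_coweight if_distrib cong: if_cong)

lemma height_eqI: "\<beta> (\<Sum>i\<in>UNIV. coweight L i) = of_nat m \<Longrightarrow> height \<beta> = m"
  unfolding height_def by (rule the_equality) auto

lemma height_Qplus:
  assumes "\<beta> \<in> Qplus L" shows "\<beta> (\<Sum>i\<in>UNIV. coweight L i) = of_nat (height \<beta>)"
proof -
  obtain n where n: "\<beta> = (\<Sum>i\<in>UNIV. fun_scale (of_nat (n i)) (\<alpha> i))" using assms by (auto simp: Qplus_def)
  have "\<beta> (coweight L j) = of_nat (n j)" for j
    unfolding n by (rule coefficient_coweight)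
  then have eq: "\<beta> (\<Sum>i\<in>UNIV. coweight L i) = of_nat (\<Sum>j\<in>UNIV. n j)"
    by (simp add: dual_sum[OF Qplus_dual[OF assms] coweight_cartan])
  then show ?thesis by (simp only: height_eqI[of \<beta> "\<Sum>j\<in>UNIV. n j", OF eq])
qed

lemma Qplus_add: "\<beta> \<in> Qplus L \<Longrightarrow> \<gamma> \<in> Qplus L \<Longrightarrow> \<beta> + \<gamma> \<in> Qplus L"
proof -
  assume "\<beta> \<in> Qplus L" "\<gamma> \<in> Qplus L"
  then obtain n m where "\<beta> = (\<Sum>i\<in>UNIV. fun_scale (of_nat (n i)) (\<alpha> i))"
    "\<gamma> = (\<Sum>i\<in>UNIV. fun_scale (of_nat (m i)) (\<alpha> i))" by (auto simp: Qplus_def)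
  then have "\<beta> + \<gamma> = (\<Sum>i\<in>UNIV. fun_scale (of_nat (n i + m i)) (\<alpha> i))"
    by (simp add: fun_eq_iff fun_sum_apply fun_scale_def distrib_right sum.distrib)
  then show ?thesis unfolding Qplus_def by (intro CollectI exI[of _ "\<lambda>i. n i + m i"] conjI TrueI)
qed

lemma root_Qplus: "\<alpha> i \<in> Qplus L"
  unfolding Qplus_def
  by (intro CollectI exI[of _ "\<lambda>j. if j = i then 1 else 0"])
    (simp add: fun_eq_iff fun_sum_apply fun_scale_def if_distrib if_distribR cong: if_cong)

lemma Qplus_antisym:
  assumes "\<beta> \<in> Qplus L" "- \<beta> \<in> Qplus L" shows "\<beta> = 0"
proof -
  obtain n m where n: "\<beta> = (\<Sum>i\<in>UNIV. fun_scale (of_nat (n i)) (\<alpha> i))"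
    and m: "- \<beta> = (\<Sum>i\<in>UNIV. fun_scale (of_nat (m i)) (\<alpha> i))" using assms by (auto simp: Qplus_def)
  have "of_nat (n j + m j) = (0::complex)" for j
  proof -
    have 1: "of_nat (n j) = \<beta> (coweight L j)" unfolding n by (rule coefficient_coweight[symmetric])
    have 2: "of_nat (m j) = (- \<beta>) (coweight L j)" unfolding m by (rule coefficient_coweight[symmetric])
    show ?thesis by (simp add: 1 2)
  qed
  then have "n j = 0" for j by (metis add_is_0 of_nat_eq_0_iff)
  then show ?thesis by (simp add: n fun_eq_iff fun_sum_apply fun_scale_def)
qed

lemma dual_eq_0_on_coroots:
  assumes \<beta>: "\<beta> \<in> cartan_dual L" and "\<And>i. \<beta> (coroot i) = 0" shows "\<beta> = 0"
proof
  fix h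
  show "\<beta> h = 0 h"
  proof (cases "h \<in> cartan L")
    case True
    obtain c where c: "h = (\<Sum>i\<in>UNIV. scaleL L (c i) (coroot i))" by (rule cartan_span[OF True])
    have "\<beta> h = (\<Sum>i\<in>UNIV. \<beta> (scaleL L (c i) (coroot i)))"
      unfolding c by (rule dual_sum[OF \<beta>]) (intro cartan_scale coroot_cartan)
    then show ?thesis by (simp add: dual_scale[OF \<beta>] coroot_cartan assms)
  qed (simp add: dual_outside[OF \<beta>])
qed

text \<open>Invariance of the trace form: tr([x, y] h) = tr(x [y, h]). It says that under the trace
  form a coroot is still proportional to its root.\<close>

lemma trace_coroot:
  assumes "h \<in> cartan L"
  shows "trace (\<pi> (coroot i) ** \<pi> h) = \<alpha> i h * trace (\<pi> (xplus L i) ** \<pi> (xminus L i))"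
proof -
  let ?X = "\<pi> (xplus L i)" and ?Y = "\<pi> (xminus L i)" and ?H = "\<pi> h"
  have "trace (\<pi> (coroot i) ** ?H) = trace (?X ** (?Y ** ?H)) - trace (?Y ** (?X ** ?H))"
    by (simp add: pi_coroot mcomm_def mat_mult_diff_left trace_sub matrix_mul_assoc)
  also have "trace (?Y ** (?X ** ?H)) = trace (?X ** (?H ** ?Y))"
    by (subst trace_mul_sym) (simp add: matrix_mul_assoc)
  also have "trace (?X ** (?Y ** ?H)) - \<dots> = trace (?X ** (?Y ** ?H - ?H ** ?Y))"
    by (simp add: mat_mult_diff_right trace_sub)
  also have "?Y ** ?H - ?H ** ?Y = smat (\<alpha> i h) ?Y"
  proof -
    have "?Y ** ?H - ?H ** ?Y = - mcomm ?H ?Y" by (simp add: mcomm_def)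
    then show ?thesis unfolding pi_xminus[OF assms] by (simp add: vec_eq_iff)
  qed
  finally show ?thesis by (simp add: mat_mult_smat trace_smat)
qed

end

context multiplicity_free_representation
begin

lemma trace_form:
  assumes x: "x \<in> cartan L" and y: "y \<in> cartan L"
  shows "trace (\<pi> x ** \<pi> y) = (\<Sum>k\<in>indices. of_nat (vec.dim (Vw k)) * (snd k x * snd k y))"
proof -
  have "\<pi> x ** \<pi> y = (\<Sum>k\<in>indices. smat (snd k x * snd k y) (wproj k))"
    by (subst pi_cartan_sum[OF x]) (simp add: mat_mult_sum_left smat_mult_left wproj_pi[OF y] smat_smat)
  then show ?thesis by (simp only: trace_sum trace_smat) (simp add: trace_wproj mult.commute)
qed

text \<open>The trace form of the faithful module is positive definite on the real span of the coroots;
  this replaces the positivity of the Cartan matrix.\<close>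

lemma antidominant_Qplus_zero:
  assumes \<beta>: "\<beta> \<in> Qplus L" and m: "\<And>i. - \<beta> (coroot i) / sym_d L i = of_nat (m i)"
  shows "\<beta> = 0"
proof -
  obtain n where n: "\<beta> = (\<Sum>i\<in>UNIV. fun_scale (of_nat (n i)) (\<alpha> i))" using \<beta> by (auto simp: Qplus_def)
  \<comment> \<open>The integers by which the normalized coroots h / d act on the weight spaces;
    \<open>Re\<close> only turns them into real numbers.\<close>
  define a where "a k i = Re (snd k (coroot i) / sym_d L i)" for k :: "'j \<times> ('g \<Rightarrow> complex)" and i
  define D where "D k = real (vec.dim (Vw k))" for k
  have D: "D k > 0" if "k \<in> indices" for k
    unfolding D_def of_nat_0_less_iff using dim_Vw_nonzero[OF that] by (rule neq0_conv[THEN iffD1])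
  have a: "snd k (coroot i) = sym_d L i * of_real (a k i)" if k: "k \<in> indices" for k i
  proof -
    obtain v where v: "v \<in> Vw k" "v \<noteq> 0"
    proof -
      obtain u where u: "wproj k *v u \<noteq> 0 *v u"
        using wproj_nonzero[OF k] mat_eq_vecI by blast
      show thesis by (rule that[OF wproj_in[OF k]]) (use u in simp)
    qed
    have "\<pi> (coroot i) *v v = snd k (coroot i) *s v"
      using v(1) coroot_cartan by (cases k) (simp add: weight_space_def)
    then have "snd k (coroot i) / sym_d L i \<in> \<int>" using v(2) by (rule coroot_eigenvalue_integer)
    then have "snd k (coroot i) / sym_d L i = of_real (a k i)"
      by (auto simp: a_def elim!: Ints_cases)
    then show ?thesis using sym_d_nonzero[of i] by (simp add: field_simps)
  qed
  \<comment> \<open>The Gram matrix of the normalized coroots for the trace form. The identity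
    \<open>G\<close> below expresses its entries through values of the roots, and for i = j it
    determines the constant \<open>e\<close>.\<close>
  define G where "G i j = (\<Sum>k\<in>indices. D k * (a k i * a k j))" for i j
  define e where "e i = trace (\<pi> (xplus L i) ** \<pi> (xminus L i)) / sym_d L i" for i
  have G: "of_real (G i j) = \<alpha> i (coroot j) / sym_d L j * e i" for i j
  proof -
    have "\<alpha> i (coroot j) * trace (\<pi> (xplus L i) ** \<pi> (xminus L i))
      = (\<Sum>k\<in>indices. of_nat (vec.dim (Vw k)) * (snd k (coroot i) * snd k (coroot j)))"
      by (simp only: trace_coroot[OF coroot_cartan, symmetric] trace_form[OF coroot_cartan coroot_cartan])
    also have "\<dots> = (\<Sum>k\<in>indices. sym_d L i * sym_d L j * of_real (D k * (a k i * a k j)))"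
      by (intro sum.cong refl) (simp add: a D_def)
    also have "\<dots> = sym_d L i * sym_d L j * of_real (G i j)"
      by (simp add: G_def sum_distrib_left)
    finally show ?thesis using sym_d_nonzero[of i] sym_d_nonzero[of j] by (simp add: e_def field_simps)
  qed
  have e: "e i = of_real (G i i / 2)" for i
    using G[of i i] sym_d_nonzero[of i] by (simp add: sym_d_eq field_simps)
  have Gpos: "G i i > 0" for i
  proof -
    have "G i i \<ge> 0" unfolding G_def using D by (intro sum_nonneg) (simp add: less_imp_le)
    moreover have "G i i \<noteq> 0"
    proof
      assume "G i i = 0"
      then have "D k * (a k i * a k i) = 0" if "k \<in> indices" for k
        unfolding G_def using that D finite_indices
        by (subst (asm) sum_nonneg_eq_0_iff) (auto simp: less_imp_le)
      then have "snd k (coroot i) = 0" if "k \<in> indices" for k using that D[OF that] a[OF that, of i] by force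
      then have "\<pi> (coroot i) = 0" unfolding pi_cartan_sum[OF coroot_cartan] by simp
      then have "coroot i = 0" by (rule pi_eq_0)
      then show False using root_coroot_nonzero[of i] dual_sum[OF root_dual, of "{}"] by simp
    qed
    ultimately show ?thesis by simp
  qed
  \<comment> \<open>Since \<alpha> takes the value 2 G(i,j) / G(i,i) on the normalized coroots,
    these are the coefficients of the element that represents \<beta> under the trace form. They are
    nonnegative.\<close>
  define c where "c i = 2 * real (n i) / G i i" for i
  have c: "c i \<ge> 0" for i using Gpos[of i] by (simp add: c_def)
  have \<beta>c: "\<beta> (coroot j) / sym_d L j = of_real (\<Sum>i\<in>UNIV. c i * G i j)" for j
  proof -
    have "of_nat (n i) * \<alpha> i (coroot j) / sym_d L j = of_real (c i * G i j)" for i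
    proof -
      have "c i * (G i i / 2) = real (n i)" using Gpos[of i] by (simp add: c_def)
      then have n: "of_nat (n i) = (of_real (c i) * of_real (G i i / 2) :: complex)"
        by (metis of_real_mult of_real_of_nat_eq)
      show ?thesis unfolding of_real_mult G e n by (simp only: times_divide_eq_left times_divide_eq_right mult_ac)
    qed
    then show ?thesis by (simp add: n fun_sum_apply fun_scale_def sum_divide_distrib)
  qed
  have cG: "(\<Sum>i\<in>UNIV. c i * G i j) = - real (m j)" for j
  proof -
    have "complex_of_real (\<Sum>i\<in>UNIV. c i * G i j) = of_real (- real (m j))"
      using m[of j] \<beta>c[of j] by (simp add: minus_equation_iff)
    then show ?thesis by (simp only: of_real_eq_iff)
  qed
  \<comment> \<open>The eigenvalue of the representing element on the weight space \<open>k\<close>.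
    Its squared length is the sum of - c j * m j, which is at most zero, so all eigenvalues
    vanish.\<close>
  define x where "x k = (\<Sum>i\<in>UNIV. c i * a k i)" for k
  have Dx: "(\<Sum>k\<in>indices. D k * (x k * a k j)) = (\<Sum>i\<in>UNIV. c i * G i j)" for j
    unfolding G_def x_def sum_distrib_left sum_distrib_right
    by (subst sum.swap) (intro sum.cong refl, simp add: mult_ac)
  have "(\<Sum>k\<in>indices. D k * (x k * x k)) = (\<Sum>j\<in>UNIV. c j * (\<Sum>k\<in>indices. D k * (x k * a k j)))"
  proof -
    have "D k * (x k * x k) = (\<Sum>j\<in>UNIV. c j * (D k * (x k * a k j)))" for k
      by (subst (2) x_def) (simp add: sum_distrib_left mult_ac)
    then show ?thesis unfolding sum_distrib_left by (subst sum.swap) simp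
  qed
  also have "\<dots> \<le> 0" unfolding Dx cG using c by (intro sum_nonpos) (simp add: mult_nonneg_nonneg)
  finally have "(\<Sum>k\<in>indices. D k * (x k * x k)) \<le> 0" .
  moreover have "(\<Sum>k\<in>indices. D k * (x k * x k)) \<ge> 0"
    using D by (intro sum_nonneg) (auto simp: less_imp_le)
  ultimately have "(\<Sum>k\<in>indices. D k * (x k * x k)) = 0" by linarith
  then have "D k * (x k * x k) = 0" if "k \<in> indices" for k
    using that D finite_indices by (subst (asm) sum_nonneg_eq_0_iff) (auto simp: less_imp_le)
  then have "x k = 0" if "k \<in> indices" for k using that D[OF that] by force
  then have "\<beta> (coroot j) / sym_d L j = 0" for j
    unfolding \<beta>c Dx[symmetric] by simp
  then show ?thesis using sym_d_nonzero by (intro dual_eq_0_on_coroots Qplus_dual \<beta>) simp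
qed

text \<open>Blocks between equal weights of different summands \<open>V j\<close> have weight zero
  as well, so the block diagonal form of the theorem is not automatic; \<open>block_L_eq\<close>
  shows that they vanish.\<close>

lemma weight_component_0:
  fixes X :: "'a::hbar_algebra^'n^'n"
  shows "weight_component L \<pi> 0 X
    = (\<Sum>k\<in>indices. \<Sum>l\<in>indices. if snd k = snd l then cmat (wproj k) ** X ** cmat (wproj l) else 0)"
proof -
  have unit: "(\<Sum>a\<in>UNIV. \<Sum>b\<in>UNIV. smat (X $ a $ b) (cmat (P ** mat_unit a b ** Q))) = cmat P ** X ** cmat Q"
    for P Q :: "complex^'n^'n"
  proof -
    have X: "(\<Sum>a\<in>UNIV. \<Sum>b\<in>UNIV. smat (X $ a $ b) (cmat (mat_unit a b))) = X"
    proof (rule mat_eqI)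
      fix i j
      have "(\<Sum>a\<in>UNIV. \<Sum>b\<in>UNIV. smat (X $ a $ b) (cmat (mat_unit a b))) $ i $ j
        = (\<Sum>a\<in>UNIV. \<Sum>b\<in>UNIV. if a = i then (if b = j then X $ a $ b else 0) else 0)"
        unfolding mat_sum_nth by (intro sum.cong refl) (simp add: mat_unit_def)
      also have "\<dots> = (\<Sum>a\<in>UNIV. if a = i then (\<Sum>b\<in>UNIV. if b = j then X $ a $ b else 0) else 0)"
        by (intro sum.cong refl) simp
      finally show "(\<Sum>a\<in>UNIV. \<Sum>b\<in>UNIV. smat (X $ a $ b) (cmat (mat_unit a b))) $ i $ j = X $ i $ j" by simp
    qed
    have "smat (X $ a $ b) (cmat (P ** mat_unit a b ** Q)) = cmat P ** smat (X $ a $ b) (cmat (mat_unit a b)) ** cmat Q" for a b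
      by (simp add: cmat_mult cmat_smat_mult smat_mult_left)
    then have "(\<Sum>a\<in>UNIV. \<Sum>b\<in>UNIV. smat (X $ a $ b) (cmat (P ** mat_unit a b ** Q)))
      = cmat P ** (\<Sum>a\<in>UNIV. \<Sum>b\<in>UNIV. smat (X $ a $ b) (cmat (mat_unit a b))) ** cmat Q"
      by (simp only: mat_mult_sum_left mat_mult_sum_right)
    then show ?thesis by (simp only: X)
  qed
  have gl: "smat x (cmat (gl_component L \<pi> 0 (mat_unit a b)))
    = (\<Sum>k\<in>indices. \<Sum>l\<in>indices. if snd k = snd l then smat x (cmat (wproj k ** mat_unit a b ** wproj l)) else 0)"
    for x :: 'a and a b
    unfolding gl_component_eq cmat_sum smat_sum_right by (intro sum.cong refl) simp
  have "weight_component L \<pi> 0 X = (\<Sum>a\<in>UNIV. \<Sum>b\<in>UNIV. \<Sum>k\<in>indices. \<Sum>l\<in>indices.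
      if snd k = snd l then smat (X $ a $ b) (cmat (wproj k ** mat_unit a b ** wproj l)) else 0)"
    unfolding weight_component_def gl ..
  also have "\<dots> = (\<Sum>k\<in>indices. \<Sum>l\<in>indices. \<Sum>a\<in>UNIV. \<Sum>b\<in>UNIV.
      if snd k = snd l then smat (X $ a $ b) (cmat (wproj k ** mat_unit a b ** wproj l)) else 0)"
    (is "?l = ?r")
  proof -
    let ?f = "\<lambda>a b k l. if snd k = snd l then smat (X $ a $ b) (cmat (wproj k ** mat_unit a b ** wproj l)) else 0"
    have "?l = (\<Sum>a\<in>UNIV. \<Sum>k\<in>indices. \<Sum>b\<in>UNIV. \<Sum>l\<in>indices. ?f a b k l)"
      by (rule sum.cong[OF refl], rule sum.swap)
    also have "\<dots> = (\<Sum>k\<in>indices. \<Sum>a\<in>UNIV. \<Sum>b\<in>UNIV. \<Sum>l\<in>indices. ?f a b k l)"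
      by (rule sum.swap)
    also have "\<dots> = (\<Sum>k\<in>indices. \<Sum>a\<in>UNIV. \<Sum>l\<in>indices. \<Sum>b\<in>UNIV. ?f a b k l)"
      by (rule sum.cong[OF refl], rule sum.cong[OF refl], rule sum.swap)
    also have "\<dots> = ?r" by (rule sum.cong[OF refl], rule sum.swap)
    finally show ?thesis .
  qed
  also have "\<dots> = (\<Sum>k\<in>indices. \<Sum>l\<in>indices. if snd k = snd l then cmat (wproj k) ** X ** cmat (wproj l) else 0)"
    by (intro sum.cong refl) (simp add: unit)
  finally show ?thesis .
qed

end

section \<open>Locally nilpotent commutators modulo \<open>\<hbar>\<close>\<close>

lemma hlinear_comm: "hlinear (comm x)"
  by (simp add: hlinear_def comm_def distrib_left distrib_right right_diff_distrib
      of_fps_left_commute[of x] mult.assoc)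

lemma comm_add_left: "comm (x + y) z = comm x z + comm y (z :: 'a::ring)"
  by (simp add: comm_def distrib_left distrib_right)

lemma comm_scale_left: "comm (of_fps c * x) y = of_fps c * comm x (y::'a::hbar_algebra)"
  by (simp add: comm_def right_diff_distrib of_fps_left_commute[of y] mult.assoc)

lemma comm_mult_right: "comm f (x * y) = comm f x * y + x * comm f (y :: 'a::ring)"
  by (simp add: comm_def algebra_simps)

lemma comm_jacobi: "comm a (comm b x) = comm (comm a b) x + comm b (comm a (x :: 'a::ring))"
  by (simp add: comm_def algebra_simps)

lemma comm_tensor_left: "comm (x \<otimes> 1) (a \<otimes> b) = comm x a \<otimes> b"
  and comm_tensor_right: "comm (1 \<otimes> y) (a \<otimes> b) = a \<otimes> comm y b"
  by (simp_all add: comm_def tensor_mult hlinear_diff[OF hlinear_tensor_left] hlinear_diff[OF hlinear_tensor_right])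

lemma hcong_comm: "hcong n x x' \<Longrightarrow> hcong n y y' \<Longrightarrow> hcong n (comm x y) (comm x' y')"
  unfolding comm_def by (intro hcong_diff hcong_mult)

lemma hcong_comm_power: "hcong n f f' \<Longrightarrow> hcong n x x' \<Longrightarrow> hcong n ((comm f ^^ k) x) ((comm f' ^^ k) x')"
  by (induction k) (auto intro: hcong_comm)

lemma comm_power_0: "(comm f ^^ k) 0 = (0 :: 'a::ring)"
  by (induction k) (simp_all add: comm_def)

lemma comm_power_add: "(comm f ^^ k) (x + y) = (comm f ^^ k) x + (comm f ^^ k) (y :: 'a::hbar_algebra)"
  by (induction k) (simp_all add: hlinear_add[OF hlinear_comm])

lemma comm_power_scale: "(comm f ^^ k) (of_fps c * x) = of_fps c * (comm f ^^ k) (x :: 'a::hbar_algebra)"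
  by (induction k) (simp_all add: hlinear_scale[OF hlinear_comm])

text \<open>The elements killed modulo \<hbar> by some power of ad f. They form a closed subalgebra,
  so nilpotency on generators, given by the Serre relations, extends to all they generate.\<close>

definition ad_nilpotent :: "'a::hbar_algebra \<Rightarrow> 'a set" where
  "ad_nilpotent f = {x. \<exists>k. hcong 1 ((comm f ^^ k) x) 0}"

lemma comm_power_mono:
  assumes "hcong 1 ((comm f ^^ k) x) 0" "k \<le> l" shows "hcong 1 ((comm f ^^ l) x) 0"
proof -
  have "(comm f ^^ l) x = (comm f ^^ (l - k)) ((comm f ^^ k) x)"
    using assms(2) by (metis comp_apply funpow_add le_add_diff_inverse2)
  then show ?thesis using hcong_comm_power[OF hcong_refl assms(1), where f = f and k = "l - k"] by (simp add: comm_power_0)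
qed

lemma hsubmodule_ad_nilpotent: "hsubmodule (ad_nilpotent f)"
  unfolding hsubmodule_def
proof (intro conjI ballI allI)
  show "0 \<in> ad_nilpotent f" by (auto simp: ad_nilpotent_def comm_power_0)
  fix x y c assume "x \<in> ad_nilpotent f"
  then obtain k where k: "hcong 1 ((comm f ^^ k) x) 0" by (auto simp: ad_nilpotent_def)
  show "of_fps c * x \<in> ad_nilpotent f"
    using hcong_mult_left[OF k, of "of_fps c"] by (auto simp: ad_nilpotent_def comm_power_scale simp del: One_nat_def)
  assume "y \<in> ad_nilpotent f"
  then obtain l where l: "hcong 1 ((comm f ^^ l) y) 0" by (auto simp: ad_nilpotent_def)
  have "hcong 1 ((comm f ^^ (k + l)) (x + y)) (0 + 0)"
    unfolding comm_power_add
    by (intro hcong_add comm_power_mono[OF k] comm_power_mono[OF l]) auto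
  then show "x + y \<in> ad_nilpotent f" by (auto simp: ad_nilpotent_def)
qed

text \<open>Membership depends only on the residue modulo \<hbar>, so an approximation modulo
  \<hbar> already decides it; no uniform bound on the exponents is involved.\<close>

lemma hclosed_ad_nilpotent: "hclosed (ad_nilpotent f)"
  unfolding hclosed_def
proof (intro allI impI)
  fix x assume "\<forall>n. \<exists>y\<in>ad_nilpotent f. hcong n x y"
  then obtain y where y: "y \<in> ad_nilpotent f" "hcong 1 x y" by blast
  then obtain k where "hcong 1 ((comm f ^^ k) y) 0" by (auto simp: ad_nilpotent_def)
  then have "hcong 1 ((comm f ^^ k) x) 0" by (rule hcong_trans[OF hcong_comm_power[OF hcong_refl y(2)]])
  then show "x \<in> ad_nilpotent f" by (auto simp: ad_nilpotent_def)
qed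

text \<open>Leibniz rule: each commutator falls on one of the factors and lowers one of the two
  exponents.\<close>

lemma comm_power_mult:
  "hcong 1 ((comm f ^^ k) x) 0 \<Longrightarrow> hcong 1 ((comm f ^^ l) y) 0 \<Longrightarrow> hcong 1 ((comm f ^^ (k + l)) (x * y)) 0"
proof (induction "k + l" arbitrary: k l x y)
  case 0
  then have "hcong 1 (x * y) (0 * y)" by (intro hcong_mult) auto
  with 0 show ?case by simp
next
  case (Suc n)
  show ?case
  proof (cases "k = 0 \<or> l = 0")
    case True
    then have "hcong 1 (x * y) 0"
      using Suc.prems hcong_mult_right[of 1 x 0 y] hcong_mult_left[of 1 y 0 x] by auto
    then show ?thesis using hcong_comm_power[OF hcong_refl, where n = 1 and x = "x * y" and x' = 0 and f = f and k = "k + l"] by (simp add: comm_power_0)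
  next
    case False
    then obtain k' l' where kl: "k = Suc k'" "l = Suc l'" by (metis not0_implies_Suc)
    have 1: "hcong 1 ((comm f ^^ (k' + l)) (comm f x * y)) 0"
      using Suc.hyps(1)[of k' l "comm f x" y] Suc.hyps(2) Suc.prems by (simp add: kl funpow_swap1)
    have 2: "hcong 1 ((comm f ^^ (k + l')) (x * comm f y)) 0"
      using Suc.hyps(1)[of k l' x "comm f y"] Suc.hyps(2) Suc.prems by (simp add: kl funpow_swap1)
    have "(comm f ^^ (k + l)) (x * y) = (comm f ^^ (k' + l)) (comm f x * y) + (comm f ^^ (k + l')) (x * comm f y)"
    proof -
      have j: "k + l = Suc (k' + l)" "k + l' = k' + l" by (simp_all add: kl)
      show ?thesis unfolding j by (simp only: funpow_Suc_right o_apply comm_mult_right comm_power_add)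
    qed
    then show ?thesis using hcong_add[OF 1 2] by simp
  qed
qed

lemma ad_nilpotent_mult: "x \<in> ad_nilpotent f \<Longrightarrow> y \<in> ad_nilpotent f \<Longrightarrow> x * y \<in> ad_nilpotent f"
  unfolding ad_nilpotent_def using comm_power_mult by blast

lemma ad_nilpotent_1: "1 \<in> ad_nilpotent f"
  unfolding ad_nilpotent_def by (intro CollectI exI[of _ 1]) (simp add: comm_def)

lemma ad_nilpotent_tensor:
  assumes "b \<in> ad_nilpotent f" shows "a \<otimes> b \<in> ad_nilpotent (1 \<otimes> f)"
proof -
  obtain k where k: "hcong 1 ((comm f ^^ k) b) 0" using assms by (auto simp: ad_nilpotent_def)
  have "(comm (1 \<otimes> f) ^^ j) (a \<otimes> b) = a \<otimes> (comm f ^^ j) b" for j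
    by (induction j) (simp_all add: comm_tensor_right)
  then show ?thesis
    using hlinear_hcong[OF hlinear_tensor_right[of a] k]
    by (auto simp: ad_nilpotent_def hlinear_0[OF hlinear_tensor_right])
qed

text \<open>The sl2 argument modulo \<hbar>. With u k = (ad f)^k v one has [e, u (k+1)] = (k + 1)(m
  - k) u k. If u (l+1) is the first term divisible by \<hbar>, the left side is zero modulo \<hbar>
  for k = l while u l is not, so m = l.\<close>

lemma highest_weight_natural:
  fixes e f h v :: "'a::hbar_algebra"
  assumes ef: "hcong 1 (comm e f) h" and hf: "hcong 1 (comm h f) (of_cx (- 2) * f)"
    and hv: "hcong 1 (comm h v) (of_cx m * v)" and ev: "hcong 1 (comm e v) 0"
    and nil: "v \<in> ad_nilpotent f" and v: "\<not> hcong 1 v 0"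
  shows "\<exists>k::nat. m = of_nat k"
proof -
  define u where "u k = (comm f ^^ k) v" for k
  have u_Suc: "u (Suc k) = comm f (u k)" for k by (simp add: u_def)
  note lin = hlinear_scale[OF hlinear_comm]
  have h: "hcong 1 (comm h (u k)) (of_cx (m - 2 * of_nat k) * u k)" for k
  proof (induction k)
    case (Suc k)
    have "comm h (u (Suc k)) = comm (comm h f) (u k) + comm f (comm h (u k))"
      unfolding u_Suc by (rule comm_jacobi)
    also have "hcong 1 \<dots> (comm (of_cx (- 2) * f) (u k) + comm f (of_cx (m - 2 * of_nat k) * u k))"
      by (intro hcong_add hcong_comm hf Suc hcong_refl)
    also have "\<dots> = of_cx (- 2 + (m - 2 * of_nat k)) * u (Suc k)"
      unfolding comm_scale_left lin u_Suc of_cx_add distrib_right ..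
    also have "- 2 + (m - 2 * of_nat k) = m - 2 * of_nat (Suc k)" by simp
    finally show ?case .
  qed (use hv in \<open>simp add: u_def\<close>)
  have e: "hcong 1 (comm e (u (Suc k))) (of_cx (of_nat (Suc k) * (m - of_nat k)) * u k)" for k
  proof (induction k)
    case 0
    have "comm e (u (Suc 0)) = comm (comm e f) (u 0) + comm f (comm e (u 0))"
      unfolding u_Suc by (rule comm_jacobi)
    also have "hcong 1 \<dots> (comm h (u 0) + comm f 0)"
      using ev by (intro hcong_add hcong_comm ef) (auto simp: u_def)
    also have "hcong 1 \<dots> (of_cx (m - 2 * of_nat 0) * u 0 + 0)"
      by (intro hcong_add h) (simp add: comm_def)
    finally show ?case by simp
  next
    case (Suc k)
    have "comm e (u (Suc (Suc k))) = comm (comm e f) (u (Suc k)) + comm f (comm e (u (Suc k)))"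
      unfolding u_Suc[of "Suc k"] by (rule comm_jacobi)
    also have "hcong 1 \<dots> (comm h (u (Suc k)) + comm f (of_cx (of_nat (Suc k) * (m - of_nat k)) * u k))"
      by (intro hcong_add hcong_comm ef Suc hcong_refl)
    also have "hcong 1 \<dots> (of_cx (m - 2 * of_nat (Suc k)) * u (Suc k)
        + of_cx (of_nat (Suc k) * (m - of_nat k)) * u (Suc k))"
      unfolding lin u_Suc[symmetric] by (intro hcong_add h hcong_refl)
    also have "\<dots> = of_cx (m - 2 * of_nat (Suc k) + of_nat (Suc k) * (m - of_nat k)) * u (Suc k)"
      unfolding of_cx_add distrib_right ..
    also have "m - 2 * of_nat (Suc k) + of_nat (Suc k) * (m - of_nat k) = of_nat (Suc (Suc k)) * (m - of_nat (Suc k))"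
      by (simp add: algebra_simps)
    finally show ?case .
  qed
  obtain K where K: "hcong 1 (u K) 0" using nil by (auto simp: ad_nilpotent_def u_def)
  define k where "k = (LEAST k. hcong 1 (u k) 0)"
  have uk: "hcong 1 (u k) 0" unfolding k_def by (rule LeastI[of _ K]) (rule K)
  have "k \<noteq> 0" using uk v by (intro notI) (simp add: u_def)
  then obtain l where l: "k = Suc l" by (cases k) auto
  have ul: "\<not> hcong 1 (u l) 0" using not_less_Least[of l "\<lambda>k. hcong 1 (u k) 0", folded k_def] l by simp
  let ?c = "of_nat (Suc l) * (m - of_nat l)"
  have "hcong 1 (of_cx ?c * u l) (comm e (u k))" unfolding l by (rule hcong_sym[OF e])
  also have "hcong 1 \<dots> (comm e 0)" by (intro hcong_comm uk hcong_refl)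
  finally have "hcong 1 (of_cx ?c * u l) 0" by (simp add: comm_def)
  from hcong_mult_left[OF this, of "of_cx (inverse ?c)"] have "?c = 0"
    using ul of_cx_cancel[of ?c "u l"] by (cases "?c = 0") (auto simp del: of_nat_Suc)
  then have "m = of_nat l" by (simp del: of_nat_Suc)
  then show ?thesis by blast
qed

section \<open>Quantum integers and the quantum Serre relations modulo \<open>\<hbar>\<close>\<close>

lemma hcong_of_fps: "hcong 1 (of_fps u * x) (of_cx (fps_nth u 0) * (x::'a::hbar_algebra))"
proof -
  have u: "u = fps_const (fps_nth u 0) + fps_X * fps_shift 1 u"
    by (rule fps_ext) auto
  have "of_fps u * x - of_cx (fps_nth u 0) * x = \<hbar> ^ 1 * (of_fps (fps_shift 1 u) * x)"
    by (subst (1) u) (simp only: of_fps_add of_fps_mult distrib_right mult.assoc add_diff_cancel_left' power_one_right)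
  then show ?thesis unfolding hcong_def by blast
qed

text \<open>The quotient of q^d - q^(-d) by \<hbar>. Its constant term is d, so it is a unit for
  nonzero d; quotients of q-numbers are evaluated at \<hbar> = 0 through it.\<close>

definition qshift :: "complex \<Rightarrow> complex fps" where
  "qshift d = fps_shift 1 (qscal d - qscal (- d))"

lemma qshift: "qscal d - qscal (- d) = fps_X * qshift d" and qshift_nth_0: "fps_nth (qshift d) 0 = d"
  by (rule fps_ext, simp add: qshift_def qscal_def, simp add: qshift_def qscal_def)

lemma qint_nth_0:
  assumes "d \<noteq> 0" shows "fps_nth (qint d n) 0 = of_nat n"
proof -
  have "qint d n = (fps_X * qshift (d * of_nat n)) / (fps_X * qshift d)"
    unfolding qint_def qshift[symmetric] by simp
  also have "\<dots> = qshift (d * of_nat n) / qshift d" by (simp add: fps_divide_cancel)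
  also have "\<dots> = qshift (d * of_nat n) * inverse (qshift d)"
    by (rule fps_divide_unit) (simp add: qshift_nth_0 assms)
  finally show ?thesis using assms by (simp add: qshift_nth_0)
qed

lemma qfact_nth_0: "d \<noteq> 0 \<Longrightarrow> fps_nth (qfact d n) 0 = fact n"
  unfolding qfact_def by (induction n) (simp_all add: qint_nth_0)

lemma qbinom_nth_0:
  assumes "d \<noteq> 0" "k \<le> n" shows "fps_nth (qbinom d n k) 0 = of_nat (n choose k)"
proof -
  have "qbinom d n k = qfact d n * inverse (qfact d k * qfact d (n - k))"
    unfolding qbinom_def by (rule fps_divide_unit) (simp add: qfact_nth_0 assms)
  then show ?thesis by (simp add: qfact_nth_0 assms binomial_fact divide_inverse)
qed

lemma comm_power_binomial:
  fixes x y :: "'a::hbar_algebra"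
  shows "(comm x ^^ m) y = (\<Sum>k\<le>m. of_cx ((- 1) ^ k * of_nat (m choose k)) * (x ^ (m - k) * y * x ^ k))"
proof (induction m)
  case (Suc m)
  let ?a = "\<lambda>m k. (- 1) ^ k * of_nat (m choose k) :: complex"
  let ?t = "\<lambda>k. x ^ (Suc m - k) * y * x ^ k"
  have "x * (\<Sum>k\<le>m. of_cx (?a m k) * (x ^ (m - k) * y * x ^ k)) = (\<Sum>k\<le>m. of_cx (?a m k) * ?t k)"
    unfolding sum_distrib_left
    by (intro sum.cong refl) (simp add: of_fps_left_commute[of x] Suc_diff_le mult.assoc)
  also have "\<dots> = of_cx (?a m 0) * ?t 0 + (\<Sum>k\<le>m. of_cx (?a m (Suc k)) * ?t (Suc k))"
  proof -
    have "(\<Sum>k\<le>m. of_cx (?a m k) * ?t k) = (\<Sum>k\<le>Suc m. of_cx (?a m k) * ?t k)" by (simp add: binomial_eq_0)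
    then show ?thesis by (simp only: sum.atMost_Suc_shift)
  qed
  finally have 1: "x * (\<Sum>k\<le>m. of_cx (?a m k) * (x ^ (m - k) * y * x ^ k))
    = of_cx (?a m 0) * ?t 0 + (\<Sum>k\<le>m. of_cx (?a m (Suc k)) * ?t (Suc k))" .
  have 2: "(\<Sum>k\<le>m. of_cx (?a m k) * (x ^ (m - k) * y * x ^ k)) * x = (\<Sum>k\<le>m. of_cx (?a m k) * ?t (Suc k))"
    unfolding sum_distrib_right
    by (intro sum.cong refl) (simp add: mult.assoc power_commutes)
  have "(comm x ^^ Suc m) y = of_cx (?a m 0) * ?t 0 + (\<Sum>k\<le>m. of_cx (?a m (Suc k)) * ?t (Suc k))
      - (\<Sum>k\<le>m. of_cx (?a m k) * ?t (Suc k))"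
    by (simp only: funpow.simps o_apply Suc comm_def 1 2)
  also have "\<dots> = of_cx (?a (Suc m) 0) * ?t 0 + (\<Sum>k\<le>m. of_cx (?a (Suc m) (Suc k)) * ?t (Suc k))"
  proof -
    have "of_cx (?a m (Suc k)) * ?t (Suc k) - of_cx (?a m k) * ?t (Suc k) = of_cx (?a (Suc m) (Suc k)) * ?t (Suc k)" for k
    proof -
      have "?a m (Suc k) - ?a m k = ?a (Suc m) (Suc k)" by (simp add: algebra_simps)
      then show ?thesis by (metis left_diff_distrib of_cx_diff)
    qed
    then show ?thesis by (simp add: add_diff_eq[symmetric] sum_subtractf[symmetric] del: sum.atMost_Suc binomial_Suc_Suc power_Suc)
  qed
  also have "\<dots> = (\<Sum>k\<le>Suc m. of_cx (?a (Suc m) k) * ?t k)" by (simp only: sum.atMost_Suc_shift)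
  finally show ?case .
qed simp

text \<open>Modulo \<hbar> the q-binomials become binomials, and the Serre sum becomes a power of ad
  x applied to y. Only the existence of some exponent matters, so the value of \<open>a\<close> is
  left open.\<close>

lemma q_serre_ad_nilpotent:
  fixes x y :: "'a::hbar_algebra"
  assumes "d \<noteq> 0" "q_serre d a x y = 0" shows "y \<in> ad_nilpotent x"
proof -
  define m where "m = nat (1 - a)"
  have "hcong 1 (\<Sum>k\<le>m. of_fps ((- 1) ^ k * qbinom d m k) * (x ^ (m - k) * y * x ^ k))
    (\<Sum>k\<le>m. of_cx ((- 1) ^ k * of_nat (m choose k)) * (x ^ (m - k) * y * x ^ k))"
  proof (rule hcong_sum)
    fix k assume "k \<in> {..m}"
    then have "fps_nth ((- 1) ^ k * qbinom d m k) 0 = (- 1) ^ k * of_nat (m choose k)"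
      by (simp add: qbinom_nth_0 assms(1) fps_nth_power_0)
    then show "hcong 1 (of_fps ((- 1) ^ k * qbinom d m k) * (x ^ (m - k) * y * x ^ k))
      (of_cx ((- 1) ^ k * of_nat (m choose k)) * (x ^ (m - k) * y * x ^ k))"
      using hcong_of_fps[of "(- 1) ^ k * qbinom d m k"] by metis
  qed
  then have "hcong 1 (q_serre d a x y) ((comm x ^^ m) y)"
    unfolding comm_power_binomial q_serre_def Let_def m_def .
  then have "hcong 1 ((comm x ^^ m) y) 0" using assms(2) hcong_sym by metis
  then show ?thesis by (auto simp: ad_nilpotent_def)
qed

lemma qpow_diff: "\<exists>v. qpow x - qpow (- x) = \<hbar> * (x + \<hbar> * (v::'a::hbar_algebra))"
proof -
  have q: "hcong 2 (qpow y) (1 + of_cx (1/2) * (\<hbar> * y))" for y :: 'a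
  proof -
    have "hcong 2 (qpow y) (\<Sum>n<2. of_cx (1 / fact n) * (of_fps (fps_const (1/2) * fps_X) * y) ^ n)"
      by (rule qpow_trunc)
    also have "\<dots> = 1 + of_cx (1/2) * (\<hbar> * y)"
      by (simp add: eval_nat_numeral of_fps_mult mult.assoc)
    finally show ?thesis .
  qed
  have "hcong 2 (qpow x - qpow (- x)) ((1 + of_cx (1/2) * (\<hbar> * x)) - (1 + of_cx (1/2) * (\<hbar> * (- x))))"
    by (intro hcong_diff q)
  also have "(1 + of_cx (1/2) * (\<hbar> * x)) - (1 + of_cx (1/2) * (\<hbar> * (- x))) = of_cx (1/2 + 1/2) * (\<hbar> * x)"
    unfolding of_cx_add distrib_right by simp
  finally obtain v where "qpow x - qpow (- x) - \<hbar> * x = \<hbar> ^ 2 * v"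
    by (auto simp: hcong_def)
  then have "qpow x - qpow (- x) = \<hbar> * (x + \<hbar> * v)"
    by (simp add: diff_eq_eq power2_eq_square distrib_left mult.assoc)
  then show ?thesis by blast
qed

lemma hdiv_unique:
  assumes "of_fps c * y = x" "\<And>y'. of_fps c * y' = x \<Longrightarrow> y' = y" shows "hdiv x c = y"
  unfolding hdiv_def by (rule the_equality) (rule assms(1), rule assms(2))

lemma fps_hbar_torsion_free: "\<hbar> * (z :: 'a::complex_algebra_1 fps) = 0 \<Longrightarrow> z = 0"
proof (rule fps_ext)
  fix n assume "\<hbar> * z = 0"
  then have "fps_X * z = 0" using of_fps_X_power[of 1, where 'a = 'a] by simp
  then have "fps_nth (fps_X * z) (Suc n) = 0" by simp
  then show "fps_nth z n = fps_nth 0 n" by simp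
qed

text \<open>The quotient in the relation for E and F is formed in the free algebra, a ring of power
  series, where \<hbar> can be cancelled and the quotient is unique. The divisor is \<hbar> times a
  unit with constant term d.\<close>

lemma hdiv_qpow:
  fixes x :: "'a::complex_algebra_1 fps"
  assumes "d \<noteq> 0"
  shows "hcong 1 (hdiv (qpow x - qpow (- x)) (qscal d - qscal (- d))) (of_cx (1 / d) * x)"
proof -
  define u where "u = inverse (qshift d)"
  have u: "qshift d * u = 1" "u * qshift d = 1" "fps_nth u 0 = 1 / d"
    using assms by (simp_all add: u_def qshift_nth_0 inverse_mult_eq_1 inverse_mult_eq_1' divide_inverse)
  obtain v where v: "qpow x - qpow (- x) = \<hbar> * (x + \<hbar> * v)" using qpow_diff by blast
  have "hdiv (qpow x - qpow (- x)) (qscal d - qscal (- d)) = of_fps u * (x + \<hbar> * v)"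
  proof (rule hdiv_unique)
    show "of_fps (qscal d - qscal (- d)) * (of_fps u * (x + \<hbar> * v)) = qpow x - qpow (- x)"
      unfolding qshift v mult.assoc[symmetric] of_fps_mult[symmetric] by (simp add: mult.assoc u)
    fix y assume "of_fps (qscal d - qscal (- d)) * y = qpow x - qpow (- x)"
    then have "of_fps (fps_X * qshift d) * y = \<hbar> * (x + \<hbar> * v)" by (simp only: qshift v)
    then have "\<hbar> * (of_fps (qshift d) * y - (x + \<hbar> * v)) = 0"
      by (simp only: of_fps_mult mult.assoc right_diff_distrib diff_self)
    then have "of_fps (qshift d) * y - (x + \<hbar> * v) = 0" by (rule fps_hbar_torsion_free)
    then have "of_fps u * (of_fps (qshift d) * y) = of_fps u * (x + \<hbar> * v)" by simp
    then show "y = of_fps u * (x + \<hbar> * v)"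
      unfolding mult.assoc[symmetric] of_fps_mult[symmetric] u by simp
  qed
  also have "hcong 1 (of_fps u * (x + \<hbar> * v)) (of_fps u * x)"
    using hcong_mult_left[OF hcong_add[OF hcong_refl[of 1 x] hcong_hpow[of 1 1 v]], of "of_fps u"] by simp
  also have "hcong 1 \<dots> (of_cx (fps_nth u 0) * x)" by (rule hcong_of_fps)
  finally show ?thesis by (simp add: u(3))
qed

section \<open>The universal R-matrix modulo \<open>\<hbar>\<close>\<close>

locale quantum_double_setup = multiplicity_free_representation L \<pi> V
  for L :: "('g::ab_group_add, 'i::finite) lie_data" and \<pi> :: "'g \<Rightarrow> complex^'n^'n"
    and V :: "'j::finite \<Rightarrow> (complex^'n) set" +
  fixes Q :: "('g, 'i, 'u::hbar_algebra, 'c::hbar_algebra) double"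
  assumes double: "quantum_double L Q"
begin

lemma presentation:
  "presented_by (GH ` cartan L \<union> range GE \<union> range GF)
     (case_ugen (Uh Q) (UE Q) (UF Q)) (quantum_relations L)"
  using double unfolding quantum_double_def by (elim conjE)

text \<open>The defining relations, pushed through the evaluation map. Those between E and F and
  among the F are kept only modulo \<hbar>, which is all that the proof of \<open>R_cong_1\<close>
  uses.\<close>

lemma
  shows Uh_commute: "x \<in> cartan L \<Longrightarrow> y \<in> cartan L \<Longrightarrow> Uh Q x * Uh Q y = Uh Q y * Uh Q x"
    and comm_Uh_E: "x \<in> cartan L \<Longrightarrow> comm (Uh Q x) (UE Q i) = of_cx (\<alpha> i x) * UE Q i"
    and comm_Uh_F: "x \<in> cartan L \<Longrightarrow> comm (Uh Q x) (UF Q i) = of_cx (- \<alpha> i x) * UF Q i"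
    and comm_E_F: "hcong 1 (comm (UE Q i) (UF Q i)) (of_cx (1 / sym_d L i) * Uh Q (coroot i))"
    and serre_F: "UF Q j \<in> ad_nilpotent (UF Q i)"
proof -
  obtain ev where ev: "hhom ev"
    and gen: "\<And>x. x \<in> GH ` cartan L \<union> range GE \<union> range GF \<Longrightarrow> ev (hvar x) = case_ugen (Uh Q) (UE Q) (UF Q) x"
    and rel: "\<And>r. r \<in> quantum_relations L \<Longrightarrow> ev r = 0"
    by (rule presented_by_evaluation[OF presentation]) blast
  note l = hhom_hlinear[OF ev]
  have gH: "ev (hvar (GH x)) = Uh Q x" if "x \<in> cartan L" for x using gen[of "GH x"] that by simp
  have gE: "ev (hvar (GE i)) = UE Q i" and gF: "ev (hvar (GF i)) = UF Q i" for i
    using gen[of "GE i"] gen[of "GF i"] by simp_all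
  have evc: "ev (comm a b) = comm (ev a) (ev b)" for a b
    by (simp add: comm_def hlinear_diff[OF l] hhom_mult[OF ev])
  show "Uh Q x * Uh Q y = Uh Q y * Uh Q x" if x: "x \<in> cartan L" and y: "y \<in> cartan L"
  proof -
    have "comm (hvar (GH x)) (hvar (GH y)) \<in> quantum_relations L"
      using x y unfolding quantum_relations_def Let_def
      by - (rule UnI1, rule UnI1, rule UnI1, rule UnI1, rule UnI1, rule UnI2, blast)
    from rel[OF this] have "comm (Uh Q x) (Uh Q y) = 0" by (simp only: evc gH[OF x] gH[OF y])
    then show ?thesis by (simp add: comm_def)
  qed
  show "comm (Uh Q x) (UE Q i) = of_cx (\<alpha> i x) * UE Q i" if x: "x \<in> cartan L"
  proof -
    have "comm (hvar (GH x)) (hvar (GE i)) - of_cx (\<alpha> i x) * hvar (GE i) \<in> quantum_relations L"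
      using x unfolding quantum_relations_def Let_def
      by - (rule UnI1, rule UnI1, rule UnI1, rule UnI1, rule UnI2, blast)
    from rel[OF this] show ?thesis by (simp add: hlinear_diff[OF l] hlinear_scale[OF l] evc gH x gE)
  qed
  show "comm (Uh Q x) (UF Q i) = of_cx (- \<alpha> i x) * UF Q i" if x: "x \<in> cartan L"
  proof -
    have "comm (hvar (GH x)) (hvar (GF i)) + of_cx (\<alpha> i x) * hvar (GF i) \<in> quantum_relations L"
      using x unfolding quantum_relations_def Let_def
      by - (rule UnI1, rule UnI1, rule UnI1, rule UnI2, blast)
    from rel[OF this] show ?thesis
      by (simp add: hlinear_add[OF l] hlinear_scale[OF l] evc gH x gF of_cx_minus eq_neg_iff_add_eq_0)
  qed
  show "hcong 1 (comm (UE Q i) (UF Q i)) (of_cx (1 / sym_d L i) * Uh Q (coroot i))"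
  proof -
    let ?h = "hvar (GH (coroot i)) :: ('g, 'i) ugen free_hbar"
    let ?y = "hdiv (qpow ?h - qpow (- ?h)) (qscal (sym_d L i) - qscal (- sym_d L i))"
    have "comm (hvar (GE i)) (hvar (GF i)) - (if i = i then ?y else 0) \<in> quantum_relations L"
      unfolding quantum_relations_def Let_def
      by - (rule UnI1, rule UnI1, rule UnI2, blast)
    from rel[OF this] have "comm (UE Q i) (UF Q i) = ev ?y"
      by (simp add: hlinear_diff[OF l] evc gE gF)
    also have "hcong 1 \<dots> (ev (of_cx (1 / sym_d L i) * ?h))"
      by (intro hlinear_hcong[OF l] hdiv_qpow sym_d_nonzero)
    also have "\<dots> = of_cx (1 / sym_d L i) * Uh Q (coroot i)"
      by (simp add: hlinear_scale[OF l] gH coroot_cartan)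
    finally show ?thesis .
  qed
  show "UF Q j \<in> ad_nilpotent (UF Q i)"
  proof (cases "i = j")
    case True
    then show ?thesis unfolding ad_nilpotent_def by (intro CollectI exI[of _ 1]) (simp add: comm_def)
  next
    case False
    have "q_serre (sym_d L i) (cartan_entry L i j) (hvar (GF i)) (hvar (GF j)) \<in> quantum_relations L"
      using False unfolding quantum_relations_def Let_def
      by - (rule UnI2, blast)
    from rel[OF this] have "q_serre (sym_d L i) (cartan_entry L i j) (UF Q i) (UF Q j) = 0"
      by (simp only: q_serre_def Let_def hlinear_sum[OF l] hlinear_scale[OF l])
        (simp only: hhom_mult[OF ev] hhom_power[OF ev] gF)
    then show ?thesis by (rule q_serre_ad_nilpotent[OF sym_d_nonzero])
  qed
qed

abbreviation "D0 h \<equiv> Uh Q h \<otimes> (1 :: 'c)"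
abbreviation "Xp i \<equiv> Xplus L Q i"
abbreviation "Xm i \<equiv> Xminus L Q i"

lemma D0_zeta: "D0 h * zetaD Q k = zetaD Q k * D0 h"
  by (simp add: zetaD_def tensor_mult)

lemma comm_D0_q: "comm (D0 h) (qpow (of_cx c * zetaD Q k)) = 0"
proof -
  have "of_cx c * zetaD Q k * D0 h = D0 h * (of_cx c * zetaD Q k)"
    by (simp only: of_fps_left_commute[of "D0 h"] D0_zeta mult.assoc)
  from qpow_commute[OF this] show ?thesis by (simp add: comm_def)
qed

lemma comm_D0_Xp: "h \<in> cartan L \<Longrightarrow> comm (D0 h) (Xp i) = of_cx (\<alpha> i h) * Xp i"
  unfolding Xplus_def comm_mult_right comm_D0_q
  by (simp add: comm_tensor_left comm_Uh_E tensor_scale_left of_fps_left_commute[of "qpow _"])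

lemma comm_D0_Xm: "h \<in> cartan L \<Longrightarrow> comm (D0 h) (Xm i) = of_cx (- \<alpha> i h) * Xm i"
  unfolding Xminus_def comm_mult_right comm_D0_q
  by (simp add: comm_tensor_left comm_Uh_F tensor_scale_left of_fps_left_commute[of "qpow _"])

lemma Xp_cong: "hcong 1 (Xp i) (UE Q i \<otimes> 1)"
  unfolding Xplus_def using hcong_mult_right[OF qpow_cong_1] by fastforce

lemma Xm_cong: "hcong 1 (Xm i) (UF Q i \<otimes> 1)"
  unfolding Xminus_def using hcong_mult_right[OF qpow_cong_1] by fastforce

lemma comm_Xp_Xm: "hcong 1 (comm (Xp i) (Xm i)) (of_cx (1 / sym_d L i) * D0 (coroot i))"
proof -
  have "hcong 1 (comm (Xp i) (Xm i)) (comm (UE Q i \<otimes> 1) (UF Q i \<otimes> 1))"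
    by (intro hcong_comm Xp_cong Xm_cong)
  also have "\<dots> = comm (UE Q i) (UF Q i) \<otimes> 1" by (rule comm_tensor_left)
  also have "hcong 1 \<dots> ((of_cx (1 / sym_d L i) * Uh Q (coroot i)) \<otimes> 1)"
    by (rule hlinear_hcong[OF hlinear_tensor_left comm_E_F])
  finally show ?thesis by (simp only: tensor_scale_left)
qed

lemma Xm_ad_nilpotent: "Xm j \<in> ad_nilpotent (Xm i)"
proof -
  obtain k where k: "hcong 1 ((comm (UF Q i) ^^ k) (UF Q j)) 0"
    using serre_F[of j i] by (auto simp: ad_nilpotent_def)
  have "hcong 1 ((comm (Xm i) ^^ k) (Xm j)) ((comm (UF Q i \<otimes> 1) ^^ k) (UF Q j \<otimes> 1))"
    by (intro hcong_comm_power Xm_cong)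
  also have "(comm (UF Q i \<otimes> 1) ^^ m) (UF Q j \<otimes> (1::'c)) = (comm (UF Q i) ^^ m) (UF Q j) \<otimes> 1" for m
    by (induction m) (simp_all add: comm_tensor_left)
  also have "hcong 1 ((comm (UF Q i) ^^ k) (UF Q j) \<otimes> (1::'c)) (0 \<otimes> 1)"
    by (rule hlinear_hcong[OF hlinear_tensor_left k])
  finally have "hcong 1 ((comm (Xm i) ^^ k) (Xm j)) 0" by (simp only: hlinear_0[OF hlinear_tensor_left])
  then show ?thesis by (auto simp: ad_nilpotent_def)
qed

lemma Xm_subalgebra_ad_nilpotent: "b \<in> closed_subalgebra (range (Xminus L Q)) \<Longrightarrow> b \<in> ad_nilpotent (Xm i)"
proof -
  have "closed_subalgebra (range (Xminus L Q)) \<subseteq> ad_nilpotent (Xm i)"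
    by (rule closed_subalgebra_least[OF hsubmodule_ad_nilpotent ad_nilpotent_1 ad_nilpotent_mult hclosed_ad_nilpotent])
      (auto intro: Xm_ad_nilpotent)
  then show "b \<in> closed_subalgebra (range (Xminus L Q)) \<Longrightarrow> b \<in> ad_nilpotent (Xm i)" by blast
qed

definition weight_pairs :: "('g \<Rightarrow> complex) \<Rightarrow> (('u \<otimes> 'c) \<otimes> ('u \<otimes> 'c)) set" where
  "weight_pairs \<beta> = {a \<otimes> b | a b.
     a \<in> nilpotent_weight L Q (Xplus L Q) \<beta> \<and> b \<in> nilpotent_weight L Q (Xminus L Q) (- \<beta>)}"

lemma weight_pairs_comm:
  assumes x: "x \<in> closed_hspan (weight_pairs \<beta>)" and h: "h \<in> cartan L"
  shows "comm (D0 h \<otimes> 1) x = of_cx (\<beta> h) * x" and "comm (1 \<otimes> D0 h) x = of_cx (- \<beta> h) * x"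
proof -
  have 1: "closed_hspan (weight_pairs \<beta>) \<subseteq> {x. comm (D0 h \<otimes> 1) x = of_cx (\<beta> h) * x}"
    by (intro closed_hspan_least hsubmodule_equalizer hclosed_equalizer hlinear_comm hlinear_mult_left)
      (use h in \<open>auto simp: weight_pairs_def nilpotent_weight_def comm_tensor_left tensor_scale_left\<close>)
  show "comm (D0 h \<otimes> 1) x = of_cx (\<beta> h) * x" using subsetD[OF 1 x] by simp
  have 2: "closed_hspan (weight_pairs \<beta>) \<subseteq> {x. comm (1 \<otimes> D0 h) x = of_cx (- \<beta> h) * x}"
    by (intro closed_hspan_least hsubmodule_equalizer hclosed_equalizer hlinear_comm hlinear_mult_left)
      (use h in \<open>auto simp: weight_pairs_def nilpotent_weight_def comm_tensor_right tensor_scale_right\<close>)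
  show "comm (1 \<otimes> D0 h) x = of_cx (- \<beta> h) * x" using subsetD[OF 2 x] by simp
qed

lemma weight_pairs_ad_nilpotent:
  assumes "x \<in> closed_hspan (weight_pairs \<beta>)" shows "x \<in> ad_nilpotent (1 \<otimes> Xm i)"
proof -
  have "closed_hspan (weight_pairs \<beta>) \<subseteq> ad_nilpotent (1 \<otimes> Xm i)"
    by (intro closed_hspan_least hsubmodule_ad_nilpotent hclosed_ad_nilpotent)
      (auto simp: weight_pairs_def nilpotent_weight_def intro!: ad_nilpotent_tensor Xm_subalgebra_ad_nilpotent)
  with assms show ?thesis by blast
qed

lemma comult_Xp: "comult (hopfD Q) (Xp i) = Xp i \<otimes> qpow (hplus Q (coroot i)) + 1 \<otimes> Xp i"
  using double unfolding quantum_double_def by blast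

text \<open>Eigencomponents of a sum divisible by \<hbar> are divisible by \<hbar>; this replaces
  passing to the quotient algebra modulo \<hbar>. The weight is measured in the first tensor
  leg.\<close>

lemma sum_hcong_weight_zero:
  fixes u :: "'k \<Rightarrow> ('u \<otimes> 'c) \<otimes> ('u \<otimes> 'c)"
  assumes "finite J" and u: "\<And>j h. j \<in> J \<Longrightarrow> h \<in> cartan L \<Longrightarrow> comm (D0 h \<otimes> 1) (u j) = of_cx (wt j h) * u j"
    and v: "\<And>h. h \<in> cartan L \<Longrightarrow> comm (D0 h \<otimes> 1) v = of_cx (\<beta> h) * v"
    and "\<And>j. j \<in> J \<Longrightarrow> \<exists>h\<in>cartan L. wt j h \<noteq> \<beta> h"
    and "hcong 1 (v + (\<Sum>j\<in>J. u j)) 0"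
  shows "hcong 1 v 0"
proof -
  let ?sc = "\<lambda>c (x :: ('u \<otimes> 'c) \<otimes> ('u \<otimes> 'c)). of_cx c * x" and ?N = "{x :: ('u \<otimes> 'c) \<otimes> ('u \<otimes> 'c). hcong 1 x 0}"
  have vs: "vector_space ?sc"
    by unfold_locales (simp_all only: of_cx_add of_cx_mult distrib_left distrib_right mult.assoc of_cx_1 mult_1_left)
  interpret vector_space ?sc by (rule vs)
  have N: "subspace ?N"
  proof (rule subspaceI)
    fix x y c assume "x \<in> ?N" "y \<in> ?N"
    then show "x + y \<in> ?N" using hcong_add[of 1 x 0 y 0] by simp
    show "of_cx c * x \<in> ?N" using hcong_mult_left[of 1 x 0 "of_cx c"] \<open>x \<in> ?N\<close> by simp
  qed simp
  have "v \<in> ?N"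
  proof (rule weight_vector_separation[OF vs N _ _ assms(1) u v assms(4)])
    show "Vector_Spaces.linear ?sc ?sc (comm (D0 h \<otimes> 1))" if "h \<in> cartan L" for h
      unfolding Vector_Spaces.linear_iff using vs by (simp add: hlinear_add[OF hlinear_comm] hlinear_scale[OF hlinear_comm])
    show "comm (D0 h \<otimes> 1) x \<in> ?N" if "h \<in> cartan L" "x \<in> ?N" for h x
      using hcong_comm[OF hcong_refl, of 1 x 0 "D0 h \<otimes> 1"] that by (simp add: comm_def)
    show "v + (\<Sum>j\<in>J. u j) \<in> ?N" using assms(5) by simp
  qed
  then show ?thesis by simp
qed

lemma R_expansion:
  assumes "universal_R L Q R"
  obtains R\<beta> S where "R\<beta> 0 = 1" "\<And>\<beta>. \<beta> \<in> Qplus L \<Longrightarrow> R\<beta> \<beta> \<in> closed_hspan (weight_pairs \<beta>)"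
    "has_hsum R\<beta> (Qplus L) S"
    "R = qpow (\<Sum>i\<in>UNIV. hplus Q (coweight L i) \<otimes> hminus Q (coroot i)) * S"
    "\<And>x. R * comult (hopfD Q) x = tensor_flip (comult (hopfD Q) x) * R"
  using assms unfolding universal_R_def weight_pairs_def[symmetric] by blast

text \<open>Adding one more index to a sufficiently large finite set changes the sum by less than
  the precision, so all further terms are small.\<close>

lemma has_hsum_terms:
  assumes "has_hsum f A s"
  obtains F0 where "finite F0" "F0 \<subseteq> A" "\<And>F. finite F \<Longrightarrow> F0 \<subseteq> F \<Longrightarrow> F \<subseteq> A \<Longrightarrow> hcong N (sum f F) s"
    "\<And>b. b \<in> A \<Longrightarrow> b \<notin> F0 \<Longrightarrow> hcong N (f b) 0"
proof -
  obtain F0 where F0: "finite F0" "F0 \<subseteq> A" "\<And>F. finite F \<Longrightarrow> F0 \<subseteq> F \<Longrightarrow> F \<subseteq> A \<Longrightarrow> hcong N (sum f F) s"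
    using assms unfolding has_hsum_def by meson
  have "hcong N (f b) 0" if "b \<in> A" "b \<notin> F0" for b
  proof -
    have "hcong N (sum f (insert b F0) - sum f F0) (s - s)"
      by (intro hcong_diff F0(3)) (use F0(1,2) that in auto)
    then show ?thesis using F0(1) that(2) by simp
  qed
  with F0 that show thesis by blast
qed

text \<open>Modulo \<hbar> the coproduct of X^+ is symmetric, so the intertwining property says that
  S commutes with X^+ \<otimes> 1 + 1 \<otimes> X^+. In first-leg weight \<beta> this involves
  [1 \<otimes> X^+, R_\<beta>] and terms [X^+ \<otimes> 1, R_\<gamma>] with \<gamma> + \<alpha> =
  \<beta>. By minimality of the height of \<beta> the latter are absent, so R_\<beta> is a highest
  weight vector in the second leg, where its weight is -\<beta>.\<close>

lemma R_cong_1: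
  assumes "universal_R L Q R" shows "hcong 1 R 1"
proof -
  obtain R\<beta> S where R0: "R\<beta> 0 = 1" and R\<beta>: "\<And>\<beta>. \<beta> \<in> Qplus L \<Longrightarrow> R\<beta> \<beta> \<in> closed_hspan (weight_pairs \<beta>)"
    and hsum: "has_hsum R\<beta> (Qplus L) S"
    and R: "R = qpow (\<Sum>i\<in>UNIV. hplus Q (coweight L i) \<otimes> hminus Q (coroot i)) * S"
    and inter: "\<And>x. R * comult (hopfD Q) x = tensor_flip (comult (hopfD Q) x) * R"
    by (rule R_expansion[OF assms]) blast
  have RS: "hcong 1 R S" unfolding R using hcong_mult_right[OF qpow_cong_1] by fastforce
  define Bad where "Bad = {\<gamma>\<in>Qplus L. \<gamma> \<noteq> 0 \<and> \<not> hcong 1 (R\<beta> \<gamma>) 0}"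
  obtain F0 where F0: "finite F0" "F0 \<subseteq> Qplus L"
    "\<And>F. finite F \<Longrightarrow> F0 \<subseteq> F \<Longrightarrow> F \<subseteq> Qplus L \<Longrightarrow> hcong 1 (sum R\<beta> F) S"
    "\<And>b. b \<in> Qplus L \<Longrightarrow> b \<notin> F0 \<Longrightarrow> hcong 1 (R\<beta> b) 0"
    by (rule has_hsum_terms[OF hsum]) blast
  have Bad: "finite Bad" "Bad \<subseteq> F0" using F0(1,4) by (auto simp: Bad_def intro: finite_subset[of _ F0])
  have S: "hcong 1 S (1 + (\<Sum>\<gamma>\<in>Bad. R\<beta> \<gamma>))"
  proof -
    have "hcong 1 S (sum R\<beta> (insert 0 F0))"
      using F0 Qplus_0 by (intro hcong_sym[OF F0(3)]) auto
    also have "sum R\<beta> (insert 0 F0) = 1 + sum R\<beta> (F0 - {0})"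
      using F0(1) R0 by (simp add: sum.insert_remove)
    also have "sum R\<beta> (F0 - {0}) = sum R\<beta> Bad + sum R\<beta> (F0 - {0} - Bad)"
      using F0(1) Bad by (intro sum.subset_diff[of Bad, simplified add.commute]) (auto simp: Bad_def)
    also have "hcong 1 (1 + (sum R\<beta> Bad + sum R\<beta> (F0 - {0} - Bad))) (1 + (sum R\<beta> Bad + (\<Sum>\<gamma>\<in>F0 - {0} - Bad. 0)))"
      using F0(2) by (intro hcong_add hcong_refl hcong_sum) (auto simp: Bad_def)
    finally show ?thesis by simp
  qed
  have "Bad = {}"
  proof (rule ccontr)
    assume "Bad \<noteq> {}"
    then obtain \<beta> where \<beta>: "\<beta> \<in> Bad" "\<And>\<gamma>. \<gamma> \<in> Bad \<Longrightarrow> height \<beta> \<le> height \<gamma>"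
      using ex_min_if_finite[of "height ` Bad"] Bad(1) by (metis arg_min_if_finite(1) arg_min_least)
    have \<beta>Q: "\<beta> \<in> Qplus L" and \<beta>0: "\<beta> \<noteq> 0" and \<beta>bad: "\<not> hcong 1 (R\<beta> \<beta>) 0"
      using \<beta>(1) by (auto simp: Bad_def)
    have primitive: "hcong 1 (comm (1 \<otimes> Xp i) (R\<beta> \<beta>)) 0" for i
    proof -
      let ?Y = "Xp i \<otimes> 1 + 1 \<otimes> Xp i"
      have "hcong 1 (comult (hopfD Q) (Xp i)) (Xp i \<otimes> 1 + 1 \<otimes> Xp i)"
        unfolding comult_Xp
        by (intro hcong_add hcong_refl hlinear_hcong[OF hlinear_tensor_right] qpow_cong_1)
      moreover have "hcong 1 (tensor_flip (comult (hopfD Q) (Xp i))) ?Y"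
      proof -
        have "hcong 1 (tensor_flip (comult (hopfD Q) (Xp i))) (tensor_flip ?Y)"
          by (rule hlinear_hcong[OF hhom_hlinear[OF hhom_tensor_flip]]) fact
        also have "tensor_flip ?Y = ?Y"
          by (simp add: hlinear_add[OF hhom_hlinear[OF hhom_tensor_flip]] tensor_flip_tensor add.commute)
        finally show ?thesis .
      qed
      ultimately have "hcong 1 (tensor_flip (comult (hopfD Q) (Xp i)) * R - R * comult (hopfD Q) (Xp i)) (?Y * S - S * ?Y)"
        by (intro hcong_diff hcong_mult RS)
      then have "hcong 1 0 (comm ?Y S)" by (simp add: inter comm_def)
      also have "hcong 1 (comm ?Y S) (comm ?Y (1 + (\<Sum>\<gamma>\<in>Bad. R\<beta> \<gamma>)))"
        by (intro hcong_comm hcong_refl S)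
      also have "\<dots> = (\<Sum>\<gamma>\<in>Bad. comm (1 \<otimes> Xp i) (R\<beta> \<gamma>) + comm (Xp i \<otimes> 1) (R\<beta> \<gamma>))"
      proof -
        have "comm ?Y 1 = 0" by (simp add: comm_def)
        then show ?thesis
          by (simp only: hlinear_add[OF hlinear_comm] hlinear_sum[OF hlinear_comm] comm_add_left add_0_left add.commute)
      qed
      finally have sum0: "hcong 1 (\<Sum>\<gamma>\<in>Bad. comm (1 \<otimes> Xp i) (R\<beta> \<gamma>) + comm (Xp i \<otimes> 1) (R\<beta> \<gamma>)) 0"
        by (rule hcong_sym)
      \<comment> \<open>The two families of commutators are indexed together: \<open>True\<close>
        marks those with 1 \<otimes> X^+, which keep the first-leg weight, \<open>False\<close>
        those with X^+ \<otimes> 1, which raise it by \<alpha>.\<close>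
      define u where "u j = (if snd j then comm (1 \<otimes> Xp i) (R\<beta> (fst j)) else comm (Xp i \<otimes> 1) (R\<beta> (fst j)))"
        for j :: "('g \<Rightarrow> complex) \<times> bool"
      define wt where "wt j = (if snd j then fst j else fst j + \<alpha> i)" for j :: "('g \<Rightarrow> complex) \<times> bool"
      let ?J = "Bad \<times> UNIV - {(\<beta>, True)}"
      have weights: "comm (D0 h \<otimes> 1) (comm (1 \<otimes> Xp i) (R\<beta> \<gamma>)) = of_cx (\<gamma> h) * comm (1 \<otimes> Xp i) (R\<beta> \<gamma>)"
        "comm (D0 h \<otimes> 1) (comm (Xp i \<otimes> 1) (R\<beta> \<gamma>)) = of_cx ((\<gamma> + \<alpha> i) h) * comm (Xp i \<otimes> 1) (R\<beta> \<gamma>)"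
        if h: "h \<in> cartan L" and "\<gamma> \<in> Bad" for h \<gamma>
      proof -
        have "\<gamma> \<in> Qplus L" using that by (simp add: Bad_def)
        note R\<gamma> = weight_pairs_comm(1)[OF R\<beta>[OF this] h]
        have c1: "comm (D0 h \<otimes> 1) (1 \<otimes> Xp i) = (0 :: ('u \<otimes> 'c) \<otimes> ('u \<otimes> 'c))"
          by (simp add: comm_def tensor_mult)
        have c2: "comm (D0 h \<otimes> 1) (Xp i \<otimes> 1) = of_cx (\<alpha> i h) * (Xp i \<otimes> (1 :: 'u \<otimes> 'c))"
          by (simp add: comm_tensor_left comm_D0_Xp[OF h] tensor_scale_left)
        show "comm (D0 h \<otimes> 1) (comm (1 \<otimes> Xp i) (R\<beta> \<gamma>)) = of_cx (\<gamma> h) * comm (1 \<otimes> Xp i) (R\<beta> \<gamma>)"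
          by (subst comm_jacobi) (simp add: c1 R\<gamma> hlinear_scale[OF hlinear_comm], simp add: comm_def)
        show "comm (D0 h \<otimes> 1) (comm (Xp i \<otimes> 1) (R\<beta> \<gamma>)) = of_cx ((\<gamma> + \<alpha> i) h) * comm (Xp i \<otimes> 1) (R\<beta> \<gamma>)"
          by (subst comm_jacobi) (simp add: c2 R\<gamma> hlinear_scale[OF hlinear_comm] comm_scale_left of_cx_add distrib_right add.commute)
      qed
      have "hcong 1 (u (\<beta>, True)) 0"
      proof (rule sum_hcong_weight_zero[where J = ?J and u = u and wt = wt and \<beta> = \<beta>])
        show "finite ?J" using Bad(1) by simp
        show "comm (D0 h \<otimes> 1) (u j) = of_cx (wt j h) * u j" if "j \<in> ?J" "h \<in> cartan L" for j h
          using weights[OF that(2), of "fst j"] that(1) by (auto simp: u_def wt_def simp del: plus_fun_apply)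
        show "comm (D0 h \<otimes> 1) (u (\<beta>, True)) = of_cx (\<beta> h) * u (\<beta>, True)" if "h \<in> cartan L" for h
          using weights(1)[OF that \<beta>(1)] by (simp add: u_def)
        show "\<exists>h\<in>cartan L. wt j h \<noteq> \<beta> h" if j: "j \<in> ?J" for j
        proof (rule ccontr)
          obtain \<gamma> b where jb: "j = (\<gamma>, b)" by (cases j)
          have \<gamma>: "\<gamma> \<in> Bad" "\<gamma> \<in> Qplus L" using j jb by (auto simp: Bad_def)
          have wtQ: "wt j \<in> Qplus L" using \<gamma> by (simp add: wt_def jb Qplus_add root_Qplus)
          assume "\<not> (\<exists>h\<in>cartan L. wt j h \<noteq> \<beta> h)"
          then have eq: "wt j = \<beta>" using dual_eqI[OF Qplus_dual[OF wtQ] Qplus_dual[OF \<beta>Q]] by blast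
          show False
          proof (cases b)
            case True
            then show False using eq j by (simp add: wt_def jb)
          next
            case False
            \<comment> \<open>Evaluation at the sum of the coweights turns \<gamma> + \<alpha> =
              \<beta> into height \<beta> = height \<gamma> + 1, against minimality.\<close>
            let ?\<rho> = "\<Sum>i\<in>UNIV. coweight L i"
            have \<alpha>\<rho>: "\<alpha> i ?\<rho> = 1" by (simp add: dual_sum[OF root_dual coweight_cartan] root_coweight)
            have "\<beta> ?\<rho> = of_nat (height \<gamma>) + 1"
              using eq False height_Qplus[OF \<gamma>(2)] \<alpha>\<rho> by (auto simp: wt_def jb)
            then have "\<beta> ?\<rho> = of_nat (Suc (height \<gamma>))" by simp
            then have "height \<beta> = Suc (height \<gamma>)" by (rule height_eqI)
            then show False using \<beta>(2)[OF \<gamma>(1)] by simp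
          qed
        qed
        have "(\<Sum>\<gamma>\<in>Bad. comm (1 \<otimes> Xp i) (R\<beta> \<gamma>) + comm (Xp i \<otimes> 1) (R\<beta> \<gamma>)) = (\<Sum>\<gamma>\<in>Bad. \<Sum>b\<in>UNIV. u (\<gamma>, b))"
          by (intro sum.cong refl) (simp add: u_def UNIV_bool add.commute)
        also have "\<dots> = (\<Sum>j\<in>Bad \<times> UNIV. u j)" by (simp add: sum.cartesian_product)
        also have "\<dots> = u (\<beta>, True) + (\<Sum>j\<in>?J. u j)"
          using \<beta>(1) Bad(1) by (intro sum.remove) auto
        finally show "hcong 1 (u (\<beta>, True) + (\<Sum>j\<in>?J. u j)) 0" using sum0 by simp
      qed
      then show ?thesis by (simp add: u_def)
    qed
    have "\<exists>k::nat. - \<beta> (coroot i) / sym_d L i = of_nat k" for i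
    \<comment> \<open>All three sl2 elements sit in the second leg; dividing the coroot by d gives
      X^- the weight -2.\<close>
    proof (rule highest_weight_natural[where e = "1 \<otimes> Xp i" and f = "1 \<otimes> Xm i"
          and h = "1 \<otimes> (of_cx (1 / sym_d L i) * D0 (coroot i))" and v = "R\<beta> \<beta>"])
      show "hcong 1 (comm ((1 :: 'u \<otimes> 'c) \<otimes> Xp i) (1 \<otimes> Xm i)) (1 \<otimes> (of_cx (1 / sym_d L i) * D0 (coroot i)))"
        unfolding comm_tensor_right by (rule hlinear_hcong[OF hlinear_tensor_right comm_Xp_Xm])
      have "comm (of_cx (1 / sym_d L i) * D0 (coroot i)) (Xm i) = of_cx (1 / sym_d L i * (- \<alpha> i (coroot i))) * Xm i"
        by (simp only: comm_scale_left comm_D0_Xm[OF coroot_cartan] of_cx_mult mult.assoc)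
      also have "1 / sym_d L i * (- \<alpha> i (coroot i)) = - 2"
        using sym_d_nonzero[of i] by (simp add: sym_d_eq)
      finally have eq: "comm (of_cx (1 / sym_d L i) * D0 (coroot i)) (Xm i) = of_cx (- 2) * Xm i" .
      have "comm ((1 :: 'u \<otimes> 'c) \<otimes> (of_cx (1 / sym_d L i) * D0 (coroot i))) (1 \<otimes> Xm i) = of_cx (- 2) * (1 \<otimes> Xm i)"
        unfolding comm_tensor_right eq by (rule tensor_scale_right)
      then show "hcong 1 (comm ((1 :: 'u \<otimes> 'c) \<otimes> (of_cx (1 / sym_d L i) * D0 (coroot i))) (1 \<otimes> Xm i)) (of_cx (- 2) * (1 \<otimes> Xm i))"
        by simp
      have "comm (1 \<otimes> (of_cx (1 / sym_d L i) * D0 (coroot i))) (R\<beta> \<beta>)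
        = of_cx (1 / sym_d L i * (- \<beta> (coroot i))) * R\<beta> \<beta>"
        by (simp only: tensor_scale_right comm_scale_left weight_pairs_comm(2)[OF R\<beta>[OF \<beta>Q] coroot_cartan] of_cx_mult mult.assoc)
      then show "hcong 1 (comm (1 \<otimes> (of_cx (1 / sym_d L i) * D0 (coroot i))) (R\<beta> \<beta>))
        (of_cx (- \<beta> (coroot i) / sym_d L i) * R\<beta> \<beta>)"
        by simp
    qed (fact primitive \<beta>bad weight_pairs_ad_nilpotent[OF R\<beta>[OF \<beta>Q]])+
    then obtain m :: "'i \<Rightarrow> nat" where "\<And>i. - \<beta> (coroot i) / sym_d L i = of_nat (m i)" by metis
    then show False using antidominant_Qplus_zero[OF \<beta>Q] \<beta>0 by blast
  qed
  then have "hcong 1 S 1" using S by simp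
  with RS show ?thesis by (rule hcong_trans)
qed

end

section \<open>Block matrices with respect to the weights\<close>

text \<open>Multiplication by \<hbar> shifts the coefficients of the expansion by one place. If the
  product is zero, uniqueness of the expansion of zero makes the shifted coefficients
  vanish.\<close>

lemma topologically_free_torsion_free:
  assumes "topologically_free TYPE('a::hbar_algebra)" and x: "\<hbar> * (x :: 'a) = 0"
  shows "x = 0"
proof -
  obtain M :: "'a set" where M: "0 \<in> M"
    and uniq: "\<And>x. \<exists>!a. (\<forall>n. a n \<in> M) \<and> x = hlim (\<lambda>N. \<Sum>n<N. \<hbar> ^ n * a n)"
    using assms(1) unfolding topologically_free_def by blast
  have lim: "\<exists>y. hlim (\<lambda>N. \<Sum>n<N. \<hbar> ^ n * a n) = y \<and> (\<forall>N n. n \<ge> N \<longrightarrow> hcong N (\<Sum>n<n. \<hbar> ^ n * a n) y)"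
    for a :: "nat \<Rightarrow> 'a"
  proof -
    let ?s = "\<lambda>N. \<Sum>n<N. \<hbar> ^ n * a n"
    have "hcong n (?s (Suc n)) (?s n)" for n
      using hcong_add[OF hcong_refl hcong_hpow[OF order_refl], of n "?s n"] by simp
    then show ?thesis by (rule hlim_exists) blast
  qed
  obtain a where a: "\<And>n. a n \<in> M" "x = hlim (\<lambda>N. \<Sum>n<N. \<hbar> ^ n * a n)"
    using ex1_implies_ex[OF uniq[of x]] by blast
  define b where "b n = (case n of 0 \<Rightarrow> 0 | Suc m \<Rightarrow> a m)" for n
  have b: "b n \<in> M" for n using a(1) M by (cases n) (auto simp: b_def)
  have "hlim (\<lambda>N. \<Sum>n<N. \<hbar> ^ n * b n) = \<hbar> * x"
  proof (rule hlim_eqI)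
    fix N
    have "hcong N (\<Sum>n<m. \<hbar> ^ n * b n) (\<hbar> * x)" if m: "m \<ge> Suc N" for m
    proof -
      obtain m' where m': "m = Suc m'" using m by (cases m) auto
      have "(\<Sum>n<m. \<hbar> ^ n * b n) = \<hbar> * (\<Sum>n<m'. \<hbar> ^ n * a n)"
        unfolding m' sum.lessThan_Suc_shift by (simp add: b_def sum_distrib_left mult.assoc)
      moreover have "hcong N (\<Sum>n<m'. \<hbar> ^ n * a n) x" using lim[of a] a(2) m m' by auto
      ultimately show ?thesis by (simp add: hcong_mult_left)
    qed
    then show "\<exists>n0. \<forall>n\<ge>n0. hcong N (\<Sum>n<n. \<hbar> ^ n * b n) (\<hbar> * x)" by blast
  qed
  then have "0 = hlim (\<lambda>N. \<Sum>n<N. \<hbar> ^ n * b n)" using x by simp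
  moreover have z: "0 = hlim (\<lambda>N. \<Sum>n<N. \<hbar> ^ n * (0::'a))"
    by (rule hlim_eqI[symmetric]) simp
  moreover obtain c where c: "\<And>a. (\<forall>n. a n \<in> M) \<and> 0 = hlim (\<lambda>N. \<Sum>n<N. \<hbar> ^ n * a n) \<Longrightarrow> a = c"
    by (rule ex1E[OF uniq[of 0]]) blast
  ultimately have "b = c" "(\<lambda>_. 0) = c" using b M by auto
  then have "b (Suc n) = 0" for n by (metis)
  then have "a n = 0" for n by (simp add: b_def)
  then show ?thesis using a(2) z by simp
qed

text \<open>A functional with value 1 at the unit, such as a counit, gives a linear retraction of
  the embedding into the tensor product.\<close>

lemma
  fixes \<epsilon> :: "'a::hbar_algebra \<Rightarrow> complex fps"
  assumes "hlinear \<epsilon>" "\<epsilon> 1 = 1"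
  shows inj_tensor_right: "inj (\<lambda>x :: 'b::hbar_algebra. (1::'a) \<otimes> x)"
    and inj_tensor_left: "inj (\<lambda>x :: 'b::hbar_algebra. x \<otimes> (1::'a))"
proof -
  have of\<epsilon>: "of_fps (\<epsilon> (of_fps c * a)) = (of_fps c * of_fps (\<epsilon> a) :: 'b)"
    "of_fps (\<epsilon> (a + a')) = (of_fps (\<epsilon> a) + of_fps (\<epsilon> a') :: 'b)" for c a a'
    using hlinear_scale[OF assms(1), of c a] hlinear_add[OF assms(1), of a a']
    by (simp_all add: of_fps_complex of_fps_mult of_fps_add)
  have 1: "hbilinear (\<lambda>(a::'a) (b::'b). of_fps (\<epsilon> a) * b)"
    by (rule hbilinearI[OF hlinear_mult_left]) (simp add: hlinear_def of\<epsilon> distrib_right mult.assoc)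
  show "inj (\<lambda>x :: 'b. (1::'a) \<otimes> x)"
    by (rule inj_on_inverseI[where g = "tensor_lift (\<lambda>a b. of_fps (\<epsilon> a) * b)"])
      (simp add: tensor_lift_tensor[OF 1] assms(2))
  have 2: "hbilinear (\<lambda>(b::'b) (a::'a). of_fps (\<epsilon> a) * b)"
    by (rule hbilinearI[OF _ hlinear_mult_left]) (simp add: hlinear_def of\<epsilon> distrib_right mult.assoc)
  show "inj (\<lambda>x :: 'b. x \<otimes> (1::'a))"
    by (rule inj_on_inverseI[where g = "tensor_lift (\<lambda>b a. of_fps (\<epsilon> a) * b)"])
      (simp add: tensor_lift_tensor[OF 2] assms(2))
qed

lemma tensor_functional:
  fixes \<epsilon> :: "'a::hbar_algebra \<Rightarrow> complex fps" and \<delta> :: "'b::hbar_algebra \<Rightarrow> complex fps"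
  assumes "hlinear \<epsilon>" "\<epsilon> 1 = 1" "hlinear \<delta>" "\<delta> 1 = 1"
  obtains \<phi> :: "'a \<otimes> 'b \<Rightarrow> complex fps" where "hlinear \<phi>" "\<phi> 1 = 1"
proof -
  have "hbilinear (\<lambda>a b. \<epsilon> a * \<delta> b)"
    by (intro hbilinearI hlinear_comp[OF hlinear_mult_left] hlinear_comp[OF hlinear_mult_right] assms)
  then show thesis
    using that[of "tensor_lift (\<lambda>a b. \<epsilon> a * \<delta> b)"]
    by (simp add: hlinear_tensor_lift tensor_one tensor_lift_tensor assms)
qed

lemma prod_list_qpow:
  fixes f :: "'k \<Rightarrow> 'a::hbar_algebra"
  assumes "\<And>k l. f k * f l = f l * f k"
  shows "prod_list (map (\<lambda>k. qpow (f k) ^ n k) ks) = qpow (\<Sum>k\<leftarrow>ks. of_nat (n k) * f k)"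
proof (induction ks)
  case (Cons k ks)
  have nat_comm: "x * (of_nat m * y) = of_nat m * y * x" if "x * y = y * x" for x y :: 'a and m
  proof -
    have "x * (of_nat m * y) = (x * of_nat m) * y" by (rule mult.assoc[symmetric])
    also have "\<dots> = of_nat m * (x * y)" by (simp only: mult_of_nat_commute[symmetric] mult.assoc)
    finally show ?thesis by (simp only: that mult.assoc)
  qed
  have "f k * (\<Sum>l\<leftarrow>ks. of_nat (n l) * f l) = (\<Sum>l\<leftarrow>ks. of_nat (n l) * f l) * f k"
    by (induction ks) (simp_all add: distrib_left distrib_right nat_comm assms)
  from nat_comm[OF this[symmetric], of "n k"]
  have "(of_nat (n k) * f k) * (\<Sum>l\<leftarrow>ks. of_nat (n l) * f l) = (\<Sum>l\<leftarrow>ks. of_nat (n l) * f l) * (of_nat (n k) * f k)"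
    by (rule sym)
  from qpow_add[OF this] Cons show ?case by (simp add: qpow_scale_nat)
qed (simp add: qpow_0)

section \<open>Matrices with entries in a tensor square\<close>

lemma mat_tensor_nth: "mat_tensor A B $ i $ j = (\<Sum>k\<in>UNIV. A $ i $ k \<otimes> B $ k $ j)"
  by (simp add: mat_tensor_def)

lemma tensor_sum_left: "(\<Sum>i\<in>A. f i) \<otimes> b = (\<Sum>i\<in>A. f i \<otimes> b)"
  and tensor_sum_right: "a \<otimes> (\<Sum>i\<in>A. g i) = (\<Sum>i\<in>A. a \<otimes> g i)"
  by (rule hlinear_sum[OF hlinear_tensor_left], rule hlinear_sum[OF hlinear_tensor_right])

lemma tensor_zero_left: "0 \<otimes> b = 0" and tensor_zero_right: "a \<otimes> 0 = 0"
  by (rule hlinear_0[OF hlinear_tensor_left], rule hlinear_0[OF hlinear_tensor_right])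

lemma cmat_mat_tensor: "cmat P ** mat_tensor A B = mat_tensor (cmat P ** A) B"
proof (rule mat_eqI)
  fix i j
  have "(cmat P ** mat_tensor A B) $ i $ j = (\<Sum>l\<in>UNIV. \<Sum>k\<in>UNIV. of_cx (P $ i $ l) * (A $ l $ k \<otimes> B $ k $ j))"
    by (simp add: mat_mult_nth mat_tensor_nth sum_distrib_left)
  also have "\<dots> = (\<Sum>k\<in>UNIV. \<Sum>l\<in>UNIV. of_cx (P $ i $ l) * (A $ l $ k \<otimes> B $ k $ j))" by (rule sum.swap)
  finally show "(cmat P ** mat_tensor A B) $ i $ j = mat_tensor (cmat P ** A) B $ i $ j"
    by (simp add: mat_mult_nth mat_tensor_nth tensor_sum_left tensor_scale_left)
qed

lemma mat_tensor_cmat: "mat_tensor A B ** cmat P = mat_tensor A (B ** cmat P)"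
proof (rule mat_eqI)
  fix i j
  have "(mat_tensor A B ** cmat P) $ i $ j = (\<Sum>l\<in>UNIV. \<Sum>k\<in>UNIV. (A $ i $ k \<otimes> B $ k $ l) * of_cx (P $ l $ j))"
    by (simp add: mat_mult_nth mat_tensor_nth sum_distrib_right)
  also have "\<dots> = (\<Sum>k\<in>UNIV. \<Sum>l\<in>UNIV. (A $ i $ k \<otimes> B $ k $ l) * of_cx (P $ l $ j))" by (rule sum.swap)
  finally show "(mat_tensor A B ** cmat P) $ i $ j = mat_tensor A (B ** cmat P) $ i $ j"
    by (simp add: mat_mult_nth mat_tensor_nth tensor_sum_right tensor_scale_right flip: of_fps_central)
qed

lemma mat_tensor_middle: "mat_tensor (A ** cmat P) B = mat_tensor A (cmat P ** B)"
proof (rule mat_eqI)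
  fix i j
  have "mat_tensor (A ** cmat P) B $ i $ j = (\<Sum>k\<in>UNIV. \<Sum>l\<in>UNIV. of_cx (P $ l $ k) * (A $ i $ l \<otimes> B $ k $ j))"
    by (simp add: mat_mult_nth mat_tensor_nth tensor_sum_left tensor_scale_left flip: of_fps_central)
  also have "\<dots> = (\<Sum>l\<in>UNIV. \<Sum>k\<in>UNIV. of_cx (P $ l $ k) * (A $ i $ l \<otimes> B $ k $ j))" by (rule sum.swap)
  finally show "mat_tensor (A ** cmat P) B $ i $ j = mat_tensor A (cmat P ** B) $ i $ j"
    by (simp add: mat_mult_nth mat_tensor_nth tensor_sum_right tensor_scale_right)
qed

lemma mat_tensor_sum_left: "mat_tensor (sum f K) B = (\<Sum>k\<in>K. mat_tensor (f k) B)"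
  by (rule mat_eqI) (simp add: mat_tensor_nth tensor_sum_left, rule sum.swap)

lemma mat_tensor_zero: "mat_tensor 0 B = 0" "mat_tensor A 0 = 0"
  by (rule mat_eqI, simp add: mat_tensor_nth tensor_zero_left tensor_zero_right)+

lemma mat_tensor_smat_cmat:
  "mat_tensor (smat a (cmat P)) (smat b (cmat Q)) = smat (a \<otimes> b) (cmat (P ** Q))"
proof (rule mat_eqI)
  fix i j
  have "(a * of_cx p) \<otimes> (b * of_cx q) = (a \<otimes> b) * of_cx (p * q)" for p q
  proof -
    have "(a * of_cx p) \<otimes> (b * of_cx q) = of_cx q * (of_cx p * (a \<otimes> b))"
      unfolding of_fps_central[of "fps_const p" a, symmetric] of_fps_central[of "fps_const q" b, symmetric]
      by (simp only: tensor_scale_left tensor_scale_right)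
    then show ?thesis
      unfolding of_fps_central[of "fps_const (p * q)" "a \<otimes> b", symmetric]
      by (simp only: mult.commute[of p q] of_cx_mult mult.assoc)
  qed
  then show "mat_tensor (smat a (cmat P)) (smat b (cmat Q)) $ i $ j = smat (a \<otimes> b) (cmat (P ** Q)) $ i $ j"
    by (simp add: mat_tensor_nth mat_mult_nth of_cx_sum sum_distrib_left)
qed

lemma smat_cmat_inject:
  assumes "smat x (cmat P) = smat y (cmat P)" "P \<noteq> 0" shows "x = (y::'a::hbar_algebra)"
proof -
  obtain i j where ij: "P $ i $ j \<noteq> 0" using assms(2) by (metis mat_eqI zero_index)
  have "x * of_cx (P $ i $ j) = y * of_cx (P $ i $ j)"
    using arg_cong[OF assms(1), of "\<lambda>M. M $ i $ j"] by simp
  then have "of_cx (P $ i $ j) * (x - y) = 0" by (simp add: right_diff_distrib of_fps_central)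
  then show ?thesis using of_cx_eq_0[OF _ ij] by fastforce
qed

section \<open>Blocks cut out by the weight projections\<close>

context multiplicity_free_representation
begin

definition block :: "'j \<times> ('g \<Rightarrow> complex) \<Rightarrow> 'j \<times> ('g \<Rightarrow> complex) \<Rightarrow> 'a::hbar_algebra^'n^'n \<Rightarrow> 'a^'n^'n" where
  "block k l M = cmat (wproj k) ** M ** cmat (wproj l)"

lemma cmat_wproj_mult: "k \<in> indices \<Longrightarrow> l \<in> indices \<Longrightarrow>
    cmat (wproj k) ** cmat (wproj l) = (if k = l then cmat (wproj k) else 0)"
  by (simp add: idempotents_mult[OF wproj_idempotents] flip: cmat_mult)

lemma cmat_wproj_sum: "(\<Sum>k\<in>indices. cmat (wproj k)) = mat 1"
  by (simp add: idempotents_sum[OF wproj_idempotents] cmat_1 flip: cmat_sum)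

lemma block_1: "k \<in> indices \<Longrightarrow> l \<in> indices \<Longrightarrow> block k l (mat 1) = (if k = l then cmat (wproj k) else 0)"
  by (simp add: block_def cmat_wproj_mult)

lemma block_mult:
  fixes M N :: "'a::hbar_algebra^'n^'n"
  shows "block k l (M ** N) = (\<Sum>m\<in>indices. block k m M ** block m l N)"
proof -
  have "block k l (M ** N) = cmat (wproj k) ** M ** (\<Sum>m\<in>indices. cmat (wproj m)) ** N ** cmat (wproj l)"
    by (simp add: cmat_wproj_sum block_def matrix_mul_assoc)
  also have "\<dots> = (\<Sum>m\<in>indices. cmat (wproj k) ** M ** cmat (wproj m) ** N ** cmat (wproj l))"
    by (simp only: mat_mult_sum_left mat_mult_sum_right)
  also have "\<dots> = (\<Sum>m\<in>indices. block k m M ** block m l N)"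
  proof (intro sum.cong refl)
    fix m assume m: "m \<in> indices"
    have "block k m M ** block m l N
      = cmat (wproj k) ** M ** (cmat (wproj m) ** cmat (wproj m)) ** N ** cmat (wproj l)"
      by (simp only: block_def matrix_mul_assoc)
    then show "cmat (wproj k) ** M ** cmat (wproj m) ** N ** cmat (wproj l) = block k m M ** block m l N"
      by (simp add: cmat_wproj_mult m)
  qed
  finally show ?thesis .
qed

lemma block_diag_left:
  fixes a :: "'j \<times> ('g \<Rightarrow> complex) \<Rightarrow> 'a::hbar_algebra"
  assumes "k \<in> indices"
  shows "cmat (wproj k) ** (\<Sum>m\<in>indices. smat (a m) (cmat (wproj m))) = smat (a k) (cmat (wproj k))"
proof -
  have "cmat (wproj k) ** (\<Sum>m\<in>indices. smat (a m) (cmat (wproj m)))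
    = (\<Sum>m\<in>indices. if k = m then smat (a m) (cmat (wproj k)) else 0)"
    unfolding mat_mult_sum_right by (intro sum.cong refl) (simp add: cmat_smat_mult cmat_wproj_mult assms)
  then show ?thesis using finite_indices assms by simp
qed

lemma block_diag_right:
  fixes a :: "'j \<times> ('g \<Rightarrow> complex) \<Rightarrow> 'a::hbar_algebra"
  assumes "l \<in> indices"
  shows "(\<Sum>m\<in>indices. smat (a m) (cmat (wproj m))) ** cmat (wproj l) = smat (a l) (cmat (wproj l))"
proof -
  have "(\<Sum>m\<in>indices. smat (a m) (cmat (wproj m))) ** cmat (wproj l)
    = (\<Sum>m\<in>indices. if l = m then smat (a m) (cmat (wproj l)) else 0)"
    unfolding mat_mult_sum_left by (intro sum.cong refl) (auto simp add: smat_mult_left cmat_wproj_mult assms)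
  then show ?thesis using finite_indices assms by simp
qed

lemma weight_diff_dual:
  "k \<in> indices \<Longrightarrow> l \<in> indices \<Longrightarrow> snd k - snd l \<in> cartan_dual L"
  by (auto simp: weights_def dual_def right_diff_distrib)

text \<open>A matrix of weight \<gamma> maps the weight \<nu> to \<nu> + \<gamma>: sandwiched
  between projections, the commutator with h is the scalar given by the difference of
  weights.\<close>

lemma block_weight_zero:
  fixes M :: "'a::hbar_algebra^'n^'n"
  assumes M: "\<And>h. h \<in> cartan L \<Longrightarrow> cmat (\<pi> h) ** M - M ** cmat (\<pi> h) = smat (of_cx (\<gamma> h)) M"
    and \<gamma>: "\<gamma> \<in> cartan_dual L" and k: "k \<in> indices" and l: "l \<in> indices" and ne: "snd k - snd l \<noteq> \<gamma>"
  shows "block k l M = 0"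
proof -
  obtain h where h: "h \<in> cartan L" "(snd k - snd l) h \<noteq> \<gamma> h"
    using dual_eqI[OF weight_diff_dual[OF k l] \<gamma>] ne by blast
  have "cmat (wproj k) ** (cmat (\<pi> h) ** M - M ** cmat (\<pi> h)) ** cmat (wproj l)
    = smat (of_cx (snd k h)) (block k l M) - smat (of_cx (snd l h)) (block k l M)"
  proof -
    have 1: "cmat (wproj k) ** cmat (\<pi> h) = smat (of_cx (snd k h)) (cmat (wproj k) :: 'a^'n^'n)"
      by (simp add: wproj_pi[OF h(1) k] cmat_smat flip: cmat_mult)
    have 2: "cmat (\<pi> h) ** cmat (wproj l) = smat (of_cx (snd l h)) (cmat (wproj l) :: 'a^'n^'n)"
      by (simp add: pi_wproj[OF h(1) l] cmat_smat flip: cmat_mult)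
    have "cmat (wproj k) ** (cmat (\<pi> h) ** M) ** cmat (wproj l) = smat (of_cx (snd k h)) (block k l M)"
      by (simp add: matrix_mul_assoc 1 smat_mult_left block_def)
    moreover have "cmat (wproj k) ** (M ** cmat (\<pi> h)) ** cmat (wproj l) = smat (of_cx (snd l h)) (block k l M)"
    proof -
      have sc: "X ** smat (of_cx c) Y = smat (of_cx c) (X ** (Y :: 'a^'n^'n))" for X Y c
        by (rule mat_eqI) (simp add: mat_mult_nth sum_distrib_left of_fps_left_commute)
      have "cmat (wproj k) ** (M ** cmat (\<pi> h)) ** cmat (wproj l) = cmat (wproj k) ** M ** (cmat (\<pi> h) ** cmat (wproj l))"
        by (simp only: matrix_mul_assoc)
      then show ?thesis by (simp add: 2 sc block_def)
    qed
    ultimately show ?thesis by (simp add: mat_mult_diff_left mat_mult_diff_right)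
  qed
  moreover have "cmat (wproj k) ** (cmat (\<pi> h) ** M - M ** cmat (\<pi> h)) ** cmat (wproj l) = smat (of_cx (\<gamma> h)) (block k l M)"
    by (simp add: M h(1) cmat_smat_mult smat_mult_left block_def)
  ultimately have eq: "smat (of_cx (snd k h)) (block k l M) - smat (of_cx (snd l h)) (block k l M) = smat (of_cx (\<gamma> h)) (block k l M)"
    by simp
  show ?thesis
  proof (rule mat_eqI)
    fix i j
    have "of_cx (snd k h) * block k l M $ i $ j - of_cx (snd l h) * block k l M $ i $ j = of_cx (\<gamma> h) * block k l M $ i $ j"
      using arg_cong[OF eq, of "\<lambda>M. M $ i $ j"] by simp
    then have "of_cx (snd k h - snd l h - \<gamma> h) * block k l M $ i $ j = 0"
      by (simp only: of_cx_diff left_diff_distrib diff_self)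
    then show "block k l M $ i $ j = 0 $ i $ j" using of_cx_eq_0 h(2) by fastforce
  qed
qed

lemma hlinear_block:
  assumes "\<And>i j. hlinear (\<lambda>x. F x $ i $ j)" shows "hlinear (\<lambda>x. block k l (F x) $ i $ j)"
  unfolding block_def mat_mult_nth map_mat_nth
  by (intro hlinear_lincomb hlinear_comp[OF hlinear_mult_right] hlinear_comp[OF hlinear_mult_left] assms)

text \<open>Back substitution along the partial order of weights.\<close>

lemma unitriangular_inverse:
  fixes N N' :: "'a::hbar_algebra^'n^'n"
  assumes inv: "N ** N' = mat 1"
    and tri: "\<And>k l. k \<in> indices \<Longrightarrow> l \<in> indices \<Longrightarrow> snd l - snd k \<notin> Qplus L \<Longrightarrow> block k l N = 0"
    and diag: "\<And>k l. k \<in> indices \<Longrightarrow> l \<in> indices \<Longrightarrow> snd k = snd l \<Longrightarrow> block k l N = block k l (mat 1)"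
    and k: "k \<in> indices" and l: "l \<in> indices"
  shows "snd l - snd k \<notin> Qplus L \<Longrightarrow> block k l N' = 0"
    and "snd k = snd l \<Longrightarrow> block k l N' = block k l (mat 1)"
proof -
  \<comment> \<open>The indices with strictly larger weight. Antisymmetry of the order makes these
    sets strictly decreasing along it, so induction on their size runs from the top weights
    downwards.\<close>
  define above where "above k = {m\<in>indices. snd m - snd k \<in> Qplus L - {0}}" for k :: "'j \<times> ('g \<Rightarrow> complex)"
  have fin: "finite (above k)" for k using finite_indices by (simp add: above_def)
  have mono: "above m \<subset> above k" if "m \<in> above k" for m k
  proof -
    have mk: "snd m - snd k \<in> Qplus L" "snd m - snd k \<noteq> 0" using that by (auto simp: above_def)
    have "n \<in> above k" if "n \<in> above m" for n
    proof -
      have nm: "n \<in> indices" "snd n - snd m \<in> Qplus L" "snd n - snd m \<noteq> 0" using that by (auto simp: above_def)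
      have sum: "(snd n - snd m) + (snd m - snd k) \<in> Qplus L" by (rule Qplus_add[OF nm(2) mk(1)])
      have "snd n - snd k \<noteq> 0"
      proof
        assume "snd n - snd k = 0"
        then have "- (snd m - snd k) = snd n - snd m" by (simp add: algebra_simps)
        then have "- (snd m - snd k) \<in> Qplus L" using nm(2) by simp
        then show False using Qplus_antisym[OF mk(1)] mk(2) by blast
      qed
      then show ?thesis using sum nm(1) by (simp add: above_def)
    qed
    moreover have "m \<notin> above m" by (simp add: above_def)
    ultimately show ?thesis using that by blast
  qed
  have main: "(snd l - snd k \<notin> Qplus L \<longrightarrow> block k l N' = 0) \<and> (snd k = snd l \<longrightarrow> block k l N' = block k l (mat 1))"
    if "k \<in> indices" for k
    using that
  proof (induction "card (above k)" arbitrary: k rule: less_induct)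
    case less
    note k = less.prems
    have IH: "(snd l - snd m \<notin> Qplus L \<longrightarrow> block m l N' = 0)" if "m \<in> above k" for m
      using less.hyps[of m] that psubset_card_mono[OF fin mono[OF that]] by (auto simp: above_def)
    \<comment> \<open>The (k, l) block of N N' = 1; its term m = k is the unknown block, and the
      other nonzero terms involve only blocks from larger weights.\<close>
    have "block k l (mat 1) = (\<Sum>m\<in>indices. block k m N ** block m l N')"
      unfolding block_mult[symmetric] inv ..
    also have "\<dots> = block k k N ** block k l N' + (\<Sum>m\<in>indices - {k}. block k m N ** block m l N')"
      using k finite_indices by (intro sum.remove) auto
    also have "block k k N ** block k l N' = block k l N'"
      using k by (simp add: diag block_1) (simp add: block_def cmat_wproj_mult matrix_mul_assoc)
    finally have eq: "block k l (mat 1) = block k l N' + (\<Sum>m\<in>indices - {k}. block k m N ** block m l N')" .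
    have zero: "block k m N ** block m l N' = 0"
      if m: "m \<in> indices - {k}" and a: "m \<in> above k \<Longrightarrow> snd l - snd m \<notin> Qplus L" for m
    proof (cases "m \<in> above k")
      case True
      then show ?thesis using IH a by simp
    next
      case False
      then have "snd m - snd k \<notin> Qplus L \<or> snd k = snd m" using m by (auto simp: above_def)
      then have "block k m N = 0" 
      proof
        assume "snd k = snd m"
        moreover have "k \<noteq> m" using m by blast
        ultimately show ?thesis using m k diag[of k m] by (simp add: block_1)
      qed (use m k tri[of k m] in simp)
      then show ?thesis by simp
    qed
    show ?case
    proof (intro conjI impI)
      assume nQ: "snd l - snd k \<notin> Qplus L"
      then have "k \<noteq> l" using Qplus_0 by auto
      have "(\<Sum>m\<in>indices - {k}. block k m N ** block m l N') = 0"
      proof (intro sum.neutral ballI zero)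
        fix m assume "m \<in> above k"
        then have "snd m - snd k \<in> Qplus L" by (simp add: above_def)
        show "snd l - snd m \<notin> Qplus L"
          using nQ
        proof (rule contrapos_nn)
          assume "snd l - snd m \<in> Qplus L"
          then have "(snd l - snd m) + (snd m - snd k) \<in> Qplus L"
            using \<open>snd m - snd k \<in> Qplus L\<close> by (rule Qplus_add)
          then show "snd l - snd k \<in> Qplus L" by simp
        qed
      qed
      then show "block k l N' = 0" using eq \<open>k \<noteq> l\<close> k l by (simp add: block_1)
    next
      assume kl: "snd k = snd l"
      have "(\<Sum>m\<in>indices - {k}. block k m N ** block m l N') = 0"
      proof (intro sum.neutral ballI zero notI)
        fix m assume m: "m \<in> above k" and lm: "snd l - snd m \<in> Qplus L"
        have "- (snd m - snd k) \<in> Qplus L" using lm kl by (simp add: minus_diff_eq)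
        moreover have "snd m - snd k \<in> Qplus L" "snd m - snd k \<noteq> 0" using m by (simp_all add: above_def)
        ultimately show False using Qplus_antisym by blast
      qed
      then show "block k l N' = block k l (mat 1)" using eq by simp
    qed
  qed
  show "snd l - snd k \<notin> Qplus L \<Longrightarrow> block k l N' = 0"
    "snd k = snd l \<Longrightarrow> block k l N' = block k l (mat 1)" using main[OF k] by auto
qed

end

section \<open>Factorization of the generating matrices\<close>

lemma hhom_of_fps_map: "hhom (of_fps :: complex fps \<Rightarrow> 'a::hbar_algebra)"
  by (simp add: hhom_def hlinear_def of_fps_1 of_fps_add of_fps_mult of_fps_complex)

lemma map_mat_of_fps_const: "map_mat of_fps (map_mat fps_const A) = cmat A"
  by (simp add: map_mat_comp)

locale R_matrix_setup = quantum_double_setup L \<pi> V Q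
  for L :: "('g::ab_group_add, 'i::finite) lie_data"
    and \<pi> :: "'g \<Rightarrow> complex^'n^'n"
    and V :: "'j::finite \<Rightarrow> (complex^'n) set"
    and Q :: "('g, 'i, 'u::hbar_algebra, 'c::hbar_algebra) double" +
  fixes R :: "('u \<otimes> 'c) \<otimes> ('u \<otimes> 'c)"
    and \<pi>h :: "'u \<Rightarrow> complex fps^'n^'n"
    and T :: "pm \<Rightarrow> 'r::hbar_algebra^'n^'n" and HR :: "'r hopf"
    and \<iota> :: "(complex^'n^'n \<Rightarrow> complex) \<Rightarrow> 's::hbar_algebra" and HZ :: "pm \<Rightarrow> 's hopf"
    and \<Upsilon> :: "'r \<Rightarrow> (('u \<otimes> 'c) \<otimes> 's) \<otimes> 's"
    and z :: "pm \<Rightarrow> 'j \<Rightarrow> 'r"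
  assumes universal: "universal_R L Q R"
    and quantum_rep: "quantum_representation L Q \<pi> \<pi>h"
    and RTT: "R_matrix_algebra L \<pi> (pi_tensor_pi (piD L Q \<pi>h) R) T HR"
    and central: "central_factor \<pi> \<iota> HZ"
    and iso: "Upsilon_isomorphism L Q R \<pi> \<pi>h T HR \<iota> HZ \<Upsilon>"
    and primitive: "central_elements \<pi> V \<iota> \<Upsilon> z"
begin

lemma
  shows hhom_omega: "hhom (omegaD Q)"
    and symmetric_Sh: "symmetric_hbar_algebra (scaleL L) (cartan L) (Sh Q)"
    and hopf_D: "topological_hopf_algebra (hopfD Q)"
  using double unfolding quantum_double_def by (elim conjE, (assumption | blast)+)+

lemma
  shows hhom_counit_Sh: "hhom (counit_Sh L Q)"
    and counit_Sh: "h \<in> cartan L \<Longrightarrow> counit_Sh L Q (Sh Q h) = 0"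
  using theI'[OF symmetric_hbar_algebra_counit[OF symmetric_Sh], folded counit_Sh_def] by simp_all

abbreviation "p \<equiv> piD L Q \<pi>h"

lemma counit_factor:
  defines "G \<equiv> tensor_lift (\<lambda>u s. u * of_fps (counit_Sh L Q s) :: 'u)"
  shows "hhom G" and "h \<in> cartan L \<Longrightarrow> G (hplus Q h) = Uh Q h"
    and "h \<in> cartan L \<Longrightarrow> G (hminus Q h) = Uh Q h" and "G (D0 h) = Uh Q h"
proof -
  note e = hhom_counit_Sh
  have bil: "hbilinear (\<lambda>u s. u * of_fps (counit_Sh L Q s) :: 'u)"
    by (intro hbilinearI hlinear_mult_right hlinear_comp[OF hlinear_mult_left]
        hhom_hlinear[OF hhom_comp[OF hhom_of_fps_map e]])
  have G: "G (u \<otimes> s) = u * of_fps (counit_Sh L Q s)" for u s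
    unfolding G_def by (rule tensor_lift_tensor[OF bil])
  show hG: "hhom G"
  proof (rule hhom_tensorI)
    show "hlinear G" unfolding G_def by (rule hlinear_tensor_lift[OF bil])
    show "G 1 = 1" by (simp add: tensor_one G hhom_1[OF e] of_fps_1)
    fix a s a' s'
    show "G ((a \<otimes> s) * (a' \<otimes> s')) = G (a \<otimes> s) * G (a' \<otimes> s')"
      unfolding tensor_mult G hhom_mult[OF e] of_fps_mult
      by (simp add: mult.assoc of_fps_left_commute of_fps_central[of "counit_Sh L Q s" a', symmetric])
  qed
  show D0: "G (D0 h) = Uh Q h" for h by (simp add: G hhom_1[OF e] of_fps_1)
  show "G (hplus Q h) = Uh Q h" "G (hminus Q h) = Uh Q h" if "h \<in> cartan L" for h
    by (simp_all add: hplus_def hminus_def zetaD_def hlinear_add[OF hhom_hlinear[OF hG]]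
        hlinear_diff[OF hhom_hlinear[OF hG]] G hhom_1[OF e] of_fps_1 counit_Sh that)
qed

lemma mat_hom_p: "mat_hom p"
proof -
  have add: "\<pi>h (x + y) = \<pi>h x + \<pi>h y" and scale: "\<pi>h (of_fps c * x) = smat c (\<pi>h x)"
    and one: "\<pi>h 1 = mat 1" and mult: "\<pi>h (x * y) = \<pi>h x ** \<pi>h y" for x y c
    using quantum_rep unfolding quantum_representation_def by blast+
  have "mat_hom \<pi>h"
    unfolding mat_hom_def hlinear_def
  proof (intro conjI allI)
    show "\<pi>h (of_fps c * x) $ i $ j = of_fps c * \<pi>h x $ i $ j" for c x i j
      by (simp only: scale smat_nth of_fps_complex)
  qed (simp_all only: add mult one vector_add_component)
  from mat_hom_comp[OF this counit_factor(1)] show ?thesis by (simp add: piD_def[abs_def])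
qed

lemma
  assumes "h \<in> cartan L"
  shows p_hplus: "map_mat of_fps (p (hplus Q h)) = cmat (\<pi> h)"
    and p_hminus: "map_mat of_fps (p (hminus Q h)) = cmat (\<pi> h)"
    and p_D0: "map_mat of_fps (p (D0 h)) = cmat (\<pi> h)"
proof -
  have "\<pi>h (Uh Q h) = map_mat fps_const (\<pi> h)"
    using quantum_rep assms unfolding quantum_representation_def by simp
  then show "map_mat of_fps (p (hplus Q h)) = cmat (\<pi> h)" "map_mat of_fps (p (hminus Q h)) = cmat (\<pi> h)"
    "map_mat of_fps (p (D0 h)) = cmat (\<pi> h)"
    by (simp_all add: piD_def counit_factor assms map_mat_of_fps_const)
qed

lemma
  shows hhom_Upsilon: "hhom \<Upsilon>" and bij_Upsilon: "bij \<Upsilon>"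
    and Upsilon_L: "map_mat \<Upsilon> (L_mat T s) =
        map_mat (\<lambda>d. (d \<otimes> 1) \<otimes> 1) (pi_tensor_id p (R_omega Q R s)) ** map_mat (embed_central s) (Z_ring \<pi> \<iota> s)"
  using iso unfolding Upsilon_isomorphism_def hopf_isomorphism_def by blast+

lemma hhom_inv_Upsilon: "hhom (inv \<Upsilon>)"
  by (rule hhom_inv[OF hhom_Upsilon bij_Upsilon])

lemma inv_Upsilon: "inv \<Upsilon> (\<Upsilon> x) = x"
  by (rule inv_f_f[OF bij_is_inj[OF bij_Upsilon]])

definition embed_double :: "'u \<otimes> 'c \<Rightarrow> 'r" where
  "embed_double d = inv \<Upsilon> ((d \<otimes> 1) \<otimes> 1)"

definition embed_omega :: "'u \<otimes> 'c \<Rightarrow> 'r" where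
  "embed_omega d = embed_double (omegaD Q d)"

lemma hhom_embed_double: "hhom embed_double"
  unfolding embed_double_def[abs_def]
  by (intro hhom_comp[OF hhom_inv_Upsilon] hhom_comp[OF hhom_tensor_left] hhom_tensor_left)

lemma hhom_embed_omega: "hhom embed_omega"
  unfolding embed_omega_def[abs_def] by (rule hhom_comp[OF hhom_embed_double hhom_omega])

definition \<Psi> :: "('u \<otimes> 'c) \<otimes> ('u \<otimes> 'c) \<Rightarrow> 'r^'n^'n" where
  "\<Psi> x = (\<chi> i j. tensor_lift (\<lambda>a b. of_fps (p a $ i $ j) * embed_omega b) x)"

lemma mat_hom_Psi: "mat_hom \<Psi>" and Psi_tensor: "\<Psi> (a \<otimes> b) = smat (embed_omega b) (map_mat of_fps (p a))"
proof -
  obtain \<Psi>' where \<Psi>': "mat_hom \<Psi>'" "\<And>a b. \<Psi>' (a \<otimes> b) = smat (embed_omega b) (map_mat of_fps (p a))"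
    "\<And>x i j. \<Psi>' x $ i $ j = tensor_lift (\<lambda>a b. of_fps (p a $ i $ j) * embed_omega b) x"
    by (rule mat_hom_tensor[OF mat_hom_p hhom_embed_omega]) blast
  have "\<Psi> = \<Psi>'" by (rule ext, rule mat_eqI) (simp add: \<Psi>_def \<Psi>'(3))
  then show "mat_hom \<Psi>" "\<Psi> (a \<otimes> b) = smat (embed_omega b) (map_mat of_fps (p a))" using \<Psi>' by simp_all
qed

lemma Psi_omega: "map_mat embed_double (pi_tensor_id p (tensor_map id (omegaD Q) x)) = \<Psi> x"
proof (rule mat_eqI)
  fix i j
  have bil: "hbilinear (\<lambda>a b. of_fps (p a $ i $ j) * b)"
    using hbilinear_entry[OF mat_hom_p, of "\<lambda>x. x"] by (simp add: hhom_def hlinear_id)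
  have om: "hlinear (omegaD Q)" and id: "hlinear (id :: 'u \<otimes> 'c \<Rightarrow> 'u \<otimes> 'c)"
    by (simp_all add: hhom_hlinear[OF hhom_omega] id_def hlinear_id)
  note E = hhom_embed_double
  have "embed_double (tensor_lift (\<lambda>a b. of_fps (p a $ i $ j) * b) (tensor_map id (omegaD Q) x)) = \<Psi> x $ i $ j"
  proof (rule hlinear_tensor_eqI[of _ "\<lambda>x. \<Psi> x $ i $ j"])
    show "hlinear (\<lambda>x. embed_double (tensor_lift (\<lambda>a b. of_fps (p a $ i $ j) * b) (tensor_map id (omegaD Q) x)))"
      by (rule hlinear_comp[OF hhom_hlinear[OF E] hlinear_comp[OF hlinear_tensor_lift[OF bil] hlinear_tensor_map[OF id om]]])
    show "hlinear (\<lambda>x. \<Psi> x $ i $ j)" by (rule mat_hom_hlinear[OF mat_hom_Psi])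
    show "embed_double (tensor_lift (\<lambda>a b. of_fps (p a $ i $ j) * b) (tensor_map id (omegaD Q) (a \<otimes> b)))
      = \<Psi> (a \<otimes> b) $ i $ j" for a b
      unfolding tensor_map_tensor[OF id om] tensor_lift_tensor[OF bil] hhom_mult[OF E] hhom_of_fps[OF E]
      by (simp add: Psi_tensor embed_omega_def of_fps_central)
  qed
  then show "map_mat embed_double (pi_tensor_id p (tensor_map id (omegaD Q) x)) $ i $ j = \<Psi> x $ i $ j"
    by (simp add: pi_tensor_id_def)
qed

definition R_signed :: "pm \<Rightarrow> ('u \<otimes> 'c) \<otimes> ('u \<otimes> 'c)" where
  "R_signed s = (case s of Pls \<Rightarrow> R | Mns \<Rightarrow> hinverse (tensor_flip R))"

definition central_matrix :: "pm \<Rightarrow> 'r^'n^'n" where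
  "central_matrix s = map_mat (\<lambda>x. inv \<Upsilon> (embed_central s x)) (Z_ring \<pi> \<iota> s)"

lemma L_factorization: "L_mat T s = \<Psi> (R_signed s) ** central_matrix s"
proof -
  have "L_mat T s = map_mat (inv \<Upsilon>) (map_mat \<Upsilon> (L_mat T s))"
    by (simp add: map_mat_comp inv_Upsilon) (simp add: map_mat_def)
  also have "\<dots> = map_mat embed_double (pi_tensor_id p (R_omega Q R s)) ** central_matrix s"
    unfolding Upsilon_L map_mat_mult[OF hhom_inv_Upsilon] by (simp add: map_mat_comp embed_double_def[abs_def] central_matrix_def)
  also have "R_omega Q R s = tensor_map id (omegaD Q) (R_signed s)" by (cases s) (simp_all add: R_signed_def)
  finally show ?thesis by (simp only: Psi_omega)
qed

text \<open>Injectivity is obtained from the counits of the other tensor factors. It is needed to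
  carry the diagonal form of \<open>Z\<close>, which is only known for its image in the R-matrix
  algebra, back to the symmetric algebra.\<close>

lemma
  shows hhom_embed_central: "hhom (embed_central s :: 's \<Rightarrow> (('u \<otimes> 'c) \<otimes> 's) \<otimes> 's)"
    and inj_embed_central: "inj (embed_central s :: 's \<Rightarrow> (('u \<otimes> 'c) \<otimes> 's) \<otimes> 's)"
proof -
  let ?\<epsilon> = "counit (hopfD Q)" and ?\<delta> = "counit (HZ Pls)"
  have "hhom ?\<epsilon>" "hhom ?\<delta>"
    using hopf_D central unfolding topological_hopf_algebra_def central_factor_def by blast+
  then have \<epsilon>: "hlinear ?\<epsilon>" "?\<epsilon> 1 = 1" and \<delta>: "hlinear ?\<delta>" "?\<delta> 1 = 1"
    by (simp_all add: hhom_hlinear hhom_1)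
  obtain \<phi> :: "('u \<otimes> 'c) \<otimes> 's \<Rightarrow> complex fps" where \<phi>: "hlinear \<phi>" "\<phi> 1 = 1"
    by (rule tensor_functional[OF \<epsilon> \<delta>])
  have emb_Pls: "embed_central Pls = (\<lambda>x :: ('u \<otimes> 'c) \<otimes> 's. x \<otimes> (1 :: 's)) \<circ> (\<lambda>x :: 's. (1 :: 'u \<otimes> 'c) \<otimes> x)"
    by (rule ext) simp
  have emb_Mns: "embed_central Mns = (\<lambda>x :: 's. (1 :: ('u \<otimes> 'c) \<otimes> 's) \<otimes> x)"
    by (rule ext) (simp add: tensor_one[where ?'a = "'u \<otimes> 'c"])
  show "inj (embed_central s :: 's \<Rightarrow> (('u \<otimes> 'c) \<otimes> 's) \<otimes> 's)"
  proof (cases s)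
    case Pls
    then show ?thesis
      by (simp only: emb_Pls) (rule inj_compose[OF inj_tensor_left[OF \<delta>] inj_tensor_right[OF \<epsilon>]])
  next
    case Mns
    then show ?thesis using inj_tensor_right[OF \<phi>] by (simp only: emb_Mns)
  qed
  show "hhom (embed_central s :: 's \<Rightarrow> (('u \<otimes> 'c) \<otimes> 's) \<otimes> 's)"
  proof (cases s)
    case Pls
    then show ?thesis
      by (simp only: emb_Pls comp_def) (rule hhom_comp[OF hhom_tensor_left hhom_tensor_right])
  next
    case Mns
    then show ?thesis using hhom_tensor_right by (simp only: emb_Mns)
  qed
qed

definition \<phi> :: "pm \<Rightarrow> 's \<Rightarrow> 'r" where
  "\<phi> s x = inv \<Upsilon> (embed_central s x)"

lemma hhom_phi: "hhom (\<phi> s)" and inj_phi: "inj (\<phi> s)"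
proof -
  show "hhom (\<phi> s)"
    unfolding \<phi>_def[abs_def] by (rule hhom_comp[OF hhom_inv_Upsilon hhom_embed_central])
  have "\<phi> s = inv \<Upsilon> \<circ> embed_central s" by (rule ext) (simp add: \<phi>_def)
  then show "inj (\<phi> s)"
    using inj_compose[OF bij_is_inj[OF bij_imp_bij_inv[OF bij_Upsilon]] inj_embed_central] by simp
qed

text \<open>The elements \<open>z s j\<close> are given in the R-matrix algebra, while the
  exponential equation for \<open>Z\<close> lives in the symmetric algebra. So preimages independent
  of the sign are produced, \<open>Z\<close> is diagonalized there by injectivity, and the matrix
  exponential is taken blockwise.\<close>

lemma central_diagonal:
  obtains \<zeta> :: "'j \<Rightarrow> 's" where "\<And>s j. \<phi> s (\<zeta> j) = z s j"
    "mat 1 + smat \<hbar> (canonical_element \<pi> \<iota>) = (\<Sum>j\<in>UNIV. smat (qpow (\<zeta> j)) (cmat (proj j)))"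
proof -
  obtain Z where Z: "mat_hexp (smat (of_cx (1/2) * \<hbar>) Z) = mat 1 + smat \<hbar> (canonical_element \<pi> \<iota>)"
    "\<And>s. map_mat (\<phi> s) Z = (\<Sum>j\<in>UNIV. smat (z s j) (cmat (proj j)))"
    using primitive unfolding central_elements_def \<phi>_def[abs_def] by blast
  \<comment> \<open>The coefficient of the projection onto \<open>V j\<close> is recovered as the
    trace of that projection times \<open>Z\<close>, divided by dim \<open>V j\<close>.\<close>
  define \<zeta> where "\<zeta> j = of_cx (1 / of_nat (vec.dim (V j))) * (\<Sum>a\<in>UNIV. \<Sum>b\<in>UNIV. of_cx (proj j $ a $ b) * Z $ b $ a)" for j
  have \<phi>\<zeta>: "\<phi> s (\<zeta> j) = z s j" for s j
  proof -
    note lin = hhom_hlinear[OF hhom_phi[of s]]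
    have trace_0': "trace (0 :: complex^'n^'n) = 0" by (simp add: trace_def)
    have Zba: "\<phi> s (Z $ b $ a) = (\<Sum>j'\<in>UNIV. z s j' * of_cx (proj j' $ b $ a))" for a b
      using arg_cong[OF Z(2)[of s], of "\<lambda>M. M $ b $ a"] by simp
    have "(\<Sum>a\<in>UNIV. \<Sum>b\<in>UNIV. of_cx (proj j $ a $ b) * \<phi> s (Z $ b $ a))
      = (\<Sum>a\<in>UNIV. \<Sum>b\<in>UNIV. \<Sum>j'\<in>UNIV. z s j' * of_cx (proj j $ a $ b * proj j' $ b $ a))"
      by (simp add: Zba sum_distrib_left of_cx_mult of_fps_left_commute)
    also have "\<dots> = (\<Sum>a\<in>UNIV. \<Sum>j'\<in>UNIV. \<Sum>b\<in>UNIV. z s j' * of_cx (proj j $ a $ b * proj j' $ b $ a))"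
      by (intro sum.cong refl sum.swap)
    also have "\<dots> = (\<Sum>j'\<in>UNIV. \<Sum>a\<in>UNIV. \<Sum>b\<in>UNIV. z s j' * of_cx (proj j $ a $ b * proj j' $ b $ a))"
      by (rule sum.swap)
    also have "\<dots> = (\<Sum>j'\<in>UNIV. z s j' * of_cx (trace (proj j ** proj j')))"
      by (simp add: trace_def mat_mult_nth of_cx_sum sum_distrib_left)
    also have "\<dots> = (\<Sum>j'\<in>UNIV. if j = j' then z s j * of_cx (of_nat (vec.dim (V j))) else 0)"
      by (intro sum.cong refl) (simp add: idempotents_mult[OF proj_idempotents] trace_proj trace_0')
    also have "\<dots> = of_cx (of_nat (vec.dim (V j))) * z s j" by (simp add: of_fps_central[of _ "z s j"])
    finally show ?thesis
      using of_cx_cancel[of "of_nat (vec.dim (V j))" "z s j"] dim_V_nonzero[of j]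
      by (simp add: \<zeta>_def hlinear_scale[OF lin] hlinear_sum[OF lin] inverse_eq_divide)
  qed
  have eq: "map_mat (\<phi> Pls) Z = map_mat (\<phi> Pls) (\<Sum>j\<in>UNIV. smat (\<zeta> j) (cmat (proj j)))"
    by (simp add: Z(2) map_mat_sum[OF hhom_hlinear[OF hhom_phi]] map_mat_smat[OF hhom_phi]
        map_mat_cmat[OF hhom_phi] \<phi>\<zeta>)
  have "\<phi> Pls (Z $ a $ b) = \<phi> Pls ((\<Sum>j\<in>UNIV. smat (\<zeta> j) (cmat (proj j))) $ a $ b)" for a b
    using arg_cong[OF eq, of "\<lambda>M. M $ a $ b"] unfolding map_mat_nth .
  then have "Z $ a $ b = (\<Sum>j\<in>UNIV. smat (\<zeta> j) (cmat (proj j))) $ a $ b" for a b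
    by (rule injD[OF inj_phi])
  then have "Z = (\<Sum>j\<in>UNIV. smat (\<zeta> j) (cmat (proj j)))" by (rule mat_eqI)
  then have "mat 1 + smat \<hbar> (canonical_element \<pi> \<iota>) = (\<Sum>j\<in>UNIV. smat (qpow (\<zeta> j)) (cmat (proj j)))"
    using Z(1) mat_hexp_block_diag[OF proj_idempotents, of \<zeta>] by simp
  then show thesis using that \<phi>\<zeta> by blast
qed

lemma central_matrix_eq: "central_matrix s = (\<Sum>j\<in>UNIV. smat (qpow (of_cx (pm_sign s) * z s j)) (cmat (proj j)))"
proof -
  obtain \<zeta> :: "'j \<Rightarrow> 's" where \<zeta>: "\<And>s j. \<phi> s (\<zeta> j) = z s j"
    "mat 1 + smat \<hbar> (canonical_element \<pi> \<iota>) = (\<Sum>j\<in>UNIV. smat (qpow (\<zeta> j)) (cmat (proj j)))"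
    by (rule central_diagonal) blast
  have inv: "qpow (a :: 's) * qpow (- a) = 1" for a
    using qpow_add[of a "- a"] by (simp add: qpow_0)
  have inv': "qpow (- a) * qpow (a :: 's) = 1" for a
    using inv[of "- a"] by simp
  have "Z_ring \<pi> \<iota> s = (\<Sum>j\<in>UNIV. smat (qpow (of_cx (pm_sign s) * \<zeta> j)) (cmat (proj j)))"
  proof (cases s)
    case Mns
    have "matrix_inv (\<Sum>j\<in>UNIV. smat (qpow (\<zeta> j)) (cmat (proj j))) = (\<Sum>j\<in>UNIV. smat (qpow (- \<zeta> j)) (cmat (proj j)))"
      by (rule matrix_inv_unique_ring;
          simp only: block_diag_mult[OF proj_idempotents] inv inv' block_diag_1[OF proj_idempotents])
    then show ?thesis using Mns by (simp add: \<zeta>(2) of_cx_minus)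
  qed (simp add: \<zeta>(2))
  then have "central_matrix s = map_mat (\<phi> s) (\<Sum>j\<in>UNIV. smat (qpow (of_cx (pm_sign s) * \<zeta> j)) (cmat (proj j)))"
    by (simp add: central_matrix_def \<phi>_def[abs_def])
  then show ?thesis
    by (simp add: map_mat_sum[OF hhom_hlinear[OF hhom_phi]] map_mat_smat[OF hhom_phi]
        map_mat_cmat[OF hhom_phi] qpow_hhom[OF hhom_phi] hlinear_scale[OF hhom_hlinear[OF hhom_phi]] \<zeta>(1))
qed

end

context quantum_double_setup
begin

text \<open>A fixed block sees only terms whose weight is its own difference of weights, so no limit
  process remains. \<sigma> is the identity for the R-matrix and the negation after the flip, which
  exchanges the legs of opposite weights.\<close>

lemma block_has_hsum:
  fixes F :: "'b::hbar_algebra \<Rightarrow> 'a::hbar_algebra^'n^'n"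
  assumes sum: "has_hsum f (Qplus L) S" and lin: "\<And>i j. hlinear (\<lambda>x. F x $ i $ j)"
    and f0: "F (f 0) = mat 1" and \<sigma>: "\<And>\<beta>. \<sigma> \<beta> = 0 \<longleftrightarrow> \<beta> = 0"
    and van: "\<And>\<beta>. \<beta> \<in> Qplus L \<Longrightarrow> snd k - snd l \<noteq> \<sigma> \<beta> \<Longrightarrow> block k l (F (f \<beta>)) = 0"
  shows "snd k - snd l \<notin> \<sigma> ` Qplus L \<Longrightarrow> block k l (F S) = 0"
    and "snd k = snd l \<Longrightarrow> block k l (F S) = block k l (mat 1)"
proof -
  note linb = hlinear_block[of F k l, OF lin]
  have "\<exists>M. finite M \<and> 0 \<in> M \<and> M \<subseteq> Qplus L \<and>
      (\<forall>i j. hcong N (block k l (F S) $ i $ j) (\<Sum>\<beta>\<in>M. block k l (F (f \<beta>)) $ i $ j))" for N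
  proof -
    obtain F0 where F0: "finite F0" "F0 \<subseteq> Qplus L"
      "\<And>M. finite M \<Longrightarrow> F0 \<subseteq> M \<Longrightarrow> M \<subseteq> Qplus L \<Longrightarrow> hcong N (sum f M) S"
      by (rule has_hsum_terms[OF sum, of N]) blast
    have "hcong N S (sum f (insert 0 F0))"
      by (rule hcong_sym, rule F0(3)) (use F0 Qplus_0 in auto)
    then have "hcong N (block k l (F S) $ i $ j) (\<Sum>\<beta>\<in>insert 0 F0. block k l (F (f \<beta>)) $ i $ j)" for i j
      using hlinear_hcong[OF linb[of i j]] hlinear_sum[OF linb[of i j], of f] by metis
    then show ?thesis using F0 Qplus_0 by (intro exI[of _ "insert 0 F0"]) auto
  qed
  then obtain M where M: "\<And>N. finite (M N)" "\<And>N. 0 \<in> M N" "\<And>N. M N \<subseteq> Qplus L"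
    "\<And>N i j. hcong N (block k l (F S) $ i $ j) (\<Sum>\<beta>\<in>M N. block k l (F (f \<beta>)) $ i $ j)"
    by metis
  show "block k l (F S) = 0" if "snd k - snd l \<notin> \<sigma> ` Qplus L"
  proof (rule mat_eqI, rule hcong_eqI)
    fix i j N
    have "(\<Sum>\<beta>\<in>M N. block k l (F (f \<beta>)) $ i $ j) = 0"
      using that M(3)[of N] by (intro sum.neutral ballI) (subst van, auto)
    then show "hcong N (block k l (F S) $ i $ j) (0 $ i $ j)" using M(4)[of N i j] by simp
  qed
  show "block k l (F S) = block k l (mat 1)" if eq: "snd k = snd l"
  proof (rule mat_eqI, rule hcong_eqI)
    fix i j N
    have "(\<Sum>\<beta>\<in>M N - {0}. block k l (F (f \<beta>)) $ i $ j) = 0"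
    proof (intro sum.neutral ballI)
      fix \<beta> assume \<beta>: "\<beta> \<in> M N - {0}"
      then have "snd k - snd l \<noteq> \<sigma> \<beta>" using \<sigma>[of \<beta>] eq by simp
      moreover have "\<beta> \<in> Qplus L" using \<beta> M(3)[of N] by blast
      ultimately show "block k l (F (f \<beta>)) $ i $ j = 0" by (simp add: van)
    qed
    then have "(\<Sum>\<beta>\<in>M N. block k l (F (f \<beta>)) $ i $ j) = block k l (mat 1) $ i $ j"
      by (simp add: sum.remove[OF M(1,2)] f0)
    then show "hcong N (block k l (F S) $ i $ j) (block k l (mat 1) $ i $ j)" using M(4)[of N i j] by simp
  qed
qed

end

lemma sum_scaled_commute:
  fixes f :: "'i \<Rightarrow> 'a::hbar_algebra"
  assumes "\<And>i. f i * y = y * f i"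
  shows "(\<Sum>i\<in>A. of_cx (c i) * f i) * y = y * (\<Sum>i\<in>A. of_cx (c i) * f i)"
  by (simp add: sum_distrib_left sum_distrib_right mult.assoc assms of_fps_left_commute[of y])

section \<open>The commuting family of torus and central elements, and the blocks of the
  R-matrix\<close>

context R_matrix_setup
begin

definition torus :: "('u \<otimes> 'c) set" where
  "torus = hplus Q ` cartan L \<union> hminus Q ` cartan L"

lemma torus_commute:
  assumes "x \<in> torus" "y \<in> torus" shows "x * y = y * x"
proof -
  have D: "D0 h * D0 k = D0 k * D0 h" if "h \<in> cartan L" "k \<in> cartan L" for h k
    by (simp add: tensor_mult Uh_commute[OF that])
  have z: "zetaD Q h * zetaD Q k = zetaD Q k * zetaD Q h" for h k
    by (simp add: zetaD_def tensor_mult symmetric_hbar_algebra_commute[OF symmetric_Sh, of "Sh Q h"])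
  obtain h c where h: "h \<in> cartan L" "x = D0 h + of_cx c * zetaD Q h"
  proof -
    from assms(1) consider h where "h \<in> cartan L" "x = hplus Q h" | h where "h \<in> cartan L" "x = hminus Q h"
      unfolding torus_def by blast
    then show thesis
    proof cases
      case 1 then show ?thesis using that[of h 1] by (simp add: hplus_def)
    next
      case 2 then show ?thesis using that[of h "- 1"] by (simp add: hminus_def of_cx_minus)
    qed
  qed
  obtain k d where k: "k \<in> cartan L" "y = D0 k + of_cx d * zetaD Q k"
  proof -
    from assms(2) consider h where "h \<in> cartan L" "y = hplus Q h" | h where "h \<in> cartan L" "y = hminus Q h"
      unfolding torus_def by blast
    then show thesis
    proof cases
      case 1 then show ?thesis using that[of h 1] by (simp add: hplus_def)
    next
      case 2 then show ?thesis using that[of h "- 1"] by (simp add: hminus_def of_cx_minus)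
    qed
  qed
  have "D0 h * (of_cx d * zetaD Q k) = of_cx d * zetaD Q k * D0 h"
    "of_cx c * zetaD Q h * D0 k = D0 k * (of_cx c * zetaD Q h)"
    by (simp_all only: of_fps_left_commute[of "D0 _"] mult.assoc D0_zeta)
  moreover have "of_cx c * zetaD Q h * (of_cx d * zetaD Q k) = of_cx d * zetaD Q k * (of_cx c * zetaD Q h)"
    by (simp only: of_fps_mult_mult z[of h k] mult.commute[of "fps_const c"])
  ultimately show ?thesis
    unfolding h(2) k(2) by (simp add: distrib_left distrib_right D h k add_ac)
qed

text \<open>The two maps come from different tensor factors of the target of \<Upsilon>.\<close>

lemma g_phi_commute: "embed_omega d * \<phi> s x = \<phi> s x * embed_omega d"
  unfolding embed_omega_def embed_double_def \<phi>_def hhom_mult[OF hhom_inv_Upsilon, symmetric]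
  by (cases s) (simp_all add: tensor_mult)

lemma phi_commute: "\<phi> s x * \<phi> s' y = \<phi> s' y * \<phi> s x"
proof -
  have "symmetric_hbar_algebra fun_scale (dual smat (gl_invariants \<pi>)) \<iota>"
    using central unfolding central_factor_def by blast
  note c = symmetric_hbar_algebra_commute[OF this, of x y]
  show ?thesis
    unfolding \<phi>_def hhom_mult[OF hhom_inv_Upsilon, symmetric]
    by (cases s; cases s') (simp_all add: tensor_mult c)
qed

lemma z_phi: "\<exists>\<zeta>. \<forall>s j. z s j = \<phi> s (\<zeta> j)"
proof -
  obtain \<zeta> where \<zeta>: "\<And>s j. \<phi> s (\<zeta> j) = z s j"
    by (rule central_diagonal) blast
  then show ?thesis by (intro exI[of _ \<zeta>]) simp
qed

definition diagonal :: "'r set" where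
  "diagonal = embed_omega ` torus \<union> {z s j | s j. True}"

lemma diagonal_commute:
  assumes "x \<in> diagonal" "y \<in> diagonal" shows "x * y = y * x"
proof -
  obtain \<zeta> where \<zeta>: "\<And>s j. z s j = \<phi> s (\<zeta> j)" using z_phi by blast
  have gg: "embed_omega a * embed_omega b = embed_omega b * embed_omega a" if "a \<in> torus" "b \<in> torus" for a b
    using torus_commute[OF that] by (simp add: hhom_mult[OF hhom_embed_omega, symmetric])
  show ?thesis
    using assms unfolding diagonal_def \<zeta> by (auto simp: gg g_phi_commute phi_commute)
qed

lemma Psi_cartan_qpow:
  assumes "\<And>i. h i \<in> cartan L" "\<And>i. map_mat of_fps (p (x i)) = (cmat (\<pi> (h i)) :: 'r^'n^'n)"
  shows "\<Psi> (qpow (\<Sum>i\<in>A. x i \<otimes> y i))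
    = (\<Sum>k\<in>indices. smat (qpow (\<Sum>i\<in>A. of_cx (snd k (h i)) * embed_omega (y i))) (cmat (wproj k)))"
proof (rule mat_hom_qpow[OF mat_hom_Psi wproj_idempotents])
  have "\<Psi> (\<Sum>i\<in>A. x i \<otimes> y i) = (\<Sum>i\<in>A. \<Sum>k\<in>indices. smat (of_cx (snd k (h i)) * embed_omega (y i)) (cmat (wproj k)))"
    unfolding mat_hom_sum[OF mat_hom_Psi]
    by (intro sum.cong refl)
      (simp add: Psi_tensor assms pi_cartan_sum cmat_sum smat_sum_right cmat_smat smat_smat of_fps_central)
  then show "\<Psi> (\<Sum>i\<in>A. x i \<otimes> y i) = (\<Sum>k\<in>indices. smat (\<Sum>i\<in>A. of_cx (snd k (h i)) * embed_omega (y i)) (cmat (wproj k)))"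
    by (simp add: smat_sum_left sum.swap[of _ A])
qed

lemma block_smat: "block k l (smat a M) = smat (a :: 'r) (block k l M)"
  by (simp add: block_def cmat_smat_mult smat_mult_left)

lemma p_weight_block:
  assumes a: "\<And>h. h \<in> cartan L \<Longrightarrow> comm (D0 h) a = of_cx (\<gamma> h) * a" and \<gamma>: "\<gamma> \<in> cartan_dual L"
    and k: "k \<in> indices" "l \<in> indices" "snd k - snd l \<noteq> \<gamma>"
  shows "block k l (\<Psi> (a \<otimes> b)) = 0"
proof -
  have "block k l (map_mat of_fps (p a) :: 'r^'n^'n) = 0"
  proof (rule block_weight_zero[OF _ \<gamma> k])
    fix h assume h: "h \<in> cartan L"
    note P = map_mat_mult[OF hhom_of_fps_map[where ?'a = 'r]]
    have "map_mat of_fps (p (comm (D0 h) a)) = (map_mat of_fps (p (of_cx (\<gamma> h) * a)) :: 'r^'n^'n)"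
      by (simp add: a h)
    moreover have "map_mat of_fps (p (comm (D0 h) a))
      = cmat (\<pi> h) ** map_mat of_fps (p a) - map_mat of_fps (p a) ** (cmat (\<pi> h) :: 'r^'n^'n)"
      unfolding comm_def mat_hom_diff[OF mat_hom_p] mat_hom_mult[OF mat_hom_p]
      unfolding p_D0[OF h, symmetric] P[symmetric]
      by (rule mat_eqI) (simp add: hlinear_diff[OF hhom_hlinear[OF hhom_of_fps_map]])
    moreover have "map_mat of_fps (p (of_cx (\<gamma> h) * a)) = (smat (of_cx (\<gamma> h)) (map_mat of_fps (p a)) :: 'r^'n^'n)"
      unfolding mat_hom_scale[OF mat_hom_p] map_mat_smat[OF hhom_of_fps_map] by (simp add: of_fps_complex)
    ultimately show "cmat (\<pi> h) ** map_mat of_fps (p a) - map_mat of_fps (p a) ** cmat (\<pi> h)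
      = smat (of_cx (\<gamma> h)) (map_mat of_fps (p a) :: 'r^'n^'n)" by simp
  qed
  then show ?thesis by (simp add: Psi_tensor block_smat)
qed

lemma neg_dual: "\<beta> \<in> cartan_dual L \<Longrightarrow> - \<beta> \<in> cartan_dual L"
  by (auto simp: dual_def)

lemma block_closed_hspan:
  assumes F: "\<And>i j. hlinear (\<lambda>x. F x $ i $ j)" and "\<And>x. x \<in> G \<Longrightarrow> block k l (F x) = (0 :: 'r^'n^'n)"
    and x: "x \<in> closed_hspan G"
  shows "block k l (F x) = 0"
proof (rule mat_eqI)
  fix i j
  note lin = hlinear_block[of F k l, OF F]
  have "closed_hspan G \<subseteq> {x. block k l (F x) $ i $ j = 0}"
    by (rule closed_hspan_least[OF hsubmodule_equalizer[OF lin hlinear_zero] hclosed_equalizer[OF lin hlinear_zero]])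
      (use assms(2) in auto)
  then show "block k l (F x) $ i $ j = 0 $ i $ j" using x by auto
qed

lemma
  assumes \<beta>: "\<beta> \<in> Qplus L" and x: "x \<in> closed_hspan (weight_pairs \<beta>)" and k: "k \<in> indices" "l \<in> indices"
  shows block_Psi_pairs: "snd k - snd l \<noteq> \<beta> \<Longrightarrow> block k l (\<Psi> x) = 0"
    and block_Psi_flip_pairs: "snd k - snd l \<noteq> - \<beta> \<Longrightarrow> block k l (\<Psi> (tensor_flip x)) = 0"
proof -
  note lin = mat_hom_hlinear[OF mat_hom_Psi]
  note d = Qplus_dual[OF \<beta>]
  show "block k l (\<Psi> x) = 0" if ne: "snd k - snd l \<noteq> \<beta>"
  proof (rule block_closed_hspan[OF lin _ x])
    fix y assume "y \<in> weight_pairs \<beta>"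
    then obtain a b where y: "y = a \<otimes> b" "\<And>h. h \<in> cartan L \<Longrightarrow> comm (D0 h) a = of_cx (\<beta> h) * a"
      unfolding weight_pairs_def nilpotent_weight_def by blast
    show "block k l (\<Psi> y) = 0" unfolding y(1) by (rule p_weight_block[OF y(2) d k ne])
  qed
  show "block k l (\<Psi> (tensor_flip x)) = 0" if ne: "snd k - snd l \<noteq> - \<beta>"
  proof (rule block_closed_hspan[OF hlinear_comp[OF lin hhom_hlinear[OF hhom_tensor_flip]] _ x])
    fix y assume "y \<in> weight_pairs \<beta>"
    then obtain a b where y: "y = a \<otimes> b" "\<And>h. h \<in> cartan L \<Longrightarrow> comm (D0 h) b = of_cx ((- \<beta>) h) * b"
      unfolding weight_pairs_def nilpotent_weight_def by blast
    show "block k l (\<Psi> (tensor_flip y)) = 0"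
      unfolding y(1) tensor_flip_tensor by (rule p_weight_block[OF y(2) neg_dual[OF d] k ne])
  qed
qed

section \<open>The zero weight component\<close>

text \<open>The element A_\<lambda> of the overview. The two cases differ because the flip exchanges
  the legs: the weight is evaluated on coweights for the sign plus and on coroots for the sign
  minus, where the inverse adds a sign.\<close>

definition torus_exponent :: "pm \<Rightarrow> 'j \<times> ('g \<Rightarrow> complex) \<Rightarrow> 'r" where
  "torus_exponent s k = (case s of
     Pls \<Rightarrow> \<Sum>i\<in>UNIV. of_cx (snd k (coweight L i)) * embed_omega (hminus Q (coroot i))
   | Mns \<Rightarrow> - (\<Sum>i\<in>UNIV. of_cx (snd k (coroot i)) * embed_omega (hplus Q (coweight L i))))"

definition exponent :: "pm \<Rightarrow> 'j \<times> ('g \<Rightarrow> complex) \<Rightarrow> 'r" where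
  "exponent s k = torus_exponent s k + of_cx (pm_sign s) * z s (fst k)"

lemma torus_exponent_commute:
  assumes "\<And>x. x \<in> diagonal \<Longrightarrow> x * y = y * x"
  shows "torus_exponent s k * y = y * torus_exponent s k"
proof -
  have "embed_omega (hminus Q (coroot i)) * y = y * embed_omega (hminus Q (coroot i))"
    "embed_omega (hplus Q (coweight L i)) * y = y * embed_omega (hplus Q (coweight L i))" for i
    by (rule assms, simp add: diagonal_def torus_def coroot_cartan coweight_cartan)+
  then show ?thesis
    by (cases s) (simp_all add: torus_exponent_def sum_scaled_commute)
qed

lemma torus_exponent_z: "torus_exponent s k * (of_cx c * z s' j) = of_cx c * z s' j * torus_exponent s k"
proof -
  have "torus_exponent s k * z s' j = z s' j * torus_exponent s k"
    by (rule torus_exponent_commute, rule diagonal_commute) (auto simp: diagonal_def)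
  then show ?thesis by (simp only: of_fps_left_commute[of "torus_exponent s k"] mult.assoc)
qed

lemma exponent_commute: "exponent s k * exponent s' l = exponent s' l * exponent s k"
proof -
  have comm: "exponent s k * y = y * exponent s k" if "\<And>x. x \<in> diagonal \<Longrightarrow> x * y = y * x" for y s k
  proof -
    have "z s (fst k) * y = y * z s (fst k)" by (rule that) (auto simp: diagonal_def)
    then have "of_cx (pm_sign s) * z s (fst k) * y = y * (of_cx (pm_sign s) * z s (fst k))"
      by (simp only: of_fps_left_commute[of y] mult.assoc)
    then show ?thesis
      by (simp add: exponent_def distrib_left distrib_right torus_exponent_commute[OF that])
  qed
  show ?thesis by (rule comm, rule comm[symmetric], rule diagonal_commute)
qed

lemma central_matrix_weights: "central_matrix s = (\<Sum>k\<in>indices. smat (qpow (of_cx (pm_sign s) * z s (fst k))) (cmat (wproj k)))"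
  unfolding central_matrix_eq proj_sum cmat_sum smat_sum_right
  by (subst sum.Sigma) (auto simp: finite_V_weights intro!: sum.cong)

lemma qpow_inverse: "qpow (a :: 'a::hbar_algebra) * qpow (- a) = 1" "qpow (- a) * qpow a = 1"
  using qpow_add[of a "- a"] qpow_add[of "- a" a] by (simp_all add: qpow_0)

text \<open>Gauss decomposition. For the sign minus it is obtained by inverting the one of \<open>\<Psi>\<close> applied to
  the flipped R-matrix.\<close>

lemma L_triangular:
  obtains a b N where "L_mat T s = (\<Sum>k\<in>indices. smat (a k) (cmat (wproj k))) ** N **
      (\<Sum>k\<in>indices. smat (b k) (cmat (wproj k)))"
    and "\<And>k. a k * b k = qpow (exponent s k)"
    and "\<And>k l. k \<in> indices \<Longrightarrow> l \<in> indices \<Longrightarrow>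
      snd k - snd l \<notin> (case s of Pls \<Rightarrow> id | Mns \<Rightarrow> uminus) ` Qplus L \<Longrightarrow> block k l N = 0"
    and "\<And>k l. k \<in> indices \<Longrightarrow> l \<in> indices \<Longrightarrow> snd k = snd l \<Longrightarrow> block k l N = block k l (mat 1)"
proof -
  obtain R\<beta> S where S: "R\<beta> 0 = 1" "\<And>\<beta>. \<beta> \<in> Qplus L \<Longrightarrow> R\<beta> \<beta> \<in> closed_hspan (weight_pairs \<beta>)"
    "has_hsum R\<beta> (Qplus L) S"
    "R = qpow (\<Sum>i\<in>UNIV. hplus Q (coweight L i) \<otimes> hminus Q (coroot i)) * S"
    by (rule R_expansion[OF universal]) blast
  note lin = mat_hom_hlinear[OF mat_hom_Psi]
  note Psi_mult = mat_hom_mult[OF mat_hom_Psi]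
  have exp: "qpow (torus_exponent s k) * qpow (of_cx (pm_sign s) * z s (fst k)) = qpow (exponent s k)" for k
    unfolding exponent_def by (rule qpow_add[symmetric]) (rule torus_exponent_z)
  show thesis
  proof (cases s)
    case Pls
    have tri: "snd k - snd l \<notin> id ` Qplus L \<Longrightarrow> block k l (\<Psi> S) = 0"
      "snd k = snd l \<Longrightarrow> block k l (\<Psi> S) = block k l (mat 1)" if "k \<in> indices" "l \<in> indices" for k l
      using block_has_hsum[OF S(3) lin, where \<sigma> = id and k = k and l = l] that
      by (simp_all add: S(1) mat_hom_1[OF mat_hom_Psi] block_Psi_pairs[OF _ S(2)])
    have "\<Psi> R = (\<Sum>k\<in>indices. smat (qpow (torus_exponent s k)) (cmat (wproj k))) ** \<Psi> S"
      unfolding S(4) Psi_mult Psi_cartan_qpow[OF coweight_cartan p_hplus[OF coweight_cartan]]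
      by (simp add: torus_exponent_def Pls)
    then have "L_mat T s = (\<Sum>k\<in>indices. smat (qpow (torus_exponent s k)) (cmat (wproj k))) ** \<Psi> S **
      (\<Sum>k\<in>indices. smat (qpow (of_cx (pm_sign s) * z s (fst k))) (cmat (wproj k)))"
      by (simp add: L_factorization R_signed_def Pls central_matrix_weights)
    then show thesis
      by (rule that) (use exp tri in \<open>simp_all add: Pls\<close>)
  next
    case Mns
    define a where "a k = (\<Sum>i\<in>UNIV. of_cx (snd k (coroot i)) * embed_omega (hplus Q (coweight L i)))" for k :: "'j \<times> ('g \<Rightarrow> complex)"
    define E where "E = (\<Sum>k\<in>indices. smat (qpow (a k)) (cmat (wproj k)))"
    define E' where "E' = (\<Sum>k\<in>indices. smat (qpow (- a k)) (cmat (wproj k)))"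
    have E: "E ** E' = mat 1" "E' ** E = mat 1"
      unfolding E_def E'_def block_diag_mult[OF wproj_idempotents] qpow_inverse
      by (rule block_diag_1[OF wproj_idempotents])+
    have flin: "hlinear (\<lambda>x. \<Psi> (tensor_flip x) $ i $ j)" for i j
      by (rule hlinear_comp[OF lin hhom_hlinear[OF hhom_tensor_flip]])
    have tri: "snd k - snd l \<notin> uminus ` Qplus L \<Longrightarrow> block k l (\<Psi> (tensor_flip S)) = 0"
      "snd k = snd l \<Longrightarrow> block k l (\<Psi> (tensor_flip S)) = block k l (mat 1)" if "k \<in> indices" "l \<in> indices" for k l
      using block_has_hsum[OF S(3) flin, where \<sigma> = uminus and k = k and l = l] that
      by (simp_all add: S(1) hhom_1[OF hhom_tensor_flip] mat_hom_1[OF mat_hom_Psi] block_Psi_flip_pairs[OF _ S(2)])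
    have neg: "snd k - snd l \<notin> uminus ` Qplus L" if "snd l - snd k \<notin> Qplus L" for k l :: "'j \<times> ('g \<Rightarrow> complex)"
    proof
      assume "snd k - snd l \<in> uminus ` Qplus L"
      then obtain \<beta> where \<beta>: "\<beta> \<in> Qplus L" "snd k - snd l = - \<beta>" by (rule imageE)
      have "snd l - snd k = - (snd k - snd l)" by simp
      then show False using that \<beta> by simp
    qed
    have "tensor_flip R = qpow (\<Sum>i\<in>UNIV. hminus Q (coroot i) \<otimes> hplus Q (coweight L i)) * tensor_flip S"
      unfolding S(4) hhom_mult[OF hhom_tensor_flip] qpow_hhom[OF hhom_tensor_flip]
        hlinear_sum[OF hhom_hlinear[OF hhom_tensor_flip]] tensor_flip_tensor ..
    then have flipR: "\<Psi> (tensor_flip R) = E ** \<Psi> (tensor_flip S)"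
      by (simp add: Psi_mult Psi_cartan_qpow[OF coroot_cartan p_hminus[OF coroot_cartan]] E_def a_def)
    have "hcong 1 (tensor_flip R) (tensor_flip 1)"
      by (rule hlinear_hcong[OF hhom_hlinear[OF hhom_tensor_flip] R_cong_1[OF universal]])
    then have "hcong 1 (tensor_flip R) 1" by (simp add: hhom_1[OF hhom_tensor_flip])
    then obtain y where y: "tensor_flip R * y = 1" "y * tensor_flip R = 1" by (rule hunit_exists)
    have R_signed: "R_signed s = y" by (simp add: R_signed_def Mns hinverse_props[OF y])
    have "E ** \<Psi> (tensor_flip S) ** \<Psi> y = mat 1"
      by (simp add: flipR[symmetric] Psi_mult[symmetric] y(1) mat_hom_1[OF mat_hom_Psi])
    then have "E' ** (E ** \<Psi> (tensor_flip S) ** \<Psi> y) = E'" by simp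
    then have "\<Psi> (tensor_flip S) ** \<Psi> y = E'" by (simp add: matrix_mul_assoc E)
    \<comment> \<open>The torus factor of the inverse is absorbed on the right, so that what remains
      is the inverse of a unitriangular matrix and \<open>unitriangular_inverse\<close>
      applies.\<close>
    then have inv: "\<Psi> (tensor_flip S) ** (\<Psi> y ** E) = mat 1" by (simp add: matrix_mul_assoc E)
    have tri': "snd l - snd k \<notin> Qplus L \<Longrightarrow> block k l (\<Psi> y ** E) = 0"
      "snd k = snd l \<Longrightarrow> block k l (\<Psi> y ** E) = block k l (mat 1)" if "k \<in> indices" "l \<in> indices" for k l
      by (rule unitriangular_inverse[OF inv _ _ that]; simp add: tri neg)+
    have "\<Psi> y = \<Psi> y ** (E ** E')" by (simp add: E)
    then have "\<Psi> y = mat 1 ** (\<Psi> y ** E) ** E'" by (simp add: matrix_mul_assoc)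
    then have "\<Psi> y ** central_matrix s = mat 1 ** (\<Psi> y ** E) ** E' ** central_matrix s" by (rule arg_cong)
    also have "\<dots> = mat 1 ** (\<Psi> y ** E) ** (E' ** central_matrix s)" by (rule matrix_mul_assoc[symmetric])
    also have "E' ** central_matrix s = (\<Sum>k\<in>indices. smat (qpow (torus_exponent s k) * qpow (of_cx (pm_sign s) * z s (fst k))) (cmat (wproj k)))"
      unfolding E'_def central_matrix_weights block_diag_mult[OF wproj_idempotents] by (simp add: torus_exponent_def Mns a_def)
    \<comment> \<open>Inversion reverses the factors, so here the torus part stands entirely on the
      right and the left diagonal factor is the identity.\<close>
    finally have "L_mat T s = (\<Sum>k\<in>indices. smat 1 (cmat (wproj k))) ** (\<Psi> y ** E) **
      (\<Sum>k\<in>indices. smat (qpow (exponent s k)) (cmat (wproj k)))"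
      unfolding L_factorization R_signed block_diag_1[OF wproj_idempotents] exp .
    then show thesis
    proof (rule that)
      show "block k l (\<Psi> y ** E) = 0"
        if kl: "k \<in> indices" "l \<in> indices" and nQ: "snd k - snd l \<notin> (case s of Pls \<Rightarrow> id | Mns \<Rightarrow> uminus) ` Qplus L" for k l
      proof (rule tri'(1)[OF kl], rule notI)
        assume "snd l - snd k \<in> Qplus L"
        then have "- (snd l - snd k) \<in> uminus ` Qplus L" by (rule imageI)
        then show False using nQ Mns by simp
      qed
    qed (simp_all add: tri')
  qed
qed

end

section \<open>Consequences of the Gauss decomposition\<close>

context R_matrix_setup
begin

text \<open>The outer diagonal factors only rescale the blocks of N. Nonzero blocks in both
  directions would put a difference of weights and its negative into \<open>Qplus\<close>, which has
  no nonzero such elements.\<close>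

lemma
  assumes k: "k \<in> indices" "l \<in> indices"
  shows block_L_eq: "snd k = snd l \<Longrightarrow>
      block k l (L_mat T s) = (if k = l then smat (qpow (exponent s k)) (cmat (wproj k)) else 0)"
    and block_L_zero: "snd k \<noteq> snd l \<Longrightarrow> block k l (L_mat T s) = 0 \<or> block l k (L_mat T s) = 0"
proof -
  obtain a b N where L: "L_mat T s = (\<Sum>k\<in>indices. smat (a k) (cmat (wproj k))) ** N **
      (\<Sum>k\<in>indices. smat (b k) (cmat (wproj k)))"
    and ab: "\<And>k. a k * b k = qpow (exponent s k)"
    and tri: "\<And>k l. k \<in> indices \<Longrightarrow> l \<in> indices \<Longrightarrow>
      snd k - snd l \<notin> (case s of Pls \<Rightarrow> id | Mns \<Rightarrow> uminus) ` Qplus L \<Longrightarrow> block k l N = 0"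
    and diag: "\<And>k l. k \<in> indices \<Longrightarrow> l \<in> indices \<Longrightarrow> snd k = snd l \<Longrightarrow> block k l N = block k l (mat 1)"
    by (rule L_triangular[of s]) blast
  have block: "block k l (L_mat T s) = smat (a k) (block k l N ** smat (b l) (cmat (wproj l)))"
    if kl: "k \<in> indices" "l \<in> indices" for k l
  proof -
    let ?A = "\<Sum>k\<in>indices. smat (a k) (cmat (wproj k))" and ?B = "\<Sum>k\<in>indices. smat (b k) (cmat (wproj k))"
    have "block k l (L_mat T s) = (cmat (wproj k) ** ?A) ** N ** (?B ** cmat (wproj l))"
      by (simp add: L block_def matrix_mul_assoc)
    also have "\<dots> = smat (a k) (cmat (wproj k)) ** N ** smat (b l) (cmat (wproj l))"
      by (simp only: block_diag_left[OF kl(1)] block_diag_right[OF kl(2)])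
    also have "smat (b l) (cmat (wproj l)) = cmat (wproj l) ** smat (b l) (cmat (wproj l))"
      by (simp add: cmat_smat_mult cmat_wproj_mult kl)
    finally show ?thesis by (simp only: block_def smat_mult_left matrix_mul_assoc)
  qed
  show "block k l (L_mat T s) = (if k = l then smat (qpow (exponent s k)) (cmat (wproj k)) else 0)"
    if "snd k = snd l"
    using that k
    by (simp add: block diag block_1 cmat_smat_mult cmat_wproj_mult smat_smat ab)
  show "block k l (L_mat T s) = 0 \<or> block l k (L_mat T s) = 0" if ne: "snd k \<noteq> snd l"
  proof (rule ccontr)
    let ?\<sigma> = "(case s of Pls \<Rightarrow> id | Mns \<Rightarrow> uminus) :: ('g \<Rightarrow> complex) \<Rightarrow> _"
    assume "\<not> (block k l (L_mat T s) = 0 \<or> block l k (L_mat T s) = 0)"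
    then have "block k l N \<noteq> 0" "block l k N \<noteq> 0"
      unfolding block[OF k] block[OF k(2,1)] by auto
    then have *: "snd k - snd l \<in> ?\<sigma> ` Qplus L" "snd l - snd k \<in> ?\<sigma> ` Qplus L"
      using tri[OF k] tri[OF k(2,1)] by blast+
    have neg: "- (snd k - snd l) = snd l - snd k" for k l :: "'j \<times> ('g \<Rightarrow> complex)" by simp
    have "snd k - snd l \<in> Qplus L \<and> - (snd k - snd l) \<in> Qplus L"
    proof (cases s)
      case Pls
      then show ?thesis using * by (simp add: neg)
    next
      case Mns
      obtain \<beta> \<gamma> where \<beta>\<gamma>: "\<beta> \<in> Qplus L" "snd k - snd l = - \<beta>" "\<gamma> \<in> Qplus L" "snd l - snd k = - \<gamma>"
        using * Mns by (auto simp only: pm.case image_iff)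
      have "snd k - snd l = \<gamma>" unfolding neg[of l k, symmetric] \<beta>\<gamma>(4) by simp
      moreover have "- (snd k - snd l) = \<beta>" unfolding \<beta>\<gamma>(2) by simp
      ultimately show ?thesis using \<beta>\<gamma>(1,3) by (simp only: simp_thms)
    qed
    then have "snd k - snd l = 0" using Qplus_antisym by blast
    then show False using ne by simp
  qed
qed

lemma weight_component_L:
  "weight_component L \<pi> 0 (L_mat T s) = (\<Sum>k\<in>indices. smat (qpow (exponent s k)) (cmat (wproj k)))"
proof -
  have "(\<Sum>l\<in>indices. if snd k = snd l then block k l (L_mat T s) else 0)
    = smat (qpow (exponent s k)) (cmat (wproj k))" if k: "k \<in> indices" for k
  proof -
    have "(\<Sum>l\<in>indices. if snd k = snd l then block k l (L_mat T s) else 0)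
      = (\<Sum>l\<in>indices. if k = l then smat (qpow (exponent s k)) (cmat (wproj k)) else 0)"
      by (intro sum.cong refl) (simp add: block_L_eq k)
    then show ?thesis using k finite_indices by simp
  qed
  then show ?thesis unfolding weight_component_0 block_def[symmetric] by (intro sum.cong refl)
qed

lemma grouplike_qpow_exponent:
  assumes k: "k \<in> indices"
  shows "grouplike HR (qpow (exponent s k))"
proof -
  have hopf: "topological_hopf_algebra HR"
    and \<Delta>: "map_mat (comult HR) (L_mat T s) = mat_tensor (L_mat T s) (L_mat T s)"
    and \<epsilon>: "map_mat (counit HR) (L_mat T s) = mat 1"
    using RTT unfolding R_matrix_algebra_def by blast+
  have h\<Delta>: "hhom (comult HR)" and h\<epsilon>: "hhom (counit HR)"
    using hopf unfolding topological_hopf_algebra_def by blast+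
  have bL: "cmat (wproj k) ** L_mat T s ** cmat (wproj k) = smat (qpow (exponent s k)) (cmat (wproj k))"
    using block_L_eq[OF k k, of s] by (simp add: block_def)
  let ?e = "qpow (exponent s k)"
  have "smat (comult HR ?e) (cmat (wproj k)) = map_mat (comult HR) (cmat (wproj k) ** L_mat T s ** cmat (wproj k))"
    by (simp add: bL map_mat_smat[OF h\<Delta>] map_mat_cmat[OF h\<Delta>])
  also have "\<dots> = cmat (wproj k) ** mat_tensor (L_mat T s) (L_mat T s) ** cmat (wproj k)"
    by (simp add: map_mat_mult[OF h\<Delta>] map_mat_cmat[OF h\<Delta>] \<Delta>)
  \<comment> \<open>The resolution of the identity is inserted between the two legs, which splits
    the coproduct formula into products of a (k, m) and an (m, k) block.\<close>
  also have "\<dots> = mat_tensor (cmat (wproj k) ** L_mat T s ** (\<Sum>m\<in>indices. cmat (wproj m))) (L_mat T s ** cmat (wproj k))"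
    by (simp add: cmat_mat_tensor mat_tensor_cmat cmat_wproj_sum)
  also have "\<dots> = (\<Sum>m\<in>indices. mat_tensor (block k m (L_mat T s)) (block m k (L_mat T s)))"
    unfolding mat_mult_sum_right mat_tensor_sum_left
  proof (intro sum.cong refl)
    fix m assume m: "m \<in> indices"
    have "cmat (wproj m) = (cmat (wproj m) ** cmat (wproj m) :: 'r^'n^'n)" by (simp add: cmat_wproj_mult m)
    then have "cmat (wproj k) ** L_mat T s ** cmat (wproj m) = block k m (L_mat T s) ** cmat (wproj m)"
      by (simp only: block_def matrix_mul_assoc[symmetric])
    then show "mat_tensor (cmat (wproj k) ** L_mat T s ** cmat (wproj m)) (L_mat T s ** cmat (wproj k))
      = mat_tensor (block k m (L_mat T s)) (block m k (L_mat T s))"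
      by (simp add: mat_tensor_middle) (simp add: block_def matrix_mul_assoc)
  qed
  also have "\<dots> = (\<Sum>m\<in>indices. if k = m then mat_tensor (block k k (L_mat T s)) (block k k (L_mat T s)) else 0)"
  proof (intro sum.cong refl)
    fix m assume m: "m \<in> indices"
    consider "k = m" | "k \<noteq> m" "snd k = snd m" | "snd k \<noteq> snd m" by auto
    then show "mat_tensor (block k m (L_mat T s)) (block m k (L_mat T s))
      = (if k = m then mat_tensor (block k k (L_mat T s)) (block k k (L_mat T s)) else 0)"
    proof cases
      case 2
      then show ?thesis by (simp add: block_L_eq k m mat_tensor_zero)
    next
      case 3
      then show ?thesis using block_L_zero[OF k m 3, of s] by (auto simp only: mat_tensor_zero split: if_split)
    qed simp
  qed
  also have "\<dots> = smat (?e \<otimes> ?e) (cmat (wproj k))"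
    using k finite_indices
    by (simp add: block_L_eq mat_tensor_smat_cmat idempotents_mult[OF wproj_idempotents])
  finally have "comult HR ?e = ?e \<otimes> ?e" by (rule smat_cmat_inject) (rule wproj_nonzero[OF k])
  moreover have "counit HR ?e = 1"
  proof -
    have "smat (counit HR ?e) (cmat (wproj k)) = map_mat (counit HR) (cmat (wproj k) ** L_mat T s ** cmat (wproj k))"
      by (simp add: bL map_mat_smat[OF h\<epsilon>] map_mat_cmat[OF h\<epsilon>])
    also have "\<dots> = cmat (wproj k) ** cmat (wproj k)"
      by (simp add: map_mat_mult[OF h\<epsilon>] map_mat_cmat[OF h\<epsilon>] \<epsilon>)
    also have "\<dots> = smat 1 (cmat (wproj k))" by (simp add: cmat_wproj_mult k)
    finally show ?thesis by (rule smat_cmat_inject) (rule wproj_nonzero[OF k])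
  qed
  ultimately show ?thesis by (simp add: grouplike_def)
qed

abbreviation "dimw j \<mu> \<equiv> vec.dim (weight_space L \<pi> (V j) \<mu>)"

text \<open>The torus part drops out since the weights of \<open>V j\<close>, with multiplicities, add up to zero.\<close>

lemma exponent_sum:
  "(\<Sum>\<mu>\<in>weights L \<pi> (V j). of_nat (dimw j \<mu>) * exponent s (j, \<mu>))
    = of_cx (pm_sign s * of_nat (vec.dim (V j))) * z s j"
proof -
  have zero: "(\<Sum>\<mu>\<in>weights L \<pi> (V j). of_cx (of_nat (dimw j \<mu>)) * (\<Sum>i\<in>UNIV. of_cx (\<mu> (h i)) * f i)) = 0"
    if "\<And>i. h i \<in> cartan L" for h :: "'i \<Rightarrow> 'g" and f :: "'i \<Rightarrow> 'r"
  proof -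
    have "(\<Sum>\<mu>\<in>weights L \<pi> (V j). of_cx (of_nat (dimw j \<mu>)) * (\<Sum>i\<in>UNIV. of_cx (\<mu> (h i)) * f i))
      = (\<Sum>\<mu>\<in>weights L \<pi> (V j). \<Sum>i\<in>UNIV. of_cx (of_nat (dimw j \<mu>) * \<mu> (h i)) * f i)"
      by (simp only: sum_distrib_left of_cx_mult mult.assoc)
    also have "\<dots> = (\<Sum>i\<in>UNIV. of_cx (\<Sum>\<mu>\<in>weights L \<pi> (V j). of_nat (dimw j \<mu>) * \<mu> (h i)) * f i)"
      by (subst sum.swap) (simp only: of_cx_sum sum_distrib_right)
    finally show ?thesis using weight_sum_zero[OF that] by simp
  qed
  have torus: "(\<Sum>\<mu>\<in>weights L \<pi> (V j). of_cx (of_nat (dimw j \<mu>)) * torus_exponent s (j, \<mu>)) = 0"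
    by (cases s) (simp_all add: torus_exponent_def sum_negf zero coroot_cartan coweight_cartan)
  have "(\<Sum>\<mu>\<in>weights L \<pi> (V j). of_nat (dimw j \<mu>) * exponent s (j, \<mu>))
    = (\<Sum>\<mu>\<in>weights L \<pi> (V j). of_cx (of_nat (dimw j \<mu>)) * (of_cx (pm_sign s) * z s j))"
    using torus by (simp only: exponent_def distrib_left sum.distrib of_cx_of_nat[symmetric] fst_conv add_0)
  also have "\<dots> = of_cx (\<Sum>\<mu>\<in>weights L \<pi> (V j). of_nat (dimw j \<mu>)) * (of_cx (pm_sign s) * z s j)"
    by (simp only: of_cx_sum sum_distrib_right)
  also have "\<dots> = of_cx (pm_sign s * of_nat (vec.dim (V j))) * z s j"
    by (simp only: dim_V[symmetric] mult.commute[of "pm_sign s"] of_cx_mult mult.assoc)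
  finally show ?thesis .
qed

lemma prod_qpow_exponent:
  assumes "distinct \<mu>s" "set \<mu>s = weights L \<pi> (V j)"
  shows "prod_list (map (\<lambda>\<mu>. qpow (exponent s (j, \<mu>)) ^ dimw j \<mu>) \<mu>s)
    = qpow (of_cx (pm_sign s * of_nat (vec.dim (V j))) * z s j)"
  unfolding prod_list_qpow[of "\<lambda>\<mu>. exponent s (j, \<mu>)", OF exponent_commute]
    sum_list_distinct_conv_sum_set[OF assms(1)] assms(2) exponent_sum ..

text \<open>Torsion-freeness of the R-matrix algebra makes the quotient by \<hbar> unique, so
  \<open>hdiv\<close> returns the evident one.\<close>

lemma hdiv_hlog_qpow: "hdiv (hlog (qpow x)) fps_X = of_cx (1/2) * (x :: 'r)"
proof -
  have "topologically_free TYPE('r)" using RTT unfolding R_matrix_algebra_def by blast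
  note tf = topologically_free_torsion_free[OF this]
  have "hlog (qpow x) = of_cx (1/2) * \<hbar> * x" unfolding qpow_def by (rule hlog_hexp[OF qpow_arg_small])
  also have "\<dots> = \<hbar> * (of_cx (1/2) * x)"
    by (simp only: mult.assoc of_fps_left_commute[of "of_cx (1/2)"])
  finally have eq: "hlog (qpow x) = \<hbar> * (of_cx (1/2) * x)" .
  show ?thesis
  proof (rule hdiv_unique[OF eq[symmetric]])
    fix y assume "\<hbar> * y = hlog (qpow x)"
    then have "\<hbar> * (y - of_cx (1/2) * x) = 0" by (simp add: eq right_diff_distrib)
    then have "y - of_cx (1/2) * x = 0" by (rule tf)
    then show "y = of_cx (1/2) * x" by simp
  qed
qed

lemma z_eq_hlog:
  "z s j = of_cx (pm_sign s) * (\<Sum>\<mu>\<in>weights L \<pi> (V j).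
     of_cx (2 * of_nat (dimw j \<mu>) / of_nat (vec.dim (V j))) * hdiv (hlog (qpow (exponent s (j, \<mu>)))) fps_X)"
proof -
  let ?d = "of_nat (vec.dim (V j)) :: complex"
  have d: "?d \<noteq> 0" using dim_V_nonzero by simp
  have "(\<Sum>\<mu>\<in>weights L \<pi> (V j). of_cx (2 * of_nat (dimw j \<mu>) / ?d) * hdiv (hlog (qpow (exponent s (j, \<mu>)))) fps_X)
    = (\<Sum>\<mu>\<in>weights L \<pi> (V j). of_cx (inverse ?d) * (of_nat (dimw j \<mu>) * exponent s (j, \<mu>)))"
  proof (intro sum.cong refl)
    fix \<mu>
    have "2 * of_nat (dimw j \<mu>) / ?d * (1/2) = inverse ?d * of_nat (dimw j \<mu>)" by (simp add: field_simps)
    then show "of_cx (2 * of_nat (dimw j \<mu>) / ?d) * hdiv (hlog (qpow (exponent s (j, \<mu>)))) fps_X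
      = of_cx (inverse ?d) * (of_nat (dimw j \<mu>) * exponent s (j, \<mu>))"
      unfolding hdiv_hlog_qpow of_cx_of_nat[symmetric] by (simp only: mult.assoc[symmetric] of_cx_mult[symmetric])
  qed
  also have "\<dots> = of_cx (inverse ?d) * (of_cx (pm_sign s * ?d) * z s j)"
    by (simp only: sum_distrib_left[symmetric] exponent_sum)
  finally have sum: "(\<Sum>\<mu>\<in>weights L \<pi> (V j). of_cx (2 * of_nat (dimw j \<mu>) / ?d) * hdiv (hlog (qpow (exponent s (j, \<mu>)))) fps_X)
    = of_cx (inverse ?d) * (of_cx (pm_sign s * ?d) * z s j)" .
  \<comment> \<open>The sign enters twice, from the exponent and from the formula itself, and its
    square is 1.\<close>
  have "pm_sign s * (inverse ?d * (pm_sign s * ?d)) = 1" using d by (cases s) (simp_all add: field_simps)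
  then show ?thesis unfolding sum by (simp only: mult.assoc[symmetric] of_cx_mult[symmetric]) simp
qed

lemma zero_weight_component:
  "\<exists>t. let l = (\<lambda>s j \<mu>. 1 + \<hbar> * t s j \<mu>);
        P = (\<lambda>k. cmat (wproj k));
        L0 = (\<lambda>s. weight_component L \<pi> 0 (L_mat T s)) in
     finite indices \<and>
     (\<forall>s. L0 s = (\<Sum>(j, \<mu>)\<in>indices. smat (l s j \<mu>) (P (j, \<mu>)))) \<and>
     (\<forall>s. L0 s = mat 1 + smat \<hbar> (\<Sum>(j, \<mu>)\<in>indices. smat (t s j \<mu>) (P (j, \<mu>)))) \<and>
     (\<forall>s. \<forall>(j, \<mu>)\<in>indices. grouplike HR (l s j \<mu>)) \<and>
     (\<forall>x\<in>closed_subalgebra {l s j \<mu> | s j \<mu>. \<mu> \<in> weights L \<pi> (V j)}.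
      \<forall>y\<in>closed_subalgebra {l s j \<mu> | s j \<mu>. \<mu> \<in> weights L \<pi> (V j)}. x * y = y * x) \<and>
     (\<forall>s j \<mu>s. distinct \<mu>s \<and> set \<mu>s = weights L \<pi> (V j) \<longrightarrow>
        prod_list (map (\<lambda>\<mu>. l s j \<mu> ^ dimw j \<mu>) \<mu>s)
          = qpow (of_cx (pm_sign s * of_nat (vec.dim (V j))) * z s j)) \<and>
     (\<forall>s j. z s j = of_cx (pm_sign s) *
        (\<Sum>\<mu>\<in>weights L \<pi> (V j). of_cx (2 * of_nat (dimw j \<mu>) / of_nat (vec.dim (V j)))
           * hdiv (hlog (1 + \<hbar> * t s j \<mu>)) fps_X))"
proof -
  have "\<exists>t. qpow (exponent s (j, \<mu>)) = 1 + \<hbar> * t" for s j \<mu>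
  proof -
    obtain t where "qpow (exponent s (j, \<mu>)) - 1 = \<hbar> ^ 1 * t"
      using qpow_cong_1[of "exponent s (j, \<mu>)"] unfolding hcong_def by blast
    then show ?thesis by (intro exI[of _ t]) (simp add: algebra_simps)
  qed
  then obtain t where t: "\<And>s j \<mu>. 1 + \<hbar> * t s j \<mu> = qpow (exponent s (j, \<mu>))"
    by metis
  have sum: "weight_component L \<pi> 0 (L_mat T s)
      = (\<Sum>(j, \<mu>)\<in>indices. smat (qpow (exponent s (j, \<mu>))) (cmat (wproj (j, \<mu>))))" for s
    unfolding weight_component_L by (rule sum.cong) auto
  have "(\<Sum>(j, \<mu>)\<in>indices. smat (qpow (exponent s (j, \<mu>))) (cmat (wproj (j, \<mu>))))
      = mat 1 + smat \<hbar> (\<Sum>(j, \<mu>)\<in>indices. smat (t s j \<mu>) (cmat (wproj (j, \<mu>))))" for s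
  proof -
    have "(\<Sum>(j, \<mu>)\<in>indices. smat (qpow (exponent s (j, \<mu>))) (cmat (wproj (j, \<mu>))))
      = (\<Sum>k\<in>indices. smat 1 (cmat (wproj k)) + smat \<hbar> (case k of (j, \<mu>) \<Rightarrow> smat (t s j \<mu>) (cmat (wproj (j, \<mu>)))))"
      unfolding t[symmetric] by (intro sum.cong refl) (auto simp only: smat_add_left smat_smat split: prod.split)
    then show ?thesis
      by (simp only: sum.distrib block_diag_1[OF wproj_idempotents] smat_sum_right)
  qed
  note sum' = sum[unfolded this]
  have comm: "x * y = y * x"
    if "x \<in> closed_subalgebra {qpow (exponent s (j, \<mu>)) | s j \<mu>. \<mu> \<in> weights L \<pi> (V j)}"
      "y \<in> closed_subalgebra {qpow (exponent s (j, \<mu>)) | s j \<mu>. \<mu> \<in> weights L \<pi> (V j)}" for x y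
  proof (rule closed_subalgebra_commute[OF _ that])
    have "qpow (exponent s k) * qpow (exponent s' l) = qpow (exponent s' l) * qpow (exponent s k)" for s s' k l
      by (rule qpow_commute, rule qpow_commute[symmetric], rule exponent_commute)
    then show "x * y = y * x" if "x \<in> {qpow (exponent s (j, \<mu>)) | s j \<mu>. \<mu> \<in> weights L \<pi> (V j)}"
      "y \<in> {qpow (exponent s (j, \<mu>)) | s j \<mu>. \<mu> \<in> weights L \<pi> (V j)}" for x y
      using that by (elim CollectE exE conjE) (simp only:)
  qed
  show ?thesis
    unfolding Let_def
  proof (intro exI[of _ t] conjI allI impI ballI, unfold t)
    show "finite indices" by (rule finite_indices)
    show "case k of (j, \<mu>) \<Rightarrow> grouplike HR (qpow (exponent s (j, \<mu>)))" if "k \<in> indices" for s k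
      using grouplike_qpow_exponent[OF that] by (simp split: prod.split)
    show "x * y = y * x"
      if "x \<in> closed_subalgebra {qpow (exponent s (j, \<mu>)) | s j \<mu>. \<mu> \<in> weights L \<pi> (V j)}"
        "y \<in> closed_subalgebra {qpow (exponent s (j, \<mu>)) | s j \<mu>. \<mu> \<in> weights L \<pi> (V j)}" for x y
      by (rule comm[OF that])
    show "prod_list (map (\<lambda>\<mu>. qpow (exponent s (j, \<mu>)) ^ dimw j \<mu>) \<mu>s)
        = qpow (of_cx (pm_sign s * of_nat (vec.dim (V j))) * z s j)"
      if "distinct \<mu>s \<and> set \<mu>s = weights L \<pi> (V j)" for s j \<mu>s
      using prod_qpow_exponent that by blast
  qed (rule sum sum' z_eq_hlog)+
qed

end

theorem corollary6p5:
  fixes L :: "('g::ab_group_add, 'i::finite) lie_data"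
    and \<pi> :: "'g \<Rightarrow> complex^'n^'n"
    and V :: "'j::finite \<Rightarrow> (complex^'n) set"
    and Q :: "('g, 'i, 'u::hbar_algebra, 'c::hbar_algebra) double"
    and R :: "('u \<otimes> 'c) \<otimes> ('u \<otimes> 'c)"
    and \<pi>h :: "'u \<Rightarrow> complex fps^'n^'n"
    and T :: "pm \<Rightarrow> 'r::hbar_algebra^'n^'n" and HR :: "'r hopf"
    and \<iota> :: "(complex^'n^'n \<Rightarrow> complex) \<Rightarrow> 's::hbar_algebra" and HZ :: "pm \<Rightarrow> 's hopf"
    and \<Upsilon> :: "'r \<Rightarrow> (('u \<otimes> 'c) \<otimes> 's) \<otimes> 's"
    and z :: "pm \<Rightarrow> 'j \<Rightarrow> 'r"
  defines "\<Lambda> \<equiv> \<lambda>j. weights L \<pi> (V j)"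
    and "Vw \<equiv> \<lambda>(j, \<mu>). weight_space L \<pi> (V j) \<mu>"
    and "dimw \<equiv> \<lambda>j \<mu>. vec.dim (weight_space L \<pi> (V j) \<mu>)"
    and "dimV \<equiv> \<lambda>j. vec.dim (V j)"
    and "L0 \<equiv> \<lambda>s. weight_component L \<pi> 0 (L_mat T s)"
  assumes "simple_lie_data L"
    and "representation L \<pi>" and "inj \<pi>" and "multiplicity_free \<pi> V"
    and "quantum_double L Q" and "universal_R L Q R"
    and "quantum_representation L Q \<pi> \<pi>h"
    and "R_matrix_algebra L \<pi> (pi_tensor_pi (piD L Q \<pi>h) R) T HR"
    and "central_factor \<pi> \<iota> HZ"
    and "Upsilon_isomorphism L Q R \<pi> \<pi>h T HR \<iota> HZ \<Upsilon>"
    and "central_elements \<pi> V \<iota> \<Upsilon> z"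
  shows "\<exists>t. let l = (\<lambda>s j \<mu>. 1 + \<hbar> * t s j \<mu>);
              I = Sigma UNIV \<Lambda>;
              P = (\<lambda>k. map_mat of_cx (projection_onto I Vw k)) in
       finite I \<and>
       (\<forall>s. L0 s = (\<Sum>(j, \<mu>)\<in>I. smat (l s j \<mu>) (P (j, \<mu>)))) \<and>
       (\<forall>s. L0 s = mat 1 + smat \<hbar> (\<Sum>(j, \<mu>)\<in>I. smat (t s j \<mu>) (P (j, \<mu>)))) \<and>
       (\<forall>s. \<forall>(j, \<mu>)\<in>I. grouplike HR (l s j \<mu>)) \<and>
       (\<forall>x\<in>closed_subalgebra {l s j \<mu> | s j \<mu>. \<mu> \<in> \<Lambda> j}.
        \<forall>y\<in>closed_subalgebra {l s j \<mu> | s j \<mu>. \<mu> \<in> \<Lambda> j}. x * y = y * x) \<and>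
       (\<forall>s j \<mu>s. distinct \<mu>s \<and> set \<mu>s = \<Lambda> j \<longrightarrow>
          prod_list (map (\<lambda>\<mu>. l s j \<mu> ^ dimw j \<mu>) \<mu>s)
            = qpow (of_cx (pm_sign s * of_nat (dimV j)) * z s j)) \<and>
       (\<forall>s j. z s j = of_cx (pm_sign s) *
          (\<Sum>\<mu>\<in>\<Lambda> j. of_cx (2 * of_nat (dimw j \<mu>) / of_nat (dimV j))
             * hdiv (hlog (1 + \<hbar> * t s j \<mu>)) fps_X))"
proof -
  interpret R_matrix_setup L \<pi> V Q R \<pi>h T HR \<iota> HZ \<Upsilon> z
    by unfold_locales (use assms in simp_all)
  show ?thesis
    using zero_weight_component unfolding \<Lambda>_def Vw_def dimw_def dimV_def L0_def Let_def .
qed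

end
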